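(* (STORM+EXTRA, online scenario.) Assume (A1)–(A3) of the context and that $W$ is symmetric, doubly stochastic, primitive and positive semidefinite. Run DAMA with the EXTRA matrices $\mathcal A_x=I$, $\mathcal B_x=(I-W\otimes I_{d_1})^{1/2}$, $\mathcal C_x=W\otimes I_{d_1}$ (and the same with $d_2$ for $y$), and hyperparameters of order $$\mu_x=\mathcal O\Big(\frac{K^{2/3}}{T^{1/3}\kappa^2}\Big),\ \mu_y=\mathcal O\Big(\frac{K^{2/3}}{T^{1/3}}\Big),\ \beta_x=\beta_y=\mathcal O\Big(\frac{K^{1/3}}{T^{2/3}}\Big),\ p=0,\ b_0=\mathcal O\Big(\frac{T^{1/3}}{K^{2/3}}\Big),\ b=\mathcal O(1).$$ Then for all sufficiently large $T$, $$\frac1T\sum_{i=0}^{T-1}\big(\mathbb E\|\nabla_xJ(x_{c,i},y_{c,i})\|^2+\mathbb E\|\nabla_yJ(x_{c,i},y_{c,i})\|^2\big)\le\mathcal O\Big(\frac{\kappa^2\mathbb EG_{p,0}}{(TK)^{2/3}}+\frac{\kappa^2\mathbb E\Delta_{c,0}}{(KT)^{2/3}}+\frac{\kappa^2\sigma^2}{(KT)^{2/3}}+\frac{\kappa^2\zeta_0^2}{T(1-\lambda)^2}+\frac{\kappa^2K^{2/3}\sigma^2}{T^{4/3}(1-\lambda)^3}+\frac{\kappa^2K\sigma^2}{T^2(1-\lambda)^3}+\frac{\kappa^2K^{5/3}\zeta_0^2}{T^{7/3}(1-\lambda)^4}\Big).$$ The transient time is $$T=\max\Big\{\mathcal O\Big(\frac{K^{7/5}}{(1-\lambda)^{2.4}}\Big),\mathcal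 O\Big(\frac{K^{5/4}}{(1-\lambda)^{9/4}}\Big),\mathcal O\Big(\frac{K^2}{(1-\lambda)^{4.5}}\Big),\mathcal O\Big(\frac{K^2}{(1-\lambda)^6}\Big)\Big\},$$ and the sample complexity is $$\mathcal O\Big(\frac{\kappa^3\varepsilon^{-3}}K+\frac{\kappa^2\varepsilon^{-2}}{(1-\lambda)^2}+\frac{\kappa^{1.5}K^{0.5}\varepsilon^{-1.5}}{(1-\lambda)^{9/4}}\Big).$$
   Context: Problem. $K$ agents solve $\min_{x\in\mathbb R^{d_1}}\max_{y\in\mathbb R^{d_2}}J(x,y)$, $J=\frac1K\sum_{k=1}^KJ_k$, with $J_k(x,y)=\mathbb E[Q_k(x,y;\zeta_k)]$ (online scenario). $P(x)=\max_yJ(x,y)$. Assumptions. (A1) For each $x$ the maximum is attained, $\|\nabla_yJ(x,y)\|^2\ge2\nu(P(x)-J(x,y))$ for all $x,y$ ($\nu>0$), and $P^\star=\inf_xP(x)>-\infty$. (A2) For each $k$ and $w\in\{x,y\}$, $\mathbb E\|\nabla_wQ_k(x_1,y_1;\xi)-\nabla_wQ_k(x_2,y_2;\xi)\|^2\le L_f^2(\|x_1-x_2\|^2+\|y_1-y_2\|^2)$ with $\xi$ a random local sample. (A3) Samples are i.i.d., independent over agents and iterations; conditionally on the past, sample gradients $\nabla_wQ_k$ at the current iterate are unbiased for $\nabla_wJ_k$ with variance at most $\sigma^2$. Algorithm DAMA. Stack $\mathcal X_i=\mathrm{col}\{x_{1,i},\dots,x_{K,i}\}$, $\mathcal Y_i=\mathrm{col}\{y_{k,i}\}$,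 gradient estimates $\mathcal G_{x,i}=\mathrm{col}\{g^x_{k,i}\}$, $\mathcal G_{y,i}=\mathrm{col}\{g^y_{k,i}\}$. For $i\ge0$: $\mathcal X_{i+1}=\mathcal A_x(\mathcal C_x\mathcal X_i-\mu_x\mathcal G_{x,i})-\mathcal B_x\mathcal D_{x,i}$, $\mathcal Y_{i+1}=\mathcal A_y(\mathcal C_y\mathcal Y_i+\mu_y\mathcal G_{y,i})-\mathcal B_y\mathcal D_{y,i}$, $\mathcal D_{x,i+1}=\mathcal D_{x,i}+\mathcal B_x\mathcal X_{i+1}$, $\mathcal D_{y,i+1}=\mathcal D_{y,i}+\mathcal B_y\mathcal Y_{i+1}$; all agents start from identical $x_{k,0}=x_0$, $y_{k,0}=y_0$ and identical dual blocks. Estimator (GRACE): $g^w_{k,0}$ is a minibatch gradient with $b_0$ i.i.d. samples; for $i\ge1$, with $\pi_i\sim\mathrm{Bernoulli}(p)$ shared by all agents: if $\pi_i=1$, $g^w_{k,i}$ is a minibatch gradient at $(x_{k,i},y_{k,i})$ with $B$ samples (never used when $p=0$); if $\pi_i=0$, with $b$ i.i.d. samples $\mathcal E'_{k,i}$, $g^w_{k,i}=(1-\beta_w)\big(g^w_{k,i-1}-\frac1b\sum_{\xi\in\mathcal E'_{k,i}}\nabla_wQ_k(x_{k,i-1},y_{k,i-1};\xi)\big)+\frac1b\sum_{\xi\in\mathcal E'_{k,i}}\nabla_wQ_k(x_{k,i},y_{k,i};\xi)$. Notation. $x_{c,i}=\frac1K\sum_kx_{k,i}$, $y_{c,i}=\frac1K\sum_ky_{k,i}$;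 $\kappa=L_f/\nu$; $G_{p,0}=P(x_{c,0})-P^\star$; $\Delta_{c,0}=P(x_{c,0})-J(x_{c,0},y_{c,0})$; $\zeta_0^2=\frac1K\mathbb E\|(\mathcal A_x-\frac1K\mathbf 1\mathbf 1^\top\otimes I)\mathcal G_{x,0}\|^2+\frac1K\mathbb E\|(\mathcal A_y-\frac1K\mathbf 1\mathbf 1^\top\otimes I)\mathcal G_{y,0}\|^2$; $\lambda$ is the largest eigenvalue of $W$ other than the simple eigenvalue $1$. Order conventions. Hyperparameters prescribed by $\mathcal O(\cdot)$ are set equal to suitable constant multiples of the given expression (batch sizes rounded to integers). Constants in $\mathcal O$ may depend on $L_f$ and on the smallest nonzero eigenvalue of $W$, but not on $T,K,\lambda,\kappa,\sigma,\zeta_0,\varepsilon$; "sufficiently large $T$" may depend on all problem parameters. The transient time is the order of $T$ beyond which the terms of order $\kappa^2/(KT)^{2/3}$ dominate the remaining terms, and the sample complexity is the number of samples used per agent to make the left-hand average at most $\varepsilon^2$ (for small $\varepsilon$, i.e. large $T$); in both, $\mathbb EG_{p,0},\mathbb E\Delta_{c,0},\sigma^2,\zeta_0^2$ are treated as constants.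
   Formalization: It is assumed that ν ≤ L_f, i.e. κ ≥ 1; (A1)–(A2) imply this unless J is constant in y, in which case every ν is admissible and the bound fails for small κ (e.g. J = x²/2 with additive noise). *)

theory Defs
  imports "HOL-Probability.Probability" "Jordan_Normal_Form.Char_Poly"
begin

hide_const (open) Finite_Cartesian_Product.vec Finite_Cartesian_Product.mat
unbundle no vec_syntax

(* Vectors of R^d are library vectors in carrier_vec d. The dimensions and the number of agents are
   ordinary numbers rather than types, since the constants of the result must not depend on them. *)
type_synonym rvec = "real Matrix.vec"
type_synonym rmat = "real Matrix.mat"

definition sqn :: "rvec \<Rightarrow> real" where
  "sqn v = v \<bullet> v"

definition vec_borel :: "nat \<Rightarrow> rvec measure" where
  "vec_borel d = vimage_algebra (carrier_vec d) (\<lambda>v. \<lambda>j\<in>{..<d}. v $ j) (\<Pi>\<^sub>M j\<in>{..<d}. borel)"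

definition has_partials :: "nat \<Rightarrow> (rvec \<Rightarrow> real) \<Rightarrow> rvec \<Rightarrow> bool" where
  "has_partials d f x \<longleftrightarrow>
     (\<forall>j<d. (\<lambda>t. f (x + t \<cdot>\<^sub>v unit_vec d j)) differentiable (at (0::real)))"

definition grad :: "nat \<Rightarrow> (rvec \<Rightarrow> real) \<Rightarrow> rvec \<Rightarrow> rvec" where
  "grad d f x = Matrix.vec d (\<lambda>j. deriv (\<lambda>t. f (x + t \<cdot>\<^sub>v unit_vec d j)) 0)"


section \<open>The minimax problem\<close>

record 's problem =
  agents :: nat
  dimx :: nat
  dimy :: nat
  law :: "nat \<Rightarrow> 's measure"
  loss :: "nat \<Rightarrow> rvec \<Rightarrow> rvec \<Rightarrow> 's \<Rightarrow> real"

abbreviation Xs :: "'s problem \<Rightarrow> rvec set" where "Xs p \<equiv> carrier_vec (dimx p)"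
abbreviation Ys :: "'s problem \<Rightarrow> rvec set" where "Ys p \<equiv> carrier_vec (dimy p)"

definition risk :: "'s problem \<Rightarrow> nat \<Rightarrow> rvec \<Rightarrow> rvec \<Rightarrow> real" where
  "risk p k x y = (\<integral>s. loss p k x y s \<partial>law p k)"

definition J :: "'s problem \<Rightarrow> rvec \<Rightarrow> rvec \<Rightarrow> real" where
  "J p x y = (\<Sum>k<agents p. risk p k x y) / real (agents p)"

definition P :: "'s problem \<Rightarrow> rvec \<Rightarrow> real" where
  "P p x = (SUP y\<in>Ys p. J p x y)"

definition Pstar :: "'s problem \<Rightarrow> real" where
  "Pstar p = (INF x\<in>Xs p. P p x)"

definition gradx_loss :: "'s problem \<Rightarrow> nat \<Rightarrow> rvec \<Rightarrow> rvec \<Rightarrow> 's \<Rightarrow> rvec" where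
  "gradx_loss p k x y s = grad (dimx p) (\<lambda>u. loss p k u y s) x"
definition grady_loss :: "'s problem \<Rightarrow> nat \<Rightarrow> rvec \<Rightarrow> rvec \<Rightarrow> 's \<Rightarrow> rvec" where
  "grady_loss p k x y s = grad (dimy p) (\<lambda>v. loss p k x v s) y"

definition gradx_risk :: "'s problem \<Rightarrow> nat \<Rightarrow> rvec \<Rightarrow> rvec \<Rightarrow> rvec" where
  "gradx_risk p k x y = grad (dimx p) (\<lambda>u. risk p k u y) x"
definition grady_risk :: "'s problem \<Rightarrow> nat \<Rightarrow> rvec \<Rightarrow> rvec \<Rightarrow> rvec" where
  "grady_risk p k x y = grad (dimy p) (\<lambda>v. risk p k x v) y"

definition gradx_J :: "'s problem \<Rightarrow> rvec \<Rightarrow> rvec \<Rightarrow> rvec" where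
  "gradx_J p x y = grad (dimx p) (\<lambda>u. J p u y) x"
definition grady_J :: "'s problem \<Rightarrow> rvec \<Rightarrow> rvec \<Rightarrow> rvec" where
  "grady_J p x y = grad (dimy p) (\<lambda>v. J p x v) y"

(* The standing regularity implicit in writing down the losses, their expectations and gradients. *)
definition well_posed :: "'s problem \<Rightarrow> bool" where
  "well_posed p \<longleftrightarrow>
     (\<forall>k<agents p. prob_space (law p k)) \<and>
     (\<forall>k<agents p. \<forall>x\<in>Xs p. \<forall>y\<in>Ys p. integrable (law p k) (loss p k x y)) \<and>
     (\<forall>k<agents p. \<forall>x\<in>Xs p. \<forall>y\<in>Ys p. \<forall>s\<in>space (law p k).
        has_partials (dimx p) (\<lambda>u. loss p k u y s) x \<and>
        has_partials (dimy p) (\<lambda>v. loss p k x v s) y) \<and>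
     (\<forall>k<agents p. \<forall>x\<in>Xs p. \<forall>y\<in>Ys p.
        has_partials (dimx p) (\<lambda>u. risk p k u y) x \<and>
        has_partials (dimy p) (\<lambda>v. risk p k x v) y) \<and>
     (\<forall>k<agents p.
        (\<lambda>((x, y), s). gradx_loss p k x y s)
          \<in> (vec_borel (dimx p) \<Otimes>\<^sub>M vec_borel (dimy p)) \<Otimes>\<^sub>M law p k \<rightarrow>\<^sub>M vec_borel (dimx p) \<and>
        (\<lambda>((x, y), s). grady_loss p k x y s)
          \<in> (vec_borel (dimx p) \<Otimes>\<^sub>M vec_borel (dimy p)) \<Otimes>\<^sub>M law p k \<rightarrow>\<^sub>M vec_borel (dimy p))"

definition PL_condition :: "'s problem \<Rightarrow> real \<Rightarrow> bool" where
  "PL_condition p \<nu> \<longleftrightarrow>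
     0 < \<nu> \<and>
     (\<forall>x\<in>Xs p. \<exists>y\<in>Ys p. \<forall>y'\<in>Ys p. J p x y' \<le> J p x y) \<and>
     (\<forall>x\<in>Xs p. \<forall>y\<in>Ys p. sqn (grady_J p x y) \<ge> 2 * \<nu> * (P p x - J p x y)) \<and>
     bdd_below (P p ` Xs p)"

definition mean_square_smooth :: "'s problem \<Rightarrow> real \<Rightarrow> bool" where
  "mean_square_smooth p Lf \<longleftrightarrow>
     (\<forall>k<agents p. \<forall>x1\<in>Xs p. \<forall>y1\<in>Ys p. \<forall>x2\<in>Xs p. \<forall>y2\<in>Ys p.
        (\<integral>\<^sup>+s. ennreal (sqn (gradx_loss p k x1 y1 s - gradx_loss p k x2 y2 s)) \<partial>law p k)
          \<le> ennreal (Lf\<^sup>2 * (sqn (x1 - x2) + sqn (y1 - y2))) \<and>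
        (\<integral>\<^sup>+s. ennreal (sqn (grady_loss p k x1 y1 s - grady_loss p k x2 y2 s)) \<partial>law p k)
          \<le> ennreal (Lf\<^sup>2 * (sqn (x1 - x2) + sqn (y1 - y2))))"

(* The samples drawn at an iteration are independent of the past, so unbiasedness conditionally on
   the past is unbiasedness under the law of one sample at a frozen point. *)
definition unbiased_gradients :: "'s problem \<Rightarrow> bool" where
  "unbiased_gradients p \<longleftrightarrow>
     (\<forall>k<agents p. \<forall>x\<in>Xs p. \<forall>y\<in>Ys p.
        (\<forall>j<dimx p. has_bochner_integral (law p k) (\<lambda>s. gradx_loss p k x y s $ j)
                      (gradx_risk p k x y $ j)) \<and>
        (\<forall>j<dimy p. has_bochner_integral (law p k) (\<lambda>s. grady_loss p k x y s $ j)
                      (grady_risk p k x y $ j)))"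


section \<open>Network matrices\<close>

definition psd_mat :: "nat \<Rightarrow> rmat \<Rightarrow> bool" where
  "psd_mat n A \<longleftrightarrow> A \<in> carrier_mat n n \<and> transpose_mat A = A \<and>
     (\<forall>v\<in>carrier_vec n. 0 \<le> v \<bullet> (A *\<^sub>v v))"

definition is_psd_sqrt :: "nat \<Rightarrow> rmat \<Rightarrow> rmat \<Rightarrow> bool" where
  "is_psd_sqrt n R A \<longleftrightarrow> psd_mat n R \<and> R * R = A"

definition doubly_stochastic :: "nat \<Rightarrow> rmat \<Rightarrow> bool" where
  "doubly_stochastic n A \<longleftrightarrow> A \<in> carrier_mat n n \<and>
     (\<forall>k<n. \<forall>l<n. 0 \<le> A $$ (k, l)) \<and>
     (\<forall>k<n. (\<Sum>l<n. A $$ (k, l)) = 1) \<and> (\<forall>l<n. (\<Sum>k<n. A $$ (k, l)) = 1)"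

definition primitive_mat :: "nat \<Rightarrow> rmat \<Rightarrow> bool" where
  "primitive_mat n A \<longleftrightarrow> (\<exists>m>0. \<forall>k<n. \<forall>l<n. 0 < (A ^\<^sub>m m) $$ (k, l))"

definition mixing_matrix :: "nat \<Rightarrow> rmat \<Rightarrow> bool" where
  "mixing_matrix n W \<longleftrightarrow> psd_mat n W \<and> doubly_stochastic n W \<and> primitive_mat n W"

definition lam2 :: "rmat \<Rightarrow> real" where
  "lam2 W = Max {c. eigenvalue W c \<and> c \<noteq> 1}"

definition min_nonzero_eig :: "rmat \<Rightarrow> real" where
  "min_nonzero_eig W = Min {c. eigenvalue W c \<and> c \<noteq> 0}"

(* A \<otimes> I_d; block k of a stacked vector of length K * d occupies the indices k * d, ..., k * d + d - 1. *)
definition kron_id :: "rmat \<Rightarrow> nat \<Rightarrow> rmat" where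
  "kron_id A d = Matrix.mat (dim_row A * d) (dim_col A * d)
     (\<lambda>(r, c). A $$ (r div d, c div d) * (if r mod d = c mod d then 1 else 0))"

definition stack :: "nat \<Rightarrow> nat \<Rightarrow> (nat \<Rightarrow> rvec) \<Rightarrow> rvec" where
  "stack K d f = Matrix.vec (K * d) (\<lambda>r. f (r div d) $ (r mod d))"

definition block :: "nat \<Rightarrow> rvec \<Rightarrow> nat \<Rightarrow> rvec" where
  "block d V k = Matrix.vec d (\<lambda>j. V $ (k * d + j))"

definition centroid :: "nat \<Rightarrow> nat \<Rightarrow> rvec \<Rightarrow> rvec" where
  "centroid K d V = Matrix.vec d (\<lambda>j. (\<Sum>k<K. block d V k $ j) / real K)"

definition averaging :: "nat \<Rightarrow> nat \<Rightarrow> rmat" where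
  "averaging K d = kron_id (Matrix.mat K K (\<lambda>_. 1 / real K)) d"


section \<open>DAMA with the GRACE estimator\<close>

record dama_matrices =
  Ax :: rmat
  Bx :: rmat
  Cx :: rmat
  Ay :: rmat
  By :: rmat
  Cy :: rmat

definition extra_matrices :: "'s problem \<Rightarrow> rmat \<Rightarrow> rmat \<Rightarrow> rmat \<Rightarrow> dama_matrices" where
  "extra_matrices p W Rx Ry =
     \<lparr> Ax = 1\<^sub>m (agents p * dimx p), Bx = Rx, Cx = kron_id W (dimx p),
       Ay = 1\<^sub>m (agents p * dimy p), By = Ry, Cy = kron_id W (dimy p) \<rparr>"

record dama_hyper =
  mux :: real
  muy :: real
  betax :: real
  betay :: real
  batch0 :: nat
  batch_big :: nat
  batch :: nat

record dama_state =
  stX :: rvec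
  stY :: rvec
  stDX :: rvec
  stDY :: rvec
  stGX :: rvec
  stGY :: rvec

definition minibatch :: "nat \<Rightarrow> nat \<Rightarrow> (nat \<Rightarrow> rvec) \<Rightarrow> rvec" where
  "minibatch d n f = Matrix.vec d (\<lambda>c. (\<Sum>j<n. f j $ c) / real n)"

(* One GRACE update of a single agent: gold is the previous estimate, snew j and sold j are the
   gradients of the j-th fresh sample at the current and at the previous iterate. *)
definition grace :: "nat \<Rightarrow> real \<Rightarrow> dama_hyper \<Rightarrow> bool \<Rightarrow> rvec \<Rightarrow> (nat \<Rightarrow> rvec) \<Rightarrow> (nat \<Rightarrow> rvec) \<Rightarrow> rvec" where
  "grace d \<beta> h c gold sold snew =
     (if c then minibatch d (batch_big h) snew
      else (1 - \<beta>) \<cdot>\<^sub>v (gold - minibatch d (batch h) sold) + minibatch d (batch h) snew)"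

(* One sample path: s k i j is the j-th sample of agent k at iteration i and coin i the shared
   Bernoulli variable; the initial blocks x, y, u, v are common to all agents. *)
primrec dama :: "'s problem \<Rightarrow> dama_matrices \<Rightarrow> dama_hyper \<Rightarrow> (nat \<Rightarrow> nat \<Rightarrow> nat \<Rightarrow> 's) \<Rightarrow> (nat \<Rightarrow> bool) \<Rightarrow>
    rvec \<Rightarrow> rvec \<Rightarrow> rvec \<Rightarrow> rvec \<Rightarrow> nat \<Rightarrow> dama_state" where
  "dama p A h s coin x y u v 0 =
     (let K = agents p; d1 = dimx p; d2 = dimy p;
          X = stack K d1 (\<lambda>_. x); Y = stack K d2 (\<lambda>_. y)
      in \<lparr> stX = X, stY = Y, stDX = stack K d1 (\<lambda>_. u), stDY = stack K d2 (\<lambda>_. v),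
           stGX = stack K d1 (\<lambda>k. minibatch d1 (batch0 h)
                    (\<lambda>j. gradx_loss p k (block d1 X k) (block d2 Y k) (s k 0 j))),
           stGY = stack K d2 (\<lambda>k. minibatch d2 (batch0 h)
                    (\<lambda>j. grady_loss p k (block d1 X k) (block d2 Y k) (s k 0 j))) \<rparr>)"
| "dama p A h s coin x y u v (Suc i) =
     (let K = agents p; d1 = dimx p; d2 = dimy p;
          S = dama p A h s coin x y u v i;
          X = Ax A *\<^sub>v (Cx A *\<^sub>v stX S - mux h \<cdot>\<^sub>v stGX S) - Bx A *\<^sub>v stDX S;
          Y = Ay A *\<^sub>v (Cy A *\<^sub>v stY S + muy h \<cdot>\<^sub>v stGY S) - By A *\<^sub>v stDY S
      in \<lparr> stX = X, stY = Y, stDX = stDX S + Bx A *\<^sub>v X, stDY = stDY S + By A *\<^sub>v Y,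
           stGX = stack K d1 (\<lambda>k. grace d1 (betax h) h (coin (Suc i)) (block d1 (stGX S) k)
                    (\<lambda>j. gradx_loss p k (block d1 (stX S) k) (block d2 (stY S) k) (s k (Suc i) j))
                    (\<lambda>j. gradx_loss p k (block d1 X k) (block d2 Y k) (s k (Suc i) j))),
           stGY = stack K d2 (\<lambda>k. grace d2 (betay h) h (coin (Suc i)) (block d2 (stGY S) k)
                    (\<lambda>j. grady_loss p k (block d1 (stX S) k) (block d2 (stY S) k) (s k (Suc i) j))
                    (\<lambda>j. grady_loss p k (block d1 X k) (block d2 Y k) (s k (Suc i) j))) \<rparr>)"

definition storm_hyper ::
    "real \<Rightarrow> real \<Rightarrow> real \<Rightarrow> real \<Rightarrow> nat \<Rightarrow> nat \<Rightarrow> nat \<Rightarrow> real \<Rightarrow> nat \<Rightarrow> dama_hyper" where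
  "storm_hyper cx cy c\<beta> c0 b B K \<kappa> T =
     \<lparr> mux = cx * (real K powr (2/3) / (real T powr (1/3) * \<kappa>\<^sup>2)),
       muy = cy * (real K powr (2/3) / real T powr (1/3)),
       betax = c\<beta> * (real K powr (1/3) / real T powr (2/3)),
       betay = c\<beta> * (real K powr (1/3) / real T powr (2/3)),
       batch0 = nat \<lceil>c0 * (real T powr (1/3) / real K powr (2/3))\<rceil>,
       batch_big = B,
       batch = b \<rparr>"


section \<open>The random run\<close>

datatype source = Init | Coin nat | Sample nat nat nat

(* The sigma-algebra carried by each primitive source of randomness. *)
definition source_sets :: "'w measure \<Rightarrow> 's problem \<Rightarrow> (nat \<Rightarrow> nat \<Rightarrow> nat \<Rightarrow> 'w \<Rightarrow> 's) \<Rightarrow> (nat \<Rightarrow> 'w \<Rightarrow> bool) \<Rightarrow>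
    ('w \<Rightarrow> rvec) \<Rightarrow> ('w \<Rightarrow> rvec) \<Rightarrow> source \<Rightarrow> 'w set set" where
  "source_sets M p \<xi> coin x0 y0 r = (case r of
       Init \<Rightarrow> sets (vimage_algebra (space M) (\<lambda>\<omega>. (x0 \<omega>, y0 \<omega>)) (vec_borel (dimx p) \<Otimes>\<^sub>M vec_borel (dimy p)))
     | Coin i \<Rightarrow> sets (vimage_algebra (space M) (coin i) (count_space UNIV))
     | Sample k i j \<Rightarrow> sets (vimage_algebra (space M) (\<xi> k i j) (law p k)))"

definition sampling_model :: "'w measure \<Rightarrow> 's problem \<Rightarrow> real \<Rightarrow> (nat \<Rightarrow> nat \<Rightarrow> nat \<Rightarrow> 'w \<Rightarrow> 's) \<Rightarrow>
    (nat \<Rightarrow> 'w \<Rightarrow> bool) \<Rightarrow> ('w \<Rightarrow> rvec) \<Rightarrow> ('w \<Rightarrow> rvec) \<Rightarrow> bool" where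
  "sampling_model M p prb \<xi> coin x0 y0 \<longleftrightarrow>
     prob_space M \<and>
     x0 \<in> M \<rightarrow>\<^sub>M vec_borel (dimx p) \<and> y0 \<in> M \<rightarrow>\<^sub>M vec_borel (dimy p) \<and>
     (\<forall>k<agents p. \<forall>i j. \<xi> k i j \<in> M \<rightarrow>\<^sub>M law p k \<and> distr M (law p k) (\<xi> k i j) = law p k) \<and>
     (\<forall>i. coin i \<in> M \<rightarrow>\<^sub>M count_space UNIV \<and>
          distr M (count_space UNIV) (coin i) = measure_pmf (bernoulli_pmf prb)) \<and>
     prob_space.indep_sets M (source_sets M p \<xi> coin x0 y0)
       ({Init} \<union> range Coin \<union> {Sample k i j | k i j. k < agents p})"

definition past :: "'w measure \<Rightarrow> 's problem \<Rightarrow> (nat \<Rightarrow> nat \<Rightarrow> nat \<Rightarrow> 'w \<Rightarrow> 's) \<Rightarrow>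
    (nat \<Rightarrow> 'w \<Rightarrow> bool) \<Rightarrow> ('w \<Rightarrow> rvec) \<Rightarrow> ('w \<Rightarrow> rvec) \<Rightarrow> nat \<Rightarrow> 'w measure" where
  "past M p \<xi> coin x0 y0 i = sigma (space M)
     (\<Union>r\<in>{Init} \<union> {Coin n | n. n < i} \<union> {Sample k n j | k n j. k < agents p \<and> n < i}.
        source_sets M p \<xi> coin x0 y0 r)"

definition run :: "'s problem \<Rightarrow> dama_matrices \<Rightarrow> dama_hyper \<Rightarrow> (nat \<Rightarrow> nat \<Rightarrow> nat \<Rightarrow> 'w \<Rightarrow> 's) \<Rightarrow>
    (nat \<Rightarrow> 'w \<Rightarrow> bool) \<Rightarrow> ('w \<Rightarrow> rvec) \<Rightarrow> ('w \<Rightarrow> rvec) \<Rightarrow> rvec \<Rightarrow> rvec \<Rightarrow> nat \<Rightarrow> 'w \<Rightarrow> dama_state" where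
  "run p A h \<xi> coin x0 y0 u v i \<omega> =
     dama p A h (\<lambda>k i j. \<xi> k i j \<omega>) (\<lambda>i. coin i \<omega>) (x0 \<omega>) (y0 \<omega>) u v i"

definition bounded_variance :: "'w measure \<Rightarrow> 's problem \<Rightarrow> (nat \<Rightarrow> nat \<Rightarrow> nat \<Rightarrow> 'w \<Rightarrow> 's) \<Rightarrow>
    (nat \<Rightarrow> 'w \<Rightarrow> bool) \<Rightarrow> ('w \<Rightarrow> rvec) \<Rightarrow> ('w \<Rightarrow> rvec) \<Rightarrow> real \<Rightarrow> (nat \<Rightarrow> 'w \<Rightarrow> dama_state) \<Rightarrow> nat \<Rightarrow> bool" where
  "bounded_variance M p \<xi> coin x0 y0 \<sigma> st T \<longleftrightarrow>
     (\<forall>k<agents p. \<forall>i<T. \<forall>j.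
        let x = (\<lambda>\<omega>. block (dimx p) (stX (st i \<omega>)) k);
            y = (\<lambda>\<omega>. block (dimy p) (stY (st i \<omega>)) k);
            F = past M p \<xi> coin x0 y0 i
        in (AE \<omega> in M. nn_cond_exp M F (\<lambda>\<omega>. ennreal (sqn
              (gradx_loss p k (x \<omega>) (y \<omega>) (\<xi> k i j \<omega>) - gradx_risk p k (x \<omega>) (y \<omega>)))) \<omega> \<le> ennreal (\<sigma>\<^sup>2)) \<and>
           (AE \<omega> in M. nn_cond_exp M F (\<lambda>\<omega>. ennreal (sqn
              (grady_loss p k (x \<omega>) (y \<omega>) (\<xi> k i j \<omega>) - grady_risk p k (x \<omega>) (y \<omega>)))) \<omega> \<le> ennreal (\<sigma>\<^sup>2)))"

definition xc :: "'s problem \<Rightarrow> dama_state \<Rightarrow> rvec" where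
  "xc p S = centroid (agents p) (dimx p) (stX S)"
definition yc :: "'s problem \<Rightarrow> dama_state \<Rightarrow> rvec" where
  "yc p S = centroid (agents p) (dimy p) (stY S)"


section \<open>Quantities in the bound\<close>

(* Expectations of nonnegative quantities are taken in the extended nonnegative reals, so none of
   them degenerates to 0 for lack of integrability. *)

definition avg_sq_grad :: "'w measure \<Rightarrow> 's problem \<Rightarrow> (nat \<Rightarrow> 'w \<Rightarrow> dama_state) \<Rightarrow> nat \<Rightarrow> ennreal" where
  "avg_sq_grad M p st T = ennreal (1 / real T) *
     (\<Sum>i<T. (\<integral>\<^sup>+\<omega>. ennreal (sqn (gradx_J p (xc p (st i \<omega>)) (yc p (st i \<omega>)))) \<partial>M) +
             (\<integral>\<^sup>+\<omega>. ennreal (sqn (grady_J p (xc p (st i \<omega>)) (yc p (st i \<omega>)))) \<partial>M))"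

definition primal_gap0 :: "'w measure \<Rightarrow> 's problem \<Rightarrow> (nat \<Rightarrow> 'w \<Rightarrow> dama_state) \<Rightarrow> ennreal" where
  "primal_gap0 M p st = (\<integral>\<^sup>+\<omega>. ennreal (P p (xc p (st 0 \<omega>)) - Pstar p) \<partial>M)"

definition dual_gap0 :: "'w measure \<Rightarrow> 's problem \<Rightarrow> (nat \<Rightarrow> 'w \<Rightarrow> dama_state) \<Rightarrow> ennreal" where
  "dual_gap0 M p st =
     (\<integral>\<^sup>+\<omega>. ennreal (P p (xc p (st 0 \<omega>)) - J p (xc p (st 0 \<omega>)) (yc p (st 0 \<omega>))) \<partial>M)"

definition zeta0_sq :: "'w measure \<Rightarrow> 's problem \<Rightarrow> dama_matrices \<Rightarrow> (nat \<Rightarrow> 'w \<Rightarrow> dama_state) \<Rightarrow> ennreal" where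
  "zeta0_sq M p A st =
     ennreal (1 / real (agents p)) *
       (\<integral>\<^sup>+\<omega>. ennreal (sqn ((Ax A - averaging (agents p) (dimx p)) *\<^sub>v stGX (st 0 \<omega>))) \<partial>M) +
     ennreal (1 / real (agents p)) *
       (\<integral>\<^sup>+\<omega>. ennreal (sqn ((Ay A - averaging (agents p) (dimy p)) *\<^sub>v stGY (st 0 \<omega>))) \<partial>M)"

definition lead_terms :: "nat \<Rightarrow> nat \<Rightarrow> real \<Rightarrow> ennreal \<Rightarrow> ennreal \<Rightarrow> ennreal \<Rightarrow> ennreal" where
  "lead_terms K T \<kappa> G \<Delta> s =
     ennreal (\<kappa>\<^sup>2 / (real T * real K) powr (2/3)) * G +
     ennreal (\<kappa>\<^sup>2 / (real K * real T) powr (2/3)) * \<Delta> +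
     ennreal (\<kappa>\<^sup>2 / (real K * real T) powr (2/3)) * s"

definition rest_terms :: "nat \<Rightarrow> nat \<Rightarrow> real \<Rightarrow> real \<Rightarrow> ennreal \<Rightarrow> ennreal \<Rightarrow> ennreal" where
  "rest_terms K T \<kappa> lam s z =
     ennreal (\<kappa>\<^sup>2 / (real T * (1 - lam)^2)) * z +
     ennreal (\<kappa>\<^sup>2 * real K powr (2/3) / (real T powr (4/3) * (1 - lam)^3)) * s +
     ennreal (\<kappa>\<^sup>2 * real K / (real T ^ 2 * (1 - lam)^3)) * s +
     ennreal (\<kappa>\<^sup>2 * real K powr (5/3) / (real T powr (7/3) * (1 - lam)^4)) * z"

definition transient_order :: "nat \<Rightarrow> real \<Rightarrow> real" where
  "transient_order K lam = Max
     {real K powr (7/5) / (1 - lam) powr (24/10), real K powr (5/4) / (1 - lam) powr (9/4),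
      real K ^ 2 / (1 - lam) powr (45/10), real K ^ 2 / (1 - lam) ^ 6}"

(* With p = 0 every agent draws b0 samples at iteration 0 and b samples at each of the iterations
   1, ..., T - 1. *)
definition samples_per_agent :: "dama_hyper \<Rightarrow> nat \<Rightarrow> nat" where
  "samples_per_agent h T = batch0 h + batch h * (T - 1)"

definition sample_order :: "nat \<Rightarrow> real \<Rightarrow> real \<Rightarrow> real \<Rightarrow> real" where
  "sample_order K \<kappa> lam \<epsilon> =
     \<kappa> ^ 3 * \<epsilon> powr (-3) / real K +
     \<kappa>\<^sup>2 * \<epsilon> powr (-2) / (1 - lam)^2 +
     \<kappa> powr (15/10) * real K powr (5/10) * \<epsilon> powr (-15/10) / (1 - lam) powr (9/4)"

end

theory Submission
  imports Defs
begin

text \<open>A step of the centroid is an inexact gradient descent-ascent step on \<open>J\<close>. The potential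
  \<open>P(x) - P\<^sup>\<star> + (P(x) - J(x, y)) / 8\<close> decreases along it up to the squared errors of the averaged gradient
  estimates: since \<open>\<mu>\<^sub>x\<close> is smaller than \<open>\<mu>\<^sub>y\<close> by a factor of order \<open>\<kappa>\<^sup>2\<close>, the PL inequality lets the ascent in \<open>y\<close>
  dominate the drift of the maximum. Smoothness of \<open>P\<close> is never needed: near-maximizers obtained by gradient
  ascent suffice.

  The error splits into the consensus spread and the error of the averaged STORM estimate. The latter contracts
  by \<open>(1 - \<beta>)\<^sup>2\<close> per iteration, at the price of \<open>\<beta>\<^sup>2 \<sigma>\<^sup>2 / K\<close> and of \<open>L\<^sup>2 / K\<^sup>2\<close> times the squared increments of the
  iterates; the factor \<open>1 / K\<close> comes from the independence of the agents. For EXTRA, a Lyapunov function of the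
  primal-dual recursion on the complement of the constants bounds the total spread by the initial disagreement of
  the estimates and their subsequent drift. Increments, spread and drift are bounded by one another; for the
  prescribed step sizes and large \<open>T\<close> this loop closes and the increments are absorbed by the descent.

  With \<open>p = 0\<close> the coins are almost surely false, so the run is replaced by one that ignores them. When the
  initial gaps or \<open>\<zeta>\<^sub>0\<close> have infinite expectation, the bound is trivial; otherwise all quantities are integrable by
  induction along the run.\<close>

text \<open>One relation between the step sizes is sharp:
  \<open>1024 * L^2 * muy^2 = \<beta> * K\<close>. Summed over the run, increments enter the
  averaged STORM error with weight \<open>L^2 / (\<beta> * K)\<close>, while the descent supplies
  only \<open>muy\<close> times the squared estimates; this fixes how small \<open>\<beta>\<close>
  may be for the given \<open>muy\<close>. All other conditions hold for large \<open>T\<close> with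
  slack: the feedback of the spread into itself is then at most one half, and the noise entering
  through the spread, amplified by \<open>1 / gam^3\<close>, falls below the leading noise. Of the
  network effects only the initial disagreement of the estimates stays visible, at order
  \<open>z / (T * gam^2)\<close>. The hypotheses provide partial derivatives, a conditional variance
  bound and no integrability of iterates or gradients. So second moments are extended nonnegative
  integrals, for which the fresh-sample inequalities need no finiteness, and real expectations
  appear only after an induction along the run. Differentiability along lines and measurability of
  \<open>J p\<close> and \<open>P p\<close> are not given either: both are extracted from Lipschitz
  estimates.\<close>

lemma sqn_sum: "sqn v = (\<Sum>j<dim_vec v. (v $ j)\<^sup>2)"
  by (simp add: sqn_def scalar_prod_def power2_eq_square lessThan_atLeast0)

lemma sqn_carrier: "v \<in> carrier_vec d \<Longrightarrow> sqn v = (\<Sum>j<d. (v $ j)\<^sup>2)"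
  by (simp add: sqn_sum)

lemma sqn_nonneg [simp]: "0 \<le> sqn v"
  by (simp add: sqn_sum sum_nonneg)

lemma scalar_prod_carrier: "w \<in> carrier_vec d \<Longrightarrow> v \<bullet> w = (\<Sum>j<d. v $ j * w $ j)"
  by (simp add: scalar_prod_def lessThan_atLeast0)

definition nrm :: "rvec \<Rightarrow> real" where "nrm v = sqrt (sqn v)"

lemma nrm_nonneg [simp]: "0 \<le> nrm v" by (simp add: nrm_def)
lemma nrm_sq [simp]: "(nrm v)\<^sup>2 = sqn v" by (simp add: nrm_def)

lemma nrm_L2: "v \<in> carrier_vec d \<Longrightarrow> nrm v = L2_set (\<lambda>j. v $ j) {..<d}"
  by (simp add: nrm_def L2_set_def sqn_carrier)

lemma nrm_triangle:
  assumes "v \<in> carrier_vec d" "w \<in> carrier_vec d" shows "nrm (v + w) \<le> nrm v + nrm w"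
proof -
  have "nrm (v + w) = L2_set (\<lambda>j. v $ j + w $ j) {..<d}"
    unfolding nrm_L2[OF add_carrier_vec[OF assms]] by (rule L2_set_cong) (use assms in auto)
  also have "\<dots> \<le> nrm v + nrm w" unfolding nrm_L2[OF assms(1)] nrm_L2[OF assms(2)]
    by (rule L2_set_triangle_ineq)
  finally show ?thesis .
qed

lemma abs_scalar_prod_le:
  assumes "v \<in> carrier_vec d" "w \<in> carrier_vec d" shows "\<bar>v \<bullet> w\<bar> \<le> nrm v * nrm w"
proof -
  have "\<bar>v \<bullet> w\<bar> \<le> (\<Sum>j<d. \<bar>v $ j\<bar> * \<bar>w $ j\<bar>)"
    unfolding scalar_prod_carrier[OF assms(2)] abs_mult[symmetric] by (rule sum_abs)
  also have "\<dots> \<le> nrm v * nrm w"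
    unfolding nrm_L2[OF assms(1)] nrm_L2[OF assms(2)] by (rule L2_set_mult_ineq)
  finally show ?thesis .
qed

lemma sqn_smult: "sqn (c \<cdot>\<^sub>v v) = c\<^sup>2 * sqn v"
  by (simp add: sqn_sum power_mult_distrib sum_distrib_left)

lemma nrm_smult: "nrm (c \<cdot>\<^sub>v v) = \<bar>c\<bar> * nrm v"
  by (simp add: nrm_def sqn_smult real_sqrt_mult)

lemma sqn_uminus_sub:
  assumes "v \<in> carrier_vec d" "w \<in> carrier_vec d" shows "sqn (v - w) = sqn (w - v)"
  using assms by (simp add: sqn_sum power2_commute)

lemma sqn_add:
  assumes "v \<in> carrier_vec d" "w \<in> carrier_vec d"
  shows "sqn (v + w) = sqn v + 2 * (v \<bullet> w) + sqn w"
  using assms by (simp add: sqn_sum scalar_prod_carrier[OF assms(2)] power2_sum sum.distrib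
      sum_distrib_left algebra_simps)

lemma sqn_sub:
  assumes "v \<in> carrier_vec d" "w \<in> carrier_vec d"
  shows "sqn (v - w) = sqn v - 2 * (v \<bullet> w) + sqn w"
  using assms by (simp add: sqn_sum scalar_prod_carrier[OF assms(2)] power2_diff sum.distrib
      sum_distrib_left sum_subtractf algebra_simps)

lemma sqn_add_le:
  assumes "v \<in> carrier_vec d" "w \<in> carrier_vec d"
  shows "sqn (v + w) \<le> 2 * sqn v + 2 * sqn w"
proof -
  have "0 \<le> sqn (v - w)" by simp
  then show ?thesis unfolding sqn_add[OF assms] sqn_sub[OF assms] by simp
qed

lemma sqn_sub_le:
  assumes "v \<in> carrier_vec d" "w \<in> carrier_vec d"
  shows "sqn (v - w) \<le> 2 * sqn v + 2 * sqn w"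
proof -
  have "0 \<le> sqn (v + w)" by simp
  then show ?thesis unfolding sqn_add[OF assms] sqn_sub[OF assms] by simp
qed

section \<open>Nonconvex-PL objectives\<close>

text \<open>Gradients enter only through two-sided quadratic expansions and Lipschitz bounds, which
  keeps calculus out of this part. \<open>Pm\<close> is tied to \<open>F\<close> as an upper bound
  with the PL inequality; that \<open>F\<close> comes arbitrarily close to it is derived in
  \<open>near_maximizer\<close>.\<close>

locale nonconvex_PL =
  fixes d1 d2 :: nat and F :: "rvec \<Rightarrow> rvec \<Rightarrow> real" and gx gy :: "rvec \<Rightarrow> rvec \<Rightarrow> rvec"
    and Pm :: "rvec \<Rightarrow> real" and L \<nu> Pst :: real
  assumes nu: "0 < \<nu>" "\<nu> \<le> L"
    and gxc: "\<And>x y. x \<in> carrier_vec d1 \<Longrightarrow> y \<in> carrier_vec d2 \<Longrightarrow> gx x y \<in> carrier_vec d1"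
    and gyc: "\<And>x y. x \<in> carrier_vec d1 \<Longrightarrow> y \<in> carrier_vec d2 \<Longrightarrow> gy x y \<in> carrier_vec d2"
    and descx: "\<And>x x' y. x \<in> carrier_vec d1 \<Longrightarrow> x' \<in> carrier_vec d1 \<Longrightarrow> y \<in> carrier_vec d2 \<Longrightarrow>
      \<bar>F x' y - F x y - gx x y \<bullet> (x' - x)\<bar> \<le> L / 2 * sqn (x' - x)"
    and descy: "\<And>x y y'. x \<in> carrier_vec d1 \<Longrightarrow> y \<in> carrier_vec d2 \<Longrightarrow> y' \<in> carrier_vec d2 \<Longrightarrow>
      \<bar>F x y' - F x y - gy x y \<bullet> (y' - y)\<bar> \<le> L / 2 * sqn (y' - y)"
    and lipx: "\<And>x x' y y'. x \<in> carrier_vec d1 \<Longrightarrow> x' \<in> carrier_vec d1 \<Longrightarrow> y \<in> carrier_vec d2 \<Longrightarrow>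
      y' \<in> carrier_vec d2 \<Longrightarrow> sqn (gx x y - gx x' y') \<le> L\<^sup>2 * (sqn (x - x') + sqn (y - y'))"
    and lipy: "\<And>x x' y y'. x \<in> carrier_vec d1 \<Longrightarrow> x' \<in> carrier_vec d1 \<Longrightarrow> y \<in> carrier_vec d2 \<Longrightarrow>
      y' \<in> carrier_vec d2 \<Longrightarrow> sqn (gy x y - gy x' y') \<le> L\<^sup>2 * (sqn (x - x') + sqn (y - y'))"
    and PL: "\<And>x y. x \<in> carrier_vec d1 \<Longrightarrow> y \<in> carrier_vec d2 \<Longrightarrow> 2 * \<nu> * (Pm x - F x y) \<le> sqn (gy x y)"
    and le_Pm: "\<And>x y. x \<in> carrier_vec d1 \<Longrightarrow> y \<in> carrier_vec d2 \<Longrightarrow> F x y \<le> Pm x"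
    and Pst_le: "\<And>x. x \<in> carrier_vec d1 \<Longrightarrow> Pst \<le> Pm x"
begin

definition "kap = L / \<nu>"

lemma Lpos: "0 < L" using nu by simp
lemma kap1: "1 \<le> kap" using nu by (simp add: kap_def)

lemma nrm_diff_carrier: 
  "v \<in> carrier_vec d \<Longrightarrow> w \<in> carrier_vec d \<Longrightarrow> sqn (v - w) \<le> L\<^sup>2 * s \<Longrightarrow> 0 \<le> s \<Longrightarrow> nrm (v - w) \<le> L * sqrt s"
  using real_sqrt_le_mono[of "sqn (v - w)" "L\<^sup>2 * s"] Lpos by (simp add: nrm_def real_sqrt_mult)

lemma lip_nrm_xy:
  assumes "x \<in> carrier_vec d1" "y \<in> carrier_vec d2" "y' \<in> carrier_vec d2"
  shows "nrm (gx x y' - gx x y) \<le> L * nrm (y' - y)"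
proof -
  have "sqn (x - x) = 0" using assms by (simp add: sqn_sum)
  then have "sqn (gx x y' - gx x y) \<le> L\<^sup>2 * sqn (y' - y)"
    using lipx[of x x y' y] assms by simp
  then show ?thesis using nrm_diff_carrier[of "gx x y'" d1 "gx x y" "sqn (y' - y)"] gxc assms by (simp add: nrm_def)
qed

lemma lip_nrm_yx:
  assumes "x \<in> carrier_vec d1" "x' \<in> carrier_vec d1" "y \<in> carrier_vec d2"
  shows "nrm (gy x' y - gy x y) \<le> L * nrm (x' - x)"
proof -
  have "sqn (y - y) = 0" using assms by (simp add: sqn_sum)
  then have "sqn (gy x' y - gy x y) \<le> L\<^sup>2 * sqn (x' - x)"
    using lipy[of x' x y y] assms by simp
  then show ?thesis using nrm_diff_carrier[of "gy x' y" d2 "gy x y" "sqn (x' - x)"] gyc assms by (simp add: nrm_def)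
qed

lemma lip_nrm_xx:
  assumes "x \<in> carrier_vec d1" "x' \<in> carrier_vec d1" "y \<in> carrier_vec d2"
  shows "nrm (gx x' y - gx x y) \<le> L * nrm (x' - x)"
proof -
  have "sqn (y - y) = 0" using assms by (simp add: sqn_sum)
  then have "sqn (gx x' y - gx x y) \<le> L\<^sup>2 * sqn (x' - x)"
    using lipx[of x' x y y] assms by simp
  then show ?thesis using nrm_diff_carrier[of "gx x' y" d1 "gx x y" "sqn (x' - x)"] gxc assms by (simp add: nrm_def)
qed

lemma nrm_gy_le:
  assumes "x \<in> carrier_vec d1" "x' \<in> carrier_vec d1" "y \<in> carrier_vec d2"
  shows "nrm (gy x' y) \<le> nrm (gy x y) + L * nrm (x' - x)"
proof -
  have "gy x' y = (gy x' y - gy x y) + gy x y" using gyc[of x y] gyc[of x' y] assms by (intro eq_vecI) auto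
  then have "nrm (gy x' y) \<le> nrm (gy x' y - gy x y) + nrm (gy x y)"
    using nrm_triangle[of "gy x' y - gy x y" d2 "gy x y"] gyc assms by simp
  then show ?thesis using lip_nrm_yx[OF assms] by simp
qed

lemma nrm_gx_le:
  assumes "x \<in> carrier_vec d1" "x' \<in> carrier_vec d1" "y \<in> carrier_vec d2"
  shows "nrm (gx x' y) \<le> nrm (gx x y) + L * nrm (x' - x)"
proof -
  have "gx x' y = (gx x' y - gx x y) + gx x y" using gxc[of x y] gxc[of x' y] assms by (intro eq_vecI) auto
  then have "nrm (gx x' y) \<le> nrm (gx x' y - gx x y) + nrm (gx x y)"
    using nrm_triangle[of "gx x' y - gx x y" d1 "gx x y"] gxc assms by simp
  then show ?thesis using lip_nrm_xx[OF assms] by simp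
qed

text \<open>The length \<open>1 / L\<close> maximizes the quadratic lower bound given by
  \<open>descy\<close>: the linear gain is \<open>sqn (gy x y) / L\<close> and the curvature takes
  back half of it.\<close>

lemma ascent_step:
  assumes x: "x \<in> carrier_vec d1" and y: "y \<in> carrier_vec d2"
  defines "y1 \<equiv> y + (1 / L) \<cdot>\<^sub>v gy x y"
  shows "Pm x - F x y1 \<le> Pm x - F x y - sqn (gy x y) / (2 * L)"
    and "nrm (y1 - y) = nrm (gy x y) / L"
proof -
  let ?g = "gy x y"
  have g: "?g \<in> carrier_vec d2" using gyc x y by auto
  have y1: "y1 \<in> carrier_vec d2" using g y by (simp add: y1_def)
  have d: "y1 - y = (1 / L) \<cdot>\<^sub>v ?g" using y g unfolding y1_def by auto
  have "?g \<bullet> (y1 - y) = sqn ?g / L" unfolding d sqn_def using g by simp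
  moreover have "L / 2 * sqn (y1 - y) = sqn ?g / (2 * L)" unfolding d sqn_smult
    using Lpos by (simp add: field_simps power2_eq_square)
  moreover have "sqn ?g / L = sqn ?g / (2 * L) + sqn ?g / (2 * L)" by simp
  ultimately show "Pm x - F x y1 \<le> Pm x - F x y - sqn (gy x y) / (2 * L)"
    using abs_le_D2[OF descy[OF x y y1]] by linarith
  show "nrm (y1 - y) = nrm (gy x y) / L" unfolding d nrm_smult using Lpos by simp
qed

text \<open>One ascent step cannot gain more than the remaining gap.\<close>

lemma sqn_gy_le:
  assumes x: "x \<in> carrier_vec d1" and y: "y \<in> carrier_vec d2"
  shows "sqn (gy x y) \<le> 2 * L * (Pm x - F x y)"
proof -
  have "y + (1 / L) \<cdot>\<^sub>v gy x y \<in> carrier_vec d2" using gyc x y by auto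
  from ascent_step(1)[OF x y] le_Pm[OF x this]
  have "sqn (gy x y) / (2 * L) \<le> Pm x - F x y" by linarith
  then show ?thesis using Lpos by (simp add: pos_divide_le_eq mult.commute)
qed

text \<open>The Lojasiewicz length argument. A step of length \<open>nrm (gy x y) / L\<close> lowers
  the gap by a multiple of the squared gradient, and PL bounds the root of the gap by the gradient;
  dividing, the root of the gap drops in proportion to the length of the step. Hence the total path
  length of the ascent is bounded by the initial root of the gap.\<close>

lemma sqrt_gap_step:
  assumes x: "x \<in> carrier_vec d1" and y: "y \<in> carrier_vec d2"
  defines "y1 \<equiv> y + (1 / L) \<cdot>\<^sub>v gy x y"
  shows "sqrt (Pm x - F x y1) + sqrt (2 * \<nu>) / 4 * nrm (y1 - y) \<le> sqrt (Pm x - F x y)"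
proof -
  define a b G where "a = sqrt (Pm x - F x y)" "b = sqrt (Pm x - F x y1)" "G = nrm (gy x y)"
  have y1: "y1 \<in> carrier_vec d2" using gyc x y by (auto simp: y1_def)
  have ab: "a\<^sup>2 = Pm x - F x y" "b\<^sup>2 = Pm x - F x y1" "0 \<le> a" "0 \<le> b" "0 \<le> G"
    using le_Pm[OF x y] le_Pm[OF x y1] by (auto simp: a_b_G_def)
  have 1: "b\<^sup>2 \<le> a\<^sup>2 - G\<^sup>2 / (2 * L)" using ascent_step(1)[OF x y] ab by (simp add: y1_def a_b_G_def)
  have sa: "sqrt (2 * \<nu>) * a \<le> G" using PL[OF x y] unfolding a_b_G_def nrm_def
    by (simp add: real_sqrt_mult[symmetric])
  define s where "s = sqrt (2 * \<nu>)"
  have s: "0 < s" "s * a \<le> G" using nu sa by (auto simp: s_def)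
  have "0 \<le> G\<^sup>2 / (2 * L)" using Lpos by simp
  then have "b\<^sup>2 \<le> a\<^sup>2" using 1 by linarith
  then have "b \<le> a" using ab power2_le_imp_le by blast
  have "b + s / 4 * (G / L) \<le> a"
  proof (cases "G = 0")
    case True then show ?thesis using \<open>b \<le> a\<close> by simp
  next
    case False
    then have G: "0 < G" using ab by simp
    have "G\<^sup>2 / (2 * L) \<le> (a - b) * (a + b)" using 1 by (simp add: power2_eq_square algebra_simps)
    also have "\<dots> \<le> (a - b) * (2 * a)" using \<open>b \<le> a\<close> by (intro mult_left_mono) auto
    finally have "s * (G\<^sup>2 / (2 * L)) \<le> s * ((a - b) * (2 * a))" using s by (intro mult_left_mono) auto
    also have "\<dots> = (a - b) * 2 * (s * a)" by simp
    also have "\<dots> \<le> (a - b) * 2 * G" using s \<open>b \<le> a\<close> by (intro mult_left_mono) auto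
    also have "\<dots> = 2 * ((a - b) * G)" by simp
    finally have "s * (G\<^sup>2 / (2 * L)) \<le> 2 * ((a - b) * G)" .
    moreover have "s * (G\<^sup>2 / (2 * L)) = 2 * ((s / 4 * (G / L)) * G)" by (simp add: power2_eq_square)
    ultimately have "(s / 4 * (G / L)) * G \<le> (a - b) * G" by linarith
    from mult_right_le_imp_le[OF this G] show ?thesis by linarith
  qed
  then show ?thesis unfolding ascent_step(2)[OF x y, folded y1_def] a_b_G_def s_def .
qed

text \<open>Gradient ascent from \<open>y\<close> yields near-maximizers within a distance controlled by the gradient at
  \<open>y\<close>; this replaces a projection onto the set of maximizers.\<close>

lemma near_maximizer:
  assumes x: "x \<in> carrier_vec d1" and y: "y \<in> carrier_vec d2" and e: "0 < e"
  shows "\<exists>y'\<in>carrier_vec d2. Pm x \<le> F x y' + e \<and> nrm (y' - y) \<le> 2 / \<nu> * nrm (gy x y)"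
proof -
  define s where "s = sqrt (2 * \<nu>)"
  have s: "0 < s" "s\<^sup>2 = 2 * \<nu>" using nu by (auto simp: s_def)
  let ?d = "\<lambda>y. Pm x - F x y" and ?q = "1 - \<nu> / L"
  have q: "0 \<le> ?q" "?q < 1" using nu by auto
  \<comment> \<open>Two facts are carried along the ascent: PL contracts the gap by
    \<open>1 - \<nu> / L\<close> per step, and the distance travelled is paid for by the root of the
    gap. The second is kept as a distance to the starting point, by the triangle inequality.\<close>
  have it: "\<exists>y'\<in>carrier_vec d2. ?d y' \<le> ?q ^ n * ?d y \<and> sqrt (?d y') + s / 4 * nrm (y' - y) \<le> sqrt (?d y)" for n
  proof (induction n)
    case 0
    have "nrm (y - y) = 0" using y by (simp add: nrm_def sqn_sum)
    then show ?case using y by (intro bexI[of _ y]) auto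
  next
    case (Suc n)
    then obtain z where z: "z \<in> carrier_vec d2" "?d z \<le> ?q ^ n * ?d y"
      "sqrt (?d z) + s / 4 * nrm (z - y) \<le> sqrt (?d y)" by auto
    let ?z = "z + (1 / L) \<cdot>\<^sub>v gy x z"
    have zc: "?z \<in> carrier_vec d2" using z gyc x by auto
    have "?d ?z \<le> ?d z - sqn (gy x z) / (2 * L)" using ascent_step(1)[OF x z(1)] .
    also have "\<dots> \<le> ?d z - 2 * \<nu> * ?d z / (2 * L)" using divide_right_mono[OF PL[OF x z(1)], of "2 * L"] Lpos by linarith
    also have "\<dots> = ?q * ?d z" using Lpos by (simp add: field_simps)
    also have "\<dots> \<le> ?q * (?q ^ n * ?d y)" using z(2) q by (intro mult_left_mono) auto
    finally have A: "?d ?z \<le> ?q ^ Suc n * ?d y" by simp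
    have "?z - y = (?z - z) + (z - y)" using z y zc gyc[OF x z(1)] by auto
    then have "nrm (?z - y) \<le> nrm (?z - z) + nrm (z - y)"
      using nrm_triangle[of "?z - z" d2 "z - y"] zc z y by simp
    then have "s / 4 * nrm (?z - y) \<le> s / 4 * nrm (?z - z) + s / 4 * nrm (z - y)"
      using s by (simp add: distrib_left[symmetric])
    moreover have "sqrt (?d ?z) + s / 4 * nrm (?z - z) \<le> sqrt (?d z)"
      using sqrt_gap_step[OF x z(1)] by (simp add: s_def)
    ultimately show ?case using z(3) A zc by (intro bexI[of _ ?z]) auto
  qed
  have "(\<lambda>n. ?q ^ n * ?d y) \<longlonglongrightarrow> 0 * ?d y" by (intro tendsto_mult LIMSEQ_power_zero tendsto_const) (use q in auto)
  then have "eventually (\<lambda>n. ?q ^ n * ?d y < e) sequentially" using e by (intro order_tendstoD) auto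
  then obtain n where n: "?q ^ n * ?d y < e" by (auto simp: eventually_sequentially)
  obtain y' where y': "y' \<in> carrier_vec d2" "?d y' \<le> ?q ^ n * ?d y"
      "sqrt (?d y') + s / 4 * nrm (y' - y) \<le> sqrt (?d y)" using it[of n] by auto
  \<comment> \<open>A second factor \<open>s = sqrt (2 * \<nu>)\<close> turns the root of the gap
    into the gradient norm by PL, so the distance bound ends with \<open>2 / \<nu>\<close>.\<close>
  have "s * (s / 4 * nrm (y' - y)) \<le> s * sqrt (?d y)"
    using y'(3) real_sqrt_ge_zero[of "?d y'"] le_Pm[OF x y'(1)] s by (intro mult_left_mono) linarith+
  also have "\<dots> \<le> nrm (gy x y)" using PL[OF x y] by (simp add: s_def nrm_def real_sqrt_mult[symmetric])
  finally have "s * (s / 4 * nrm (y' - y)) \<le> nrm (gy x y)" .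
  moreover have "s * (s / 4 * nrm (y' - y)) = 2 * \<nu> / 4 * nrm (y' - y)" by (simp add: s(2)[symmetric] power2_eq_square)
  ultimately have "2 * \<nu> / 4 * nrm (y' - y) \<le> nrm (gy x y)" by linarith
  then have "nrm (y' - y) \<le> 2 / \<nu> * nrm (gy x y)" using nu by (simp add: field_simps)
  then show ?thesis using y' n by (intro bexI[of _ y']) auto
qed

text \<open>Replaces a descent inequality for \<open>Pm\<close>. Let \<open>y'\<close> nearly
  maximize \<open>F x'\<close>. Then \<open>Pm x' - Pm x\<close> is at most
  \<open>F x' y' - F x y'\<close> up to an arbitrarily small error, and this is expanded in
  \<open>x\<close> at fixed \<open>y'\<close>. Moving the gradient from \<open>y'\<close> back to
  \<open>y\<close> costs \<open>L * nrm (y' - y)\<close>, which \<open>near_maximizer\<close> bounds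
  by \<open>2 * kap\<close> times the \<open>y\<close>-gradient at \<open>x'\<close>.\<close>

lemma primal_step:
  assumes x: "x \<in> carrier_vec d1" and x': "x' \<in> carrier_vec d1" and y: "y \<in> carrier_vec d2"
  shows "Pm x' \<le> Pm x + gx x y \<bullet> (x' - x) + 2 * kap * nrm (gy x y) * nrm (x' - x)
     + 5 / 2 * kap * L * sqn (x' - x)"
proof (rule field_le_epsilon)
  fix e :: real assume "0 < e"
  from near_maximizer[OF x' y this] obtain y' where y': "y' \<in> carrier_vec d2" "Pm x' \<le> F x' y' + e"
    "nrm (y' - y) \<le> 2 / \<nu> * nrm (gy x' y)" by auto
  define D where "D = nrm (x' - x)"
  have D: "0 \<le> D" "sqn (x' - x) = D\<^sup>2" by (auto simp: D_def)
  have c: "gx x y \<in> carrier_vec d1" "gx x y' \<in> carrier_vec d1" "x' - x \<in> carrier_vec d1" using gxc x x' y y' by auto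
  have "gx x y' \<bullet> (x' - x) - gx x y \<bullet> (x' - x) = (gx x y' - gx x y) \<bullet> (x' - x)"
    using c by (simp add: minus_scalar_prod_distrib)
  also have "\<dots> \<le> nrm (gx x y' - gx x y) * D" unfolding D_def
    using abs_scalar_prod_le[of "gx x y' - gx x y" d1 "x' - x"] c by auto
  also have "\<dots> \<le> L * nrm (y' - y) * D" using lip_nrm_xy[OF x y y'(1)] D by (intro mult_right_mono) auto
  also have "\<dots> \<le> L * (2 / \<nu> * (nrm (gy x y) + L * D)) * D"
    using y'(3) nrm_gy_le[OF x x' y] Lpos D nu unfolding D_def[symmetric]
    by (intro mult_right_mono mult_left_mono order_trans[OF y'(3)]) auto
  also have "\<dots> = 2 * kap * nrm (gy x y) * D + 2 * kap * L * D\<^sup>2"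
    by (simp add: kap_def power2_eq_square algebra_simps)
  finally have A: "gx x y' \<bullet> (x' - x) \<le> gx x y \<bullet> (x' - x) + 2 * kap * nrm (gy x y) * D + 2 * kap * L * D\<^sup>2" by simp
  have "F x' y' \<le> F x y' + gx x y' \<bullet> (x' - x) + L / 2 * D\<^sup>2"
    using abs_le_D1[OF descx[OF x x' y'(1)]] unfolding D by linarith
  moreover have "F x y' \<le> Pm x" using le_Pm x y' by auto
  moreover have "L / 2 * D\<^sup>2 \<le> kap * L / 2 * D\<^sup>2" using kap1 Lpos D by (intro mult_right_mono) auto
  moreover have "5 / 2 * kap * L * D\<^sup>2 = kap * L / 2 * D\<^sup>2 + 2 * kap * L * D\<^sup>2" by simp
  ultimately show "Pm x' \<le> Pm x + gx x y \<bullet> (x' - x) + 2 * kap * nrm (gy x y) * nrm (x' - x)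
     + 5 / 2 * kap * L * sqn (x' - x) + e"
    using A y'(2) unfolding D(2) D_def[symmetric] by linarith
qed

text \<open>A descent step in \<open>x\<close> cannot push \<open>Pm\<close> below
  \<open>Pst\<close>. It shows that finite initial gaps force square-integrable initial
  gradients.\<close>

lemma sqn_gx_le:
  assumes x: "x \<in> carrier_vec d1" and y: "y \<in> carrier_vec d2"
  shows "sqn (gx x y) \<le> 20 * kap * L * (Pm x - Pst) + 16 * kap\<^sup>2 * sqn (gy x y)"
proof -
  \<comment> \<open>With this length the quadratic term of \<open>primal_step\<close> is exactly
    half of the linear gain; the cross term takes another quarter, and a quarter is left.\<close>
  define t where "t = 1 / (5 * kap * L)"
  have t: "0 < t" "5 * kap * L * t = 1" using kap1 Lpos by (auto simp: t_def)
  let ?g = "gx x y" let ?x = "x - t \<cdot>\<^sub>v ?g"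
  define a b where "a = nrm ?g" "b = nrm (gy x y)"
  have g: "?g \<in> carrier_vec d1" using gxc x y by auto
  have d: "?x - x = (- t) \<cdot>\<^sub>v ?g" using x g by auto
  have "?x \<in> carrier_vec d1" using x g by auto
  note st = primal_step[OF x this y] Pst_le[OF this]
  have e1: "?g \<bullet> (?x - x) = - t * a\<^sup>2" unfolding d a_b_def nrm_sq unfolding sqn_def using g by simp
  have e2: "sqn (?x - x) = t\<^sup>2 * a\<^sup>2" "nrm (?x - x) = t * a" unfolding d sqn_smult nrm_smult a_b_def using t by auto
  have "Pm ?x \<le> Pm x - t * a\<^sup>2 + 2 * kap * b * (t * a) + 5 / 2 * kap * L * (t\<^sup>2 * a\<^sup>2)"
    using st(1) unfolding e1 e2 a_b_def by simp
  with st(2) have 1: "0 \<le> Pm x - Pst - t * a\<^sup>2 + 2 * kap * b * (t * a) + 5 / 2 * kap * L * (t\<^sup>2 * a\<^sup>2)"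
    by linarith
  have "5 / 2 * kap * L * (t\<^sup>2 * a\<^sup>2) = (5 * kap * L * t) * t * a\<^sup>2 / 2" by (simp add: power2_eq_square)
  then have 2: "5 / 2 * kap * L * (t\<^sup>2 * a\<^sup>2) = t * a\<^sup>2 / 2" using t by simp
  have "0 \<le> t * (a / 2 - 2 * kap * b)\<^sup>2" using t by simp
  then have "2 * kap * b * (t * a) \<le> t * a\<^sup>2 / 4 + 4 * kap\<^sup>2 * t * b\<^sup>2"
    by (simp add: power2_eq_square algebra_simps)
  then have "t * a\<^sup>2 / 4 \<le> Pm x - Pst + 4 * kap\<^sup>2 * t * b\<^sup>2" using 1 2 by linarith
  then have "20 * kap * L * (t * a\<^sup>2 / 4) \<le> 20 * kap * L * (Pm x - Pst + 4 * kap\<^sup>2 * t * b\<^sup>2)"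
    using kap1 Lpos by (intro mult_left_mono) auto
  moreover have "20 * kap * L * (t * a\<^sup>2 / 4) = (5 * kap * L * t) * a\<^sup>2" by simp
  moreover have "20 * kap * L * (Pm x - Pst + 4 * kap\<^sup>2 * t * b\<^sup>2)
      = 20 * kap * L * (Pm x - Pst) + 16 * kap\<^sup>2 * (5 * kap * L * t) * b\<^sup>2" by (simp add: algebra_simps)
  ultimately have "(5 * kap * L * t) * a\<^sup>2 \<le> 20 * kap * L * (Pm x - Pst) + 16 * kap\<^sup>2 * (5 * kap * L * t) * b\<^sup>2" by linarith
  then show ?thesis unfolding t a_b_def by simp
qed

text \<open>\<open>primal_step\<close> in both directions at the same \<open>y\<close>, with the
  gradients at \<open>x'\<close> moved back to \<open>x\<close>. This is local Lipschitz continuity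
  of \<open>Pm\<close>, from which its measurability follows.\<close>

lemma primal_diff_le:
  assumes x: "x \<in> carrier_vec d1" and x': "x' \<in> carrier_vec d1" and y: "y \<in> carrier_vec d2"
  shows "\<bar>Pm x' - Pm x\<bar> \<le> (nrm (gx x y) + 2 * kap * nrm (gy x y)) * nrm (x' - x) + 6 * kap * L * sqn (x' - x)"
proof -
  define D where "D = nrm (x' - x)"
  have D: "0 \<le> D" "sqn (x' - x) = D\<^sup>2" "nrm (x - x') = D" "sqn (x - x') = D\<^sup>2"
    using sqn_uminus_sub[OF x x'] by (auto simp: D_def) (simp add: nrm_def)
  have c: "gx x y \<in> carrier_vec d1" "gx x' y \<in> carrier_vec d1" using gxc x x' y by auto
  have "gx x y \<bullet> (x' - x) \<le> nrm (gx x y) * D" unfolding D_def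
    using abs_scalar_prod_le[of "gx x y" d1 "x' - x"] c x x' by auto
  then have 1: "Pm x' - Pm x \<le> (nrm (gx x y) + 2 * kap * nrm (gy x y)) * D + 5/2 * kap * L * D\<^sup>2"
    using primal_step[OF x x' y] unfolding D(2) D_def[symmetric] by (simp add: algebra_simps)
  have "gx x' y \<bullet> (x - x') \<le> nrm (gx x' y) * D" unfolding D(3)[symmetric]
    using abs_scalar_prod_le[of "gx x' y" d1 "x - x'"] c x x' by auto
  also have "\<dots> \<le> (nrm (gx x y) + L * D) * D" using nrm_gx_le[OF x x' y] D unfolding D_def by (intro mult_right_mono) auto
  finally have 2: "gx x' y \<bullet> (x - x') \<le> nrm (gx x y) * D + L * D\<^sup>2" by (simp add: algebra_simps power2_eq_square)
  have "2 * kap * nrm (gy x' y) * D \<le> 2 * kap * (nrm (gy x y) + L * D) * D"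
    using nrm_gy_le[OF x x' y] D kap1 unfolding D_def by (intro mult_right_mono mult_left_mono) auto
  then have 3: "2 * kap * nrm (gy x' y) * D \<le> 2 * kap * nrm (gy x y) * D + 2 * kap * L * D\<^sup>2"
    by (simp add: algebra_simps power2_eq_square)
  have 4: "L * D\<^sup>2 \<le> kap * L * D\<^sup>2" using kap1 Lpos D by (intro mult_right_mono) auto
  have "0 \<le> kap * L * D\<^sup>2" using kap1 Lpos by simp
  then have "Pm x - Pm x' \<le> (nrm (gx x y) + 2 * kap * nrm (gy x y)) * D + 6 * kap * L * D\<^sup>2"
    using primal_step[OF x' x y] 2 3 4 unfolding D by (simp add: algebra_simps)
  then show ?thesis using 1 \<open>0 \<le> kap * L * D\<^sup>2\<close> unfolding D(2) D_def[symmetric] by (simp add: abs_le_iff)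
qed

text \<open>The weight 1/8 lets the ascent gain \<open>my * Y / 16\<close> beat the share
  \<open>9/8 * my * Y / 50\<close> caused by the drift of the maximum, while the change of
  \<open>F\<close> under the \<open>x\<close>-step takes back only 1/8 of the descent in
  \<open>Pm\<close>.\<close>

definition "pot x y = (Pm x - Pst) + (Pm x - F x y) / 8"

lemma pot_nonneg: "x \<in> carrier_vec d1 \<Longrightarrow> y \<in> carrier_vec d2 \<Longrightarrow> 0 \<le> pot x y"
  using Pst_le[of x] le_Pm[of x y] by (simp add: pot_def)

text \<open>\<open>Pm\<close> is bounded by \<open>primal_step\<close>; the dual gap is followed
  through an ascent step in \<open>y\<close> at the old \<open>x\<close> and then a step in
  \<open>x\<close> at the new \<open>y\<close>. The condition
  \<open>mx * kap\<^sup>2 \<le> my / 400\<close> is what makes the \<open>y\<close>-gradient in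
  \<open>primal_step\<close> harmless.\<close>

lemma potential_step:
  assumes x: "x \<in> carrier_vec d1" and y: "y \<in> carrier_vec d2"
    and g: "g \<in> carrier_vec d1" and h: "h \<in> carrier_vec d2"
    and mx: "0 < mx" "mx * kap\<^sup>2 \<le> my / 400" and cx: "kap * L * mx \<le> 1 / 40" and cy: "L * my \<le> 1 / 40"
  shows "pot (x - mx \<cdot>\<^sub>v g) (y + my \<cdot>\<^sub>v h) + mx / 2 * sqn (gx x y) + mx / 8 * sqn g
     + my / 32 * sqn (gy x y) + my / 32 * sqn h
    \<le> pot x y + mx * sqn (g - gx x y) + my / 8 * sqn (h - gy x y)"
proof -
  let ?x = "x - mx \<cdot>\<^sub>v g" and ?y = "y + my \<cdot>\<^sub>v h"
  define X Y G H U V where "X = sqn (gx x y)" "Y = sqn (gy x y)" "G = sqn g" "H = sqn h"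
    "U = sqn (g - gx x y)" "V = sqn (h - gy x y)"
  note df = X_Y_G_H_U_V_def
  have k2: "1 \<le> kap\<^sup>2" using kap1 by (simp add: one_le_power)
  have mxk: "mx \<le> mx * kap\<^sup>2" using k2 mx by simp
  then have mxy: "400 * mx \<le> my" using mx(2) by linarith
  have my: "0 < my" using mxy mx by linarith
  have c: "?x \<in> carrier_vec d1" "?y \<in> carrier_vec d2" "gx x y \<in> carrier_vec d1" "gy x y \<in> carrier_vec d2"
    "gx x ?y \<in> carrier_vec d1"
    using x y g h gxc gyc by auto
  have dx: "?x - x = (- mx) \<cdot>\<^sub>v g" and dy: "?y - y = my \<cdot>\<^sub>v h" using x y g h by auto
  \<comment> \<open>Polarization turns the products of true and estimated gradients into squares
    without loss; this is the source of the negative terms in both the true gradient and its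
    estimate.\<close>
  have inx: "gx x y \<bullet> g = (X + G - U) / 2" using sqn_sub[OF g c(3)] comm_scalar_prod[OF g c(3)] by (simp add: df)
  have iny: "gy x y \<bullet> h = (Y + H - V) / 2" using sqn_sub[OF h c(4)] comm_scalar_prod[OF h c(4)] by (simp add: df)
  define a b u where "a = nrm (gy x y)" "b = nrm g" "u = nrm h"
  have sq: "a\<^sup>2 = Y" "b\<^sup>2 = G" "u\<^sup>2 = H" "0 \<le> a" "0 \<le> b" "0 \<le> u" by (auto simp: a_b_u_def df)
  have nn: "0 \<le> X" "0 \<le> Y" "0 \<le> G" "0 \<le> H" "0 \<le> U" "0 \<le> V" by (auto simp: df)
  have ex: "mx * ((X + G - U) / 2) = mx * X / 2 + mx * G / 2 - mx * U / 2"
    and ey: "my * ((Y + H - V) / 2) = my * Y / 2 + my * H / 2 - my * V / 2" by (simp_all add: field_simps)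
  have P1: "Pm ?x \<le> Pm x - mx * ((X + G - U) / 2) + 2 * kap * a * (mx * b) + 5/2 * kap * L * (mx\<^sup>2 * G)"
    using primal_step[OF x c(1) y] unfolding dx sqn_smult nrm_smult
    using c g mx(1) by (simp add: inx a_b_u_def df)
  \<comment> \<open>Young's inequality, weighted so that the part in \<open>G\<close> is one eighth
    of \<open>mx * G\<close>; the part in \<open>Y\<close> carries \<open>kap\<^sup>2 * mx\<close>
    and is compared with \<open>my\<close> next.\<close>
  have "0 \<le> mx * (b - 8 * kap * a)\<^sup>2 / 8" using mx by simp
  also have "\<dots> = mx / 8 * b\<^sup>2 + 8 * kap\<^sup>2 * mx * a\<^sup>2 - 2 * kap * a * (mx * b)"
    by (simp add: power2_diff power_mult_distrib field_simps)
  finally have P2: "2 * kap * a * (mx * b) \<le> mx * G / 8 + 8 * kap\<^sup>2 * mx * Y" unfolding sq by simp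
  have "8 * kap\<^sup>2 * mx * Y = 8 * (mx * kap\<^sup>2) * Y" by simp
  also have "\<dots> \<le> 8 * (my / 400) * Y" using mx nn by (intro mult_right_mono) auto
  finally have P2': "8 * kap\<^sup>2 * mx * Y \<le> my * Y / 50" by simp
  have "5/2 * kap * L * (mx\<^sup>2 * G) = 5/2 * (kap * L * mx) * (mx * G)" by (simp add: power2_eq_square)
  also have "\<dots> \<le> 5/2 * (1/40) * (mx * G)" using cx mx nn by (intro mult_right_mono mult_left_mono) auto
  finally have P3: "5/2 * kap * L * (mx\<^sup>2 * G) \<le> mx * G / 16" by simp
  have Pd: "Pm ?x \<le> Pm x - mx * X / 2 - mx * G / 2 + mx * U / 2 + mx * G / 8 + my * Y / 50 + mx * G / 16"
    using P1 P2 P2' P3 ex by linarith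
  have J1: "F x ?y \<ge> F x y + my * ((Y + H - V) / 2) - L / 2 * (my\<^sup>2 * H)"
    using abs_le_D2[OF descy[OF x y c(2)]] c(4) h unfolding dy sqn_smult by (simp add: iny df)
  have "L / 2 * (my\<^sup>2 * H) = (L * my) * (my * H) / 2" by (simp add: power2_eq_square)
  also have "\<dots> \<le> (1/40) * (my * H) / 2" using cy my nn by (intro divide_right_mono mult_right_mono) auto
  finally have J2: "L / 2 * (my\<^sup>2 * H) \<le> my * H / 80" by simp
  have J3: "F ?x ?y \<ge> F x ?y - mx * (gx x ?y \<bullet> g) - L / 2 * (mx\<^sup>2 * G)"
    using abs_le_D2[OF descx[OF x c(1) c(2)]] c(5) g unfolding dx sqn_smult by (simp add: df)
  have "0 \<le> L * mx" using Lpos mx(1) by simp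
  from mult_right_mono[OF kap1 this] have "1 * (L * mx) \<le> kap * (L * mx)" .
  then have Lmx: "L * mx \<le> 1/40" using cx unfolding mult.assoc by linarith
  have "L / 2 * (mx\<^sup>2 * G) = (L * mx) * (mx * G) / 2" by (simp add: power2_eq_square)
  also have "\<dots> \<le> (1/40) * (mx * G) / 2" using Lmx mx(1) nn by (intro divide_right_mono mult_right_mono) auto
  finally have J4: "L / 2 * (mx\<^sup>2 * G) \<le> mx * G / 80" by simp
  \<comment> \<open>Only linear arithmetic with placeholders: \<open>m\<close> stands for
    \<open>mx * (u * b)\<close>, \<open>r + t\<close> for its Young bound, and \<open>w\<close> for
    the enlargement of \<open>r\<close> from \<open>mx * H\<close> to \<open>my * H\<close>.\<close>
  have lin: "c \<le> e + q \<Longrightarrow> q = q' \<Longrightarrow> q' \<le> 1/40 * m \<Longrightarrow> 2 * m \<le> r + t \<Longrightarrow> r \<le> w \<Longrightarrow> c \<le> e + (w + t) / 80"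
    for c e q q' m r t w :: real by argo
  have "gx x ?y \<bullet> g - gx x y \<bullet> g = (gx x ?y - gx x y) \<bullet> g" using c g by (simp add: minus_scalar_prod_distrib)
  also have "\<dots> \<le> nrm (gx x ?y - gx x y) * b" unfolding a_b_u_def
    using abs_scalar_prod_le[of "gx x ?y - gx x y" d1 g] c g by auto
  also have "\<dots> \<le> L * (my * u) * b" 
    using lip_nrm_xy[OF x y c(2)] sq my unfolding dy nrm_smult by (intro mult_right_mono) (auto simp: a_b_u_def)
  finally have "mx * (gx x ?y \<bullet> g) \<le> mx * ((X + G - U) / 2 + L * (my * u) * b)"
    using mx(1) inx by (intro mult_left_mono) auto
  moreover have "mx * (L * (my * u) * b) = (L * my) * (mx * (u * b))" by simp
  moreover have "\<dots> \<le> 1/40 * (mx * (u * b))" using cy mx(1) sq by (intro mult_right_mono) auto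
  moreover have "0 \<le> mx * (u - b)\<^sup>2" using mx(1) by simp
  then have "2 * (mx * (u * b)) \<le> mx * H + mx * G" unfolding sq(1-3)[symmetric] by (simp add: power2_eq_square algebra_simps)
  moreover have "mx * H \<le> my * H" using mxy mx(1) nn by (intro mult_right_mono) auto
  ultimately have J5: "mx * (gx x ?y \<bullet> g) \<le> mx * ((X + G - U) / 2) + (my * H + mx * G) / 80"
    unfolding distrib_left by (rule lin)
  have Jd: "F ?x ?y \<ge> F x y + my * Y / 2 + my * H / 2 - my * V / 2 - my * H / 80 - mx * X / 2 - mx * G / 2
      + mx * U / 2 - (my * H + mx * G) / 80 - mx * G / 80"
    using J1 J2 J3 J4 J5 ex ey by linarith
  have pr: "0 \<le> mx * X" "0 \<le> my * Y" "0 \<le> mx * G" "0 \<le> my * H" "0 \<le> mx * U" "0 \<le> my * V"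
    using mx my nn by auto
  \<comment> \<open>\<open>pot\<close> combines \<open>Pd\<close> with weight 9/8 and
    \<open>Jd\<close> with weight -1/8. Then \<open>mx * X\<close> has coefficient -1/2 exactly,
    \<open>my * Y\<close> has 9/400 - 1/16, \<open>mx * U\<close> has 1/2 and \<open>my * V\<close>
    has 1/16; the claim leaves room in the others.\<close>
  show ?thesis unfolding df[symmetric] pot_def times_divide_eq_left using Pd Jd pr by argo
qed

end

section \<open>Measurable vector-valued maps\<close>

lemma deriv_from_quadratic:
  fixes g :: "real \<Rightarrow> real"
  assumes "\<And>s. \<bar>g (t + s) - g t - s * D\<bar> \<le> C * s\<^sup>2"
  shows "DERIV g t :> D"
proof -
  have "(\<lambda>s. C * s) \<midarrow>0\<rightarrow> C * 0" by (intro tendsto_intros)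
  then have "(\<lambda>s. \<bar>C * s\<bar>) \<midarrow>0\<rightarrow> 0" using tendsto_rabs_zero by simp
  moreover have "\<forall>\<^sub>F s in at 0. norm ((g (t + s) - g t) / s - D) \<le> \<bar>C * s\<bar>"
  proof (rule eventually_at_topological[THEN iffD2], intro exI[of _ UNIV] conjI ballI impI)
    fix s :: real assume s: "s \<noteq> 0"
    have "\<bar>(g (t + s) - g t) / s - D\<bar> = \<bar>g (t + s) - g t - s * D\<bar> / \<bar>s\<bar>"
      using s by (simp add: abs_divide[symmetric] diff_divide_distrib)
    also have "\<dots> \<le> C * s\<^sup>2 / \<bar>s\<bar>" using assms by (intro divide_right_mono) auto
    also have "s\<^sup>2 = \<bar>s\<bar> * \<bar>s\<bar>" by (simp add: power2_eq_square)
    also have "C * (\<bar>s\<bar> * \<bar>s\<bar>) / \<bar>s\<bar> = C * \<bar>s\<bar>" using s by (simp del: abs_mult_self_eq)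
    also have "\<dots> \<le> \<bar>C * s\<bar>" unfolding abs_mult by (intro mult_right_mono) auto
    finally show "norm ((g (t + s) - g t) / s - D) \<le> \<bar>C * s\<bar>" by simp
  qed auto
  ultimately have "(\<lambda>s. (g (t + s) - g t) / s - D) \<midarrow>0\<rightarrow> 0" by (rule Lim_null_comparison[rotated])
  then show ?thesis unfolding DERIV_def by (simp add: LIM_zero_iff)
qed

lemma partial_deriv:
  assumes "has_partials d f (x + t \<cdot>\<^sub>v unit_vec d j)" "x \<in> carrier_vec d" "j < d"
  shows "DERIV (\<lambda>t. f (x + t \<cdot>\<^sub>v unit_vec d j)) t :> grad d f (x + t \<cdot>\<^sub>v unit_vec d j) $ j"
proof -
  let ?z = "x + t \<cdot>\<^sub>v unit_vec d j"
  have e: "?z + s \<cdot>\<^sub>v unit_vec d j = x + (s + t) \<cdot>\<^sub>v unit_vec d j" for s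
    using assms(2) by (auto simp: algebra_simps)
  have "(\<lambda>s. f (?z + s \<cdot>\<^sub>v unit_vec d j)) differentiable (at 0)"
    using assms by (simp add: has_partials_def)
  then have "DERIV (\<lambda>s. f (?z + s \<cdot>\<^sub>v unit_vec d j)) 0 :> deriv (\<lambda>s. f (?z + s \<cdot>\<^sub>v unit_vec d j)) 0"
    using DERIV_deriv_iff_real_differentiable by blast
  then have "DERIV (\<lambda>s. f (x + (s + t) \<cdot>\<^sub>v unit_vec d j)) 0 :> grad d f ?z $ j"
    unfolding e using assms(3) by (simp add: grad_def e)
  then show ?thesis using DERIV_shift[of "\<lambda>t. f (x + t \<cdot>\<^sub>v unit_vec d j)" _ 0 t] by simp
qed

locale smooth_fun =
  fixes d :: nat and f :: "rvec \<Rightarrow> real" and L :: real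
  assumes part: "\<And>x. x \<in> carrier_vec d \<Longrightarrow> has_partials d f x" and L0: "0 \<le> L"
    and lip: "\<And>x x'. x \<in> carrier_vec d \<Longrightarrow> x' \<in> carrier_vec d \<Longrightarrow>
      sqn (grad d f x - grad d f x') \<le> L\<^sup>2 * sqn (x - x')"
begin

lemma gradc: "grad d f x \<in> carrier_vec d" by (simp add: grad_def)

lemma lip_nrm:
  assumes "x \<in> carrier_vec d" "x' \<in> carrier_vec d"
  shows "nrm (grad d f x - grad d f x') \<le> L * nrm (x - x')"
  using real_sqrt_le_mono[OF lip[OF assms]] L0 by (simp add: nrm_def real_sqrt_mult)

text \<open>Mean value theorem along coordinate \<open>m\<close>, with \<open>H m\<close> keeping
  the first \<open>m\<close> coordinates of \<open>h\<close>. The intermediate point differs from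
  \<open>x\<close> by a vector whose entries are bounded by those of \<open>h\<close>, so its
  gradient is within \<open>L * nrm h\<close> of that at \<open>x\<close>.\<close>

lemma coord_step:
  assumes x: "x \<in> carrier_vec d" and h: "h \<in> carrier_vec d" and m: "m < d"
  defines "H \<equiv> \<lambda>m. Matrix.vec d (\<lambda>j. if j < m then h $ j else 0)"
  shows "\<bar>f (x + H (Suc m)) - f (x + H m) - grad d f x $ m * h $ m\<bar> \<le> L * sqn h"
proof (cases "h $ m = 0")
  case True
  have "H (Suc m) = H m" unfolding H_def using True by (intro eq_vecI) (auto simp: less_Suc_eq)
  then show ?thesis using True L0 by simp
next
  case False
  let ?e = "unit_vec d m" and ?g = "grad d f"
  have Hc: "x + H m \<in> carrier_vec d" using x by (simp add: H_def)
  define \<phi> where "\<phi> t = f ((x + H m) + t \<cdot>\<^sub>v ?e)" for t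
  have zc: "(x + H m) + t \<cdot>\<^sub>v ?e \<in> carrier_vec d" for t using Hc by simp
  have d\<phi>: "DERIV \<phi> t :> ?g ((x + H m) + t \<cdot>\<^sub>v ?e) $ m" for t
    unfolding \<phi>_def[abs_def] by (rule partial_deriv[OF part[OF zc] Hc m])
  have d2: "DERIV (\<lambda>s. \<phi> (h $ m * s)) s :> ?g ((x + H m) + (h $ m * s) \<cdot>\<^sub>v ?e) $ m * h $ m" for s
    by (rule DERIV_chain'[where g = \<phi>, OF _ d\<phi>]) (auto intro!: derivative_eq_intros)
  obtain z where z: "0 < z" "z < 1" "\<phi> (h $ m * 1) - \<phi> (h $ m * 0) = (1 - 0) * (?g ((x + H m) + (h $ m * z) \<cdot>\<^sub>v ?e) $ m * h $ m)"
    using MVT2[of 0 1 "\<lambda>s. \<phi> (h $ m * s)" "\<lambda>s. ?g ((x + H m) + (h $ m * s) \<cdot>\<^sub>v ?e) $ m * h $ m"] d2 by auto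
  define y where "y = (x + H m) + (h $ m * z) \<cdot>\<^sub>v ?e"
  have yc: "y \<in> carrier_vec d" unfolding y_def by (rule zc)
  have e1: "(x + H m) + h $ m \<cdot>\<^sub>v ?e = x + H (Suc m)" unfolding H_def using x m by (intro eq_vecI) (auto simp: less_Suc_eq)
  have e0: "(x + H m) + 0 \<cdot>\<^sub>v ?e = x + H m" unfolding H_def using x by (intro eq_vecI) auto
  have "f (x + H (Suc m)) - f (x + H m) = ?g y $ m * h $ m"
    using z(3) e1 e0 by (simp add: \<phi>_def y_def)
  then have "\<bar>f (x + H (Suc m)) - f (x + H m) - ?g x $ m * h $ m\<bar> = \<bar>(?g y - ?g x) $ m\<bar> * \<bar>h $ m\<bar>"
    using m gradc[of x] by (simp add: abs_mult[symmetric] left_diff_distrib)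
  also have "\<dots> \<le> nrm (?g y - ?g x) * nrm h"
  proof (intro mult_mono)
    have c: "\<bar>v $ m\<bar> \<le> nrm v" if "v \<in> carrier_vec d" for v :: rvec
      unfolding nrm_L2[OF that] using m by (simp add: L2_set_def) (rule real_le_rsqrt, simp, rule member_le_sum, auto)
    show "\<bar>(?g y - ?g x) $ m\<bar> \<le> nrm (?g y - ?g x)" by (rule c) (simp add: gradc)
    show "\<bar>h $ m\<bar> \<le> nrm h" by (rule c[OF h])
  qed auto
  also have "\<dots> \<le> (L * nrm (y - x)) * nrm h" using lip_nrm[OF yc x] by (intro mult_right_mono) auto
  also have "nrm (y - x) \<le> nrm h"
  proof -
    have "sqn (y - x) \<le> sqn h"
    proof -
      have "sqn (y - x) = (\<Sum>j<d. ((y - x) $ j)\<^sup>2)" by (rule sqn_carrier[OF minus_carrier_vec[OF yc x]])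
      also have "\<dots> \<le> (\<Sum>j<d. (h $ j)\<^sup>2)"
      proof (rule sum_mono)
        fix j assume "j \<in> {..<d}"
        then have j: "j < d" by simp
        have "(y - x) $ j = (if j < m then h $ j else if j = m then h $ m * z else 0)"
          using j x m by (simp add: y_def H_def)
        moreover have "(h $ m * z)\<^sup>2 \<le> (h $ m)\<^sup>2" using z by (simp add: power_mult_distrib mult_left_le power_le_one)
        ultimately show "((y - x) $ j)\<^sup>2 \<le> (h $ j)\<^sup>2" by auto
      qed
      also have "\<dots> = sqn h" using h by (simp add: sqn_carrier)
      finally show ?thesis .
    qed
    then show ?thesis by (simp add: nrm_def)
  qed
  then have "(L * nrm (y - x)) * nrm h \<le> (L * nrm h) * nrm h" using L0 by (intro mult_right_mono mult_left_mono) auto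
  also have "(L * nrm h) * nrm h = L * sqn h" unfolding nrm_sq[symmetric] by (simp add: power2_eq_square)
  finally show ?thesis by simp
qed

text \<open>Telescoping over coordinates. The factor \<open>d\<close> is harmless: only the second
  order in \<open>h\<close> matters for \<open>line_deriv\<close>.\<close>

lemma crude_bound:
  assumes x: "x \<in> carrier_vec d" and h: "h \<in> carrier_vec d"
  shows "\<bar>f (x + h) - f x - grad d f x \<bullet> h\<bar> \<le> real d * L * sqn h"
proof -
  define H where "H m = Matrix.vec d (\<lambda>j. if j < m then h $ j else 0)" for m
  have H0: "x + H 0 = x" and Hd: "H d = h" using x h by (auto simp: H_def)
  have "f (x + h) - f x = (\<Sum>m<d. f (x + H (Suc m)) - f (x + H m))"
    using sum_lessThan_telescope[of "\<lambda>m. f (x + H m)" d] by (simp add: H0 Hd)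
  then have "f (x + h) - f x - grad d f x \<bullet> h = (\<Sum>m<d. f (x + H (Suc m)) - f (x + H m) - grad d f x $ m * h $ m)"
    by (simp add: scalar_prod_carrier[OF h] sum_subtractf)
  also have "\<bar>\<dots>\<bar> \<le> (\<Sum>m<d. L * sqn h)"
    by (rule order_trans[OF sum_abs sum_mono]) (use coord_step[OF x h] in \<open>simp add: H_def\<close>)
  finally show ?thesis by simp
qed

lemma line_deriv:
  assumes x: "x \<in> carrier_vec d" and h: "h \<in> carrier_vec d"
  shows "DERIV (\<lambda>t. f (x + t \<cdot>\<^sub>v h)) t :> grad d f (x + t \<cdot>\<^sub>v h) \<bullet> h"
proof (rule deriv_from_quadratic)
  fix s :: real
  have e: "x + (t + s) \<cdot>\<^sub>v h = (x + t \<cdot>\<^sub>v h) + s \<cdot>\<^sub>v h" using x h by (intro eq_vecI) (auto simp: algebra_simps)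
  have "grad d f (x + t \<cdot>\<^sub>v h) \<bullet> (s \<cdot>\<^sub>v h) = s * (grad d f (x + t \<cdot>\<^sub>v h) \<bullet> h)" using h gradc by simp
  then show "\<bar>f (x + (t + s) \<cdot>\<^sub>v h) - f (x + t \<cdot>\<^sub>v h) - s * (grad d f (x + t \<cdot>\<^sub>v h) \<bullet> h)\<bar> \<le> (real d * L * sqn h) * s\<^sup>2"
    using crude_bound[of "x + t \<cdot>\<^sub>v h" "s \<cdot>\<^sub>v h"] x h unfolding e sqn_smult by (simp add: mult_ac)
qed

lemma quadratic_bound:
  assumes x: "x \<in> carrier_vec d" and x': "x' \<in> carrier_vec d"
  shows "\<bar>f x' - f x - grad d f x \<bullet> (x' - x)\<bar> \<le> L / 2 * sqn (x' - x)"
proof -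
  define h where "h = x' - x"
  have h: "h \<in> carrier_vec d" using x x' by (simp add: h_def)
  have xh: "x + h = x'" using x x' by (auto simp: h_def)
  let ?g = "grad d f"
  \<comment> \<open>The signs \<open>c = 1\<close> and \<open>c = -1\<close> give the two halves of
    the absolute value. The Lipschitz bound makes the derivative of \<open>\<psi>\<close>
    nonpositive on the unit interval, and \<psi> 1 \<le> \<psi> 0 is the claim.\<close>
  have key: "c * (f (x + h) - f x - ?g x \<bullet> h) \<le> L / 2 * sqn h" if c: "\<bar>c\<bar> = 1" for c :: real
  proof -
    define \<psi> where "\<psi> t = c * (f (x + t \<cdot>\<^sub>v h) - f x - t * (?g x \<bullet> h)) - L / 2 * t\<^sup>2 * sqn h" for t
    have "\<psi> 1 \<le> \<psi> 0"
    proof (rule DERIV_nonpos_imp_nonincreasing[of 0 1 \<psi>])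
      fix t :: real assume t: "0 \<le> t"
      let ?x = "x + t \<cdot>\<^sub>v h"
      have xc: "?x \<in> carrier_vec d" using x h by simp
      have D: "DERIV \<psi> t :> c * (?g ?x \<bullet> h - ?g x \<bullet> h) - L * t * sqn h"
        unfolding \<psi>_def by (auto intro!: derivative_eq_intros line_deriv[OF x h])
      have "c * (?g ?x \<bullet> h - ?g x \<bullet> h) \<le> \<bar>(?g ?x - ?g x) \<bullet> h\<bar>"
        using c gradc h by (simp add: minus_scalar_prod_distrib[of _ d] abs_mult abs_le_D1[OF order_refl])
          (metis abs_mult abs_ge_self mult_1)
      also have "\<dots> \<le> nrm (?g ?x - ?g x) * nrm h" by (rule abs_scalar_prod_le[of _ d]) (use gradc h in auto)
      also have "\<dots> \<le> L * nrm (?x - x) * nrm h" using lip_nrm[OF xc x] by (intro mult_right_mono) auto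
      also have "?x - x = t \<cdot>\<^sub>v h" using x h by (intro eq_vecI) auto
      also have "L * nrm (t \<cdot>\<^sub>v h) * nrm h = L * t * sqn h"
        unfolding nrm_smult nrm_sq[symmetric] using t by (simp add: power2_eq_square)
      finally show "\<exists>y. DERIV \<psi> t :> y \<and> y \<le> 0" using D by (intro exI[of _ "c * (?g ?x \<bullet> h - ?g x \<bullet> h) - L * t * sqn h"]) simp
    qed simp
    moreover have "x + 0 \<cdot>\<^sub>v h = x" "x + 1 \<cdot>\<^sub>v h = x + h" using x h by (intro eq_vecI, auto)+
    ultimately show ?thesis by (simp add: \<psi>_def)
  qed
  have "f x' - f x - grad d f x \<bullet> h \<le> L / 2 * sqn h" using key[of 1] unfolding xh by simp
  moreover have "- (f x' - f x - grad d f x \<bullet> h) \<le> L / 2 * sqn h" using key[of "-1"] unfolding xh by simp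
  ultimately show ?thesis unfolding h_def[symmetric] by (rule abs_leI)
qed

end

section \<open>Borel structure on vectors and measurability of continuous maps\<close>

lemma space_vec_borel [simp]: "space (vec_borel d) = carrier_vec d"
  by (simp add: vec_borel_def)

lemma measurable_vec_index:
  assumes "f \<in> N \<rightarrow>\<^sub>M vec_borel d" "j < d" shows "(\<lambda>\<omega>. f \<omega> $ j) \<in> borel_measurable N"
proof -
  have "(\<lambda>v. \<lambda>j\<in>{..<d}. v $ j) \<in> vec_borel d \<rightarrow>\<^sub>M (\<Pi>\<^sub>M j\<in>{..<d}. borel :: real measure)"
    unfolding vec_borel_def by (rule measurable_vimage_algebra1) (auto simp: space_PiM)
  from measurable_compose[OF measurable_compose[OF assms(1) this] measurable_component_singleton[of j]]
  show ?thesis using assms(2) by simp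
qed

lemma measurable_vecI:
  assumes "\<And>\<omega>. \<omega> \<in> space N \<Longrightarrow> f \<omega> \<in> carrier_vec d"
    and "\<And>j. j < d \<Longrightarrow> (\<lambda>\<omega>. f \<omega> $ j) \<in> borel_measurable N"
  shows "f \<in> N \<rightarrow>\<^sub>M vec_borel d"
  unfolding vec_borel_def
  by (rule measurable_vimage_algebra2) (use assms in \<open>auto intro!: measurable_restrict\<close>)

lemma measurable_vec_carrier: "f \<in> N \<rightarrow>\<^sub>M vec_borel d \<Longrightarrow> \<omega> \<in> space N \<Longrightarrow> f \<omega> \<in> carrier_vec d"
  using measurable_space[of f N "vec_borel d" \<omega>] by simp

lemma measurable_sqn:
  assumes "f \<in> N \<rightarrow>\<^sub>M vec_borel d" shows "(\<lambda>\<omega>. sqn (f \<omega>)) \<in> borel_measurable N"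
proof -
  have "(\<lambda>\<omega>. \<Sum>j<d. (f \<omega> $ j)\<^sup>2) \<in> borel_measurable N"
    by (intro borel_measurable_sum borel_measurable_power measurable_vec_index[OF assms]) simp
  then show ?thesis
    by (rule measurable_cong[THEN iffD1, rotated]) (simp add: sqn_carrier[OF measurable_vec_carrier[OF assms]])
qed

text \<open>Rounding to a grid turns a continuous function into functions of a countable-valued variable.\<close>

lemma measurable_continuous_vec:
  fixes F :: "rvec \<Rightarrow> rvec \<Rightarrow> real"
  assumes cont: "\<And>x y. x \<in> carrier_vec d1 \<Longrightarrow> y \<in> carrier_vec d2 \<Longrightarrow> \<exists>C. \<forall>x'\<in>carrier_vec d1. \<forall>y'\<in>carrier_vec d2.
      nrm (x' - x) \<le> 1 \<longrightarrow> nrm (y' - y) \<le> 1 \<longrightarrow> \<bar>F x' y' - F x y\<bar> \<le> C * (nrm (x' - x) + nrm (y' - y))"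
    and u: "u \<in> N \<rightarrow>\<^sub>M vec_borel d1" and v: "v \<in> N \<rightarrow>\<^sub>M vec_borel d2"
  shows "(\<lambda>\<omega>. F (u \<omega>) (v \<omega>)) \<in> borel_measurable N"
proof -
  \<comment> \<open>The code of a vector is the list of integer parts of its coordinates scaled by
    \<open>Suc n\<close>. Lists of integers are countable, so any function of the code is measurable
    whatever \<open>F\<close> is; \<open>dec\<close> returns the grid point.\<close>
  define code where "code d n w = map (\<lambda>j. \<lfloor>real (Suc n) * (w $ j)\<rfloor>) [0..<d]" for d n and w :: rvec
  define dec where "dec d n l = Matrix.vec d (\<lambda>j. real_of_int (l ! j) / real (Suc n))" for d n l
  have ceq: "code d n z = l \<longleftrightarrow> length l = d \<and> (\<forall>j\<in>{..<d}. \<lfloor>real (Suc n) * (z $ j)\<rfloor> = l ! j)" for d n z l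
  proof
    assume "code d n z = l"
    from this[symmetric] show "length l = d \<and> (\<forall>j\<in>{..<d}. \<lfloor>real (Suc n) * (z $ j)\<rfloor> = l ! j)"
      by (simp add: code_def del: of_nat_Suc)
  next
    assume a: "length l = d \<and> (\<forall>j\<in>{..<d}. \<lfloor>real (Suc n) * (z $ j)\<rfloor> = l ! j)"
    show "code d n z = l" unfolding code_def by (rule nth_equalityI) (use a in \<open>simp_all del: of_nat_Suc\<close>)
  qed
  have code_meas: "(\<lambda>\<omega>. code d n (w \<omega>)) \<in> N \<rightarrow>\<^sub>M count_space UNIV" if w: "w \<in> N \<rightarrow>\<^sub>M vec_borel d" for d n w
  proof (subst measurable_count_space_eq2_countable, intro conjI ballI)
    fix l :: "int list"
    have "(\<lambda>\<omega>. code d n (w \<omega>)) -` {l} \<inter> space N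
        = {\<omega> \<in> space N. length l = d \<and> (\<forall>j\<in>{..<d}. \<lfloor>real (Suc n) * (w \<omega> $ j)\<rfloor> = l ! j)}"
      unfolding vimage_def Int_def mem_Collect_eq singleton_iff ceq by (rule Collect_cong) (rule conj_commute)
    also have "\<dots> \<in> sets N"
    proof (intro sets.sets_Collect_conj sets.sets_Collect_const sets.sets_Collect_finite_All)
      fix j assume "j \<in> {..<d}"
      then have "(\<lambda>\<omega>. real (Suc n) * (w \<omega> $ j)) \<in> borel_measurable N"
        by (intro borel_measurable_times borel_measurable_const measurable_vec_index[OF w]) simp
      then have m: "(\<lambda>\<omega>. \<lfloor>real (Suc n) * (w \<omega> $ j)\<rfloor>) \<in> N \<rightarrow>\<^sub>M count_space UNIV"
        by (rule measurable_compose[OF _ measurable_real_floor])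
      have "{\<omega> \<in> space N. \<lfloor>real (Suc n) * (w \<omega> $ j)\<rfloor> = l ! j}
          = (\<lambda>\<omega>. \<lfloor>real (Suc n) * (w \<omega> $ j)\<rfloor>) -` {l ! j} \<inter> space N" by auto
      then show "{\<omega> \<in> space N. \<lfloor>real (Suc n) * (w \<omega> $ j)\<rfloor> = l ! j} \<in> sets N"
        using measurable_sets[OF m, of "{l ! j}"] by simp
    qed simp
    finally show "(\<lambda>\<omega>. code d n (w \<omega>)) -` {l} \<inter> space N \<in> sets N" .
  qed auto
  define rd where "rd d n w = dec d n (code d n w)" for d n w
  have rdc: "rd d n w \<in> carrier_vec d" for d n w by (simp add: rd_def dec_def)
  have close: "nrm (rd d n w - w) \<le> real d / real (Suc n)" if w: "w \<in> carrier_vec d" for d n w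
  proof -
    have j: "\<bar>(rd d n w - w) $ j\<bar> \<le> 1 / real (Suc n)" if "j < d" for j
    proof -
      have "(rd d n w - w) $ j = (real_of_int \<lfloor>real (Suc n) * (w $ j)\<rfloor> - real (Suc n) * (w $ j)) / real (Suc n)"
        using that w by (simp add: rd_def dec_def code_def diff_divide_distrib)
      moreover have "\<bar>real_of_int \<lfloor>real (Suc n) * (w $ j)\<rfloor> - real (Suc n) * (w $ j)\<bar> \<le> 1" by linarith
      ultimately show ?thesis by (simp add: abs_divide divide_right_mono del: of_nat_Suc)
    qed
    have "nrm (rd d n w - w) \<le> (\<Sum>j<d. \<bar>(rd d n w - w) $ j\<bar>)"
      unfolding nrm_L2[OF minus_carrier_vec[OF rdc w]] by (rule L2_set_le_sum_abs)
    also have "\<dots> \<le> (\<Sum>j<d. 1 / real (Suc n))" by (intro sum_mono j) simp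
    finally show ?thesis by simp
  qed
  have lim0: "(\<lambda>n. real d / real (Suc n)) \<longlonglongrightarrow> 0" for d
    using LIMSEQ_Suc[OF lim_const_over_n[of "real d"]] by simp
  show ?thesis
  proof (rule borel_measurable_LIMSEQ_real)
    fix n
    let ?c = "\<lambda>\<omega>. (code d1 n (u \<omega>), code d2 n (v \<omega>))"
    have "?c \<in> N \<rightarrow>\<^sub>M count_space UNIV \<Otimes>\<^sub>M count_space UNIV"
      by (intro measurable_Pair code_meas u v)
    also have "count_space UNIV \<Otimes>\<^sub>M count_space UNIV = (count_space UNIV :: (int list \<times> int list) measure)"
      by (subst pair_measure_countable) auto
    finally have "?c \<in> N \<rightarrow>\<^sub>M count_space UNIV" .
    from measurable_compose[OF this, of "\<lambda>(a, b). F (dec d1 n a) (dec d2 n b)" borel]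
    show "(\<lambda>\<omega>. F (rd d1 n (u \<omega>)) (rd d2 n (v \<omega>))) \<in> borel_measurable N" by (simp add: rd_def)
  next
    fix \<omega> assume w: "\<omega> \<in> space N"
    let ?x = "u \<omega>" and ?y = "v \<omega>"
    have x: "?x \<in> carrier_vec d1" and y: "?y \<in> carrier_vec d2"
      using measurable_vec_carrier[OF u w] measurable_vec_carrier[OF v w] by auto
    let ?a = "\<lambda>n. nrm (rd d1 n ?x - ?x)" and ?b = "\<lambda>n. nrm (rd d2 n ?y - ?y)"
    have a: "?a \<longlonglongrightarrow> 0" by (rule tendsto_sandwich[OF always_eventually always_eventually tendsto_const lim0[of d1]]) (intro allI nrm_nonneg close[OF x])+
    have b: "?b \<longlonglongrightarrow> 0" by (rule tendsto_sandwich[OF always_eventually always_eventually tendsto_const lim0[of d2]]) (intro allI nrm_nonneg close[OF y])+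
    obtain C where C: "\<And>x' y'. x' \<in> carrier_vec d1 \<Longrightarrow> y' \<in> carrier_vec d2 \<Longrightarrow> nrm (x' - ?x) \<le> 1 \<Longrightarrow> nrm (y' - ?y) \<le> 1
       \<Longrightarrow> \<bar>F x' y' - F ?x ?y\<bar> \<le> C * (nrm (x' - ?x) + nrm (y' - ?y))" using cont[OF x y] by blast
    have "(\<lambda>n. F (rd d1 n ?x) (rd d2 n ?y) - F ?x ?y) \<longlonglongrightarrow> 0"
    proof (rule Lim_null_comparison)
      have "\<forall>\<^sub>F n in sequentially. ?a n < 1" "\<forall>\<^sub>F n in sequentially. ?b n < 1"
        using order_tendstoD(2)[OF a, of 1] order_tendstoD(2)[OF b, of 1] by auto
      then show "\<forall>\<^sub>F n in sequentially. norm (F (rd d1 n ?x) (rd d2 n ?y) - F ?x ?y) \<le> C * (?a n + ?b n)"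
        by eventually_elim (use C[OF rdc rdc] in auto)
      show "(\<lambda>n. C * (?a n + ?b n)) \<longlonglongrightarrow> 0"
        using tendsto_mult[OF tendsto_const tendsto_add[OF a b], of C] by simp
    qed
    then show "(\<lambda>n. F (rd d1 n ?x) (rd d2 n ?y)) \<longlonglongrightarrow> F ?x ?y" by (simp add: LIM_zero_iff)
  qed
qed

section \<open>Independence of fresh samples\<close>

lemma vimage_algebra_pow: "sets (vimage_algebra X f N) \<subseteq> Pow X"
  using sets.space_closed[of "vimage_algebra X f N"] by simp

locale sampling = prob_space M for M :: "'w measure" +
  fixes p :: "'s problem" and prb :: real and \<xi> :: "nat \<Rightarrow> nat \<Rightarrow> nat \<Rightarrow> 'w \<Rightarrow> 's"
    and coin :: "nat \<Rightarrow> 'w \<Rightarrow> bool" and x0 y0 :: "'w \<Rightarrow> rvec"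
  assumes model: "sampling_model M p prb \<xi> coin x0 y0"
begin

abbreviation "src \<equiv> source_sets M p \<xi> coin x0 y0"
text \<open>The index set for which \<open>sampling_model\<close> asserts independence.
  \<open>gen I\<close> is the information carried by the sources in \<open>I\<close>; adaptedness
  and freshness are statements about index sets from here on.\<close>

definition "sources = {Init} \<union> range Coin \<union> {Sample k i j | k i j. k < agents p}"
definition "gen I = sigma (space M) (\<Union>r\<in>I. src r)"

lemma x0_meas: "x0 \<in> M \<rightarrow>\<^sub>M vec_borel (dimx p)" and y0_meas: "y0 \<in> M \<rightarrow>\<^sub>M vec_borel (dimy p)"
  and xi_meas: "k < agents p \<Longrightarrow> \<xi> k i j \<in> M \<rightarrow>\<^sub>M law p k"
  and xi_distr: "k < agents p \<Longrightarrow> distr M (law p k) (\<xi> k i j) = law p k"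
  and coin_meas: "coin i \<in> M \<rightarrow>\<^sub>M count_space UNIV"
  and indep_sources: "indep_sets src sources"
  using model by (auto simp: sampling_model_def sources_def)

lemma law_prob: "k < agents p \<Longrightarrow> prob_space (law p k)"
  using prob_space_distr[OF xi_meas[of k 0 0]] xi_distr by simp

lemma pre_sets: 
  assumes "f \<in> M \<rightarrow>\<^sub>M N"
  shows "sets (vimage_algebra (space M) f N) \<subseteq> sets M"
proof -
  have "f \<in> space M \<rightarrow> space N" using assms measurable_space by auto
  then show ?thesis using measurable_sets[OF assms] by (auto simp: sets_vimage_algebra2)
qed

lemma src_sets: "r \<in> sources \<Longrightarrow> src r \<subseteq> sets M"
proof (cases r)
  case Init
  have "(\<lambda>\<omega>. (x0 \<omega>, y0 \<omega>)) \<in> M \<rightarrow>\<^sub>M vec_borel (dimx p) \<Otimes>\<^sub>M vec_borel (dimy p)"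
    by (intro measurable_Pair x0_meas y0_meas)
  then show ?thesis using Init pre_sets by (simp add: source_sets_def)
next
  case (Coin i) then show ?thesis using pre_sets[OF coin_meas] by (simp add: source_sets_def)
next
  case (Sample k i j) 
  moreover assume "r \<in> sources"
  ultimately have "k < agents p" by (auto simp: sources_def)
  then show ?thesis using Sample pre_sets[OF xi_meas] by (simp add: source_sets_def)
qed

lemma src_Int_stable: "Int_stable (src r)"
  by (cases r) (simp_all add: source_sets_def sets.Int_stable)

lemma src_pow: "src r \<subseteq> Pow (space M)"
  by (cases r) (simp_all add: source_sets_def vimage_algebra_pow)

lemma space_gen [simp]: "space (gen I) = space M"
  unfolding gen_def by (rule space_measure_of) (use src_pow in blast)

lemma sets_gen: "sets (gen I) = sigma_sets (space M) (\<Union>r\<in>I. src r)"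
  unfolding gen_def by (rule sets_measure_of) (use src_pow in blast)

lemma gen_mono: "I \<subseteq> I' \<Longrightarrow> sets (gen I) \<subseteq> sets (gen I')"
  unfolding sets_gen by (rule sigma_sets_mono') auto

lemma gen_le: "I \<subseteq> sources \<Longrightarrow> sets (gen I) \<subseteq> sets M"
  unfolding sets_gen by (rule sets.sigma_sets_subset) (use src_sets in blast)

lemma gen_subalgebra: "I \<subseteq> sources \<Longrightarrow> subalgebra M (gen I)"
  by (simp add: subalgebra_def gen_le)

lemma measurable_gen_mono: "f \<in> gen I \<rightarrow>\<^sub>M N \<Longrightarrow> I \<subseteq> I' \<Longrightarrow> f \<in> gen I' \<rightarrow>\<^sub>M N"
  using gen_mono[of I I'] by (auto simp: measurable_def)

lemma measurable_gen_M: "f \<in> gen I \<rightarrow>\<^sub>M N \<Longrightarrow> I \<subseteq> sources \<Longrightarrow> f \<in> M \<rightarrow>\<^sub>M N"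
  using gen_le[of I] by (auto simp: measurable_def)

lemma src_measurable:
  assumes "r \<in> I" "src r = sets (vimage_algebra (space M) f N)" "f \<in> M \<rightarrow>\<^sub>M N"
  shows "f \<in> gen I \<rightarrow>\<^sub>M N"
proof (rule measurableI)
  fix A assume A: "A \<in> sets N"
  have "f -` A \<inter> space M \<in> src r" unfolding assms(2) by (rule in_vimage_algebra[OF A])
  then show "f -` A \<inter> space (gen I) \<in> sets (gen I)" using assms(1) by (auto simp: sets_gen)
qed (use assms(3) measurable_space in auto)

lemma xi_gen: "Sample k i j \<in> I \<Longrightarrow> k < agents p \<Longrightarrow> \<xi> k i j \<in> gen I \<rightarrow>\<^sub>M law p k"
  by (rule src_measurable[of "Sample k i j"]) (auto simp: source_sets_def xi_meas)

lemma init_gen: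
  assumes "Init \<in> I"
  shows "x0 \<in> gen I \<rightarrow>\<^sub>M vec_borel (dimx p)" "y0 \<in> gen I \<rightarrow>\<^sub>M vec_borel (dimy p)"
proof -
  have "(\<lambda>\<omega>. (x0 \<omega>, y0 \<omega>)) \<in> gen I \<rightarrow>\<^sub>M vec_borel (dimx p) \<Otimes>\<^sub>M vec_borel (dimy p)"
    by (rule src_measurable[of Init]) (use assms x0_meas y0_meas in \<open>auto simp: source_sets_def\<close>)
  from measurable_compose[OF this measurable_fst] measurable_compose[OF this measurable_snd]
  show "x0 \<in> gen I \<rightarrow>\<^sub>M vec_borel (dimx p)" "y0 \<in> gen I \<rightarrow>\<^sub>M vec_borel (dimy p)" by simp_all
qed

text \<open>Independence of the individual sources lifts to the two blocks \<open>I\<close> and the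
  single fresh sample, because each source carries an intersection-stable system. A product law on
  rectangles then determines the joint law.\<close>

lemma fresh_distr:
  assumes I: "I \<subseteq> sources" and k: "k < agents p" and f: "Sample k i j \<notin> I" and U: "U \<in> gen I \<rightarrow>\<^sub>M N"
  shows "distr M (N \<Otimes>\<^sub>M law p k) (\<lambda>\<omega>. (U \<omega>, \<xi> k i j \<omega>)) = distr M N U \<Otimes>\<^sub>M law p k"
proof -
  \<comment> \<open>The two blocks are indexed by a truth value, the form in which pairwise
    independence of sigma-algebras is stated.\<close>
  let ?r = "Sample k i j" and ?I = "\<lambda>b. if b then I else {Sample k i j}"
  have r: "?r \<in> sources" using k by (auto simp: sources_def)
  have UM: "U \<in> M \<rightarrow>\<^sub>M N" by (rule measurable_gen_M[OF U I])
  have "(\<Union>b\<in>UNIV. ?I b) \<subseteq> sources" using I r by auto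
  then have "indep_sets src (\<Union>b\<in>UNIV. ?I b)" using indep_sources indep_sets_mono_index by blast
  then have "indep_sets (\<lambda>b. sigma_sets (space M) (\<Union>r\<in>?I b. src r)) UNIV"
    by (rule indep_sets_collect_sigma) (use f in \<open>auto simp: src_Int_stable disjoint_family_on_def\<close>)
  then have "indep_sets (case_bool (sigma_sets (space M) {U -` A \<inter> space M |A. A \<in> sets N})
      (sigma_sets (space M) {\<xi> k i j -` A \<inter> space M |A. A \<in> sets (law p k)})) UNIV"
  proof (rule indep_sets_mono_sets)
    fix b :: bool
    show "case_bool (sigma_sets (space M) {U -` A \<inter> space M |A. A \<in> sets N})
        (sigma_sets (space M) {\<xi> k i j -` A \<inter> space M |A. A \<in> sets (law p k)}) b
        \<subseteq> sigma_sets (space M) (\<Union>r\<in>?I b. src r)"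
    proof (cases b)
      case True
      have "{U -` A \<inter> space M |A. A \<in> sets N} \<subseteq> sets (gen I)" using measurable_sets[OF U] by auto
      from sets.sigma_sets_subset[OF this] show ?thesis using True by (simp add: sets_gen)
    next
      case False
      have xg: "\<xi> k i j \<in> gen {?r} \<rightarrow>\<^sub>M law p k" by (rule xi_gen) (use k in auto)
      have "{\<xi> k i j -` A \<inter> space M |A. A \<in> sets (law p k)} \<subseteq> sets (gen {?r})" using measurable_sets[OF xg] by auto
      from sets.sigma_sets_subset[OF this] show ?thesis using False by (simp add: sets_gen)
    qed
  qed
  then have ind: "indep_set (sigma_sets (space M) {U -` A \<inter> space M |A. A \<in> sets N})
      (sigma_sets (space M) {\<xi> k i j -` A \<inter> space M |A. A \<in> sets (law p k)})"
    unfolding indep_set_def .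
  let ?D = "distr M (N \<Otimes>\<^sub>M law p k) (\<lambda>\<omega>. (U \<omega>, \<xi> k i j \<omega>))"
  interpret law: prob_space "law p k" by (rule law_prob[OF k])
  interpret dU: prob_space "distr M N U" by (rule prob_space_distr[OF UM])
  have pr: "(\<lambda>\<omega>. (U \<omega>, \<xi> k i j \<omega>)) \<in> M \<rightarrow>\<^sub>M N \<Otimes>\<^sub>M law p k" by (intro measurable_Pair UM xi_meas[OF k])
  have "distr M N U \<Otimes>\<^sub>M law p k = ?D"
  proof (rule pair_measure_eqI)
    show "sigma_finite_measure (distr M N U)" "sigma_finite_measure (law p k)" by unfold_locales
    show "sets (distr M N U \<Otimes>\<^sub>M law p k) = sets ?D" by (simp cong: sets_pair_measure_cong)
    fix A B assume A: "A \<in> sets (distr M N U)" and B: "B \<in> sets (law p k)"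
    then have A': "A \<in> sets N" by simp
    let ?a = "U -` A \<inter> space M" and ?b = "\<xi> k i j -` B \<inter> space M"
    have ab: "?a \<in> events" "?b \<in> events" using measurable_sets[OF UM A'] measurable_sets[OF xi_meas[OF k] B] by auto
    have "emeasure ?D (A \<times> B) = emeasure M ((\<lambda>\<omega>. (U \<omega>, \<xi> k i j \<omega>)) -` (A \<times> B) \<inter> space M)"
      by (rule emeasure_distr[OF pr]) (use A' B in auto)
    also have "(\<lambda>\<omega>. (U \<omega>, \<xi> k i j \<omega>)) -` (A \<times> B) \<inter> space M = ?a \<inter> ?b" by auto
    also have "emeasure M (?a \<inter> ?b) = ennreal (prob ?a * prob ?b)"
      unfolding emeasure_eq_measure
      by (subst indep_setD[OF ind]) (use A' B in \<open>auto intro!: sigma_sets.Basic\<close>)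
    also have "\<dots> = emeasure M ?a * emeasure M ?b" by (simp add: emeasure_eq_measure ennreal_mult)
    also have "emeasure M ?a = emeasure (distr M N U) A" by (rule emeasure_distr[OF UM A', symmetric])
    also have "emeasure M ?b = emeasure (distr M (law p k) (\<xi> k i j)) B"
      by (rule emeasure_distr[OF xi_meas[OF k] B, symmetric])
    finally show "emeasure (distr M N U) A * emeasure (law p k) B = emeasure ?D (A \<times> B)"
      using xi_distr[OF k] by simp
  qed
  then show ?thesis ..
qed

text \<open>Freezing: what depends on the past is held fixed while the fresh sample is integrated
  against its own law. Together with \<open>fresh_mean_zero\<close> it takes the place of
  conditional expectations.\<close>

lemma fresh_nn_integral:
  assumes I: "I \<subseteq> sources" and k: "k < agents p" and f: "Sample k i j \<notin> I" and U: "U \<in> gen I \<rightarrow>\<^sub>M N"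
    and h: "h \<in> borel_measurable (N \<Otimes>\<^sub>M law p k)"
  shows "(\<integral>\<^sup>+\<omega>. h (U \<omega>, \<xi> k i j \<omega>) \<partial>M) = (\<integral>\<^sup>+\<omega>. \<integral>\<^sup>+s. h (U \<omega>, s) \<partial>law p k \<partial>M)"
proof -
  interpret law: prob_space "law p k" by (rule law_prob[OF k])
  have UM: "U \<in> M \<rightarrow>\<^sub>M N" by (rule measurable_gen_M[OF U I])
  have pr: "(\<lambda>\<omega>. (U \<omega>, \<xi> k i j \<omega>)) \<in> M \<rightarrow>\<^sub>M N \<Otimes>\<^sub>M law p k" by (intro measurable_Pair UM xi_meas[OF k])
  have h': "h \<in> borel_measurable (distr M N U \<Otimes>\<^sub>M law p k)" using h by (simp cong: measurable_cong_sets sets_pair_measure_cong)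
  have "(\<integral>\<^sup>+\<omega>. h (U \<omega>, \<xi> k i j \<omega>) \<partial>M) = integral\<^sup>N (distr M N U \<Otimes>\<^sub>M law p k) h"
    unfolding fresh_distr[OF I k f U, symmetric] by (subst nn_integral_distr[OF pr]) (use h in auto)
  also have "\<dots> = (\<integral>\<^sup>+u. \<integral>\<^sup>+s. h (u, s) \<partial>law p k \<partial>distr M N U)"
    by (rule law.nn_integral_fst[OF h', symmetric])
  also have "\<dots> = (\<integral>\<^sup>+\<omega>. \<integral>\<^sup>+s. h (U \<omega>, s) \<partial>law p k \<partial>M)"
    by (rule nn_integral_distr[OF UM]) (use law.borel_measurable_nn_integral_fst[OF h] in simp)
  finally show ?thesis .
qed

lemma fresh_mean_zero:
  fixes h :: "_ \<Rightarrow> real"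
  assumes I: "I \<subseteq> sources" and k: "k < agents p" and f: "Sample k i j \<notin> I" and U: "U \<in> gen I \<rightarrow>\<^sub>M N"
    and h: "h \<in> borel_measurable (N \<Otimes>\<^sub>M law p k)" and z: "\<And>u. u \<in> space N \<Longrightarrow> (\<integral>s. h (u, s) \<partial>law p k) = 0"
    and int: "integrable M (\<lambda>\<omega>. h (U \<omega>, \<xi> k i j \<omega>))"
  shows "(\<integral>\<omega>. h (U \<omega>, \<xi> k i j \<omega>) \<partial>M) = 0"
proof -
  interpret law: prob_space "law p k" by (rule law_prob[OF k])
  have UM: "U \<in> M \<rightarrow>\<^sub>M N" by (rule measurable_gen_M[OF U I])
  interpret dU: prob_space "distr M N U" by (rule prob_space_distr[OF UM])
  interpret pr: pair_sigma_finite "distr M N U" "law p k" ..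
  have pm: "(\<lambda>\<omega>. (U \<omega>, \<xi> k i j \<omega>)) \<in> M \<rightarrow>\<^sub>M N \<Otimes>\<^sub>M law p k" by (intro measurable_Pair UM xi_meas[OF k])
  have "integrable (distr M (N \<Otimes>\<^sub>M law p k) (\<lambda>\<omega>. (U \<omega>, \<xi> k i j \<omega>))) h"
    unfolding integrable_distr_eq[OF pm h] by (rule int)
  then have ih: "integrable (distr M N U \<Otimes>\<^sub>M law p k) h" unfolding fresh_distr[OF I k f U] .
  have "(\<integral>\<omega>. h (U \<omega>, \<xi> k i j \<omega>) \<partial>M) = integral\<^sup>L (distr M N U \<Otimes>\<^sub>M law p k) h"
    unfolding fresh_distr[OF I k f U, symmetric] integral_distr[OF pm h] ..
  also have "\<dots> = (\<integral>u. \<integral>s. h (u, s) \<partial>law p k \<partial>distr M N U)" by (rule pr.integral_fst'[OF ih, symmetric])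
  also have "\<dots> = (\<integral>u. 0 \<partial>distr M N U)" by (rule Bochner_Integration.integral_cong) (use z in auto)
  finally show ?thesis by simp
qed

text \<open>The cross term has mean zero by freezing. When either second moment is infinite the
  right side is infinite, so no integrability has to be known in advance.\<close>

lemma fresh_pythagoras:
  fixes a :: "_ \<Rightarrow> real" and h :: "_ \<Rightarrow> real"
  assumes I: "I \<subseteq> sources" and k: "k < agents p" and f: "Sample k i j \<notin> I" and U: "U \<in> gen I \<rightarrow>\<^sub>M N"
    and a: "a \<in> borel_measurable (gen I)"
    and h: "h \<in> borel_measurable (N \<Otimes>\<^sub>M law p k)" and z: "\<And>u. u \<in> space N \<Longrightarrow> (\<integral>s. h (u, s) \<partial>law p k) = 0"
  shows "(\<integral>\<^sup>+\<omega>. ennreal ((a \<omega> + h (U \<omega>, \<xi> k i j \<omega>))\<^sup>2) \<partial>M)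
     \<le> (\<integral>\<^sup>+\<omega>. ennreal ((a \<omega>)\<^sup>2) \<partial>M) + (\<integral>\<^sup>+\<omega>. ennreal ((h (U \<omega>, \<xi> k i j \<omega>))\<^sup>2) \<partial>M)"
proof -
  let ?n = "\<lambda>\<omega>. h (U \<omega>, \<xi> k i j \<omega>)"
  have UM: "U \<in> M \<rightarrow>\<^sub>M N" by (rule measurable_gen_M[OF U I])
  have aM [measurable]: "a \<in> borel_measurable M" by (rule measurable_gen_M[OF a I])
  have nM [measurable]: "?n \<in> borel_measurable M"
    by (rule measurable_compose[OF _ h]) (intro measurable_Pair UM xi_meas[OF k])
  show ?thesis
  proof (cases "(\<integral>\<^sup>+\<omega>. ennreal ((a \<omega>)\<^sup>2) \<partial>M) < \<infinity> \<and> (\<integral>\<^sup>+\<omega>. ennreal ((?n \<omega>)\<^sup>2) \<partial>M) < \<infinity>")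
    case False
    then show ?thesis by (auto simp: less_top[symmetric])
  next
    case True
    have ia: "integrable M (\<lambda>\<omega>. (a \<omega>)\<^sup>2)" by (rule integrableI_nonneg) (use True in auto)
    have in': "integrable M (\<lambda>\<omega>. (?n \<omega>)\<^sup>2)" by (rule integrableI_nonneg) (use True in auto)
    have ip: "integrable M (\<lambda>\<omega>. a \<omega> * ?n \<omega>)"
    proof (rule Bochner_Integration.integrable_bound[OF Bochner_Integration.integrable_add[OF ia in']])
      show "AE \<omega> in M. norm (a \<omega> * ?n \<omega>) \<le> norm ((a \<omega>)\<^sup>2 + (?n \<omega>)\<^sup>2)"
      proof (rule AE_I2)
        fix \<omega>
        have "0 \<le> (\<bar>a \<omega>\<bar> - \<bar>?n \<omega>\<bar>)\<^sup>2" by simp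
        then have "2 * (\<bar>a \<omega>\<bar> * \<bar>?n \<omega>\<bar>) \<le> (a \<omega>)\<^sup>2 + (?n \<omega>)\<^sup>2" by (simp add: power2_diff)
        moreover have "0 \<le> \<bar>a \<omega>\<bar> * \<bar>?n \<omega>\<bar>" by simp
        ultimately have "\<bar>a \<omega>\<bar> * \<bar>?n \<omega>\<bar> \<le> (a \<omega>)\<^sup>2 + (?n \<omega>)\<^sup>2" by linarith
        then show "norm (a \<omega> * ?n \<omega>) \<le> norm ((a \<omega>)\<^sup>2 + (?n \<omega>)\<^sup>2)" by (simp add: abs_mult)
      qed
    qed measurable
    have U2: "(\<lambda>\<omega>. (a \<omega>, U \<omega>)) \<in> gen I \<rightarrow>\<^sub>M borel \<Otimes>\<^sub>M N" by (intro measurable_Pair a U)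
    let ?H = "\<lambda>x. fst (fst x) * h (snd (fst x), snd x) :: real"
    have H: "?H \<in> borel_measurable ((borel \<Otimes>\<^sub>M N) \<Otimes>\<^sub>M law p k)"
      by (intro borel_measurable_times measurable_compose[OF _ h]) measurable
    have c0: "(\<integral>\<omega>. ?H ((a \<omega>, U \<omega>), \<xi> k i j \<omega>) \<partial>M) = 0"
    proof (rule fresh_mean_zero[OF I k f U2 H])
      fix u :: "real \<times> _" assume "u \<in> space (borel \<Otimes>\<^sub>M N)"
      then have u: "snd u \<in> space N" by (auto simp: space_pair_measure)
      show "(\<integral>s. ?H (u, s) \<partial>law p k) = 0" using z[OF u] by simp
    qed (use ip in simp)
    have i2: "integrable M (\<lambda>\<omega>. 2 * (a \<omega> * ?n \<omega>))" using ip by simp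
    have sq: "(a \<omega> + ?n \<omega>)\<^sup>2 = ((a \<omega>)\<^sup>2 + (?n \<omega>)\<^sup>2) + 2 * (a \<omega> * ?n \<omega>)" for \<omega> by (simp add: power2_sum)
    have isq: "integrable M (\<lambda>\<omega>. (a \<omega> + ?n \<omega>)\<^sup>2)" unfolding sq using ia in' i2 by simp
    have "(\<integral>\<^sup>+\<omega>. ennreal ((a \<omega> + ?n \<omega>)\<^sup>2) \<partial>M) = ennreal (\<integral>\<omega>. (a \<omega> + ?n \<omega>)\<^sup>2 \<partial>M)"
      by (rule nn_integral_eq_integral[OF isq]) simp
    also have "(\<integral>\<omega>. (a \<omega> + ?n \<omega>)\<^sup>2 \<partial>M) = (\<integral>\<omega>. (a \<omega>)\<^sup>2 \<partial>M) + (\<integral>\<omega>. (?n \<omega>)\<^sup>2 \<partial>M)"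
      unfolding sq using ia in' i2 c0 by simp
    also have "ennreal \<dots> = ennreal (\<integral>\<omega>. (a \<omega>)\<^sup>2 \<partial>M) + ennreal (\<integral>\<omega>. (?n \<omega>)\<^sup>2 \<partial>M)"
      by (rule ennreal_plus) simp_all
    also have "ennreal (\<integral>\<omega>. (a \<omega>)\<^sup>2 \<partial>M) = (\<integral>\<^sup>+\<omega>. ennreal ((a \<omega>)\<^sup>2) \<partial>M)"
      by (rule nn_integral_eq_integral[OF ia, symmetric]) simp
    also have "ennreal (\<integral>\<omega>. (?n \<omega>)\<^sup>2 \<partial>M) = (\<integral>\<^sup>+\<omega>. ennreal ((?n \<omega>)\<^sup>2) \<partial>M)"
      by (rule nn_integral_eq_integral[OF in', symmetric]) simp
    finally show ?thesis by simp
  qed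
qed

text \<open>Samples are added one at a time. Every summand already added becomes part of the past of
  the next one, so orthogonality follows from \<open>fresh_pythagoras\<close> alone.\<close>

lemma fresh_sum:
  fixes a :: "_ \<Rightarrow> real" and h :: "nat \<times> nat \<Rightarrow> _ \<Rightarrow> real"
  assumes I: "I \<subseteq> sources" and S: "finite S" and k: "\<And>r. r \<in> S \<Longrightarrow> fst r < agents p"
    and f: "\<And>r. r \<in> S \<Longrightarrow> Sample (fst r) i (snd r) \<notin> I"
    and U: "\<And>r. r \<in> S \<Longrightarrow> U r \<in> gen I \<rightarrow>\<^sub>M N" and a: "a \<in> borel_measurable (gen I)"
    and h: "\<And>r. r \<in> S \<Longrightarrow> h r \<in> borel_measurable (N \<Otimes>\<^sub>M law p (fst r))"
    and z: "\<And>r u. r \<in> S \<Longrightarrow> u \<in> space N \<Longrightarrow> (\<integral>s. h r (u, s) \<partial>law p (fst r)) = 0"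
  shows "(\<integral>\<^sup>+\<omega>. ennreal ((a \<omega> + (\<Sum>r\<in>S. h r (U r \<omega>, \<xi> (fst r) i (snd r) \<omega>)))\<^sup>2) \<partial>M)
     \<le> (\<integral>\<^sup>+\<omega>. ennreal ((a \<omega>)\<^sup>2) \<partial>M)
       + (\<Sum>r\<in>S. \<integral>\<^sup>+\<omega>. ennreal ((h r (U r \<omega>, \<xi> (fst r) i (snd r) \<omega>))\<^sup>2) \<partial>M)"
  using S k f U h z
proof (induction S rule: finite_induct)
  case empty then show ?case by simp
next
  case (insert r S)
  let ?t = "\<lambda>r \<omega>. h r (U r \<omega>, \<xi> (fst r) i (snd r) \<omega>)"
  \<comment> \<open>The past enlarged by the samples already used; the next sample is still fresh
    because pairs in a set are distinct.\<close>
  let ?J = "I \<union> (\<lambda>r. Sample (fst r) i (snd r)) ` S"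
  let ?a = "\<lambda>\<omega>. a \<omega> + (\<Sum>r\<in>S. ?t r \<omega>)"
  have J: "?J \<subseteq> sources" using I insert.prems(1) by (auto simp: sources_def)
  have a': "?a \<in> borel_measurable (gen ?J)"
  proof (intro borel_measurable_add borel_measurable_sum)
    show "a \<in> borel_measurable (gen ?J)" by (rule measurable_gen_mono[OF a]) simp
    fix q assume q: "q \<in> S"
    show "?t q \<in> borel_measurable (gen ?J)"
    proof (rule measurable_compose[OF _ insert.prems(4)])
      show "(\<lambda>\<omega>. (U q \<omega>, \<xi> (fst q) i (snd q) \<omega>)) \<in> gen ?J \<rightarrow>\<^sub>M N \<Otimes>\<^sub>M law p (fst q)"
        by (intro measurable_Pair measurable_gen_mono[OF insert.prems(3)] xi_gen) (use q insert.prems(1) in auto)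
    qed (use q in simp)
  qed
  have nin: "Sample (fst r) i (snd r) \<notin> ?J" using insert.prems(2)[of r] insert.hyps(2) by (auto simp: prod_eq_iff)
  have "(\<integral>\<^sup>+\<omega>. ennreal ((a \<omega> + (\<Sum>r\<in>insert r S. ?t r \<omega>))\<^sup>2) \<partial>M) = (\<integral>\<^sup>+\<omega>. ennreal ((?a \<omega> + ?t r \<omega>)\<^sup>2) \<partial>M)"
    using insert.hyps by (simp add: add_ac)
  also have "\<dots> \<le> (\<integral>\<^sup>+\<omega>. ennreal ((?a \<omega>)\<^sup>2) \<partial>M) + (\<integral>\<^sup>+\<omega>. ennreal ((?t r \<omega>)\<^sup>2) \<partial>M)"
    by (rule fresh_pythagoras[OF J _ nin measurable_gen_mono[OF insert.prems(3)[OF insertI1] Un_upper1] a'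
          insert.prems(4)[OF insertI1]]) (use insert.prems in auto)
  also have "\<dots> \<le> ((\<integral>\<^sup>+\<omega>. ennreal ((a \<omega>)\<^sup>2) \<partial>M) + (\<Sum>r\<in>S. \<integral>\<^sup>+\<omega>. ennreal ((?t r \<omega>)\<^sup>2) \<partial>M))
      + (\<integral>\<^sup>+\<omega>. ennreal ((?t r \<omega>)\<^sup>2) \<partial>M)"
    by (rule add_right_mono, rule insert.IH) (use insert.prems in auto)
  also have "\<dots> = (\<integral>\<^sup>+\<omega>. ennreal ((a \<omega>)\<^sup>2) \<partial>M) + (\<Sum>r\<in>insert r S. \<integral>\<^sup>+\<omega>. ennreal ((?t r \<omega>)\<^sup>2) \<partial>M)"
    using insert.hyps by (simp add: add_ac)
  finally show ?case .
qed

end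

section \<open>Minibatch gradients\<close>

text \<open>Both parts come from the variance identity when the second moment is finite and are
  trivial otherwise.\<close>

lemma (in prob_space) second_moment_bounds:
  fixes h :: "'a \<Rightarrow> real"
  assumes "has_bochner_integral M h m"
  shows "(\<integral>\<^sup>+s. ennreal ((h s - m)\<^sup>2) \<partial>M) \<le> (\<integral>\<^sup>+s. ennreal ((h s)\<^sup>2) \<partial>M)"
    and "ennreal (m\<^sup>2) \<le> (\<integral>\<^sup>+s. ennreal ((h s)\<^sup>2) \<partial>M)"
proof -
  have ih: "integrable M h" and m: "expectation h = m" using assms by (auto simp: has_bochner_integral_iff)
  have [measurable]: "h \<in> borel_measurable M" using ih by auto
  have "(\<integral>\<^sup>+s. ennreal ((h s - m)\<^sup>2) \<partial>M) \<le> (\<integral>\<^sup>+s. ennreal ((h s)\<^sup>2) \<partial>M) \<and> ennreal (m\<^sup>2) \<le> (\<integral>\<^sup>+s. ennreal ((h s)\<^sup>2) \<partial>M)"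
  proof (cases "(\<integral>\<^sup>+s. ennreal ((h s)\<^sup>2) \<partial>M) < \<infinity>")
    case False then show ?thesis by (auto simp: less_top[symmetric])
  next
    case True
    have i2: "integrable M (\<lambda>s. (h s)\<^sup>2)" by (rule integrableI_nonneg) (use True in auto)
    have sq: "(h s - m)\<^sup>2 = (h s)\<^sup>2 - 2 * m * h s + m\<^sup>2" for s by (simp add: power2_diff)
    have iv: "integrable M (\<lambda>s. (h s - m)\<^sup>2)" unfolding sq using ih i2 by simp
    have v: "expectation (\<lambda>s. (h s - m)\<^sup>2) = expectation (\<lambda>s. (h s)\<^sup>2) - m\<^sup>2"
      unfolding sq using ih i2 m by (simp add: prob_space power2_eq_square)
    have "0 \<le> expectation (\<lambda>s. (h s - m)\<^sup>2)" by simp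
    then have "m\<^sup>2 \<le> expectation (\<lambda>s. (h s)\<^sup>2)" using v by simp
    moreover have "expectation (\<lambda>s. (h s - m)\<^sup>2) \<le> expectation (\<lambda>s. (h s)\<^sup>2)" using v by simp
    moreover have "(\<integral>\<^sup>+s. ennreal ((h s - m)\<^sup>2) \<partial>M) = ennreal (expectation (\<lambda>s. (h s - m)\<^sup>2))"
      by (rule nn_integral_eq_integral[OF iv]) simp
    moreover have "(\<integral>\<^sup>+s. ennreal ((h s)\<^sup>2) \<partial>M) = ennreal (expectation (\<lambda>s. (h s)\<^sup>2))"
      by (rule nn_integral_eq_integral[OF i2]) simp
    ultimately show ?thesis by (simp add: ennreal_leI)
  qed
  then show "(\<integral>\<^sup>+s. ennreal ((h s - m)\<^sup>2) \<partial>M) \<le> (\<integral>\<^sup>+s. ennreal ((h s)\<^sup>2) \<partial>M)"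
    and "ennreal (m\<^sup>2) \<le> (\<integral>\<^sup>+s. ennreal ((h s)\<^sup>2) \<partial>M)" by auto
qed

lemma nn_integral_sqn:
  assumes "\<And>\<omega>. \<omega> \<in> space N \<Longrightarrow> v \<omega> \<in> carrier_vec d" "\<And>j. j < d \<Longrightarrow> (\<lambda>\<omega>. v \<omega> $ j) \<in> borel_measurable N"
  shows "(\<integral>\<^sup>+\<omega>. ennreal (sqn (v \<omega>)) \<partial>N) = (\<Sum>j<d. \<integral>\<^sup>+\<omega>. ennreal ((v \<omega> $ j)\<^sup>2) \<partial>N)"
proof -
  have "(\<integral>\<^sup>+\<omega>. ennreal (sqn (v \<omega>)) \<partial>N) = (\<integral>\<^sup>+\<omega>. (\<Sum>j<d. ennreal ((v \<omega> $ j)\<^sup>2)) \<partial>N)"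
    by (rule nn_integral_cong) (simp add: sqn_carrier[OF assms(1)] sum_ennreal)
  also have "\<dots> = (\<Sum>j<d. \<integral>\<^sup>+\<omega>. ennreal ((v \<omega> $ j)\<^sup>2) \<partial>N)"
    by (rule nn_integral_sum) (use assms(2) in \<open>auto intro!: measurable_compose[OF _ measurable_ennreal] borel_measurable_power\<close>)
  finally show ?thesis .
qed

lemma power2_sum4_le: "(a + b + c + e)\<^sup>2 \<le> 4 * (a\<^sup>2 + b\<^sup>2 + c\<^sup>2 + e\<^sup>2)" for a b c e :: real
proof -
  have "0 \<le> (a - b)\<^sup>2 + (a - c)\<^sup>2 + (a - e)\<^sup>2 + (b - c)\<^sup>2 + (b - e)\<^sup>2 + (c - e)\<^sup>2" by simp
  then show ?thesis by (simp add: power2_eq_square algebra_simps)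
qed

lemma power2_sum2_le: "(a + b)\<^sup>2 \<le> 2 * a\<^sup>2 + 2 * b\<^sup>2" for a b :: real
proof -
  have "0 \<le> (a - b)\<^sup>2" by simp
  then show ?thesis by (simp add: power2_eq_square algebra_simps)
qed

text \<open>Instantiated once for the gradients in \<open>x\<close> and once for those in
  \<open>y\<close>: \<open>Q\<close> is the sample gradient, \<open>R\<close> its mean, and only the
  dimension \<open>d\<close> of the values differs.\<close>

locale stoch_grad = sampling M p prb \<xi> coin x0 y0
  for M :: "'w measure" and p :: "'s problem" and prb and \<xi> and coin and x0 and y0 +
  fixes d :: nat and Q :: "nat \<Rightarrow> rvec \<Rightarrow> rvec \<Rightarrow> 's \<Rightarrow> rvec" and R :: "nat \<Rightarrow> rvec \<Rightarrow> rvec \<Rightarrow> rvec" and L :: real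
  assumes Qm: "\<And>k. k < agents p \<Longrightarrow> (\<lambda>((x, y), s). Q k x y s)
      \<in> (vec_borel (dimx p) \<Otimes>\<^sub>M vec_borel (dimy p)) \<Otimes>\<^sub>M law p k \<rightarrow>\<^sub>M vec_borel d"
    and Qc: "\<And>k x y s. Q k x y s \<in> carrier_vec d" and Rc: "\<And>k x y. R k x y \<in> carrier_vec d"
    and Qb: "\<And>k x y j. k < agents p \<Longrightarrow> x \<in> Xs p \<Longrightarrow> y \<in> Ys p \<Longrightarrow> j < d \<Longrightarrow>
      has_bochner_integral (law p k) (\<lambda>s. Q k x y s $ j) (R k x y $ j)"
    and Ql: "\<And>k x1 y1 x2 y2. k < agents p \<Longrightarrow> x1 \<in> Xs p \<Longrightarrow> y1 \<in> Ys p \<Longrightarrow> x2 \<in> Xs p \<Longrightarrow> y2 \<in> Ys p \<Longrightarrow>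
      (\<integral>\<^sup>+s. ennreal (sqn (Q k x1 y1 s - Q k x2 y2 s)) \<partial>law p k) \<le> ennreal (L\<^sup>2 * (sqn (x1 - x2) + sqn (y1 - y2)))"
begin

abbreviation "VV \<equiv> vec_borel (dimx p) \<Otimes>\<^sub>M vec_borel (dimy p)"

lemma Q_meas:
  assumes "k < agents p" "x \<in> N \<rightarrow>\<^sub>M vec_borel (dimx p)" "y \<in> N \<rightarrow>\<^sub>M vec_borel (dimy p)" "s \<in> N \<rightarrow>\<^sub>M law p k"
  shows "(\<lambda>\<omega>. Q k (x \<omega>) (y \<omega>) (s \<omega>)) \<in> N \<rightarrow>\<^sub>M vec_borel d"
proof -
  have "(\<lambda>\<omega>. ((x \<omega>, y \<omega>), s \<omega>)) \<in> N \<rightarrow>\<^sub>M VV \<Otimes>\<^sub>M law p k" by (intro measurable_Pair assms)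
  from measurable_compose[OF this Qm[OF assms(1)]] show ?thesis by simp
qed

lemma Q_const_meas: "k < agents p \<Longrightarrow> x \<in> Xs p \<Longrightarrow> y \<in> Ys p \<Longrightarrow> Q k x y \<in> law p k \<rightarrow>\<^sub>M vec_borel d"
  using Q_meas[of k "\<lambda>_. x" "law p k" "\<lambda>_. y" "\<lambda>s. s"] by simp

text \<open>\<open>R\<close> is an integral of the jointly measurable \<open>Q\<close> over its
  sample, hence measurable in the point.\<close>

lemma R_meas:
  assumes k: "k < agents p" and x: "x \<in> N \<rightarrow>\<^sub>M vec_borel (dimx p)" and y: "y \<in> N \<rightarrow>\<^sub>M vec_borel (dimy p)"
  shows "(\<lambda>\<omega>. R k (x \<omega>) (y \<omega>)) \<in> N \<rightarrow>\<^sub>M vec_borel d"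
proof (rule measurable_vecI)
  fix j assume j: "j < d"
  interpret law: prob_space "law p k" by (rule law_prob[OF k])
  have "(\<lambda>w. Q k (x (fst w)) (y (fst w)) (snd w)) \<in> N \<Otimes>\<^sub>M law p k \<rightarrow>\<^sub>M vec_borel d"
    by (intro Q_meas k measurable_compose[OF measurable_fst x] measurable_compose[OF measurable_fst y] measurable_snd)
  from measurable_vec_index[OF this j]
  have "(\<lambda>\<omega>. \<integral>s. Q k (x \<omega>) (y \<omega>) s $ j \<partial>law p k) \<in> borel_measurable N"
    by (intro law.borel_measurable_lebesgue_integral) (simp add: case_prod_beta')
  moreover have "(\<integral>s. Q k (x \<omega>) (y \<omega>) s $ j \<partial>law p k) = R k (x \<omega>) (y \<omega>) $ j" if "\<omega> \<in> space N" for \<omega>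
    using Qb[OF k measurable_vec_carrier[OF x that] measurable_vec_carrier[OF y that] j]
    by (simp add: has_bochner_integral_iff)
  ultimately show "(\<lambda>\<omega>. R k (x \<omega>) (y \<omega>) $ j) \<in> borel_measurable N"
    by (rule measurable_cong[THEN iffD1, rotated]) 
qed (rule Rc)

text \<open>Mean-square smoothness bounds the raw second moment of a difference of sample gradients.
  Its variance and its squared mean are both smaller, which gives one Lipschitz constant for the
  noise and for the risk gradient.\<close>

lemma difference_moments:
  assumes k: "k < agents p" and x: "x1 \<in> Xs p" "y1 \<in> Ys p" "x2 \<in> Xs p" "y2 \<in> Ys p"
  shows noise_difference: "(\<integral>\<^sup>+s. ennreal (sqn (Q k x1 y1 s - Q k x2 y2 s - (R k x1 y1 - R k x2 y2))) \<partial>law p k)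
      \<le> ennreal (L\<^sup>2 * (sqn (x1 - x2) + sqn (y1 - y2)))"
    and R_lipschitz: "sqn (R k x1 y1 - R k x2 y2) \<le> L\<^sup>2 * (sqn (x1 - x2) + sqn (y1 - y2))"
proof -
  interpret law: prob_space "law p k" by (rule law_prob[OF k])
  let ?D = "\<lambda>s. Q k x1 y1 s - Q k x2 y2 s" and ?m = "R k x1 y1 - R k x2 y2"
  note qm = measurable_vec_index[OF Q_const_meas[OF k x(1,2)]] measurable_vec_index[OF Q_const_meas[OF k x(3,4)]]
  have D: "?D s \<in> carrier_vec d" "?D s - ?m \<in> carrier_vec d" "?m \<in> carrier_vec d" for s using Qc Rc by auto
  have ix: "?D s $ j = Q k x1 y1 s $ j - Q k x2 y2 s $ j" "(?D s - ?m) $ j = ?D s $ j - ?m $ j"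
    "?m $ j = R k x1 y1 $ j - R k x2 y2 $ j" if "j < d" for s j
    using that Qc[of k x2 y2 s] Rc[of k x2 y2] D by auto
  have Dm: "(\<lambda>s. ?D s $ j) \<in> borel_measurable (law p k)" if "j < d" for j
    unfolding ix(1)[OF that] by (intro borel_measurable_diff qm that)
  have hb: "has_bochner_integral (law p k) (\<lambda>s. ?D s $ j) (?m $ j)" if "j < d" for j
    unfolding ix(1,3)[OF that] by (intro has_bochner_integral_diff Qb k x that)
  have le: "(\<integral>\<^sup>+s. ennreal (sqn (?D s)) \<partial>law p k) \<le> ennreal (L\<^sup>2 * (sqn (x1 - x2) + sqn (y1 - y2)))" by (rule Ql[OF k x])
  have S: "(\<integral>\<^sup>+s. ennreal (sqn (?D s)) \<partial>law p k) = (\<Sum>j<d. \<integral>\<^sup>+s. ennreal ((?D s $ j)\<^sup>2) \<partial>law p k)"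
    by (rule nn_integral_sqn) (use D Dm in auto)
  have "(\<integral>\<^sup>+s. ennreal (sqn (?D s - ?m)) \<partial>law p k) = (\<Sum>j<d. \<integral>\<^sup>+s. ennreal (((?D s - ?m) $ j)\<^sup>2) \<partial>law p k)"
  proof (rule nn_integral_sqn)
    show "(\<lambda>s. (?D s - ?m) $ j) \<in> borel_measurable (law p k)" if "j < d" for j
      unfolding ix(2)[OF that] by (intro borel_measurable_diff Dm that borel_measurable_const)
  qed (use D in auto)
  also have "\<dots> \<le> (\<Sum>j<d. \<integral>\<^sup>+s. ennreal ((?D s $ j)\<^sup>2) \<partial>law p k)"
  proof (rule sum_mono)
    fix j assume "j \<in> {..<d}"
    then have j: "j < d" by simp
    show "(\<integral>\<^sup>+s. ennreal (((?D s - ?m) $ j)\<^sup>2) \<partial>law p k) \<le> (\<integral>\<^sup>+s. ennreal ((?D s $ j)\<^sup>2) \<partial>law p k)"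
      unfolding ix(2)[OF j] by (rule law.second_moment_bounds(1)[OF hb[OF j]])
  qed
  finally show "(\<integral>\<^sup>+s. ennreal (sqn (?D s - ?m)) \<partial>law p k) \<le> ennreal (L\<^sup>2 * (sqn (x1 - x2) + sqn (y1 - y2)))"
    using S le by simp
  have "ennreal (sqn ?m) = (\<Sum>j<d. ennreal ((?m $ j)\<^sup>2))" using D by (simp add: sqn_carrier sum_ennreal)
  also have "\<dots> \<le> (\<Sum>j<d. \<integral>\<^sup>+s. ennreal ((?D s $ j)\<^sup>2) \<partial>law p k)"
    by (intro sum_mono law.second_moment_bounds(2) hb) simp
  also have "\<dots> \<le> ennreal (L\<^sup>2 * (sqn (x1 - x2) + sqn (y1 - y2)))" using S le by simp
  finally show "sqn ?m \<le> L\<^sup>2 * (sqn (x1 - x2) + sqn (y1 - y2))"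
    by (rule ennreal_le_iff[THEN iffD1, rotated]) simp
qed

text \<open>Each agent's error is measured at its own iterate, not at the centroid. That keeps the
  noise part free of the spread, which is added only in \<open>path_error\<close>.\<close>

definition merr :: "(nat \<Rightarrow> 'w \<Rightarrow> rvec) \<Rightarrow> (nat \<Rightarrow> 'w \<Rightarrow> rvec) \<Rightarrow> (nat \<Rightarrow> 'w \<Rightarrow> rvec) \<Rightarrow> 'w \<Rightarrow> rvec" where
  "merr X Y g \<omega> = Matrix.vec d (\<lambda>c. (\<Sum>k<agents p. (g k \<omega> - R k (X k \<omega>) (Y k \<omega>)) $ c) / real (agents p))"

lemma merr_carrier [simp]: "merr X Y g \<omega> \<in> carrier_vec d" by (simp add: merr_def)

lemma err_measurable:
  assumes X: "\<And>k. k < agents p \<Longrightarrow> X k \<in> N \<rightarrow>\<^sub>M vec_borel (dimx p)"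
    and Y: "\<And>k. k < agents p \<Longrightarrow> Y k \<in> N \<rightarrow>\<^sub>M vec_borel (dimy p)"
    and g: "\<And>k. k < agents p \<Longrightarrow> g k \<in> N \<rightarrow>\<^sub>M vec_borel d"
  shows "k < agents p \<Longrightarrow> (\<lambda>\<omega>. g k \<omega> - R k (X k \<omega>) (Y k \<omega>)) \<in> N \<rightarrow>\<^sub>M vec_borel d"
    and "merr X Y g \<in> N \<rightarrow>\<^sub>M vec_borel d"
proof -
  have e: "(\<lambda>\<omega>. (g k \<omega> - R k (X k \<omega>) (Y k \<omega>)) $ c) \<in> borel_measurable N" if k: "k < agents p" and c: "c < d" for k c
  proof -
    have "(\<lambda>\<omega>. g k \<omega> $ c - R k (X k \<omega>) (Y k \<omega>) $ c) \<in> borel_measurable N"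
      by (intro borel_measurable_diff measurable_vec_index[OF g] measurable_vec_index[OF R_meas] k c X Y)
    then show ?thesis by (rule measurable_cong[THEN iffD1, rotated]) (use Rc[THEN carrier_vecD] c in simp)
  qed
  then show "(\<lambda>\<omega>. g k \<omega> - R k (X k \<omega>) (Y k \<omega>)) \<in> N \<rightarrow>\<^sub>M vec_borel d" if k: "k < agents p"
    by (intro measurable_vecI minus_carrier_vec Rc measurable_vec_carrier[OF g[OF k]]) (use k in auto)
  show "merr X Y g \<in> N \<rightarrow>\<^sub>M vec_borel d"
  proof (rule measurable_vecI)
    fix c assume c: "c < d"
    have "(\<lambda>\<omega>. (\<Sum>k<agents p. (g k \<omega> - R k (X k \<omega>) (Y k \<omega>)) $ c) / real (agents p)) \<in> borel_measurable N"
      by (intro borel_measurable_divide borel_measurable_sum borel_measurable_const e c) simp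
    then show "(\<lambda>\<omega>. merr X Y g \<omega> $ c) \<in> borel_measurable N" using c by (simp add: merr_def)
  qed simp
qed

text \<open>Error recursions are proved for arbitrary weights \<open>w\<close> over the agents. The
  uniform weights of this lemma and the indicator weights of \<open>single_weights\<close> then
  yield the averaged error and the error of one agent from a single argument.\<close>

lemma mean_weights:
  assumes "\<And>k. k < agents p \<Longrightarrow> X k \<in> M \<rightarrow>\<^sub>M vec_borel (dimx p)"
    "\<And>k. k < agents p \<Longrightarrow> Y k \<in> M \<rightarrow>\<^sub>M vec_borel (dimy p)" "\<And>k. k < agents p \<Longrightarrow> g k \<in> M \<rightarrow>\<^sub>M vec_borel d"
  shows "(\<Sum>c<d. \<integral>\<^sup>+\<omega>. ennreal ((\<Sum>k<agents p. 1 / real (agents p) * (g k \<omega> - R k (X k \<omega>) (Y k \<omega>)) $ c)\<^sup>2) \<partial>M)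
     = (\<integral>\<^sup>+\<omega>. ennreal (sqn (merr X Y g \<omega>)) \<partial>M)"
proof -
  have "(\<integral>\<^sup>+\<omega>. ennreal (sqn (merr X Y g \<omega>)) \<partial>M) = (\<Sum>c<d. \<integral>\<^sup>+\<omega>. ennreal ((merr X Y g \<omega> $ c)\<^sup>2) \<partial>M)"
    by (rule nn_integral_sqn) (simp, rule measurable_vec_index[OF err_measurable(2)[where X = X and Y = Y]], use assms in auto)
  then show ?thesis by (simp add: merr_def sum_divide_distrib)
qed

lemma single_weights:
  assumes "\<And>k. k < agents p \<Longrightarrow> X k \<in> M \<rightarrow>\<^sub>M vec_borel (dimx p)"
    "\<And>k. k < agents p \<Longrightarrow> Y k \<in> M \<rightarrow>\<^sub>M vec_borel (dimy p)" "\<And>k. k < agents p \<Longrightarrow> g k \<in> M \<rightarrow>\<^sub>M vec_borel d"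
    and l: "l < agents p"
  shows "(\<Sum>c<d. \<integral>\<^sup>+\<omega>. ennreal ((\<Sum>k<agents p. (if k = l then 1 else 0) * (g k \<omega> - R k (X k \<omega>) (Y k \<omega>)) $ c)\<^sup>2) \<partial>M)
     = (\<integral>\<^sup>+\<omega>. ennreal (sqn (g l \<omega> - R l (X l \<omega>) (Y l \<omega>))) \<partial>M)"
proof -
  note m = err_measurable(1)[where X = X and Y = Y and g = g and N = M, OF assms(1-3) l]
  have "(\<integral>\<^sup>+\<omega>. ennreal (sqn (g l \<omega> - R l (X l \<omega>) (Y l \<omega>))) \<partial>M)
     = (\<Sum>c<d. \<integral>\<^sup>+\<omega>. ennreal (((g l \<omega> - R l (X l \<omega>) (Y l \<omega>)) $ c)\<^sup>2) \<partial>M)"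
    by (rule nn_integral_sqn) (auto intro: measurable_vec_carrier[OF m] measurable_vec_index[OF m])
  moreover have "(\<Sum>k<agents p. (if k = l then 1 else 0) * a k) = a l" for a :: "nat \<Rightarrow> real"
    using l by (simp add: if_distrib[where f = "\<lambda>x. x * _"] cong: if_cong)
  ultimately show ?thesis by simp
qed

context
  fixes I :: "source set" and i :: nat and X Y :: "nat \<Rightarrow> 'w \<Rightarrow> rvec" and \<sigma> :: real
  assumes I: "I \<subseteq> sources"
    and X: "\<And>k. k < agents p \<Longrightarrow> X k \<in> gen I \<rightarrow>\<^sub>M vec_borel (dimx p)"
    and Y: "\<And>k. k < agents p \<Longrightarrow> Y k \<in> gen I \<rightarrow>\<^sub>M vec_borel (dimy p)"
begin

text \<open>All samples of all agents are orthogonal given the past, so the squares of their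
  coefficients \<open>w k / b\<close> add up; summing \<open>b\<close> of them per agent leaves one
  factor \<open>1 / b\<close>.\<close>

lemma minibatch_error:
  assumes b: "0 < b" and fresh: "\<And>k j. k < agents p \<Longrightarrow> Sample k i j \<notin> I"
    and noise: "\<And>k j. k < agents p \<Longrightarrow>
      (\<integral>\<^sup>+\<omega>. ennreal (sqn (Q k (X k \<omega>) (Y k \<omega>) (\<xi> k i j \<omega>) - R k (X k \<omega>) (Y k \<omega>))) \<partial>M) \<le> ennreal (\<sigma>\<^sup>2)"
    and g: "\<And>k \<omega>. k < agents p \<Longrightarrow> \<omega> \<in> space M \<Longrightarrow> g k \<omega> = minibatch d b (\<lambda>j. Q k (X k \<omega>) (Y k \<omega>) (\<xi> k i j \<omega>))"
  shows "(\<Sum>c<d. \<integral>\<^sup>+\<omega>. ennreal ((\<Sum>k<agents p. w k * (g k \<omega> - R k (X k \<omega>) (Y k \<omega>)) $ c)\<^sup>2) \<partial>M)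
     \<le> (\<Sum>k<agents p. ennreal ((w k)\<^sup>2 * (\<sigma>\<^sup>2 / b)))"
proof -
  let ?K = "agents p"
  let ?S = "{..<?K} \<times> {..<b}"
  let ?n = "\<lambda>k j \<omega>. Q k (X k \<omega>) (Y k \<omega>) (\<xi> k i j \<omega>) - R k (X k \<omega>) (Y k \<omega>)"
  let ?h = "\<lambda>c r (z, s). w (fst r) / b * (Q (fst r) (fst z) (snd z) s - R (fst r) (fst z) (snd z)) $ c"
  have XM: "X k \<in> M \<rightarrow>\<^sub>M vec_borel (dimx p)" "Y k \<in> M \<rightarrow>\<^sub>M vec_borel (dimy p)" if "k < ?K" for k
    using measurable_gen_M[OF X[OF that] I] measurable_gen_M[OF Y[OF that] I] by auto
  have nc: "?n k j \<omega> \<in> carrier_vec d" for k j \<omega> using Qc Rc by auto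
  have ix: "(Q k x y s - R k x y) $ c = Q k x y s $ c - R k x y $ c" if "c < d" for k x y s c
    using that Rc[of k x y] by simp
  have nm: "(\<lambda>\<omega>. ?n k j \<omega> $ c) \<in> borel_measurable M" if "k < ?K" "c < d" for k j c
    unfolding ix[OF that(2)] using that
    by (intro borel_measurable_diff measurable_vec_index[OF Q_meas] measurable_vec_index[OF R_meas] XM xi_meas)
  have one: "(\<integral>\<^sup>+\<omega>. ennreal ((\<Sum>k<?K. w k * (g k \<omega> - R k (X k \<omega>) (Y k \<omega>)) $ c)\<^sup>2) \<partial>M)
     \<le> (\<Sum>k<?K. \<Sum>j<b. ennreal ((w k / b)\<^sup>2) * (\<integral>\<^sup>+\<omega>. ennreal ((?n k j \<omega> $ c)\<^sup>2) \<partial>M))" if c: "c < d" for c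
  proof -
    have "(\<integral>\<^sup>+\<omega>. ennreal ((\<Sum>k<?K. w k * (g k \<omega> - R k (X k \<omega>) (Y k \<omega>)) $ c)\<^sup>2) \<partial>M)
      = (\<integral>\<^sup>+\<omega>. ennreal ((0 + (\<Sum>r\<in>?S. ?h c r ((X (fst r) \<omega>, Y (fst r) \<omega>), \<xi> (fst r) i (snd r) \<omega>)))\<^sup>2) \<partial>M)"
    proof (rule nn_integral_cong)
      fix \<omega> assume w: "\<omega> \<in> space M"
      have "w k * (g k \<omega> - R k (X k \<omega>) (Y k \<omega>)) $ c = (\<Sum>j<b. w k / b * ?n k j \<omega> $ c)" if "k < ?K" for k
      proof -
        have "(g k \<omega> - R k (X k \<omega>) (Y k \<omega>)) $ c = (\<Sum>j<b. Q k (X k \<omega>) (Y k \<omega>) (\<xi> k i j \<omega>) $ c) / b - R k (X k \<omega>) (Y k \<omega>) $ c"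
          using c Rc[of k "X k \<omega>" "Y k \<omega>"] g[OF that w] by (simp add: minibatch_def)
        also have "\<dots> = (\<Sum>j<b. ?n k j \<omega> $ c) / b" unfolding ix[OF c] using b by (simp add: sum_subtractf diff_divide_distrib)
        finally show ?thesis by (simp add: sum_distrib_left sum_divide_distrib)
      qed
      then have "(\<Sum>k<?K. w k * (g k \<omega> - R k (X k \<omega>) (Y k \<omega>)) $ c) = (\<Sum>k<?K. \<Sum>j<b. w k / b * ?n k j \<omega> $ c)" by simp
      also have "\<dots> = (\<Sum>r\<in>?S. ?h c r ((X (fst r) \<omega>, Y (fst r) \<omega>), \<xi> (fst r) i (snd r) \<omega>))"
        unfolding sum.cartesian_product by (rule sum.cong) auto
      finally show "ennreal ((\<Sum>k<?K. w k * (g k \<omega> - R k (X k \<omega>) (Y k \<omega>)) $ c)\<^sup>2)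
        = ennreal ((0 + (\<Sum>r\<in>?S. ?h c r ((X (fst r) \<omega>, Y (fst r) \<omega>), \<xi> (fst r) i (snd r) \<omega>)))\<^sup>2)" by simp
    qed
    also have "\<dots> \<le> (\<integral>\<^sup>+\<omega>. ennreal (0\<^sup>2) \<partial>M)
       + (\<Sum>r\<in>?S. \<integral>\<^sup>+\<omega>. ennreal ((?h c r ((X (fst r) \<omega>, Y (fst r) \<omega>), \<xi> (fst r) i (snd r) \<omega>))\<^sup>2) \<partial>M)"
    proof (rule fresh_sum[OF I, where N = VV])
      fix r assume r: "r \<in> ?S"
      then have k: "fst r < ?K" by auto
      show "fst r < ?K" by (rule k)
      show "Sample (fst r) i (snd r) \<notin> I" using fresh k by auto
      show "(\<lambda>\<omega>. (X (fst r) \<omega>, Y (fst r) \<omega>)) \<in> gen I \<rightarrow>\<^sub>M VV" by (intro measurable_Pair X Y k)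
      have m: "(\<lambda>q. fst (fst q)) \<in> VV \<Otimes>\<^sub>M law p (fst r) \<rightarrow>\<^sub>M vec_borel (dimx p)"
        "(\<lambda>q. snd (fst q)) \<in> VV \<Otimes>\<^sub>M law p (fst r) \<rightarrow>\<^sub>M vec_borel (dimy p)"
        "(\<lambda>q. snd q) \<in> VV \<Otimes>\<^sub>M law p (fst r) \<rightarrow>\<^sub>M law p (fst r)" by measurable
      show "?h c r \<in> borel_measurable (VV \<Otimes>\<^sub>M law p (fst r))"
        unfolding case_prod_beta' ix[OF c]
        by (intro borel_measurable_times borel_measurable_const borel_measurable_diff
            measurable_vec_index[OF Q_meas] measurable_vec_index[OF R_meas] k c m)
      fix u assume "u \<in> space VV"
      then have u: "fst u \<in> Xs p" "snd u \<in> Ys p" by (auto simp: space_pair_measure)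
      interpret law: prob_space "law p (fst r)" by (rule law_prob[OF k])
      have "has_bochner_integral (law p (fst r)) (\<lambda>s. w (fst r) / b * (Q (fst r) (fst u) (snd u) s - R (fst r) (fst u) (snd u)) $ c)
         (w (fst r) / b * (R (fst r) (fst u) (snd u) $ c - R (fst r) (fst u) (snd u) $ c))"
        unfolding ix[OF c]
        by (intro has_bochner_integral_mult_right has_bochner_integral_diff Qb k u c)
           (simp add: has_bochner_integral_iff law.prob_space)
      then show "(\<integral>s. ?h c r (u, s) \<partial>law p (fst r)) = 0" by (simp add: has_bochner_integral_iff)
    qed auto
    also have "\<dots> = (\<Sum>r\<in>?S. ennreal ((w (fst r) / b)\<^sup>2) * (\<integral>\<^sup>+\<omega>. ennreal ((?n (fst r) (snd r) \<omega> $ c)\<^sup>2) \<partial>M))"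
    proof -
      have "(\<integral>\<^sup>+\<omega>. ennreal ((?h c r ((X (fst r) \<omega>, Y (fst r) \<omega>), \<xi> (fst r) i (snd r) \<omega>))\<^sup>2) \<partial>M)
         = ennreal ((w (fst r) / b)\<^sup>2) * (\<integral>\<^sup>+\<omega>. ennreal ((?n (fst r) (snd r) \<omega> $ c)\<^sup>2) \<partial>M)" if "r \<in> ?S" for r
      proof -
        have "(\<integral>\<^sup>+\<omega>. ennreal ((?h c r ((X (fst r) \<omega>, Y (fst r) \<omega>), \<xi> (fst r) i (snd r) \<omega>))\<^sup>2) \<partial>M)
          = (\<integral>\<^sup>+\<omega>. ennreal ((w (fst r) / b)\<^sup>2) * ennreal ((?n (fst r) (snd r) \<omega> $ c)\<^sup>2) \<partial>M)"
          by (simp add: power_mult_distrib ennreal_mult del: times_divide_eq_left)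
        also have "\<dots> = ennreal ((w (fst r) / b)\<^sup>2) * (\<integral>\<^sup>+\<omega>. ennreal ((?n (fst r) (snd r) \<omega> $ c)\<^sup>2) \<partial>M)"
          using that c by (intro nn_integral_cmult measurable_compose[OF _ measurable_ennreal] borel_measurable_power nm) auto
        finally show ?thesis .
      qed
      then show ?thesis by simp
    qed
    also have "\<dots> = (\<Sum>k<?K. \<Sum>j<b. ennreal ((w k / b)\<^sup>2) * (\<integral>\<^sup>+\<omega>. ennreal ((?n k j \<omega> $ c)\<^sup>2) \<partial>M))"
      unfolding sum.cartesian_product by (rule sum.cong) auto
    finally show ?thesis .
  qed
  have "(\<Sum>c<d. \<integral>\<^sup>+\<omega>. ennreal ((\<Sum>k<?K. w k * (g k \<omega> - R k (X k \<omega>) (Y k \<omega>)) $ c)\<^sup>2) \<partial>M)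
     \<le> (\<Sum>c<d. \<Sum>k<?K. \<Sum>j<b. ennreal ((w k / b)\<^sup>2) * (\<integral>\<^sup>+\<omega>. ennreal ((?n k j \<omega> $ c)\<^sup>2) \<partial>M))"
    by (intro sum_mono one) simp
  also have "\<dots> = (\<Sum>k<?K. \<Sum>j<b. \<Sum>c<d. ennreal ((w k / b)\<^sup>2) * (\<integral>\<^sup>+\<omega>. ennreal ((?n k j \<omega> $ c)\<^sup>2) \<partial>M))"
    unfolding sum.swap[of _ "{..<d}"] ..
  also have "\<dots> = (\<Sum>k<?K. \<Sum>j<b. ennreal ((w k / b)\<^sup>2) * (\<integral>\<^sup>+\<omega>. ennreal (sqn (?n k j \<omega>)) \<partial>M))"
    unfolding sum_distrib_left[symmetric] by (intro sum.cong refl) (subst nn_integral_sqn[OF nc nm], auto)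
  also have "\<dots> \<le> (\<Sum>k<?K. \<Sum>j<b. ennreal ((w k / b)\<^sup>2) * ennreal (\<sigma>\<^sup>2))"
    by (intro sum_mono mult_left_mono noise) auto
  also have "\<dots> = (\<Sum>k<?K. ennreal ((w k)\<^sup>2 * (\<sigma>\<^sup>2 / b)))"
  proof (rule sum.cong[OF refl])
    fix k
    have "(\<Sum>j<b. ennreal ((w k / b)\<^sup>2) * ennreal (\<sigma>\<^sup>2)) = (\<Sum>j<b. ennreal ((w k / b)\<^sup>2 * \<sigma>\<^sup>2))"
      by (simp add: ennreal_mult)
    also have "\<dots> = ennreal (\<Sum>j<b. (w k / b)\<^sup>2 * \<sigma>\<^sup>2)" by (rule sum_ennreal) simp
    also have "(\<Sum>j<b. (w k / b)\<^sup>2 * \<sigma>\<^sup>2) = (w k)\<^sup>2 * (\<sigma>\<^sup>2 / b)"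
      using b by (simp add: power_divide power2_eq_square)
    finally show "(\<Sum>j<b. ennreal ((w k / b)\<^sup>2) * ennreal (\<sigma>\<^sup>2)) = ennreal ((w k)\<^sup>2 * (\<sigma>\<^sup>2 / b))" .
  qed
  finally show ?thesis .
qed

lemma minibatch_error_bounds:
  assumes b: "0 < b" and fresh: "\<And>k j. k < agents p \<Longrightarrow> Sample k i j \<notin> I"
    and noise: "\<And>k j. k < agents p \<Longrightarrow>
      (\<integral>\<^sup>+\<omega>. ennreal (sqn (Q k (X k \<omega>) (Y k \<omega>) (\<xi> k i j \<omega>) - R k (X k \<omega>) (Y k \<omega>))) \<partial>M) \<le> ennreal (\<sigma>\<^sup>2)"
    and g: "\<And>k \<omega>. k < agents p \<Longrightarrow> \<omega> \<in> space M \<Longrightarrow> g k \<omega> = minibatch d b (\<lambda>j. Q k (X k \<omega>) (Y k \<omega>) (\<xi> k i j \<omega>))"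
    and gm: "\<And>k. k < agents p \<Longrightarrow> g k \<in> M \<rightarrow>\<^sub>M vec_borel d"
  shows "(\<integral>\<^sup>+\<omega>. ennreal (sqn (merr X Y g \<omega>)) \<partial>M) \<le> ennreal (\<sigma>\<^sup>2 / (b * real (agents p)))"
    and "k < agents p \<Longrightarrow> (\<integral>\<^sup>+\<omega>. ennreal (sqn (g k \<omega> - R k (X k \<omega>) (Y k \<omega>))) \<partial>M) \<le> ennreal (\<sigma>\<^sup>2 / b)"
proof -
  have XM: "\<And>k. k < agents p \<Longrightarrow> X k \<in> M \<rightarrow>\<^sub>M vec_borel (dimx p)" and YM: "\<And>k. k < agents p \<Longrightarrow> Y k \<in> M \<rightarrow>\<^sub>M vec_borel (dimy p)"
    by (intro measurable_gen_M[OF X I] measurable_gen_M[OF Y I]; assumption)+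
  note E = minibatch_error[OF b fresh noise g]
  have e1: "(\<Sum>c<d. \<integral>\<^sup>+\<omega>. ennreal ((\<Sum>l<agents p. 1 / real (agents p) * (g l \<omega> - R l (X l \<omega>) (Y l \<omega>)) $ c)\<^sup>2) \<partial>M) = (\<integral>\<^sup>+\<omega>. ennreal (sqn (merr X Y g \<omega>)) \<partial>M)" by (rule mean_weights[OF XM YM gm])
  have "(\<integral>\<^sup>+\<omega>. ennreal (sqn (merr X Y g \<omega>)) \<partial>M) \<le> (\<Sum>k<agents p. ennreal ((1 / real (agents p))\<^sup>2 * (\<sigma>\<^sup>2 / b)))"
    using E[of "\<lambda>_. 1 / real (agents p)"] unfolding e1 by simp
  also have "\<dots> = ennreal (\<Sum>k<agents p. (1 / real (agents p))\<^sup>2 * (\<sigma>\<^sup>2 / b))" by (rule sum_ennreal) simp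
  also have "(\<Sum>k<agents p. (1 / real (agents p))\<^sup>2 * (\<sigma>\<^sup>2 / b)) = \<sigma>\<^sup>2 / (b * real (agents p))"
    by (simp add: power2_eq_square)
  finally show "(\<integral>\<^sup>+\<omega>. ennreal (sqn (merr X Y g \<omega>)) \<partial>M) \<le> ennreal (\<sigma>\<^sup>2 / (b * real (agents p)))" .
  assume k: "k < agents p"
  have e2: "(\<Sum>c<d. \<integral>\<^sup>+\<omega>. ennreal ((\<Sum>l<agents p. (if l = k then 1 else 0) * (g l \<omega> - R l (X l \<omega>) (Y l \<omega>)) $ c)\<^sup>2) \<partial>M) = (\<integral>\<^sup>+\<omega>. ennreal (sqn (g k \<omega> - R k (X k \<omega>) (Y k \<omega>))) \<partial>M)" by (rule single_weights[OF XM YM gm k])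
  have "(\<integral>\<^sup>+\<omega>. ennreal (sqn (g k \<omega> - R k (X k \<omega>) (Y k \<omega>))) \<partial>M)
     \<le> (\<Sum>l<agents p. ennreal ((if l = k then 1 else 0)\<^sup>2 * (\<sigma>\<^sup>2 / b)))"
    using E[of "\<lambda>l. if l = k then 1 else 0"] unfolding e2 by simp
  also have "\<dots> = (\<Sum>l<agents p. if l = k then ennreal (\<sigma>\<^sup>2 / b) else 0)" by (rule sum.cong) auto
  also have "\<dots> = ennreal (\<sigma>\<^sup>2 / b)" using k by simp
  finally show "(\<integral>\<^sup>+\<omega>. ennreal (sqn (g k \<omega> - R k (X k \<omega>) (Y k \<omega>))) \<partial>M) \<le> ennreal (\<sigma>\<^sup>2 / b)" .
qed

end

end

section \<open>STORM estimates\<close>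

context stoch_grad
begin

text \<open>One STORM update with a single sample per agent. Unprimed quantities belong to the
  previous iteration, primed ones to the current; \<open>I\<close> contains everything that
  determines both pairs of iterates and the old estimate, but not the sample about to be
  drawn.\<close>

context
  fixes I :: "source set" and i :: nat and X Y X' Y' g g' :: "nat \<Rightarrow> 'w \<Rightarrow> rvec" and \<sigma> \<beta> :: real
  assumes I: "I \<subseteq> sources"
    and X: "\<And>k. k < agents p \<Longrightarrow> X k \<in> gen I \<rightarrow>\<^sub>M vec_borel (dimx p)"
    and Y: "\<And>k. k < agents p \<Longrightarrow> Y k \<in> gen I \<rightarrow>\<^sub>M vec_borel (dimy p)"
    and X': "\<And>k. k < agents p \<Longrightarrow> X' k \<in> gen I \<rightarrow>\<^sub>M vec_borel (dimx p)"
    and Y': "\<And>k. k < agents p \<Longrightarrow> Y' k \<in> gen I \<rightarrow>\<^sub>M vec_borel (dimy p)"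
    and g: "\<And>k. k < agents p \<Longrightarrow> g k \<in> gen I \<rightarrow>\<^sub>M vec_borel d"
    and fresh: "\<And>k. k < agents p \<Longrightarrow> Sample k i 0 \<notin> I"
    and beta: "0 \<le> \<beta>" "\<beta> \<le> 1"
    and noise: "\<And>k. k < agents p \<Longrightarrow>
      (\<integral>\<^sup>+\<omega>. ennreal (sqn (Q k (X' k \<omega>) (Y' k \<omega>) (\<xi> k i 0 \<omega>) - R k (X' k \<omega>) (Y' k \<omega>))) \<partial>M) \<le> ennreal (\<sigma>\<^sup>2)"
    and step: "\<And>k \<omega>. k < agents p \<Longrightarrow> \<omega> \<in> space M \<Longrightarrow>
      g' k \<omega> = (1 - \<beta>) \<cdot>\<^sub>v (g k \<omega> - Q k (X k \<omega>) (Y k \<omega>) (\<xi> k i 0 \<omega>)) + Q k (X' k \<omega>) (Y' k \<omega>) (\<xi> k i 0 \<omega>)"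
begin

abbreviation "inc k \<omega> \<equiv> sqn (X' k \<omega> - X k \<omega>) + sqn (Y' k \<omega> - Y k \<omega>)"
abbreviation "dif k \<omega> \<equiv> Q k (X' k \<omega>) (Y' k \<omega>) (\<xi> k i 0 \<omega>) - Q k (X k \<omega>) (Y k \<omega>) (\<xi> k i 0 \<omega>)"
abbreviation "rdif k \<omega> \<equiv> R k (X' k \<omega>) (Y' k \<omega>) - R k (X k \<omega>) (Y k \<omega>)"
abbreviation "nse k \<omega> \<equiv> Q k (X' k \<omega>) (Y' k \<omega>) (\<xi> k i 0 \<omega>) - R k (X' k \<omega>) (Y' k \<omega>)"

lemma in_M: assumes "k < agents p"
  shows "X k \<in> M \<rightarrow>\<^sub>M vec_borel (dimx p)" "Y k \<in> M \<rightarrow>\<^sub>M vec_borel (dimy p)"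
    "X' k \<in> M \<rightarrow>\<^sub>M vec_borel (dimx p)" "Y' k \<in> M \<rightarrow>\<^sub>M vec_borel (dimy p)" "g k \<in> M \<rightarrow>\<^sub>M vec_borel d"
  by (intro measurable_gen_M[OF _ I] X Y X' Y' g assms)+

lemma in_carrier: assumes "k < agents p" "\<omega> \<in> space M"
  shows "X k \<omega> \<in> Xs p" "Y k \<omega> \<in> Ys p" "X' k \<omega> \<in> Xs p" "Y' k \<omega> \<in> Ys p"
  by (intro measurable_vec_carrier[OF _ assms(2)] in_M assms(1))+

lemma idx:
  assumes "c < d"
  shows "(Q k x y s - Q k x' y' s') $ c = Q k x y s $ c - Q k x' y' s' $ c"
    "(Q k x y s - R k x' y') $ c = Q k x y s $ c - R k x' y' $ c"
    "(R k x y - R k x' y') $ c = R k x y $ c - R k x' y' $ c"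
    "v \<in> carrier_vec d \<Longrightarrow> (v - R k x' y') $ c = v $ c - R k x' y' $ c"
    "(Q k x y s - Q k x' y' s' - (R k x y - R k x' y')) $ c = Q k x y s $ c - Q k x' y' s' $ c - (R k x y $ c - R k x' y' $ c)"
  using assms Qc[of k x' y' s'] Rc[of k x' y'] by auto

lemma comp_meas:
  assumes k: "k < agents p" and c: "c < d"
  shows "(\<lambda>\<omega>. dif k \<omega> $ c) \<in> borel_measurable M" "(\<lambda>\<omega>. rdif k \<omega> $ c) \<in> borel_measurable M"
    "(\<lambda>\<omega>. nse k \<omega> $ c) \<in> borel_measurable M" "(\<lambda>\<omega>. (g k \<omega> - R k (X k \<omega>) (Y k \<omega>)) $ c) \<in> borel_measurable M"
    "(\<lambda>\<omega>. (dif k \<omega> - rdif k \<omega>) $ c) \<in> borel_measurable M"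
proof -
  have q: "(\<lambda>\<omega>. Q k (X' k \<omega>) (Y' k \<omega>) (\<xi> k i 0 \<omega>) $ c) \<in> borel_measurable M"
    "(\<lambda>\<omega>. Q k (X k \<omega>) (Y k \<omega>) (\<xi> k i 0 \<omega>) $ c) \<in> borel_measurable M"
    "(\<lambda>\<omega>. R k (X' k \<omega>) (Y' k \<omega>) $ c) \<in> borel_measurable M" "(\<lambda>\<omega>. R k (X k \<omega>) (Y k \<omega>) $ c) \<in> borel_measurable M"
    by (intro measurable_vec_index[OF Q_meas] measurable_vec_index[OF R_meas] k c in_M xi_meas)+
  show "(\<lambda>\<omega>. dif k \<omega> $ c) \<in> borel_measurable M" "(\<lambda>\<omega>. rdif k \<omega> $ c) \<in> borel_measurable M"
    "(\<lambda>\<omega>. nse k \<omega> $ c) \<in> borel_measurable M" "(\<lambda>\<omega>. (dif k \<omega> - rdif k \<omega>) $ c) \<in> borel_measurable M"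
    unfolding idx[OF c] by (intro borel_measurable_diff q)+
  have "(\<lambda>\<omega>. g k \<omega> $ c - R k (X k \<omega>) (Y k \<omega>) $ c) \<in> borel_measurable M"
    by (intro borel_measurable_diff q measurable_vec_index[OF in_M(5)] k c)
  then show "(\<lambda>\<omega>. (g k \<omega> - R k (X k \<omega>) (Y k \<omega>)) $ c) \<in> borel_measurable M"
    by (rule measurable_cong[THEN iffD1, rotated]) (rule idx(4)[OF c measurable_vec_carrier[OF in_M(5)[OF k]], symmetric])
qed

lemma inc_meas: "k < agents p \<Longrightarrow> (\<lambda>\<omega>. inc k \<omega>) \<in> borel_measurable M"
proof (intro borel_measurable_add measurable_sqn measurable_vecI)
  fix \<omega> assume k: "k < agents p" and w: "\<omega> \<in> space M"
  show "X' k \<omega> - X k \<omega> \<in> carrier_vec (dimx p)" "Y' k \<omega> - Y k \<omega> \<in> carrier_vec (dimy p)"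
    by (intro minus_carrier_vec in_carrier k w)+
next
  fix j assume k: "k < agents p" and j: "j < dimx p"
  have "(\<lambda>\<omega>. X' k \<omega> $ j - X k \<omega> $ j) \<in> borel_measurable M"
    by (intro borel_measurable_diff measurable_vec_index[OF in_M(1)] measurable_vec_index[OF in_M(3)] k j)
  then show "(\<lambda>\<omega>. (X' k \<omega> - X k \<omega>) $ j) \<in> borel_measurable M"
    by (rule measurable_cong[THEN iffD1, rotated]) (metis carrier_vecD in_carrier(1) index_minus_vec(1) j k)
next
  fix j assume k: "k < agents p" and j: "j < dimy p"
  have "(\<lambda>\<omega>. Y' k \<omega> $ j - Y k \<omega> $ j) \<in> borel_measurable M"
    by (intro borel_measurable_diff measurable_vec_index[OF in_M(2)] measurable_vec_index[OF in_M(4)] k j)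
  then show "(\<lambda>\<omega>. (Y' k \<omega> - Y k \<omega>) $ j) \<in> borel_measurable M"
    by (rule measurable_cong[THEN iffD1, rotated]) (metis carrier_vecD in_carrier(2) index_minus_vec(1) j k)
qed

lemma quadruple_meas:
  assumes k: "k < agents p"
  shows "(\<lambda>\<omega>. ((X k \<omega>, Y k \<omega>), (X' k \<omega>, Y' k \<omega>))) \<in> gen I \<rightarrow>\<^sub>M VV \<Otimes>\<^sub>M VV"
  by (intro measurable_Pair X Y X' Y' k)

lemma proj_meas:
  "(\<lambda>q. fst (fst (fst q))) \<in> (VV \<Otimes>\<^sub>M VV) \<Otimes>\<^sub>M N \<rightarrow>\<^sub>M vec_borel (dimx p)"
  "(\<lambda>q. snd (fst (fst q))) \<in> (VV \<Otimes>\<^sub>M VV) \<Otimes>\<^sub>M N \<rightarrow>\<^sub>M vec_borel (dimy p)"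
  "(\<lambda>q. fst (snd (fst q))) \<in> (VV \<Otimes>\<^sub>M VV) \<Otimes>\<^sub>M N \<rightarrow>\<^sub>M vec_borel (dimx p)"
  "(\<lambda>q. snd (snd (fst q))) \<in> (VV \<Otimes>\<^sub>M VV) \<Otimes>\<^sub>M N \<rightarrow>\<^sub>M vec_borel (dimy p)"
  "(\<lambda>q. snd q) \<in> (VV \<Otimes>\<^sub>M VV) \<Otimes>\<^sub>M N \<rightarrow>\<^sub>M N"
  by measurable

text \<open>Both pairs of iterates are frozen together, since the same sample is evaluated at the
  old and at the new point; this coupling makes the difference small with the increment.\<close>

lemma dif_moments:
  assumes k: "k < agents p"
  shows "(\<integral>\<^sup>+\<omega>. ennreal (sqn (dif k \<omega> - rdif k \<omega>)) \<partial>M) \<le> ennreal (L\<^sup>2) * (\<integral>\<^sup>+\<omega>. ennreal (inc k \<omega>) \<partial>M)"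
    and "(\<integral>\<^sup>+\<omega>. ennreal (sqn (dif k \<omega>)) \<partial>M) \<le> ennreal (L\<^sup>2) * (\<integral>\<^sup>+\<omega>. ennreal (inc k \<omega>) \<partial>M)"
proof -
  let ?U = "\<lambda>\<omega>. ((X k \<omega>, Y k \<omega>), (X' k \<omega>, Y' k \<omega>))"
  let ?d = "\<lambda>q. Q k (fst (snd (fst q))) (snd (snd (fst q))) (snd q) - Q k (fst (fst (fst q))) (snd (fst (fst q))) (snd q)"
  let ?r = "\<lambda>q. R k (fst (snd (fst q))) (snd (snd (fst q))) - R k (fst (fst (fst q))) (snd (fst (fst q)))"
  have cq: "(\<lambda>q. Q k (fst (snd (fst q))) (snd (snd (fst q))) (snd q) $ c) \<in> borel_measurable ((VV \<Otimes>\<^sub>M VV) \<Otimes>\<^sub>M law p k)"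
    "(\<lambda>q. Q k (fst (fst (fst q))) (snd (fst (fst q))) (snd q) $ c) \<in> borel_measurable ((VV \<Otimes>\<^sub>M VV) \<Otimes>\<^sub>M law p k)"
    "(\<lambda>q. R k (fst (snd (fst q))) (snd (snd (fst q))) $ c) \<in> borel_measurable ((VV \<Otimes>\<^sub>M VV) \<Otimes>\<^sub>M law p k)"
    "(\<lambda>q. R k (fst (fst (fst q))) (snd (fst (fst q))) $ c) \<in> borel_measurable ((VV \<Otimes>\<^sub>M VV) \<Otimes>\<^sub>M law p k)" if "c < d" for c
    by (intro measurable_vec_index[OF Q_meas] measurable_vec_index[OF R_meas] k that proj_meas)+
  have m1: "?d \<in> (VV \<Otimes>\<^sub>M VV) \<Otimes>\<^sub>M law p k \<rightarrow>\<^sub>M vec_borel d"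
    by (rule measurable_vecI) (use Qc Rc cq in \<open>auto simp: idx\<close>)
  have m2: "(\<lambda>q. ?d q - ?r q) \<in> (VV \<Otimes>\<^sub>M VV) \<Otimes>\<^sub>M law p k \<rightarrow>\<^sub>M vec_borel d"
  proof (rule measurable_vecI)
    show "?d q - ?r q \<in> carrier_vec d" for q using Qc Rc by auto
    show "(\<lambda>q. (?d q - ?r q) $ c) \<in> borel_measurable ((VV \<Otimes>\<^sub>M VV) \<Otimes>\<^sub>M law p k)" if "c < d" for c
      unfolding idx[OF that] by (intro borel_measurable_diff cq that)
  qed
  have cv: "X k \<omega> \<in> Xs p" "Y k \<omega> \<in> Ys p" "X' k \<omega> \<in> Xs p" "Y' k \<omega> \<in> Ys p" if "\<omega> \<in> space M" for \<omega>
    using in_M(1-4)[OF k, THEN measurable_vec_carrier, OF that] by auto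
  have L2: "(\<integral>\<^sup>+\<omega>. ennreal (L\<^sup>2 * inc k \<omega>) \<partial>M) = ennreal (L\<^sup>2) * (\<integral>\<^sup>+\<omega>. ennreal (inc k \<omega>) \<partial>M)"
    unfolding ennreal_mult[OF zero_le_power2 add_nonneg_nonneg[OF sqn_nonneg sqn_nonneg]]
    by (intro nn_integral_cmult measurable_compose[OF inc_meas[OF k] measurable_ennreal])
  have "(\<integral>\<^sup>+\<omega>. ennreal (sqn (dif k \<omega> - rdif k \<omega>)) \<partial>M) = (\<integral>\<^sup>+\<omega>. (\<lambda>q. ennreal (sqn (?d q - ?r q))) (?U \<omega>, \<xi> k i 0 \<omega>) \<partial>M)"
    by simp
  also have "\<dots> = (\<integral>\<^sup>+\<omega>. \<integral>\<^sup>+s. (\<lambda>q. ennreal (sqn (?d q - ?r q))) (?U \<omega>, s) \<partial>law p k \<partial>M)"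
    by (rule fresh_nn_integral[OF I k fresh[OF k] quadruple_meas[OF k]])
       (intro measurable_compose[OF measurable_sqn[OF m2] measurable_ennreal])
  also have "\<dots> \<le> (\<integral>\<^sup>+\<omega>. ennreal (L\<^sup>2 * inc k \<omega>) \<partial>M)"
    by (intro nn_integral_mono) (simp add: noise_difference[OF k cv(3,4,1,2)])
  finally show "(\<integral>\<^sup>+\<omega>. ennreal (sqn (dif k \<omega> - rdif k \<omega>)) \<partial>M) \<le> ennreal (L\<^sup>2) * (\<integral>\<^sup>+\<omega>. ennreal (inc k \<omega>) \<partial>M)"
    unfolding L2 .
  have "(\<integral>\<^sup>+\<omega>. ennreal (sqn (dif k \<omega>)) \<partial>M) = (\<integral>\<^sup>+\<omega>. (\<lambda>q. ennreal (sqn (?d q))) (?U \<omega>, \<xi> k i 0 \<omega>) \<partial>M)"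
    by simp
  also have "\<dots> = (\<integral>\<^sup>+\<omega>. \<integral>\<^sup>+s. (\<lambda>q. ennreal (sqn (?d q))) (?U \<omega>, s) \<partial>law p k \<partial>M)"
    by (rule fresh_nn_integral[OF I k fresh[OF k] quadruple_meas[OF k]])
       (intro measurable_compose[OF measurable_sqn[OF m1] measurable_ennreal])
  also have "\<dots> \<le> (\<integral>\<^sup>+\<omega>. ennreal (L\<^sup>2 * inc k \<omega>) \<partial>M)"
    by (intro nn_integral_mono) (simp add: Ql[OF k cv(3,4,1,2)])
  finally show "(\<integral>\<^sup>+\<omega>. ennreal (sqn (dif k \<omega>)) \<partial>M) \<le> ennreal (L\<^sup>2) * (\<integral>\<^sup>+\<omega>. ennreal (inc k \<omega>) \<partial>M)"
    unfolding L2 .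
qed

lemma rdif_moment:
  assumes k: "k < agents p"
  shows "(\<integral>\<^sup>+\<omega>. ennreal (sqn (rdif k \<omega>)) \<partial>M) \<le> ennreal (L\<^sup>2) * (\<integral>\<^sup>+\<omega>. ennreal (inc k \<omega>) \<partial>M)"
proof -
  have cv: "X k \<omega> \<in> Xs p" "Y k \<omega> \<in> Ys p" "X' k \<omega> \<in> Xs p" "Y' k \<omega> \<in> Ys p" if "\<omega> \<in> space M" for \<omega>
    using in_M(1-4)[OF k, THEN measurable_vec_carrier, OF that] by auto
  have "(\<integral>\<^sup>+\<omega>. ennreal (sqn (rdif k \<omega>)) \<partial>M) \<le> (\<integral>\<^sup>+\<omega>. ennreal (L\<^sup>2) * ennreal (inc k \<omega>) \<partial>M)"
    unfolding ennreal_mult[OF zero_le_power2 add_nonneg_nonneg[OF sqn_nonneg sqn_nonneg], symmetric]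
    by (intro nn_integral_mono ennreal_leI R_lipschitz[OF k cv(3,4,1,2)])
  also have "\<dots> = ennreal (L\<^sup>2) * (\<integral>\<^sup>+\<omega>. ennreal (inc k \<omega>) \<partial>M)"
    by (intro nn_integral_cmult measurable_compose[OF inc_meas[OF k] measurable_ennreal])
  finally show ?thesis .
qed

text \<open>The new error is \<open>1 - \<beta>\<close> times the old error plus a fresh term of
  mean zero, namely \<open>(1 - \<beta>) * (dif - rdif) + \<beta> * nse\<close> for each agent.
  Orthogonality to the past gives the contraction by the square, and orthogonality across agents
  makes the weights of the fresh terms appear squared.\<close>

lemma storm_error:
  fixes w :: "nat \<Rightarrow> real"
  shows "(\<Sum>c<d. \<integral>\<^sup>+\<omega>. ennreal ((\<Sum>k<agents p. w k * (g' k \<omega> - R k (X' k \<omega>) (Y' k \<omega>)) $ c)\<^sup>2) \<partial>M)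
     \<le> ennreal ((1 - \<beta>)\<^sup>2) * (\<Sum>c<d. \<integral>\<^sup>+\<omega>. ennreal ((\<Sum>k<agents p. w k * (g k \<omega> - R k (X k \<omega>) (Y k \<omega>)) $ c)\<^sup>2) \<partial>M)
       + (\<Sum>k<agents p. ennreal ((w k)\<^sup>2) * (ennreal (2 * L\<^sup>2) * (\<integral>\<^sup>+\<omega>. ennreal (inc k \<omega>) \<partial>M) + ennreal (2 * \<beta>\<^sup>2 * \<sigma>\<^sup>2)))"
proof -
  let ?K = "agents p"
  \<comment> \<open>With batch size one the only fresh index of an agent is 0; the pairs match the
    format of \<open>fresh_sum\<close>.\<close>
  let ?S = "(\<lambda>k. (k, 0 :: nat)) ` {..<?K}"
  let ?e = "\<lambda>k \<omega>. g k \<omega> - R k (X k \<omega>) (Y k \<omega>)"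
  let ?h = "\<lambda>c r q. w (fst r) * ((1 - \<beta>) * (Q (fst r) (fst (snd (fst q))) (snd (snd (fst q))) (snd q)
      - Q (fst r) (fst (fst (fst q))) (snd (fst (fst q))) (snd q)
      - (R (fst r) (fst (snd (fst q))) (snd (snd (fst q))) - R (fst r) (fst (fst (fst q))) (snd (fst (fst q))))) $ c
      + \<beta> * (Q (fst r) (fst (snd (fst q))) (snd (snd (fst q))) (snd q) - R (fst r) (fst (snd (fst q))) (snd (snd (fst q)))) $ c)"
  let ?n = "\<lambda>k c \<omega>. (1 - \<beta>) * (dif k \<omega> - rdif k \<omega>) $ c + \<beta> * nse k \<omega> $ c"
  let ?U = "\<lambda>r \<omega>. ((X (fst r) \<omega>, Y (fst r) \<omega>), (X' (fst r) \<omega>, Y' (fst r) \<omega>))"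
  have inj: "inj_on (\<lambda>k. (k, 0::nat)) {..<?K}" by (auto simp: inj_on_def)
  have one: "(\<integral>\<^sup>+\<omega>. ennreal ((\<Sum>k<?K. w k * (g' k \<omega> - R k (X' k \<omega>) (Y' k \<omega>)) $ c)\<^sup>2) \<partial>M)
     \<le> ennreal ((1 - \<beta>)\<^sup>2) * (\<integral>\<^sup>+\<omega>. ennreal ((\<Sum>k<?K. w k * ?e k \<omega> $ c)\<^sup>2) \<partial>M)
      + (\<Sum>k<?K. ennreal ((w k)\<^sup>2) * (ennreal 2 * (\<integral>\<^sup>+\<omega>. ennreal (((dif k \<omega> - rdif k \<omega>) $ c)\<^sup>2) \<partial>M)
           + ennreal (2 * \<beta>\<^sup>2) * (\<integral>\<^sup>+\<omega>. ennreal ((nse k \<omega> $ c)\<^sup>2) \<partial>M)))" (is "?l \<le> _") if c: "c < d" for c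
  proof -
    have "?l = (\<integral>\<^sup>+\<omega>. ennreal (((\<Sum>k<?K. w k * ((1 - \<beta>) * ?e k \<omega> $ c)) + (\<Sum>r\<in>?S. ?h c r (?U r \<omega>, \<xi> (fst r) i (snd r) \<omega>)))\<^sup>2) \<partial>M)"
    proof (rule nn_integral_cong)
      fix \<omega> assume \<omega>: "\<omega> \<in> space M"
      have "w k * (g' k \<omega> - R k (X' k \<omega>) (Y' k \<omega>)) $ c = w k * ((1 - \<beta>) * ?e k \<omega> $ c) + w k * ?n k c \<omega>" if k: "k < ?K" for k
      proof -
        have gc: "g k \<omega> \<in> carrier_vec d" by (rule measurable_vec_carrier[OF in_M(5)[OF k] \<omega>])
        then have g'c: "g' k \<omega> \<in> carrier_vec d" and
          ge: "g' k \<omega> $ c = (1 - \<beta>) * (g k \<omega> $ c - Q k (X k \<omega>) (Y k \<omega>) (\<xi> k i 0 \<omega>) $ c) + Q k (X' k \<omega>) (Y' k \<omega>) (\<xi> k i 0 \<omega>) $ c"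
          unfolding step[OF k \<omega>] using c Qc[of k "X k \<omega>" "Y k \<omega>" "\<xi> k i 0 \<omega>"] Qc[of k "X' k \<omega>" "Y' k \<omega>" "\<xi> k i 0 \<omega>"] by auto
        show ?thesis unfolding idx(5)[OF c] idx(2)[OF c] idx(4)[OF c gc] idx(4)[OF c g'c] ge by (simp add: algebra_simps)
      qed
      then have "(\<Sum>k<?K. w k * (g' k \<omega> - R k (X' k \<omega>) (Y' k \<omega>)) $ c)
        = (\<Sum>k<?K. w k * ((1 - \<beta>) * ?e k \<omega> $ c)) + (\<Sum>k<?K. w k * ?n k c \<omega>)" by (simp add: sum.distrib[symmetric])
      also have "(\<Sum>k<?K. w k * ?n k c \<omega>) = (\<Sum>r\<in>?S. ?h c r (?U r \<omega>, \<xi> (fst r) i (snd r) \<omega>))"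
        unfolding sum.reindex[OF inj] by simp
      finally show "ennreal ((\<Sum>k<?K. w k * (g' k \<omega> - R k (X' k \<omega>) (Y' k \<omega>)) $ c)\<^sup>2)
        = ennreal (((\<Sum>k<?K. w k * ((1 - \<beta>) * ?e k \<omega> $ c)) + (\<Sum>r\<in>?S. ?h c r (?U r \<omega>, \<xi> (fst r) i (snd r) \<omega>)))\<^sup>2)" by simp
    qed
    also have "\<dots> \<le> (\<integral>\<^sup>+\<omega>. ennreal ((\<Sum>k<?K. w k * ((1 - \<beta>) * ?e k \<omega> $ c))\<^sup>2) \<partial>M)
       + (\<Sum>r\<in>?S. \<integral>\<^sup>+\<omega>. ennreal ((?h c r (?U r \<omega>, \<xi> (fst r) i (snd r) \<omega>))\<^sup>2) \<partial>M)"
    proof (rule fresh_sum[OF I, where N = "VV \<Otimes>\<^sub>M VV"])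
      have "(\<lambda>\<omega>. (g k \<omega> - R k (X k \<omega>) (Y k \<omega>)) $ c) \<in> borel_measurable (gen I)" if k: "k < ?K" for k
      proof -
        have "(\<lambda>\<omega>. g k \<omega> $ c - R k (X k \<omega>) (Y k \<omega>) $ c) \<in> borel_measurable (gen I)"
          by (intro borel_measurable_diff measurable_vec_index[OF g] measurable_vec_index[OF R_meas] k c X Y)
        then show ?thesis
          by (rule measurable_cong[THEN iffD1, rotated]) (rule idx(4)[OF c measurable_vec_carrier[OF g[OF k]], symmetric])
      qed
      then show "(\<lambda>\<omega>. \<Sum>k<?K. w k * ((1 - \<beta>) * ?e k \<omega> $ c)) \<in> borel_measurable (gen I)"
        by (intro borel_measurable_sum borel_measurable_times borel_measurable_const) simp
    next
      fix r assume r: "r \<in> ?S"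
      then have k: "fst r < ?K" and s0: "snd r = 0" by auto
      show "fst r < ?K" by (rule k)
      show "Sample (fst r) i (snd r) \<notin> I" using fresh[OF k] s0 by simp
      show "?U r \<in> gen I \<rightarrow>\<^sub>M VV \<Otimes>\<^sub>M VV" by (rule quadruple_meas[OF k])
      show "?h c r \<in> borel_measurable ((VV \<Otimes>\<^sub>M VV) \<Otimes>\<^sub>M law p (fst r))"
        unfolding idx[OF c]
        by (intro borel_measurable_times borel_measurable_const borel_measurable_diff borel_measurable_add
            measurable_vec_index[OF Q_meas] measurable_vec_index[OF R_meas] k c proj_meas)
      fix u assume "u \<in> space (VV \<Otimes>\<^sub>M VV)"
      then have u: "fst (fst u) \<in> Xs p" "snd (fst u) \<in> Ys p" "fst (snd u) \<in> Xs p" "snd (snd u) \<in> Ys p"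
        by (auto simp: space_pair_measure)
      interpret law: prob_space "law p (fst r)" by (rule law_prob[OF k])
      have cst: "has_bochner_integral (law p (fst r)) (\<lambda>s. a) a" for a :: real
        by (simp add: has_bochner_integral_iff law.prob_space)
      let ?r1 = "R (fst r) (fst (snd u)) (snd (snd u)) $ c" and ?r0 = "R (fst r) (fst (fst u)) (snd (fst u)) $ c"
      have "has_bochner_integral (law p (fst r)) (\<lambda>s. ?h c r (u, s))
         (w (fst r) * ((1 - \<beta>) * (?r1 - ?r0 - (?r1 - ?r0)) + \<beta> * (?r1 - ?r1)))"
        unfolding idx[OF c] fst_conv snd_conv
        by (intro has_bochner_integral_mult_right has_bochner_integral_diff has_bochner_integral_add Qb k u c cst)
      then show "(\<integral>s. ?h c r (u, s) \<partial>law p (fst r)) = 0" by (simp add: has_bochner_integral_iff)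
    qed auto
    also have "(\<Sum>r\<in>?S. \<integral>\<^sup>+\<omega>. ennreal ((?h c r (?U r \<omega>, \<xi> (fst r) i (snd r) \<omega>))\<^sup>2) \<partial>M)
       = (\<Sum>k<?K. \<integral>\<^sup>+\<omega>. ennreal ((w k * ?n k c \<omega>)\<^sup>2) \<partial>M)"
      unfolding sum.reindex[OF inj] by simp
    also have "(\<integral>\<^sup>+\<omega>. ennreal ((\<Sum>k<?K. w k * ((1 - \<beta>) * ?e k \<omega> $ c))\<^sup>2) \<partial>M)
       = (\<integral>\<^sup>+\<omega>. ennreal ((1 - \<beta>)\<^sup>2) * ennreal ((\<Sum>k<?K. w k * ?e k \<omega> $ c)\<^sup>2) \<partial>M)"
      by (simp add: ennreal_mult[symmetric] power_mult_distrib[symmetric] sum_distrib_left mult.left_commute)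
    also have "\<dots> = ennreal ((1 - \<beta>)\<^sup>2) * (\<integral>\<^sup>+\<omega>. ennreal ((\<Sum>k<?K. w k * ?e k \<omega> $ c)\<^sup>2) \<partial>M)"
      by (intro nn_integral_cmult measurable_compose[OF _ measurable_ennreal] borel_measurable_power
          borel_measurable_sum borel_measurable_times borel_measurable_const comp_meas c) auto
    also have "(\<Sum>k<?K. \<integral>\<^sup>+\<omega>. ennreal ((w k * ?n k c \<omega>)\<^sup>2) \<partial>M)
       \<le> (\<Sum>k<?K. ennreal ((w k)\<^sup>2) * (ennreal 2 * (\<integral>\<^sup>+\<omega>. ennreal (((dif k \<omega> - rdif k \<omega>) $ c)\<^sup>2) \<partial>M)
           + ennreal (2 * \<beta>\<^sup>2) * (\<integral>\<^sup>+\<omega>. ennreal ((nse k \<omega> $ c)\<^sup>2) \<partial>M)))"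
    proof (rule sum_mono)
      fix k assume "k \<in> {..<?K}"
      then have k: "k < ?K" by simp
      let ?a = "\<lambda>\<omega>. (dif k \<omega> - rdif k \<omega>) $ c" and ?b = "\<lambda>\<omega>. nse k \<omega> $ c"
      have "(w k * ?n k c \<omega>)\<^sup>2 \<le> (w k)\<^sup>2 * (2 * (?a \<omega>)\<^sup>2 + 2 * \<beta>\<^sup>2 * (?b \<omega>)\<^sup>2)" for \<omega>
      proof -
        have "(?n k c \<omega>)\<^sup>2 \<le> 2 * ((1 - \<beta>) * ?a \<omega>)\<^sup>2 + 2 * (\<beta> * ?b \<omega>)\<^sup>2" by (rule power2_sum2_le)
        also have "\<dots> = 2 * ((1 - \<beta>)\<^sup>2 * (?a \<omega>)\<^sup>2) + 2 * \<beta>\<^sup>2 * (?b \<omega>)\<^sup>2" by (simp add: power_mult_distrib)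
        also have "(1 - \<beta>)\<^sup>2 * (?a \<omega>)\<^sup>2 \<le> 1 * (?a \<omega>)\<^sup>2" using beta by (intro mult_right_mono power_le_one) auto
        finally show ?thesis unfolding power_mult_distrib[of "w k"] by (intro mult_left_mono) auto
      qed
      then have "(\<integral>\<^sup>+\<omega>. ennreal ((w k * ?n k c \<omega>)\<^sup>2) \<partial>M) \<le> (\<integral>\<^sup>+\<omega>. ennreal ((w k)\<^sup>2 * (2 * (?a \<omega>)\<^sup>2 + 2 * \<beta>\<^sup>2 * (?b \<omega>)\<^sup>2)) \<partial>M)"
        by (intro nn_integral_mono ennreal_leI)
      also have "\<dots> = (\<integral>\<^sup>+\<omega>. ennreal ((w k)\<^sup>2) * (ennreal 2 * ennreal ((?a \<omega>)\<^sup>2) + ennreal (2 * \<beta>\<^sup>2) * ennreal ((?b \<omega>)\<^sup>2)) \<partial>M)"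
        by (simp only: ennreal_mult[symmetric] ennreal_plus[symmetric] zero_le_power2 mult_nonneg_nonneg add_nonneg_nonneg zero_le_numeral)
      also have "\<dots> = ennreal ((w k)\<^sup>2) * (ennreal 2 * (\<integral>\<^sup>+\<omega>. ennreal ((?a \<omega>)\<^sup>2) \<partial>M) + ennreal (2 * \<beta>\<^sup>2) * (\<integral>\<^sup>+\<omega>. ennreal ((?b \<omega>)\<^sup>2) \<partial>M))"
      proof -
        have m: "(\<lambda>\<omega>. ennreal ((?a \<omega>)\<^sup>2)) \<in> borel_measurable M" "(\<lambda>\<omega>. ennreal ((?b \<omega>)\<^sup>2)) \<in> borel_measurable M"
          using comp_meas(5)[OF k c] comp_meas(3)[OF k c] by measurable
        then show ?thesis by (simp add: nn_integral_cmult nn_integral_add)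
      qed
      finally show "(\<integral>\<^sup>+\<omega>. ennreal ((w k * ?n k c \<omega>)\<^sup>2) \<partial>M)
        \<le> ennreal ((w k)\<^sup>2) * (ennreal 2 * (\<integral>\<^sup>+\<omega>. ennreal ((?a \<omega>)\<^sup>2) \<partial>M) + ennreal (2 * \<beta>\<^sup>2) * (\<integral>\<^sup>+\<omega>. ennreal ((?b \<omega>)\<^sup>2) \<partial>M))" .
    qed
    finally show ?thesis by (simp add: add_left_mono)
  qed
  have dc: "dif k \<omega> - rdif k \<omega> \<in> carrier_vec d" "nse k \<omega> \<in> carrier_vec d" for k \<omega> using Qc Rc by auto
  have "(\<Sum>c<d. \<integral>\<^sup>+\<omega>. ennreal ((\<Sum>k<?K. w k * (g' k \<omega> - R k (X' k \<omega>) (Y' k \<omega>)) $ c)\<^sup>2) \<partial>M)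
     \<le> (\<Sum>c<d. ennreal ((1 - \<beta>)\<^sup>2) * (\<integral>\<^sup>+\<omega>. ennreal ((\<Sum>k<?K. w k * ?e k \<omega> $ c)\<^sup>2) \<partial>M)
      + (\<Sum>k<?K. ennreal ((w k)\<^sup>2) * (ennreal 2 * (\<integral>\<^sup>+\<omega>. ennreal (((dif k \<omega> - rdif k \<omega>) $ c)\<^sup>2) \<partial>M)
           + ennreal (2 * \<beta>\<^sup>2) * (\<integral>\<^sup>+\<omega>. ennreal ((nse k \<omega> $ c)\<^sup>2) \<partial>M))))"
    by (intro sum_mono one) simp
  also have "\<dots> = ennreal ((1 - \<beta>)\<^sup>2) * (\<Sum>c<d. \<integral>\<^sup>+\<omega>. ennreal ((\<Sum>k<?K. w k * ?e k \<omega> $ c)\<^sup>2) \<partial>M)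
     + (\<Sum>k<?K. \<Sum>c<d. ennreal ((w k)\<^sup>2) * (ennreal 2 * (\<integral>\<^sup>+\<omega>. ennreal (((dif k \<omega> - rdif k \<omega>) $ c)\<^sup>2) \<partial>M)
           + ennreal (2 * \<beta>\<^sup>2) * (\<integral>\<^sup>+\<omega>. ennreal ((nse k \<omega> $ c)\<^sup>2) \<partial>M)))"
    by (subst sum.swap) (simp add: sum.distrib sum_distrib_left)
  also have "(\<Sum>k<?K. \<Sum>c<d. ennreal ((w k)\<^sup>2) * (ennreal 2 * (\<integral>\<^sup>+\<omega>. ennreal (((dif k \<omega> - rdif k \<omega>) $ c)\<^sup>2) \<partial>M)
           + ennreal (2 * \<beta>\<^sup>2) * (\<integral>\<^sup>+\<omega>. ennreal ((nse k \<omega> $ c)\<^sup>2) \<partial>M)))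
     = (\<Sum>k<?K. ennreal ((w k)\<^sup>2) * (ennreal 2 * (\<integral>\<^sup>+\<omega>. ennreal (sqn (dif k \<omega> - rdif k \<omega>)) \<partial>M)
           + ennreal (2 * \<beta>\<^sup>2) * (\<integral>\<^sup>+\<omega>. ennreal (sqn (nse k \<omega>)) \<partial>M)))"
  proof (rule sum.cong[OF refl])
    fix k assume "k \<in> {..<?K}"
    then have k: "k < ?K" by simp
    show "(\<Sum>c<d. ennreal ((w k)\<^sup>2) * (ennreal 2 * (\<integral>\<^sup>+\<omega>. ennreal (((dif k \<omega> - rdif k \<omega>) $ c)\<^sup>2) \<partial>M)
           + ennreal (2 * \<beta>\<^sup>2) * (\<integral>\<^sup>+\<omega>. ennreal ((nse k \<omega> $ c)\<^sup>2) \<partial>M)))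
      = ennreal ((w k)\<^sup>2) * (ennreal 2 * (\<integral>\<^sup>+\<omega>. ennreal (sqn (dif k \<omega> - rdif k \<omega>)) \<partial>M)
           + ennreal (2 * \<beta>\<^sup>2) * (\<integral>\<^sup>+\<omega>. ennreal (sqn (nse k \<omega>)) \<partial>M))"
    proof -
      have e: "(\<integral>\<^sup>+\<omega>. ennreal (sqn (dif k \<omega> - rdif k \<omega>)) \<partial>M) = (\<Sum>c<d. \<integral>\<^sup>+\<omega>. ennreal (((dif k \<omega> - rdif k \<omega>) $ c)\<^sup>2) \<partial>M)"
        "(\<integral>\<^sup>+\<omega>. ennreal (sqn (nse k \<omega>)) \<partial>M) = (\<Sum>c<d. \<integral>\<^sup>+\<omega>. ennreal ((nse k \<omega> $ c)\<^sup>2) \<partial>M)"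
        by (rule nn_integral_sqn[OF dc(1) comp_meas(5)[OF k]], assumption)
           (rule nn_integral_sqn[OF dc(2) comp_meas(3)[OF k]], assumption)
      show ?thesis unfolding e by (simp add: sum_distrib_left sum.distrib distrib_left)
    qed
  qed
  also have "\<dots> \<le> (\<Sum>k<?K. ennreal ((w k)\<^sup>2) * (ennreal 2 * (ennreal (L\<^sup>2) * (\<integral>\<^sup>+\<omega>. ennreal (inc k \<omega>) \<partial>M))
           + ennreal (2 * \<beta>\<^sup>2) * ennreal (\<sigma>\<^sup>2)))"
    by (intro sum_mono mult_left_mono add_mono dif_moments(1) noise) auto
  also have "\<dots> = (\<Sum>k<?K. ennreal ((w k)\<^sup>2) * (ennreal (2 * L\<^sup>2) * (\<integral>\<^sup>+\<omega>. ennreal (inc k \<omega>) \<partial>M) + ennreal (2 * \<beta>\<^sup>2 * \<sigma>\<^sup>2)))"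
    by (simp add: ennreal_mult mult.assoc)
  finally show ?thesis by (simp add: add_left_mono)
qed

text \<open>The change of the estimate is \<open>- \<beta>\<close> times the old error plus
  \<open>(1 - \<beta>) * dif + \<beta> * nse + \<beta> * rdif\<close>. The four squares are bounded
  separately; the two differences share the increment and together give the factor 8. This drift is
  what disturbs the consensus dynamics.\<close>

lemma storm_drift:
  assumes k: "k < agents p"
  shows "(\<integral>\<^sup>+\<omega>. ennreal (sqn (g' k \<omega> - g k \<omega>)) \<partial>M)
     \<le> ennreal (4 * \<beta>\<^sup>2) * (\<integral>\<^sup>+\<omega>. ennreal (sqn (g k \<omega> - R k (X k \<omega>) (Y k \<omega>))) \<partial>M)
       + ennreal (8 * L\<^sup>2) * (\<integral>\<^sup>+\<omega>. ennreal (inc k \<omega>) \<partial>M) + ennreal (4 * \<beta>\<^sup>2 * \<sigma>\<^sup>2)"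
proof -
  let ?e = "\<lambda>\<omega>. g k \<omega> - R k (X k \<omega>) (Y k \<omega>)"
  have dc: "dif k \<omega> \<in> carrier_vec d" "nse k \<omega> \<in> carrier_vec d" "rdif k \<omega> \<in> carrier_vec d" for \<omega> using Qc Rc by auto
  have ec: "?e \<omega> \<in> carrier_vec d" if "\<omega> \<in> space M" for \<omega>
    by (intro minus_carrier_vec Rc measurable_vec_carrier[OF in_M(5)[OF k] that])
  have sm: "(\<lambda>\<omega>. ennreal (sqn (?e \<omega>))) \<in> borel_measurable M" "(\<lambda>\<omega>. ennreal (sqn (dif k \<omega>))) \<in> borel_measurable M"
    "(\<lambda>\<omega>. ennreal (sqn (nse k \<omega>))) \<in> borel_measurable M" "(\<lambda>\<omega>. ennreal (sqn (rdif k \<omega>))) \<in> borel_measurable M"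
    by (rule measurable_compose[OF measurable_sqn[OF measurable_vecI[where d = d]] measurable_ennreal];
        (rule ec comp_meas[OF k] dc; assumption?))+
  have pt: "sqn (g' k \<omega> - g k \<omega>) \<le> 4 * \<beta>\<^sup>2 * sqn (?e \<omega>) + 4 * sqn (dif k \<omega>) + 4 * \<beta>\<^sup>2 * sqn (nse k \<omega>) + 4 * sqn (rdif k \<omega>)"
    if \<omega>: "\<omega> \<in> space M" for \<omega>
  proof -
    have gc: "g k \<omega> \<in> carrier_vec d" by (rule measurable_vec_carrier[OF in_M(5)[OF k] \<omega>])
    have g'c: "g' k \<omega> \<in> carrier_vec d" unfolding step[OF k \<omega>] using gc Qc by auto
    have cw: "((g' k \<omega> - g k \<omega>) $ c)\<^sup>2 \<le> 4 * \<beta>\<^sup>2 * (?e \<omega> $ c)\<^sup>2 + 4 * (dif k \<omega> $ c)\<^sup>2 + 4 * \<beta>\<^sup>2 * (nse k \<omega> $ c)\<^sup>2 + 4 * (rdif k \<omega> $ c)\<^sup>2"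
      if c: "c < d" for c
    proof -
      have "g' k \<omega> $ c = (1 - \<beta>) * (g k \<omega> $ c - Q k (X k \<omega>) (Y k \<omega>) (\<xi> k i 0 \<omega>) $ c) + Q k (X' k \<omega>) (Y' k \<omega>) (\<xi> k i 0 \<omega>) $ c"
        unfolding step[OF k \<omega>] using gc c Qc[of k "X k \<omega>" "Y k \<omega>" "\<xi> k i 0 \<omega>"] Qc[of k "X' k \<omega>" "Y' k \<omega>" "\<xi> k i 0 \<omega>"] by auto
      then have "(g' k \<omega> - g k \<omega>) $ c = (- \<beta> * ?e \<omega> $ c) + ((1 - \<beta>) * dif k \<omega> $ c) + \<beta> * nse k \<omega> $ c + \<beta> * rdif k \<omega> $ c"
        using gc c unfolding idx[OF c] idx(4)[OF c gc] by (simp add: algebra_simps)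
      then have "((g' k \<omega> - g k \<omega>) $ c)\<^sup>2 \<le> 4 * ((- \<beta> * ?e \<omega> $ c)\<^sup>2 + ((1 - \<beta>) * dif k \<omega> $ c)\<^sup>2 + (\<beta> * nse k \<omega> $ c)\<^sup>2 + (\<beta> * rdif k \<omega> $ c)\<^sup>2)"
        by (simp only: power2_sum4_le)
      also have "\<dots> = 4 * \<beta>\<^sup>2 * (?e \<omega> $ c)\<^sup>2 + 4 * ((1 - \<beta>)\<^sup>2 * (dif k \<omega> $ c)\<^sup>2) + 4 * \<beta>\<^sup>2 * (nse k \<omega> $ c)\<^sup>2 + 4 * (\<beta>\<^sup>2 * (rdif k \<omega> $ c)\<^sup>2)"
        by (simp add: power_mult_distrib distrib_left)
      also have "\<dots> \<le> 4 * \<beta>\<^sup>2 * (?e \<omega> $ c)\<^sup>2 + 4 * (1 * (dif k \<omega> $ c)\<^sup>2) + 4 * \<beta>\<^sup>2 * (nse k \<omega> $ c)\<^sup>2 + 4 * (1 * (rdif k \<omega> $ c)\<^sup>2)"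
        using beta by (intro add_mono mult_left_mono mult_right_mono order_refl power_le_one) auto
      finally show ?thesis by simp
    qed
    have "sqn (g' k \<omega> - g k \<omega>) = (\<Sum>c<d. ((g' k \<omega> - g k \<omega>) $ c)\<^sup>2)" by (rule sqn_carrier[OF minus_carrier_vec[OF g'c gc]])
    also have "\<dots> \<le> (\<Sum>c<d. 4 * \<beta>\<^sup>2 * (?e \<omega> $ c)\<^sup>2 + 4 * (dif k \<omega> $ c)\<^sup>2 + 4 * \<beta>\<^sup>2 * (nse k \<omega> $ c)\<^sup>2 + 4 * (rdif k \<omega> $ c)\<^sup>2)"
      by (intro sum_mono cw) simp
    also have "\<dots> = 4 * \<beta>\<^sup>2 * sqn (?e \<omega>) + 4 * sqn (dif k \<omega>) + 4 * \<beta>\<^sup>2 * sqn (nse k \<omega>) + 4 * sqn (rdif k \<omega>)"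
      unfolding sqn_carrier[OF ec[OF \<omega>]] sqn_carrier[OF dc(1)] sqn_carrier[OF dc(2)] sqn_carrier[OF dc(3)] sum.distrib sum_distrib_left ..
    finally show ?thesis .
  qed
  have "(\<integral>\<^sup>+\<omega>. ennreal (sqn (g' k \<omega> - g k \<omega>)) \<partial>M)
     \<le> (\<integral>\<^sup>+\<omega>. ennreal (4 * \<beta>\<^sup>2 * sqn (?e \<omega>) + 4 * sqn (dif k \<omega>) + 4 * \<beta>\<^sup>2 * sqn (nse k \<omega>) + 4 * sqn (rdif k \<omega>)) \<partial>M)"
    by (intro nn_integral_mono ennreal_leI pt)
  also have "\<dots> = (\<integral>\<^sup>+\<omega>. ennreal (4 * \<beta>\<^sup>2) * ennreal (sqn (?e \<omega>)) + ennreal 4 * ennreal (sqn (dif k \<omega>))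
      + ennreal (4 * \<beta>\<^sup>2) * ennreal (sqn (nse k \<omega>)) + ennreal 4 * ennreal (sqn (rdif k \<omega>)) \<partial>M)"
    by (simp only: ennreal_mult[symmetric] ennreal_plus[symmetric] zero_le_power2 mult_nonneg_nonneg add_nonneg_nonneg zero_le_numeral sqn_nonneg)
  also have "\<dots> = ennreal (4 * \<beta>\<^sup>2) * (\<integral>\<^sup>+\<omega>. ennreal (sqn (?e \<omega>)) \<partial>M) + ennreal 4 * (\<integral>\<^sup>+\<omega>. ennreal (sqn (dif k \<omega>)) \<partial>M)
      + ennreal (4 * \<beta>\<^sup>2) * (\<integral>\<^sup>+\<omega>. ennreal (sqn (nse k \<omega>)) \<partial>M) + ennreal 4 * (\<integral>\<^sup>+\<omega>. ennreal (sqn (rdif k \<omega>)) \<partial>M)"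
    using sm by (simp add: nn_integral_cmult nn_integral_add)
  also have "\<dots> \<le> ennreal (4 * \<beta>\<^sup>2) * (\<integral>\<^sup>+\<omega>. ennreal (sqn (?e \<omega>)) \<partial>M)
      + ennreal 4 * (ennreal (L\<^sup>2) * (\<integral>\<^sup>+\<omega>. ennreal (inc k \<omega>) \<partial>M))
      + ennreal (4 * \<beta>\<^sup>2) * ennreal (\<sigma>\<^sup>2) + ennreal 4 * (ennreal (L\<^sup>2) * (\<integral>\<^sup>+\<omega>. ennreal (inc k \<omega>) \<partial>M))"
    by (intro add_mono mult_left_mono order_refl dif_moments(2) rdif_moment noise k) auto
  also have "\<dots> = ennreal (4 * \<beta>\<^sup>2) * (\<integral>\<^sup>+\<omega>. ennreal (sqn (?e \<omega>)) \<partial>M)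
     + (ennreal (4 * L\<^sup>2) + ennreal (4 * L\<^sup>2)) * (\<integral>\<^sup>+\<omega>. ennreal (inc k \<omega>) \<partial>M) + ennreal (4 * \<beta>\<^sup>2 * \<sigma>\<^sup>2)"
    by (simp add: ennreal_mult mult.assoc distrib_right add_ac)
  also have "ennreal (4 * L\<^sup>2) + ennreal (4 * L\<^sup>2) = ennreal (8 * L\<^sup>2)" by (simp add: ennreal_plus[symmetric] del: ennreal_plus)
  finally show ?thesis .
qed

text \<open>The two choices of weights differ by what independence buys: \<open>1 / K\<close> in the
  noise and \<open>1 / K^2\<close> before the sum of increments.\<close>

lemma storm_error_bounds:
  assumes g'm: "\<And>k. k < agents p \<Longrightarrow> g' k \<in> M \<rightarrow>\<^sub>M vec_borel d"
  shows "(\<integral>\<^sup>+\<omega>. ennreal (sqn (merr X' Y' g' \<omega>)) \<partial>M) \<le> ennreal ((1 - \<beta>)\<^sup>2) * (\<integral>\<^sup>+\<omega>. ennreal (sqn (merr X Y g \<omega>)) \<partial>M)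
      + ennreal (2 * L\<^sup>2 / (real (agents p))\<^sup>2) * (\<Sum>k<agents p. \<integral>\<^sup>+\<omega>. ennreal (inc k \<omega>) \<partial>M) + ennreal (2 * \<beta>\<^sup>2 * \<sigma>\<^sup>2 / real (agents p))"
    and "k < agents p \<Longrightarrow> (\<integral>\<^sup>+\<omega>. ennreal (sqn (g' k \<omega> - R k (X' k \<omega>) (Y' k \<omega>))) \<partial>M)
      \<le> ennreal ((1 - \<beta>)\<^sup>2) * (\<integral>\<^sup>+\<omega>. ennreal (sqn (g k \<omega> - R k (X k \<omega>) (Y k \<omega>))) \<partial>M)
       + ennreal (2 * L\<^sup>2) * (\<integral>\<^sup>+\<omega>. ennreal (inc k \<omega>) \<partial>M) + ennreal (2 * \<beta>\<^sup>2 * \<sigma>\<^sup>2)"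
proof -
  let ?K = "agents p"
  let ?I = "\<lambda>k. \<integral>\<^sup>+\<omega>. ennreal (inc k \<omega>) \<partial>M"
  have e1: "(\<Sum>c<d. \<integral>\<^sup>+\<omega>. ennreal ((\<Sum>l<agents p. 1 / real (agents p) * (g' l \<omega> - R l (X' l \<omega>) (Y' l \<omega>)) $ c)\<^sup>2) \<partial>M) = (\<integral>\<^sup>+\<omega>. ennreal (sqn (merr X' Y' g' \<omega>)) \<partial>M)" by (rule mean_weights[OF in_M(3,4) g'm])
  have e1': "(\<Sum>c<d. \<integral>\<^sup>+\<omega>. ennreal ((\<Sum>l<agents p. 1 / real (agents p) * (g l \<omega> - R l (X l \<omega>) (Y l \<omega>)) $ c)\<^sup>2) \<partial>M) = (\<integral>\<^sup>+\<omega>. ennreal (sqn (merr X Y g \<omega>)) \<partial>M)" by (rule mean_weights[OF in_M(1,2,5)])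
  have "(\<integral>\<^sup>+\<omega>. ennreal (sqn (merr X' Y' g' \<omega>)) \<partial>M) \<le> ennreal ((1 - \<beta>)\<^sup>2) * (\<integral>\<^sup>+\<omega>. ennreal (sqn (merr X Y g \<omega>)) \<partial>M)
      + (\<Sum>k<?K. ennreal ((1 / real ?K)\<^sup>2) * (ennreal (2 * L\<^sup>2) * ?I k + ennreal (2 * \<beta>\<^sup>2 * \<sigma>\<^sup>2)))"
    using storm_error[of "\<lambda>_. 1 / real ?K"] unfolding e1 e1' by simp
  also have "(\<Sum>k<?K. ennreal ((1 / real ?K)\<^sup>2) * (ennreal (2 * L\<^sup>2) * ?I k + ennreal (2 * \<beta>\<^sup>2 * \<sigma>\<^sup>2)))
      = ennreal ((1 / real ?K)\<^sup>2) * ennreal (2 * L\<^sup>2) * (\<Sum>k<?K. ?I k) + (\<Sum>k<?K. ennreal ((1 / real ?K)\<^sup>2 * (2 * \<beta>\<^sup>2 * \<sigma>\<^sup>2)))"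
    by (simp add: distrib_left sum.distrib sum_distrib_left ennreal_mult mult.assoc)
  also have "ennreal ((1 / real ?K)\<^sup>2) * ennreal (2 * L\<^sup>2) = ennreal (2 * L\<^sup>2 / (real ?K)\<^sup>2)"
    by (subst ennreal_mult[symmetric]) (auto simp: power_divide)
  also have "(\<Sum>k<?K. ennreal ((1 / real ?K)\<^sup>2 * (2 * \<beta>\<^sup>2 * \<sigma>\<^sup>2))) = ennreal (\<Sum>k<?K. (1 / real ?K)\<^sup>2 * (2 * \<beta>\<^sup>2 * \<sigma>\<^sup>2))"
    by (rule sum_ennreal) simp
  also have "(\<Sum>k<?K. (1 / real ?K)\<^sup>2 * (2 * \<beta>\<^sup>2 * \<sigma>\<^sup>2)) = 2 * \<beta>\<^sup>2 * \<sigma>\<^sup>2 / real ?K" by (simp add: power2_eq_square)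
  finally show "(\<integral>\<^sup>+\<omega>. ennreal (sqn (merr X' Y' g' \<omega>)) \<partial>M) \<le> ennreal ((1 - \<beta>)\<^sup>2) * (\<integral>\<^sup>+\<omega>. ennreal (sqn (merr X Y g \<omega>)) \<partial>M)
      + ennreal (2 * L\<^sup>2 / (real ?K)\<^sup>2) * (\<Sum>k<?K. ?I k) + ennreal (2 * \<beta>\<^sup>2 * \<sigma>\<^sup>2 / real ?K)" by (simp add: add.assoc)
  assume k: "k < ?K"
  have e2: "(\<Sum>c<d. \<integral>\<^sup>+\<omega>. ennreal ((\<Sum>l<agents p. (if l = k then 1 else 0) * (g' l \<omega> - R l (X' l \<omega>) (Y' l \<omega>)) $ c)\<^sup>2) \<partial>M) = (\<integral>\<^sup>+\<omega>. ennreal (sqn (g' k \<omega> - R k (X' k \<omega>) (Y' k \<omega>))) \<partial>M)" by (rule single_weights[OF in_M(3,4) g'm k])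
  have e2': "(\<Sum>c<d. \<integral>\<^sup>+\<omega>. ennreal ((\<Sum>l<agents p. (if l = k then 1 else 0) * (g l \<omega> - R l (X l \<omega>) (Y l \<omega>)) $ c)\<^sup>2) \<partial>M) = (\<integral>\<^sup>+\<omega>. ennreal (sqn (g k \<omega> - R k (X k \<omega>) (Y k \<omega>))) \<partial>M)" by (rule single_weights[OF in_M(1,2,5) k])
  have "(\<integral>\<^sup>+\<omega>. ennreal (sqn (g' k \<omega> - R k (X' k \<omega>) (Y' k \<omega>))) \<partial>M)
      \<le> ennreal ((1 - \<beta>)\<^sup>2) * (\<integral>\<^sup>+\<omega>. ennreal (sqn (g k \<omega> - R k (X k \<omega>) (Y k \<omega>))) \<partial>M)
      + (\<Sum>l<?K. ennreal ((if l = k then 1 else 0)\<^sup>2) * (ennreal (2 * L\<^sup>2) * ?I l + ennreal (2 * \<beta>\<^sup>2 * \<sigma>\<^sup>2)))"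
    using storm_error[of "\<lambda>l. if l = k then 1 else 0"]
    unfolding e2 e2' by simp
  also have "(\<Sum>l<?K. ennreal ((if l = k then 1 else 0)\<^sup>2) * (ennreal (2 * L\<^sup>2) * ?I l + ennreal (2 * \<beta>\<^sup>2 * \<sigma>\<^sup>2)))
      = (\<Sum>l<?K. if l = k then ennreal (2 * L\<^sup>2) * ?I l + ennreal (2 * \<beta>\<^sup>2 * \<sigma>\<^sup>2) else 0)" by (rule sum.cong) auto
  also have "\<dots> = ennreal (2 * L\<^sup>2) * ?I k + ennreal (2 * \<beta>\<^sup>2 * \<sigma>\<^sup>2)" using k by simp
  finally show "(\<integral>\<^sup>+\<omega>. ennreal (sqn (g' k \<omega> - R k (X' k \<omega>) (Y' k \<omega>))) \<partial>M)
      \<le> ennreal ((1 - \<beta>)\<^sup>2) * (\<integral>\<^sup>+\<omega>. ennreal (sqn (g k \<omega> - R k (X k \<omega>) (Y k \<omega>))) \<partial>M)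
       + ennreal (2 * L\<^sup>2) * ?I k + ennreal (2 * \<beta>\<^sup>2 * \<sigma>\<^sup>2)" by (simp add: add.assoc)
qed

end
end

section \<open>Mixing matrices and the EXTRA recursion\<close>

text \<open>A matrix of the form \<open>kron_id W d\<close> acts on each coordinate across the
  agents separately. The network analysis therefore treats one coordinate at a time, as a function
  on agent numbers of which only the values below \<open>K\<close> matter.\<close>

definition ip :: "nat \<Rightarrow> (nat \<Rightarrow> real) \<Rightarrow> (nat \<Rightarrow> real) \<Rightarrow> real" where
  "ip K u v = (\<Sum>k<K. u k * v k)"

definition app :: "nat \<Rightarrow> rmat \<Rightarrow> (nat \<Rightarrow> real) \<Rightarrow> nat \<Rightarrow> real" where
  "app K A v k = (\<Sum>l<K. A $$ (k, l) * v l)"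

lemma ip_comm: "ip K u v = ip K v u" by (simp add: ip_def mult.commute)
lemma ip_add: "ip K (\<lambda>k. u k + v k) w = ip K u w + ip K v w" by (simp add: ip_def sum.distrib distrib_right)
lemma ip_diff: "ip K (\<lambda>k. u k - v k) w = ip K u w - ip K v w" by (simp add: ip_def sum_subtractf left_diff_distrib)
lemma ip_add_r: "ip K w (\<lambda>k. u k + v k) = ip K w u + ip K w v" by (simp add: ip_def sum.distrib distrib_left)
lemma ip_diff_r: "ip K w (\<lambda>k. u k - v k) = ip K w u - ip K w v" by (simp add: ip_def sum_subtractf right_diff_distrib)
lemma ip_scale: "ip K (\<lambda>k. c * u k) w = c * ip K u w" by (simp add: ip_def sum_distrib_left mult.assoc)
lemma ip_scale_r: "ip K w (\<lambda>k. c * u k) = c * ip K w u" by (simp add: ip_def sum_distrib_left mult.left_commute)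
lemma ip_self: "ip K u u = (\<Sum>k<K. (u k)\<^sup>2)" by (simp add: ip_def power2_eq_square)
lemma ip_nonneg: "0 \<le> ip K u u" by (simp add: ip_self sum_nonneg)
lemma ip_cong: "(\<And>k. k < K \<Longrightarrow> u k = u' k) \<Longrightarrow> (\<And>k. k < K \<Longrightarrow> v k = v' k) \<Longrightarrow> ip K u v = ip K u' v'"
  by (simp add: ip_def)
lemma ip_zero_iff: "ip K u u = 0 \<longleftrightarrow> (\<forall>k<K. u k = 0)"
  by (auto simp: ip_self sum_nonneg_eq_0_iff)

lemma app_add: "app K A (\<lambda>k. u k + v k) k = app K A u k + app K A v k" by (simp add: app_def sum.distrib distrib_left)
lemma app_diff: "app K A (\<lambda>k. u k - v k) k = app K A u k - app K A v k" by (simp add: app_def sum_subtractf right_diff_distrib)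
lemma app_scale: "app K A (\<lambda>k. c * u k) k = c * app K A u k" by (simp add: app_def sum_distrib_left mult.left_commute)
lemma app_cong: "(\<And>k. k < K \<Longrightarrow> u k = u' k) \<Longrightarrow> app K A u = app K A u'" by (simp add: app_def fun_eq_iff)

lemma ip_cauchy: "(ip K u v)\<^sup>2 \<le> ip K u u * ip K v v"
  unfolding ip_self unfolding ip_def by (rule Cauchy_Schwarz_ineq_sum)

lemma mult_vec_app: "A \<in> carrier_mat n n \<Longrightarrow> v \<in> carrier_vec n \<Longrightarrow> k < n \<Longrightarrow> (A *\<^sub>v v) $ k = app n A (\<lambda>l. v $ l) k"
  by (auto simp: app_def scalar_prod_def lessThan_atLeast0)

locale mixing =
  fixes K :: nat and W :: rmat
  assumes K2: "2 \<le> K" and mix: "mixing_matrix K W"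
begin

lemma Wc: "W \<in> carrier_mat K K" using mix by (simp add: mixing_matrix_def psd_mat_def)

lemma W_sym: "k < K \<Longrightarrow> l < K \<Longrightarrow> W $$ (k, l) = W $$ (l, k)"
proof -
  assume kl: "k < K" "l < K"
  have "transpose_mat W = W" using mix by (simp add: mixing_matrix_def psd_mat_def)
  then have "W $$ (k, l) = transpose_mat W $$ (k, l)" by simp
  then show ?thesis using kl Wc by simp
qed

lemma W_nonneg: "k < K \<Longrightarrow> l < K \<Longrightarrow> 0 \<le> W $$ (k, l)"
  using mix by (simp add: mixing_matrix_def doubly_stochastic_def)
lemma W_row: "k < K \<Longrightarrow> (\<Sum>l<K. W $$ (k, l)) = 1"
  using mix by (simp add: mixing_matrix_def doubly_stochastic_def)
lemma W_col: "l < K \<Longrightarrow> (\<Sum>k<K. W $$ (k, l)) = 1"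
  using mix by (simp add: mixing_matrix_def doubly_stochastic_def)

abbreviation "Wa \<equiv> app K W"

lemma W_selfadj: "ip K u (Wa v) = ip K (Wa u) v"
proof -
  have "ip K u (Wa v) = (\<Sum>k<K. \<Sum>l<K. W $$ (k, l) * u k * v l)"
    by (simp add: ip_def app_def sum_distrib_left mult_ac)
  also have "\<dots> = (\<Sum>l<K. \<Sum>k<K. W $$ (k, l) * u k * v l)" by (rule sum.swap)
  also have "\<dots> = (\<Sum>l<K. \<Sum>k<K. W $$ (l, k) * u k * v l)"
    by (intro sum.cong refl arg_cong2[where f = "(*)"]) (auto intro: W_sym)
  also have "\<dots> = ip K (Wa u) v" by (simp add: ip_def app_def sum_distrib_right)
  finally show ?thesis .
qed

lemma W_psd: "0 \<le> ip K v (Wa v)"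
proof -
  let ?v = "Matrix.vec K v"
  have "0 \<le> ?v \<bullet> (W *\<^sub>v ?v)" using mix by (simp add: mixing_matrix_def psd_mat_def)
  also have "\<dots> = (\<Sum>k<K. ?v $ k * (W *\<^sub>v ?v) $ k)"
    by (rule scalar_prod_carrier) (use Wc in auto)
  also have "\<dots> = ip K v (Wa v)" unfolding ip_def
  proof (rule sum.cong[OF refl])
    fix k assume k: "k \<in> {..<K}"
    have "app K W (\<lambda>l. ?v $ l) = Wa v" by (rule app_cong) simp
    then show "?v $ k * (W *\<^sub>v ?v) $ k = v k * Wa v k" using k mult_vec_app[OF Wc, of ?v k] by simp
  qed
  finally show ?thesis .
qed

lemma W_sum: "(\<Sum>k<K. Wa v k) = (\<Sum>k<K. v k)"
proof -
  have "(\<Sum>k<K. Wa v k) = (\<Sum>l<K. \<Sum>k<K. W $$ (k, l) * v l)" unfolding app_def by (rule sum.swap)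
  also have "\<dots> = (\<Sum>l<K. v l)" by (intro sum.cong refl) (simp add: sum_distrib_right[symmetric] W_col)
  finally show ?thesis .
qed

lemma W_const: "k < K \<Longrightarrow> Wa (\<lambda>_. c) k = c"
  by (simp add: app_def sum_distrib_right[symmetric] W_row)

text \<open>The inequality between a product and the mean of two squares, weighted by the entries of
  \<open>W\<close>; row sums collect one square and column sums the other.\<close>

lemma W_le_one: "ip K v (Wa v) \<le> ip K v v"
proof -
  have "2 * ip K v (Wa v) = (\<Sum>k<K. \<Sum>l<K. W $$ (k, l) * (2 * (v k * v l)))"
    by (simp add: ip_def app_def sum_distrib_left mult_ac)
  also have "\<dots> \<le> (\<Sum>k<K. \<Sum>l<K. W $$ (k, l) * ((v k)\<^sup>2 + (v l)\<^sup>2))"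
  proof (intro sum_mono mult_left_mono)
    fix k l have "0 \<le> (v k - v l)\<^sup>2" by simp
    then show "2 * (v k * v l) \<le> (v k)\<^sup>2 + (v l)\<^sup>2" by (simp add: power2_diff)
  qed (auto intro: W_nonneg)
  also have "\<dots> = (\<Sum>k<K. \<Sum>l<K. W $$ (k, l) * (v k)\<^sup>2) + (\<Sum>k<K. \<Sum>l<K. W $$ (k, l) * (v l)\<^sup>2)"
    by (simp add: distrib_left sum.distrib)
  also have "(\<Sum>k<K. \<Sum>l<K. W $$ (k, l) * (v k)\<^sup>2) = ip K v v"
    by (simp add: sum_distrib_right[symmetric] W_row ip_self)
  also have "(\<Sum>k<K. \<Sum>l<K. W $$ (k, l) * (v l)\<^sup>2) = (\<Sum>l<K. \<Sum>k<K. W $$ (k, l) * (v l)\<^sup>2)" by (rule sum.swap)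
  also have "\<dots> = ip K v v" by (simp add: sum_distrib_right[symmetric] W_col ip_self)
  finally show ?thesis by simp
qed

lemma pow_fixed:
  assumes "\<And>k. k < K \<Longrightarrow> Wa v k = v k" "k < K"
  shows "app K (W ^\<^sub>m m) v k = v k"
  using assms(2)
proof (induction m arbitrary: k)
  case 0
  have "app K (1\<^sub>m K) v k = (\<Sum>l<K. if l = k then v l else 0)" unfolding app_def by (rule sum.cong) (use 0 in auto)
  then show ?case using 0 Wc by simp
next
  case (Suc m)
  have c: "W ^\<^sub>m m \<in> carrier_mat K K" using Wc by simp
  have e: "(W ^\<^sub>m m * W) $$ (k, l) = (\<Sum>j<K. (W ^\<^sub>m m) $$ (k, j) * W $$ (j, l))" if "l < K" for l
    using c Wc Suc.prems that by (simp add: times_mat_def scalar_prod_def lessThan_atLeast0)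
  have "app K (W ^\<^sub>m Suc m) v k = (\<Sum>l<K. \<Sum>j<K. (W ^\<^sub>m m) $$ (k, j) * (W $$ (j, l) * v l))"
    by (simp add: app_def e sum_distrib_right mult.assoc)
  also have "\<dots> = (\<Sum>j<K. \<Sum>l<K. (W ^\<^sub>m m) $$ (k, j) * (W $$ (j, l) * v l))" by (rule sum.swap)
  also have "\<dots> = (\<Sum>j<K. (W ^\<^sub>m m) $$ (k, j) * Wa v j)" by (simp add: app_def sum_distrib_left)
  also have "\<dots> = app K (W ^\<^sub>m m) v k" unfolding app_def[of K "W ^\<^sub>m m"] by (simp add: assms(1))
  finally show ?case using Suc by simp
qed

text \<open>Maximum principle: some power of \<open>W\<close> has positive entries, and at an index
  where \<open>v\<close> is maximal it represents the maximum as a strictly positive average of all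
  values, so all values equal it.\<close>

lemma fixed_imp_const:
  assumes fx: "\<And>k. k < K \<Longrightarrow> Wa v k = v k" and "k < K" "l < K"
  shows "v k = v l"
proof -
  obtain m where m: "\<And>k l. k < K \<Longrightarrow> l < K \<Longrightarrow> 0 < (W ^\<^sub>m m) $$ (k, l)"
    using mix by (auto simp: mixing_matrix_def primitive_mat_def)
  let ?M = "Max (v ` {..<K})"
  have le: "v j \<le> ?M" if "j < K" for j using that by (intro Max_ge) auto
  have "v 0 \<in> v ` {..<K}" using K2 by (intro imageI) simp
  then have "?M \<in> v ` {..<K}" by (intro Max_in) auto
  then obtain i where i: "i < K" "v i = ?M" by (metis imageE lessThan_iff)
  have "app K (W ^\<^sub>m m) (\<lambda>_. 1) i = 1" by (rule pow_fixed) (use W_const i in auto)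
  then have 1: "(\<Sum>j<K. (W ^\<^sub>m m) $$ (i, j)) = 1" by (simp add: app_def)
  have "(\<Sum>j<K. (W ^\<^sub>m m) $$ (i, j) * (?M - v j)) = ?M - app K (W ^\<^sub>m m) v i"
    using 1 by (simp add: app_def right_diff_distrib sum_subtractf sum_distrib_right[symmetric])
  also have "\<dots> = 0" using pow_fixed[OF fx i(1), of m] i by simp
  finally have z: "(\<Sum>j<K. (W ^\<^sub>m m) $$ (i, j) * (?M - v j)) = 0" .
  have nn: "0 \<le> (W ^\<^sub>m m) $$ (i, j) * (?M - v j)" if "j < K" for j
    using le[OF that] m[OF i(1) that] by simp
  have vj: "v j = ?M" if "j < K" for j
  proof -
    have "(W ^\<^sub>m m) $$ (i, j) * (?M - v j) = 0" using sum_nonneg_0[OF _ _ z, of j] nn that by auto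
    then show ?thesis using m[OF i(1) that] by simp
  qed
  show ?thesis using vj[OF assms(2)] vj[OF assms(3)] by simp
qed

text \<open>Finite-dimensional compactness inside a function space: the values beyond
  \<open>K\<close> are zero and the others lie between -1 and 1, so the set is a closed part of a
  product of compact intervals.\<close>

lemma sphere_compact:
  "compact {v :: nat \<Rightarrow> real. (\<forall>k\<ge>K. v k = 0) \<and> (\<Sum>k<K. v k) = 0 \<and> ip K v v = 1}" (is "compact ?S")
proof -
  let ?B = "\<lambda>k. if k < K then {-1..1} else {0::real}"
  have "compactin (product_topology (\<lambda>i. euclidean) UNIV) (Pi\<^sub>E UNIV ?B)"
    unfolding compactin_PiE by (auto simp: compactin_euclidean_iff)
  then have cB: "compact (Pi\<^sub>E UNIV ?B)" by (simp add: euclidean_product_topology compactin_euclidean_iff)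
  have cv: "continuous_on UNIV (\<lambda>v :: nat \<Rightarrow> real. v k)" for k
    by (rule continuous_on_product_then_coordinatewise) (rule continuous_on_id)
  have cl: "closed {v :: nat \<Rightarrow> real. (\<Sum>k<K. v k) = 0 \<and> ip K v v = 1}"
    unfolding ip_def by (intro closed_Collect_conj closed_Collect_eq continuous_intros cv)
  have "?S = Pi\<^sub>E UNIV ?B \<inter> {v. (\<Sum>k<K. v k) = 0 \<and> ip K v v = 1}"
  proof (intro equalityI subsetI)
    fix v assume v: "v \<in> ?S"
    have "\<bar>v k\<bar> \<le> 1" if "k < K" for k
    proof -
      have "(v k)\<^sup>2 \<le> (\<Sum>k<K. (v k)\<^sup>2)" by (rule member_le_sum) (use that in auto)
      then have "(v k)\<^sup>2 \<le> 1" using v by (simp add: ip_self)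
      then show ?thesis by (simp only: abs_square_le_1)
    qed
    then show "v \<in> Pi\<^sub>E UNIV ?B \<inter> {v. (\<Sum>k<K. v k) = 0 \<and> ip K v v = 1}" using v
      by (auto simp: abs_le_iff)
  next
    fix v assume "v \<in> Pi\<^sub>E UNIV ?B \<inter> {v. (\<Sum>k<K. v k) = 0 \<and> ip K v v = 1}"
    then have v: "\<And>k. v k \<in> ?B k" "(\<Sum>k<K. v k) = 0" "ip K v v = 1" by (auto simp: PiE_def Pi_def)
    have "v k = 0" if "k \<ge> K" for k using v(1)[of k] that by simp
    then show "v \<in> ?S" using v by auto
  qed
  then show ?thesis using cB cl by (simp add: compact_Int_closed)
qed

text \<open>The second eigenvalue is obtained as the maximum of the Rayleigh quotient on the orthogonal
  complement of the constants, at which the first-order condition is the eigenvalue equation.\<close>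

lemma rayleigh:
  obtains \<rho> where "eigenvalue W \<rho>" "\<rho> \<noteq> 1" "\<And>v. (\<Sum>k<K. v k) = 0 \<Longrightarrow> ip K v (Wa v) \<le> \<rho> * ip K v v"
proof -
  let ?S = "{v :: nat \<Rightarrow> real. (\<forall>k\<ge>K. v k = 0) \<and> (\<Sum>k<K. v k) = 0 \<and> ip K v v = 1}"
  have cv: "continuous_on S (\<lambda>v :: nat \<Rightarrow> real. v k)" for k and S
    by (rule continuous_on_product_then_coordinatewise) (rule continuous_on_id)
  have cont: "continuous_on ?S (\<lambda>v. ip K v (Wa v))"
    unfolding ip_def app_def by (intro continuous_intros cv)
  have K01: "{..<K} = insert 0 (insert 1 {2..<K})" using K2 by auto
  \<comment> \<open>A unit vector with zero sum, so the sphere is nonempty; it needs two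
    agents.\<close>
  let ?e = "\<lambda>k::nat. if k = 0 then 1 / sqrt 2 else if k = 1 then - 1 / sqrt 2 else 0 :: real"
  have "(\<Sum>k<K. ?e k) = 0" unfolding K01 by simp
  moreover have "ip K ?e ?e = 1" unfolding ip_def K01 by simp
  ultimately have "?e \<in> ?S" using K2 by simp
  then have ne: "?S \<noteq> {}" by (metis (no_types) empty_iff)
  from continuous_attains_sup[OF sphere_compact ne cont]
  obtain w where w: "w \<in> ?S" "\<And>v. v \<in> ?S \<Longrightarrow> ip K v (Wa v) \<le> ip K w (Wa w)" by auto
  define \<rho> where "\<rho> = ip K w (Wa w)"
  have w1: "ip K w w = 1" "(\<Sum>k<K. w k) = 0" using w by auto
  have le: "ip K v (Wa v) \<le> \<rho> * ip K v v" if v: "(\<Sum>k<K. v k) = 0" for v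
  proof (cases "ip K v v = 0")
    case True
    then have "\<forall>k<K. v k = 0" by (simp add: ip_zero_iff)
    then have "ip K v (Wa v) = 0" by (simp add: ip_def)
    then show ?thesis using True by simp
  next
    case False
    then have p: "0 < ip K v v" using ip_nonneg[of K v] by simp
    define c where "c = 1 / sqrt (ip K v v)"
    have c: "c\<^sup>2 * ip K v v = 1" using p by (simp add: c_def power_divide)
    let ?u = "\<lambda>k. if k < K then c * v k else 0"
    have iu: "ip K ?u ?u = c\<^sup>2 * ip K v v"
      by (simp add: ip_def sum_distrib_left power2_eq_square mult_ac)
    have "(\<Sum>k<K. ?u k) = c * (\<Sum>k<K. v k)" by (simp add: sum_distrib_left)
    then have "?u \<in> ?S" using iu c v by simp
    from w(2)[OF this] have "ip K ?u (Wa ?u) \<le> \<rho>" by (simp add: \<rho>_def)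
    moreover have "Wa ?u = Wa (\<lambda>k. c * v k)" by (rule app_cong) simp
    then have "ip K ?u (Wa ?u) = c\<^sup>2 * ip K v (Wa v)"
      by (simp add: ip_def app_scale sum_distrib_left power2_eq_square mult_ac)
    ultimately have "c\<^sup>2 * ip K v (Wa v) \<le> \<rho> * (c\<^sup>2 * ip K v v)" using c by simp
    then have "c\<^sup>2 * ip K v (Wa v) \<le> c\<^sup>2 * (\<rho> * ip K v v)" by (simp add: mult.left_commute)
    moreover have "0 < c\<^sup>2" using p by (simp add: c_def)
    ultimately show ?thesis by (rule mult_left_le_imp_le)
  qed
  \<comment> \<open>The residual of the eigenvalue equation at the maximizer. Moving along it keeps
    the zero sum, and optimality of \<open>w\<close> makes \<open>quad\<close> hold for every
    \<open>t\<close>; the first-order coefficient is twice the squared norm of \<open>h\<close>,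
    which must therefore vanish.\<close>
  define h where "h k = Wa w k - \<rho> * w k" for k
  have h0: "(\<Sum>k<K. h k) = 0" using w1 by (simp add: h_def sum_subtractf W_sum sum_distrib_left[symmetric])
  have quad: "2 * t * ip K h h + t\<^sup>2 * (ip K h (Wa h) - \<rho> * ip K h h) \<le> 0" for t
  proof -
    let ?v = "\<lambda>k. w k + t * h k"
    have s0: "(\<Sum>k<K. ?v k) = 0" using w1 h0 by (simp add: sum.distrib sum_distrib_left[symmetric])
    have Wv: "Wa ?v = (\<lambda>k. Wa w k + t * Wa h k)" by (simp add: fun_eq_iff app_add app_scale)
    have e1: "ip K ?v (Wa ?v) = \<rho> + 2 * t * ip K h (Wa w) + t\<^sup>2 * ip K h (Wa h)"
      unfolding Wv ip_add ip_add_r ip_scale ip_scale_r using W_selfadj[of w h] ip_comm[of K "Wa w" h]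
      by (simp add: \<rho>_def power2_eq_square algebra_simps)
    have e2: "ip K ?v ?v = 1 + 2 * t * ip K h w + t\<^sup>2 * ip K h h"
      unfolding ip_add ip_add_r ip_scale ip_scale_r using w1 ip_comm[of K w h]
      by (simp add: power2_eq_square algebra_simps)
    have "ip K h h = ip K h (\<lambda>k. Wa w k - \<rho> * w k)" by (simp only: h_def[abs_def])
    then have e3: "ip K h (Wa w) = ip K h h + \<rho> * ip K h w" by (simp add: ip_diff_r ip_scale_r)
    show ?thesis using le[OF s0] unfolding e1 e2 e3 by (simp add: algebra_simps)
  qed
  have "ip K h h = 0"
  proof (rule ccontr)
    assume "ip K h h \<noteq> 0"
    then have a: "0 < ip K h h" using ip_nonneg[of K h] by simp
    define b where "b = ip K h (Wa h) - \<rho> * ip K h h"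
    \<comment> \<open>Small enough that the quadratic coefficient \<open>b\<close> cannot compensate
      the linear one.\<close>
    define t where "t = ip K h h / (1 + \<bar>b\<bar>)"
    have t: "0 < t" using a by (simp add: t_def)
    have "t * (1 + \<bar>b\<bar>) = ip K h h" by (simp add: t_def)
    then have "t * \<bar>b\<bar> \<le> ip K h h" using t by (simp add: distrib_left)
    moreover have "t * (- b) \<le> t * \<bar>b\<bar>" using t by (intro mult_left_mono) auto
    ultimately have "- (t * b) \<le> ip K h h" by simp
    then have "0 < 2 * ip K h h + t * b" using a by simp
    then have "0 < t * (2 * ip K h h + t * b)" using t by simp
    then show False using quad[of t] by (simp add: b_def[symmetric] power2_eq_square algebra_simps)
  qed
  then have ev: "Wa w k = \<rho> * w k" if "k < K" for k using that by (auto simp: ip_zero_iff h_def)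
  let ?w = "Matrix.vec K w"
  have "W *\<^sub>v ?w = \<rho> \<cdot>\<^sub>v ?w"
  proof (rule eq_vecI)
    fix k assume "k < dim_vec (\<rho> \<cdot>\<^sub>v ?w)"
    then have k: "k < K" by simp
    have "app K W (\<lambda>l. ?w $ l) = Wa w" by (rule app_cong) simp
    then show "(W *\<^sub>v ?w) $ k = (\<rho> \<cdot>\<^sub>v ?w) $ k" using mult_vec_app[OF Wc, of ?w k] ev k by simp
  qed (use Wc in simp)
  moreover have nz: "\<not> (\<forall>k<K. w k = 0)" using w1 ip_zero_iff[of K w] by simp
  then have "?w \<noteq> 0\<^sub>v K" by (metis index_vec index_zero_vec(1))
  ultimately have "eigenvalue W \<rho>" unfolding eigenvalue_def eigenvector_def using Wc by (intro exI[of _ ?w]) auto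
  \<comment> \<open>A fixed vector of \<open>W\<close> is constant, and a constant with zero sum is
    zero, contradicting unit length.\<close>
  moreover have "\<rho> \<noteq> 1"
  proof
    assume "\<rho> = 1"
    then have "\<And>k. k < K \<Longrightarrow> Wa w k = w k" using ev by simp
    then have wc: "w k = w 0" if "k < K" for k using fixed_imp_const[of w k 0] that K2 by simp
    have "(\<Sum>k<K. w k) = (\<Sum>k<K. w 0)" by (rule sum.cong[OF refl], rule wc) simp
    then have w0: "w 0 = 0" using w1 K2 by simp
    have "w k = 0" if "k < K" for k using wc[OF that] w0 by linarith
    then show False using nz by blast
  qed
  ultimately show ?thesis using that le by blast
qed

text \<open>The maximum in \<open>lam2\<close> is over a finite set, as eigenvalues are roots of the
  characteristic polynomial, and a nonempty one, since it contains the value from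
  \<open>rayleigh\<close>. That value is at most \<open>lam2 W\<close>, hence the contraction;
  positivity of \<open>W\<close> and \<open>W_le_one\<close>, applied to an eigenvector, place
  \<open>lam2 W\<close> in the unit interval.\<close>

lemma lam2_props:
  shows contraction: "\<And>v. (\<Sum>k<K. v k) = 0 \<Longrightarrow> ip K v (Wa v) \<le> lam2 W * ip K v v"
    and lam2_nonneg: "0 \<le> lam2 W" and lam2_less: "lam2 W < 1"
proof -
  let ?E = "{c. eigenvalue W c \<and> c \<noteq> 1}"
  have "char_poly W \<noteq> 0" using degree_monic_char_poly[OF Wc] by auto
  then have "finite {c. poly (char_poly W) c = 0}" by (rule poly_roots_finite)
  then have fin: "finite ?E" by (rule rev_finite_subset) (auto simp: eigenvalue_root_char_poly[OF Wc])
  obtain \<rho> where r: "eigenvalue W \<rho>" "\<rho> \<noteq> 1" "\<And>v. (\<Sum>k<K. v k) = 0 \<Longrightarrow> ip K v (Wa v) \<le> \<rho> * ip K v v"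
    using rayleigh by blast
  have le: "\<rho> \<le> lam2 W" unfolding lam2_def by (rule Max_ge) (use fin r in auto)
  show "ip K v (Wa v) \<le> lam2 W * ip K v v" if "(\<Sum>k<K. v k) = 0" for v
    using r(3)[OF that] mult_right_mono[OF le ip_nonneg[of K v]] by linarith
  have "lam2 W \<in> ?E" unfolding lam2_def by (rule Max_in) (use fin r in auto)
  then obtain v where v: "v \<in> carrier_vec K" "v \<noteq> 0\<^sub>v K" "W *\<^sub>v v = lam2 W \<cdot>\<^sub>v v" and ne: "lam2 W \<noteq> 1"
    using Wc unfolding eigenvalue_def eigenvector_def by auto
  let ?v = "\<lambda>k. v $ k"
  have "Wa ?v k = lam2 W * ?v k" if "k < K" for k
    using mult_vec_app[OF Wc v(1) that] v that by simp
  then have e: "ip K ?v (Wa ?v) = lam2 W * ip K ?v ?v"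
    by (simp add: ip_def sum_distrib_left mult_ac)
  have "\<not> (\<forall>k<K. v $ k = 0)" using v by auto
  then have "ip K ?v ?v \<noteq> 0" by (simp add: ip_zero_iff)
  then have p: "0 < ip K ?v ?v" using ip_nonneg[of K ?v] by (simp add: order.strict_iff_order)
  show "0 \<le> lam2 W" using W_psd[of ?v] p unfolding e by (simp add: zero_le_mult_iff)
  have "lam2 W \<le> 1" using W_le_one[of ?v] p unfolding e by simp
  then show "lam2 W < 1" using ne by simp
qed

definition "gam = 1 - lam2 W"

lemma gam: "0 < gam" "gam \<le> 1" using lam2_nonneg lam2_less by (auto simp: gam_def)

abbreviation "Ea v k \<equiv> v k - Wa v k"

lemma E_coercive: "(\<Sum>k<K. v k) = 0 \<Longrightarrow> gam * ip K v v \<le> ip K v (Ea v)"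
  using contraction[of v] unfolding ip_diff_r gam_def by (simp add: algebra_simps)

text \<open>Cauchy-Schwarz replaces a spectral decomposition: with \<open>a\<close>,
  \<open>b\<close>, \<open>c\<close> for the three forms in increasing powers of \<open>E\<close>,
  the bounds \<open>b^2 \<le> a * c\<close> and \<open>gam * a \<le> b\<close> give
  \<open>gam * b \<le> c\<close>.\<close>

lemma E_sqnorm:
  assumes "(\<Sum>k<K. v k) = 0" shows "gam * ip K v (Ea v) \<le> ip K (Ea v) (Ea v)"
    and "gam\<^sup>2 * ip K v v \<le> ip K (Ea v) (Ea v)"
proof -
  let ?a = "ip K v v" and ?b = "ip K v (Ea v)" and ?c = "ip K (Ea v) (Ea v)"
  have 1: "gam * ?a \<le> ?b" using E_coercive[OF assms] .
  have nn: "0 \<le> ?a" "0 \<le> ?c" by (rule ip_nonneg)+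
  then have b0: "0 \<le> ?b" using 1 gam by (meson less_imp_le mult_nonneg_nonneg order_trans)
  have cs: "?b\<^sup>2 \<le> ?a * ?c" by (rule ip_cauchy)
  show A: "gam * ?b \<le> ?c"
  proof (cases "?b = 0")
    case True then show ?thesis using nn by simp
  next
    case False
    have "gam * ?b * ?b = gam * ?b\<^sup>2" by (simp add: power2_eq_square)
    also have "\<dots> \<le> gam * (?a * ?c)" using cs gam by (intro mult_left_mono) auto
    also have "\<dots> = (gam * ?a) * ?c" by simp
    also have "\<dots> \<le> ?b * ?c" using 1 nn by (intro mult_right_mono)
    finally have "gam * ?b * ?b \<le> ?c * ?b" by (simp add: mult.commute)
    then show ?thesis using False b0 by simp
  qed
  have "gam\<^sup>2 * ?a = gam * (gam * ?a)" by (simp add: power2_eq_square)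
  also have "\<dots> \<le> gam * ?b" using 1 gam by (intro mult_left_mono) auto
  finally show "gam\<^sup>2 * ?a \<le> ?c" using A by linarith
qed

text \<open>\<open>E\<close> vanishes on constants, so it is inverted only on vectors with zero sum.
  Adding the averaging matrix makes it nonsingular without changing it there.\<close>

lemma E_surj:
  assumes g: "(\<Sum>k<K. g k) = 0"
  obtains q where "(\<Sum>k<K. q k) = 0" "\<And>k. k < K \<Longrightarrow> Ea q k = g k"
proof -
  \<comment> \<open>This matrix preserves the sum of a vector. So the solution for a right side of
    zero sum has zero sum, and on it the averaging part disappears.\<close>
  let ?B = "Matrix.mat K K (\<lambda>(k, l). (if k = l then 1 else 0) - W $$ (k, l) + 1 / K)"
  have Bc: "?B \<in> carrier_mat K K" by simp
  have Bv: "(?B *\<^sub>v v) $ k = Ea (\<lambda>l. v $ l) k + (\<Sum>l<K. v $ l) / K" if "v \<in> carrier_vec K" "k < K" for v k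
  proof -
    have "(?B *\<^sub>v v) $ k = (\<Sum>l<K. ?B $$ (k, l) * v $ l)" unfolding mult_vec_app[OF Bc that] app_def ..
    also have "\<dots> = (\<Sum>l<K. (if l = k then v $ l else 0) - W $$ (k, l) * v $ l + v $ l / K)"
      by (rule sum.cong) (use that in \<open>auto simp: algebra_simps\<close>)
    also have "\<dots> = v $ k - app K W (\<lambda>l. v $ l) k + (\<Sum>l<K. v $ l) / K"
      using that by (simp add: sum.distrib sum_subtractf app_def sum_divide_distrib)
    finally show ?thesis .
  qed
  have sumB: "(\<Sum>k<K. (?B *\<^sub>v v) $ k) = (\<Sum>k<K. v $ k)" if "v \<in> carrier_vec K" for v
  proof -
    have "(\<Sum>k<K. (?B *\<^sub>v v) $ k) = (\<Sum>k<K. Ea (\<lambda>l. v $ l) k + (\<Sum>l<K. v $ l) / K)"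
      by (rule sum.cong) (use Bv[OF that] in auto)
    also have "\<dots> = (\<Sum>k<K. v $ k)" using K2 by (simp add: sum.distrib sum_subtractf W_sum)
    finally show ?thesis .
  qed
  have "Determinant.det ?B \<noteq> 0"
  proof
    assume "Determinant.det ?B = 0"
    then obtain v where v: "v \<in> carrier_vec K" "v \<noteq> 0\<^sub>v K" "?B *\<^sub>v v = 0\<^sub>v K"
      using det_0_iff_vec_prod_zero[OF Bc] by auto
    have s: "(\<Sum>k<K. v $ k) = 0" using sumB[OF v(1)] v(3) by simp
    have "Ea (\<lambda>l. v $ l) k = 0" if "k < K" for k using Bv[OF v(1) that] v(3) s that by simp
    then have "ip K (\<lambda>l. v $ l) (Ea (\<lambda>l. v $ l)) = 0" by (simp add: ip_def)
    then have "gam * ip K (\<lambda>l. v $ l) (\<lambda>l. v $ l) \<le> 0" using E_coercive[OF s] by simp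
    then have "ip K (\<lambda>l. v $ l) (\<lambda>l. v $ l) = 0"
      using gam ip_nonneg[of K "\<lambda>l. v $ l"] by (simp add: mult_le_0_iff)
    then show False using v by (auto simp: ip_zero_iff)
  qed
  then have "?B \<in> Units (ring_mat TYPE(real) K undefined)" using det_non_zero_imp_unit[OF Bc] by auto
  then obtain N where N: "N \<in> carrier_mat K K" "?B * N = 1\<^sub>m K" by (auto simp: Units_def ring_mat_simps)
  let ?g = "Matrix.vec K g" and ?q = "N *\<^sub>v Matrix.vec K g"
  have q: "?q \<in> carrier_vec K" using N by simp
  have Bq: "?B *\<^sub>v ?q = ?g" using N assoc_mult_mat_vec[OF Bc N(1), of ?g] by simp
  have s: "(\<Sum>k<K. ?q $ k) = 0" using sumB[OF q] Bq g by simp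
  have "Ea (\<lambda>l. ?q $ l) k = g k" if "k < K" for k using Bv[OF q that] Bq s that by simp
  then show ?thesis using that[of "\<lambda>l. ?q $ l"] s by blast
qed

definition center :: "(nat \<Rightarrow> real) \<Rightarrow> nat \<Rightarrow> real" where
  "center v k = v k - (\<Sum>l<K. v l) / K"

lemma center_sum: "(\<Sum>k<K. center v k) = 0" using K2 by (simp add: center_def sum_subtractf)

lemma center_diff: "center (\<lambda>k. u k - v k) k = center u k - center v k"
  by (simp add: center_def sum_subtractf diff_divide_distrib)
lemma center_scale: "center (\<lambda>k. c * v k) k = c * center v k"
  by (simp add: center_def sum_distrib_left[symmetric] right_diff_distrib)
lemma center_W: "k < K \<Longrightarrow> center (Wa v) k = Wa (center v) k"
proof -
  assume k: "k < K"
  have "Wa (center v) k = Wa v k - Wa (\<lambda>_. (\<Sum>l<K. v l) / K) k" unfolding center_def[abs_def] by (rule app_diff)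
  then show ?thesis using W_const[OF k] by (simp add: center_def W_sum)
qed
lemma center_id: "(\<Sum>k<K. v k) = 0 \<Longrightarrow> center v = v" by (simp add: center_def fun_eq_iff)

lemma center_sq_le: "ip K (center v) (center v) \<le> ip K v v"
proof -
  define m where "m = (\<Sum>l<K. v l) / K"
  have S: "(\<Sum>k<K. v k) = K * m" using K2 by (simp add: m_def)
  have "ip K (center v) (center v) = (\<Sum>k<K. (v k)\<^sup>2 - 2 * m * v k + m\<^sup>2)"
    unfolding ip_self center_def m_def[symmetric] by (intro sum.cong refl) (simp add: power2_diff)
  also have "\<dots> = (\<Sum>k<K. (v k)\<^sup>2) - 2 * m * (\<Sum>k<K. v k) + K * m\<^sup>2"
    by (simp add: sum.distrib sum_subtractf sum_distrib_left)
  also have "\<dots> = ip K v v - K * m\<^sup>2" unfolding S ip_self by (simp add: power2_eq_square)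
  also have "\<dots> \<le> ip K v v" by simp
  finally show ?thesis .
qed

text \<open>With \<open>E = I - W\<close> and \<open>E q = r + \<mu> g\<close>, the energy is \<open>\<langle>q, E q\<rangle> + \<langle>v, W v\<rangle>\<close>. Since
  \<open>E (q + v') = W (v - v')\<close>, the perturbation of \<open>q\<close> is paid for by the dissipation
  \<open>\<langle>v - v', W (v - v')\<rangle>\<close>.\<close>

lemma energy_step:
  assumes v': "\<And>k. k < K \<Longrightarrow> v' k = Wa v k - Ea q k"
  shows "ip K (\<lambda>k. q k + v' k) (Ea (\<lambda>k. q k + v' k)) + ip K v' (Wa v') + ip K v' (Ea v') \<le> ip K q (Ea q) + ip K v (Wa v)"
    and "ip K (\<lambda>k. q k + v' k + d k) (Ea (\<lambda>k. q k + v' k + d k)) + ip K v' (Wa v') + ip K v' (Ea v')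
       \<le> ip K q (Ea q) + ip K v (Wa v) + ip K d d"
proof -
  have Eq: "ip K u (Ea q) = ip K u (Wa v) - ip K u v'" for u
  proof -
    have "ip K u (Ea q) = ip K u (\<lambda>k. Wa v k - v' k)" by (rule ip_cong) (use v' in auto)
    then show ?thesis by (simp only: ip_diff_r)
  qed
  have sa: "ip K a (Wa b) = ip K b (Wa a)" for a b using W_selfadj[of a b] ip_comm[of K "Wa a" b] by simp
  have ap: "Wa (\<lambda>k. a k + b k) = (\<lambda>k. Wa a k + Wa b k)" "Wa (\<lambda>k. a k - b k) = (\<lambda>k. Wa a k - Wa b k)" for a b
    by (simp_all add: fun_eq_iff app_add app_diff)
  note ex = ap ip_add ip_add_r ip_diff ip_diff_r
  have E1: "ip K q (Ea q) = ip K q q - ip K q (Wa q)" by (simp only: ip_diff_r)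
  define a b c where "a = ip K v (Wa v)" "b = ip K v (Wa v')" "c = ip K v' (Wa v')"
  have F1: "ip K v' q - ip K v' (Wa q) = b - ip K v' v'"
    using Eq[of v'] sa[of v' v] unfolding ip_diff_r a_b_c_def by simp
  have F2: "ip K d q - ip K d (Wa q) = ip K d (Wa v) - ip K d v'"
    using Eq[of d] unfolding ip_diff_r by simp
  have pos: "0 \<le> ip K (\<lambda>k. v k - v' k) (Wa (\<lambda>k. v k - v' k))" by (rule W_psd)
  then have pos': "0 \<le> a - 2 * b + c" unfolding ex a_b_c_def using sa[of v' v] by simp
  \<comment> \<open>The square is completed with the perturbation included: the cross terms of
    \<open>d\<close> with \<open>W (v - v')\<close>, less the form of \<open>W\<close> at
    \<open>d\<close>, are at most the dissipation. So the perturbation costs exactly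
    \<open>ip K d d\<close>.\<close>
  have posd: "0 \<le> ip K (\<lambda>k. v k - v' k - d k) (Wa (\<lambda>k. v k - v' k - d k))" by (rule W_psd)
  then have posd': "0 \<le> a - 2 * b + c - 2 * ip K d (Wa v) + 2 * ip K d (Wa v') + ip K d (Wa d)"
    unfolding ex a_b_c_def using sa[of v' v] sa[of v d] sa[of v' d] by simp
  have S1: "ip K (\<lambda>k. q k + v' k) (Ea (\<lambda>k. q k + v' k)) = ip K q (Ea q) + 2 * (b - ip K v' v') + ip K v' v' - c"
    unfolding ex using F1 sa[of q v'] ip_comm[of K q v'] by (simp add: a_b_c_def)
  have S2: "ip K (\<lambda>k. q k + v' k + d k) (Ea (\<lambda>k. q k + v' k + d k)) = ip K q (Ea q) + 2 * (b - ip K v' v') + ip K v' v' - c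
     + 2 * (ip K d (Wa v) - ip K d (Wa v')) + ip K d d - ip K d (Wa d)"
    unfolding ex using F1 F2 sa[of q v'] ip_comm[of K q v'] sa[of q d] ip_comm[of K q d] sa[of v' d] ip_comm[of K v' d]
    by (simp add: a_b_c_def)
  have E2: "ip K v' (Ea v') = ip K v' v' - c" unfolding ip_diff_r a_b_c_def ..
  show "ip K (\<lambda>k. q k + v' k) (Ea (\<lambda>k. q k + v' k)) + ip K v' (Wa v') + ip K v' (Ea v') \<le> ip K q (Ea q) + ip K v (Wa v)"
    unfolding S1 E2 using pos' by (simp add: a_b_c_def[symmetric])
  show "ip K (\<lambda>k. q k + v' k + d k) (Ea (\<lambda>k. q k + v' k + d k)) + ip K v' (Wa v') + ip K v' (Ea v')
       \<le> ip K q (Ea q) + ip K v (Wa v) + ip K d d"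
    unfolding S2 E2 using posd' by (simp add: a_b_c_def[symmetric])
qed

text \<open>For constant \<open>g\<close> the primal-dual recursion settles, so only changes of
  \<open>g\<close> feed the spread. The correction \<open>p i\<close> with
  \<open>E (p i) = \<mu> * center (g i)\<close> absorbs the current input into the dual variable,
  leaving the differences \<open>d i\<close> of successive corrections as the only source. Inverting
  \<open>E\<close> costs \<open>gam^2\<close> in the square of \<open>d\<close>, and coercivity of
  the dissipation one more \<open>gam\<close>; for the initial term the energy costs one power and
  coercivity the second.\<close>

lemma consensus:
  fixes v g r :: "nat \<Rightarrow> nat \<Rightarrow> real"
  assumes v0: "\<And>k. k < K \<Longrightarrow> v 0 k = c" and r0: "\<And>k. k < K \<Longrightarrow> r 0 k = 0"
    and vS: "\<And>i k. k < K \<Longrightarrow> v (Suc i) k = Wa (v i) k - \<mu> * g i k - r i k"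
    and rS: "\<And>i k. k < K \<Longrightarrow> r (Suc i) k = r i k + Ea (v (Suc i)) k"
  shows "(\<Sum>k<K. v (Suc i) k) = (\<Sum>k<K. v i k) - \<mu> * (\<Sum>k<K. g i k)"
    and "(\<Sum>i\<le>Suc n. ip K (center (v i)) (center (v i)))
      \<le> \<mu>\<^sup>2 / gam\<^sup>2 * ip K (center (g 0)) (center (g 0))
       + \<mu>\<^sup>2 / gam^3 * (\<Sum>i<n. ip K (\<lambda>k. g (Suc i) k - g i k) (\<lambda>k. g (Suc i) k - g i k))"
proof -
  have rsum: "(\<Sum>k<K. r i k) = 0" for i
  proof (induction i)
    case (Suc i)
    have "(\<Sum>k<K. r (Suc i) k) = (\<Sum>k<K. r i k) + (\<Sum>k<K. Ea (v (Suc i)) k)"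
      by (simp add: rS sum.distrib)
    then show ?case using Suc by (simp add: sum_subtractf W_sum)
  qed (simp add: r0)
  show "(\<Sum>k<K. v (Suc i) k) = (\<Sum>k<K. v i k) - \<mu> * (\<Sum>k<K. g i k)" for i
    by (simp add: vS sum_subtractf W_sum rsum sum_distrib_left)
  define w where "w i = center (v i)" for i
  have wsum: "(\<Sum>k<K. w i k) = 0" for i by (simp add: w_def center_sum)
  have cc: "center (v (Suc i)) k = center (\<lambda>k. Wa (v i) k - \<mu> * g i k - r i k) k" if "k < K" for i k
    using vS that by (simp add: center_def)
  have wS: "w (Suc i) k = Wa (w i) k - (\<mu> * center (g i) k + r i k)" if "k < K" for i k
    using cc[OF that, of i] center_W[OF that, of "v i"] center_id[OF rsum, of i]
    by (simp add: w_def center_diff center_scale)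
  have Ew: "Ea (w i) k = Ea (v i) k" if "k < K" for i k
    using center_W[OF that, of "v i"] by (simp add: w_def center_def W_sum)
  have "\<exists>p. (\<Sum>k<K. p k) = 0 \<and> (\<forall>k<K. Ea p k = \<mu> * center (g i) k)" for i
  proof -
    have "(\<Sum>k<K. \<mu> * center (g i) k) = 0" by (simp add: sum_distrib_left[symmetric] center_sum)
    then obtain p where "(\<Sum>k<K. p k) = 0" "\<And>k. k < K \<Longrightarrow> Ea p k = \<mu> * center (g i) k"
      by (rule E_surj) blast
    then show ?thesis by blast
  qed
  then have "\<forall>i. \<exists>p. (\<Sum>k<K. p k) = 0 \<and> (\<forall>k<K. Ea p k = \<mu> * center (g i) k)" by blast
  from choice[OF this] obtain p where pp: "\<forall>i. (\<Sum>k<K. p i k) = 0 \<and> (\<forall>k<K. Ea (p i) k = \<mu> * center (g i) k)" ..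
  then have p: "\<And>i. (\<Sum>k<K. p i k) = 0" "\<And>i k. k < K \<Longrightarrow> Ea (p i) k = \<mu> * center (g i) k" by auto
  \<comment> \<open>The dual variable lies in the range of \<open>E\<close>, as \<open>E\<close>
    applied to the accumulated centered iterates (\<open>Er\<close>). With the correction added, one
    step reads \<open>W w - E q\<close>, the form treated by \<open>energy_step\<close>.\<close>
  define q where "q i k = (\<Sum>m=1..i. w m k) + p i k" for i k
  have Er: "r i k = Ea (\<lambda>k. \<Sum>m=1..i. w m k) k" if "k < K" for i k
  proof (induction i)
    case 0 then show ?case using r0 that by (simp add: app_def)
  next
    case (Suc i)
    have "Ea (\<lambda>k. \<Sum>m=1..Suc i. w m k) k = Ea (\<lambda>k. \<Sum>m=1..i. w m k) k + Ea (w (Suc i)) k"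
      by (simp add: app_add)
    then show ?case using Suc rS[OF that, of i] Ew[OF that] by simp
  qed
  have Eq: "Ea (q i) k = \<mu> * center (g i) k + r i k" if "k < K" for i k
    unfolding q_def[abs_def] app_add using p(2)[OF that, of i] Er[OF that, of i] by simp
  have step: "w (Suc i) k = Wa (w i) k - Ea (q i) k" if "k < K" for i k using wS Eq that by simp
  define d where "d i k = p (Suc i) k - p i k" for i k
  have qS: "q (Suc i) = (\<lambda>k. q i k + w (Suc i) k + d i k)" for i by (simp add: q_def d_def fun_eq_iff)
  define \<Phi> where "\<Phi> i = ip K (q i) (Ea (q i)) + ip K (w i) (Wa (w i))" for i
  have coer: "gam * ip K (w i) (w i) \<le> ip K (w i) (Ea (w i))" for i by (rule E_coercive[OF wsum])
  have A: "\<Phi> (Suc i) + gam * ip K (w (Suc i)) (w (Suc i)) \<le> \<Phi> i + ip K (d i) (d i)" for i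
    using energy_step(2)[of "w (Suc i)" "w i" "q i" "d i", OF step] coer[of "Suc i"]
    unfolding \<Phi>_def qS by linarith
  have nnq: "0 \<le> ip K (\<lambda>k. q i k + w (Suc i) k) (Ea (\<lambda>k. q i k + w (Suc i) k))" for i
    using W_le_one[of "\<lambda>k. q i k + w (Suc i) k"] unfolding ip_diff_r by linarith
  \<comment> \<open>The last iterate is bounded by the energy one step earlier, without a
    perturbation. Iterate \<open>Suc n\<close> depends on the estimates up to \<open>n\<close> only,
    and this is why the drift sum stops below \<open>n\<close>; the integrability induction relies
    on it.\<close>
  have B: "gam * ip K (w (Suc i)) (w (Suc i)) \<le> \<Phi> i" for i
    using energy_step(1)[of "w (Suc i)" "w i" "q i", OF step] coer[of "Suc i"] W_psd[of "w (Suc i)"] nnq[of i]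
    unfolding \<Phi>_def by linarith
  have S: "\<Phi> n + gam * (\<Sum>i=1..n. ip K (w i) (w i)) \<le> \<Phi> 0 + (\<Sum>i<n. ip K (d i) (d i))" for n
  proof (induction n)
    case (Suc n)
    then show ?case using A[of n] by (simp add: distrib_left)
  qed simp
  have w0: "w 0 k = 0" if "k < K" for k using that v0 K2 by (simp add: w_def center_def)
  then have iw0: "ip K (w 0) (w 0) = 0" by (simp add: ip_zero_iff)
  have "(\<Sum>i\<le>n. ip K (w i) (w i)) = ip K (w 0) (w 0) + (\<Sum>i=1..n. ip K (w i) (w i))"
    by (simp add: sum.atMost_shift sum.atLeast1_atMost_eq)
  then have "(\<Sum>i\<le>Suc n. ip K (w i) (w i)) = (\<Sum>i=1..n. ip K (w i) (w i)) + ip K (w (Suc n)) (w (Suc n))"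
    using iw0 by simp
  then have T1: "gam * (\<Sum>i\<le>Suc n. ip K (w i) (w i)) \<le> \<Phi> 0 + (\<Sum>i<n. ip K (d i) (d i))"
    using S[of n] B[of n] by (simp add: distrib_left)
  have "ip K (w 0) (Wa (w 0)) = 0" using w0 by (simp add: ip_def)
  then have "gam * \<Phi> 0 \<le> ip K (Ea (q 0)) (Ea (q 0))" using E_sqnorm(1)[of "q 0"] p(1) by (simp add: \<Phi>_def q_def)
  also have "\<dots> = ip K (\<lambda>k. \<mu> * center (g 0) k) (\<lambda>k. \<mu> * center (g 0) k)"
    by (rule ip_cong) (use Eq[of _ 0] r0 in auto)
  also have "\<dots> = \<mu>\<^sup>2 * ip K (center (g 0)) (center (g 0))" by (simp add: ip_scale ip_scale_r power2_eq_square)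
  finally have P0: "gam * \<Phi> 0 \<le> \<mu>\<^sup>2 * ip K (center (g 0)) (center (g 0))" .
  let ?dg = "\<lambda>i k. g (Suc i) k - g i k"
  \<comment> \<open>The change of the correction is the preimage under \<open>E\<close> of the
    centered change of the estimates.\<close>
  have D: "gam\<^sup>2 * ip K (d i) (d i) \<le> \<mu>\<^sup>2 * ip K (?dg i) (?dg i)" for i
  proof -
    have s: "(\<Sum>k<K. d i k) = 0" by (simp add: d_def sum_subtractf p)
    have "gam\<^sup>2 * ip K (d i) (d i) \<le> ip K (Ea (d i)) (Ea (d i))" by (rule E_sqnorm(2)[OF s])
    also have "\<dots> = ip K (\<lambda>k. \<mu> * center (?dg i) k) (\<lambda>k. \<mu> * center (?dg i) k)"
    proof (rule ip_cong)
      show "Ea (d i) k = \<mu> * center (?dg i) k" if "k < K" for k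
        using p(2)[OF that, of i] p(2)[OF that, of "Suc i"]
        unfolding d_def[abs_def] app_diff center_diff by (simp add: algebra_simps)
      then show "Ea (d i) k = \<mu> * center (?dg i) k" if "k < K" for k using that by blast
    qed
    also have "\<dots> = \<mu>\<^sup>2 * ip K (center (?dg i)) (center (?dg i))" by (simp add: ip_scale ip_scale_r power2_eq_square)
    also have "\<dots> \<le> \<mu>\<^sup>2 * ip K (?dg i) (?dg i)" by (intro mult_left_mono center_sq_le) simp
    finally show ?thesis .
  qed
  have D': "ip K (d i) (d i) \<le> \<mu>\<^sup>2 / gam\<^sup>2 * ip K (?dg i) (?dg i)" for i
    using D[of i] gam by (simp add: field_simps)
  have P0': "\<Phi> 0 \<le> \<mu>\<^sup>2 / gam * ip K (center (g 0)) (center (g 0))" using P0 gam by (simp add: field_simps)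
  have SD: "(\<Sum>i<n. ip K (d i) (d i)) \<le> (\<Sum>i<n. \<mu>\<^sup>2 / gam\<^sup>2 * ip K (?dg i) (?dg i))"
    by (intro sum_mono D')
  have "gam * (\<Sum>i\<le>Suc n. ip K (w i) (w i)) \<le> \<mu>\<^sup>2 / gam * ip K (center (g 0)) (center (g 0))
      + \<mu>\<^sup>2 / gam\<^sup>2 * (\<Sum>i<n. ip K (?dg i) (?dg i))"
    unfolding sum_distrib_left[of "\<mu>\<^sup>2 / gam\<^sup>2"]
    using T1 P0' SD by linarith
  then have "(\<Sum>i\<le>Suc n. ip K (w i) (w i)) \<le> (\<mu>\<^sup>2 / gam * ip K (center (g 0)) (center (g 0))
      + \<mu>\<^sup>2 / gam\<^sup>2 * (\<Sum>i<n. ip K (?dg i) (?dg i))) / gam"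
    using gam by (simp add: pos_le_divide_eq mult.commute)
  also have "\<dots> = \<mu>\<^sup>2 / gam\<^sup>2 * ip K (center (g 0)) (center (g 0)) + \<mu>\<^sup>2 / gam^3 * (\<Sum>i<n. ip K (?dg i) (?dg i))"
    by (simp add: add_divide_distrib power2_eq_square power3_eq_cube)
  finally show "(\<Sum>i\<le>Suc n. ip K (center (v i)) (center (v i)))
      \<le> \<mu>\<^sup>2 / gam\<^sup>2 * ip K (center (g 0)) (center (g 0)) + \<mu>\<^sup>2 / gam^3 * (\<Sum>i<n. ip K (?dg i) (?dg i))"
    by (simp only: w_def)
qed

end

section \<open>Consensus of stacked iterates\<close>

lemma blockc [simp]: "block d V k \<in> carrier_vec d" by (simp add: block_def)
lemma stackc [simp]: "stack K d f \<in> carrier_vec (K * d)" by (simp add: stack_def)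
lemma centroidc [simp]: "centroid K d V \<in> carrier_vec d" by (simp add: centroid_def)
lemma block_index [simp]: "j < d \<Longrightarrow> block d V k $ j = V $ (k * d + j)" by (simp add: block_def)

lemma block_bound: "k < K \<Longrightarrow> j < d \<Longrightarrow> k * d + j < K * d" for k K j d :: nat
proof -
  assume "k < K" "j < d"
  then have "k * d + j < Suc k * d" by simp
  also have "\<dots> \<le> K * d" using \<open>k < K\<close> by (intro mult_right_mono) auto
  finally show ?thesis .
qed

lemma stack_index: "k < K \<Longrightarrow> j < d \<Longrightarrow> stack K d f $ (k * d + j) = f k $ j"
  by (simp add: stack_def block_bound)

lemma block_stack: "k < K \<Longrightarrow> f k \<in> carrier_vec d \<Longrightarrow> block d (stack K d f) k = f k"
  by (rule eq_vecI) (auto simp: stack_index)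

lemma sum_blocks: "(\<Sum>r<K * d. f r) = (\<Sum>k<K. \<Sum>j<d. f (k * d + j))" for f :: "nat \<Rightarrow> 'a :: comm_monoid_add"
proof -
  have "(\<Sum>r<K * d. f r) = (\<Sum>k<K. sum f {k * d..<k * d + d})" by (rule sum.nat_group[symmetric])
  also have "\<dots> = (\<Sum>k<K. \<Sum>j<d. f (k * d + j))"
  proof (rule sum.cong[OF refl])
    fix k
    show "sum f {k * d..<k * d + d} = (\<Sum>j<d. f (k * d + j))"
      using sum.shift_bounds_nat_ivl[of f 0 "k * d" d] by (simp only: add_0 add.commute lessThan_atLeast0)
  qed
  finally show ?thesis .
qed

lemma sqn_stacked: "V \<in> carrier_vec (K * d) \<Longrightarrow> sqn V = (\<Sum>k<K. sqn (block d V k))"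
  by (simp add: sqn_carrier[of V "K * d"] sum_blocks sqn_carrier[OF blockc])

lemma power2_diff2_le: "(a - b)\<^sup>2 \<le> 2 * a\<^sup>2 + 2 * b\<^sup>2" for a b :: real
proof -
  have "0 \<le> (a + b)\<^sup>2" by simp
  then show ?thesis by (simp add: power2_eq_square algebra_simps)
qed

lemma sqn_diff_sum: "x \<in> carrier_vec d \<Longrightarrow> y \<in> carrier_vec d \<Longrightarrow> sqn (x - y) = (\<Sum>j<d. (x $ j - y $ j)\<^sup>2)"
  by (simp add: sqn_carrier[OF minus_carrier_vec])

lemma stacked_eqI:
  assumes "V \<in> carrier_vec (K * d)" "V' \<in> carrier_vec (K * d)"
    and "\<And>k j. k < K \<Longrightarrow> j < d \<Longrightarrow> V $ (k * d + j) = V' $ (k * d + j)"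
  shows "V = V'"
proof (rule eq_vecI)
  fix r assume "r < dim_vec V'"
  then have r: "r < K * d" using assms by simp
  then have d: "0 < d" by (cases d) auto
  have "r div d < K" using r by (simp add: less_mult_imp_div_less)
  moreover have "r mod d < d" using d by simp
  ultimately show "V $ r = V' $ r" using assms(3)[of "r div d" "r mod d"] by simp
qed (use assms in simp)

context mixing
begin

lemma kronc: "kron_id W d \<in> carrier_mat (K * d) (K * d)"
  using Wc by (simp add: kron_id_def)

lemma kron_mult:
  assumes V: "V \<in> carrier_vec (K * d)" and k: "k < K" and j: "j < d"
  shows "(kron_id W d *\<^sub>v V) $ (k * d + j) = Wa (\<lambda>l. V $ (l * d + j)) k"
proof -
  have "(kron_id W d *\<^sub>v V) $ (k * d + j) = (\<Sum>r<K * d. kron_id W d $$ (k * d + j, r) * V $ r)"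
    unfolding mult_vec_app[OF kronc V block_bound[OF k j]] app_def ..
  also have "\<dots> = (\<Sum>l<K. \<Sum>j'<d. kron_id W d $$ (k * d + j, l * d + j') * V $ (l * d + j'))" by (rule sum_blocks)
  also have "\<dots> = (\<Sum>l<K. \<Sum>j'<d. if j' = j then W $$ (k, l) * V $ (l * d + j') else 0)"
  proof (intro sum.cong refl)
    fix l j' assume "l \<in> {..<K}" "j' \<in> {..<d}"
    then have lj: "l < K" "j' < d" by auto
    have "kron_id W d $$ (k * d + j, l * d + j') = W $$ (k, l) * (if j = j' then 1 else 0)"
      using Wc block_bound[OF k j] block_bound[OF lj] j lj by (simp add: kron_id_def)
    then show "kron_id W d $$ (k * d + j, l * d + j') * V $ (l * d + j') = (if j' = j then W $$ (k, l) * V $ (l * d + j') else 0)" by simp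
  qed
  also have "\<dots> = Wa (\<lambda>l. V $ (l * d + j)) k" using j by (simp add: app_def)
  finally show ?thesis .
qed

end

text \<open>One block of variables along a fixed sample path. The sign of \<open>\<mu>\<close> is
  free, so that the ascent in \<open>y\<close> is covered with \<open>- muy h\<close>.\<close>

locale consensus_run = mixing K W for K W +
  fixes d :: nat and R :: rmat and \<mu> :: real and V G D :: "nat \<Rightarrow> rvec" and a u :: rvec
  assumes R: "is_psd_sqrt (K * d) R (1\<^sub>m (K * d) - kron_id W d)"
    and ac: "a \<in> carrier_vec d" and uc: "u \<in> carrier_vec d"
    and Gc: "\<And>i. G i \<in> carrier_vec (K * d)"
    and V0: "V 0 = stack K d (\<lambda>_. a)" and D0: "D 0 = stack K d (\<lambda>_. u)"
    and VS: "\<And>i. V (Suc i) = (kron_id W d *\<^sub>v V i - \<mu> \<cdot>\<^sub>v G i) - R *\<^sub>v D i"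
    and DS: "\<And>i. D (Suc i) = D i + R *\<^sub>v V (Suc i)"
begin

lemma Rmat: "R \<in> carrier_mat (K * d) (K * d)" and RR: "R * R = 1\<^sub>m (K * d) - kron_id W d" and Rsym: "transpose_mat R = R"
  using R by (auto simp: is_psd_sqrt_def psd_mat_def)

lemma Vc: "V i \<in> carrier_vec (K * d)" and Dc: "D i \<in> carrier_vec (K * d)"
proof -
  have "V i \<in> carrier_vec (K * d) \<and> D i \<in> carrier_vec (K * d)"
  proof (induction i)
    case 0 then show ?case by (simp add: V0 D0)
  next
    case (Suc i)
    have "V (Suc i) \<in> carrier_vec (K * d)" unfolding VS using Suc Gc[of i] kronc[of d] Rmat by simp
    then show ?case unfolding DS using Suc Rmat by simp
  qed
  then show "V i \<in> carrier_vec (K * d)" "D i \<in> carrier_vec (K * d)" by auto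
qed

lemma RR_index:
  assumes "Z \<in> carrier_vec (K * d)" "k < K" "j < d"
  shows "(R *\<^sub>v (R *\<^sub>v Z)) $ (k * d + j) = Ea (\<lambda>l. Z $ (l * d + j)) k"
proof -
  have "R *\<^sub>v (R *\<^sub>v Z) = (1\<^sub>m (K * d) - kron_id W d) *\<^sub>v Z"
    using assoc_mult_mat_vec[OF Rmat Rmat assms(1)] RR by simp
  also have "\<dots> = Z - kron_id W d *\<^sub>v Z"
    using minus_mult_distrib_mat_vec[OF one_carrier_mat kronc assms(1)] assms(1) by simp
  finally show ?thesis using kron_mult[OF assms] block_bound[OF assms(2,3)] kronc[of d] by simp
qed

text \<open>\<open>R\<close> is symmetric, so the squared norm of \<open>R Z\<close> is the form of
  \<open>I - W\<close> at \<open>Z\<close>, which is zero for identical blocks. Identical dual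
  blocks thus start the scalar recursion with zero dual term.\<close>

lemma R_const: "R *\<^sub>v stack K d (\<lambda>_. u) = 0\<^sub>v (K * d)"
proof -
  let ?Z = "stack K d (\<lambda>_. u)"
  have Z: "?Z \<in> carrier_vec (K * d)" by simp
  have RZ: "R *\<^sub>v ?Z \<in> carrier_vec (K * d)" using Rmat by simp
  have "R *\<^sub>v (R *\<^sub>v ?Z) = 0\<^sub>v (K * d)"
  proof (rule stacked_eqI)
    fix k j assume kj: "k < K" "j < d"
    have "app K W (\<lambda>l. ?Z $ (l * d + j)) = app K W (\<lambda>_. u $ j)" by (rule app_cong) (simp add: stack_index kj)
    then show "(R *\<^sub>v (R *\<^sub>v ?Z)) $ (k * d + j) = 0\<^sub>v (K * d) $ (k * d + j)"
      using RR_index[OF Z kj] W_const[OF kj(1)] kj by (simp add: stack_index block_bound)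
  qed (use Rmat in auto)
  then have "?Z \<bullet> (R *\<^sub>v (R *\<^sub>v ?Z)) = 0" by simp
  moreover have "(R *\<^sub>v ?Z) \<bullet> (R *\<^sub>v ?Z) = ?Z \<bullet> (R *\<^sub>v (R *\<^sub>v ?Z))"
    using transpose_vec_mult_scalar[OF Rmat Z RZ] Rsym by (simp add: comm_scalar_prod[OF Z mult_mat_vec_carrier[OF Rmat RZ]])
  ultimately have "(\<Sum>r<K * d. ((R *\<^sub>v ?Z) $ r)\<^sup>2) = 0" using sqn_carrier[OF RZ] by (simp add: sqn_def)
  then have "\<forall>r\<in>{..<K * d}. ((R *\<^sub>v ?Z) $ r)\<^sup>2 = 0" by (subst (asm) sum_nonneg_eq_0_iff) auto
  then show ?thesis using RZ Rmat by (intro eq_vecI) auto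
qed

abbreviation "vc j i k \<equiv> V i $ (k * d + j)"
abbreviation "gc j i k \<equiv> G i $ (k * d + j)"

lemma coordinate_consensus:
  assumes j: "j < d"
  shows "(\<Sum>k<K. vc j (Suc i) k) = (\<Sum>k<K. vc j i k) - \<mu> * (\<Sum>k<K. gc j i k)"
    and "(\<Sum>i\<le>Suc n. ip K (center (vc j i)) (center (vc j i)))
      \<le> \<mu>\<^sup>2 / gam\<^sup>2 * ip K (center (gc j 0)) (center (gc j 0))
       + \<mu>\<^sup>2 / gam^3 * (\<Sum>i<n. ip K (\<lambda>k. gc j (Suc i) k - gc j i k) (\<lambda>k. gc j (Suc i) k - gc j i k))"
proof -
  let ?r = "\<lambda>i k. (R *\<^sub>v D i) $ (k * d + j)"
  have c: "kron_id W d *\<^sub>v V i \<in> carrier_vec (K * d)" "R *\<^sub>v D i \<in> carrier_vec (K * d)" "R *\<^sub>v V i \<in> carrier_vec (K * d)" for i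
    by (intro mult_mat_vec_carrier[OF kronc] mult_mat_vec_carrier[OF Rmat] Vc Dc)+
  have v0: "vc j 0 k = a $ j" if "k < K" for k using that j by (simp add: V0 stack_index)
  have r0: "?r 0 k = 0" if "k < K" for k using that j by (simp add: D0 R_const block_bound)
  have vS: "vc j (Suc i) k = Wa (vc j i) k - \<mu> * gc j i k - ?r i k" if k: "k < K" for i k
    unfolding VS using kron_mult[OF Vc k j] block_bound[OF k j] carrier_vecD[OF Gc[of i]] carrier_vecD[OF c(2)[of i]] by simp
  \<comment> \<open>The scalar dual variable is \<open>R\<close> times the dual block: applying
    \<open>R\<close> to the dual update produces \<open>R * R\<close>, and the square root
    disappears in favour of \<open>I - W\<close>.\<close>
  have rS: "?r (Suc i) k = ?r i k + Ea (vc j (Suc i)) k" if k: "k < K" for i k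
  proof -
    have "R *\<^sub>v D (Suc i) = R *\<^sub>v D i + R *\<^sub>v (R *\<^sub>v V (Suc i))"
      unfolding DS by (rule mult_add_distrib_mat_vec[OF Rmat Dc c(3)])
    then show ?thesis using RR_index[OF Vc k j, of "Suc i"] block_bound[OF k j] Rmat by simp
  qed
  note C = consensus[where v = "vc j" and r = ?r and c = "a $ j" and g = "gc j" and \<mu> = \<mu>, OF v0 r0 vS rS]
  show "(\<Sum>k<K. vc j (Suc i) k) = (\<Sum>k<K. vc j i k) - \<mu> * (\<Sum>k<K. gc j i k)" by (rule C(1))
  show "(\<Sum>i\<le>Suc n. ip K (center (vc j i)) (center (vc j i)))
      \<le> \<mu>\<^sup>2 / gam\<^sup>2 * ip K (center (gc j 0)) (center (gc j 0))
       + \<mu>\<^sup>2 / gam^3 * (\<Sum>i<n. ip K (\<lambda>k. gc j (Suc i) k - gc j i k) (\<lambda>k. gc j (Suc i) k - gc j i k))"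
    by (rule C(2))
qed

text \<open>A sum over the agents, not a mean; the division by the number of agents is made in
  \<open>expected_descent\<close>.\<close>

definition "spread Z = (\<Sum>k<K. sqn (block d Z k - centroid K d Z))"

lemma spread_coord: "spread Z = (\<Sum>j<d. ip K (center (\<lambda>k. Z $ (k * d + j))) (center (\<lambda>k. Z $ (k * d + j))))"
proof -
  have "spread Z = (\<Sum>k<K. \<Sum>j<d. (center (\<lambda>k. Z $ (k * d + j)) k)\<^sup>2)"
    unfolding spread_def sqn_diff_sum[OF blockc centroidc] by (intro sum.cong refl) (simp add: center_def centroid_def)
  also have "\<dots> = (\<Sum>j<d. \<Sum>k<K. (center (\<lambda>k. Z $ (k * d + j)) k)\<^sup>2)" by (rule sum.swap)
  finally show ?thesis by (simp add: ip_self)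
qed

lemma spread_nonneg: "0 \<le> spread Z" by (simp add: spread_def sum_nonneg)

lemma centroid_step: "centroid K d (V (Suc i)) = centroid K d (V i) - \<mu> \<cdot>\<^sub>v centroid K d (G i)"
  by (rule eq_vecI) (simp_all add: centroid_def coordinate_consensus(1) diff_divide_distrib)

lemma spread_sum:
  "(\<Sum>i\<le>Suc n. spread (V i)) \<le> \<mu>\<^sup>2 / gam\<^sup>2 * spread (G 0)
     + \<mu>\<^sup>2 / gam^3 * (\<Sum>i<n. \<Sum>k<K. sqn (block d (G (Suc i)) k - block d (G i) k))"
proof -
  have "(\<Sum>i\<le>Suc n. spread (V i)) = (\<Sum>j<d. \<Sum>i\<le>Suc n. ip K (center (vc j i)) (center (vc j i)))"
    unfolding spread_coord by (rule sum.swap)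
  also have "\<dots> \<le> (\<Sum>j<d. \<mu>\<^sup>2 / gam\<^sup>2 * ip K (center (gc j 0)) (center (gc j 0))
       + \<mu>\<^sup>2 / gam^3 * (\<Sum>i<n. ip K (\<lambda>k. gc j (Suc i) k - gc j i k) (\<lambda>k. gc j (Suc i) k - gc j i k)))"
    by (intro sum_mono coordinate_consensus(2)) simp
  also have "\<dots> = \<mu>\<^sup>2 / gam\<^sup>2 * spread (G 0)
       + \<mu>\<^sup>2 / gam^3 * (\<Sum>j<d. \<Sum>i<n. ip K (\<lambda>k. gc j (Suc i) k - gc j i k) (\<lambda>k. gc j (Suc i) k - gc j i k))"
    by (simp add: sum.distrib sum_distrib_left spread_coord)
  also have "(\<Sum>j<d. \<Sum>i<n. ip K (\<lambda>k. gc j (Suc i) k - gc j i k) (\<lambda>k. gc j (Suc i) k - gc j i k))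
     = (\<Sum>i<n. \<Sum>j<d. \<Sum>k<K. (gc j (Suc i) k - gc j i k)\<^sup>2)" unfolding ip_self by (rule sum.swap)
  also have "\<dots> = (\<Sum>i<n. \<Sum>k<K. sqn (block d (G (Suc i)) k - block d (G i) k))"
  proof (rule sum.cong[OF refl])
    fix i
    have "(\<Sum>j<d. \<Sum>k<K. (gc j (Suc i) k - gc j i k)\<^sup>2) = (\<Sum>k<K. \<Sum>j<d. (gc j (Suc i) k - gc j i k)\<^sup>2)" by (rule sum.swap)
    then show "(\<Sum>j<d. \<Sum>k<K. (gc j (Suc i) k - gc j i k)\<^sup>2) = (\<Sum>k<K. sqn (block d (G (Suc i)) k - block d (G i) k))"
      by (simp add: sqn_diff_sum[OF blockc blockc])
  qed
  finally show ?thesis .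
qed

text \<open>The common shift of all agents is orthogonal to the change of the deviations, so the
  averaged estimate enters with its exact factor and only the deviations are split with a factor
  2.\<close>

lemma increment_bound:
  "(\<Sum>k<K. sqn (block d (V (Suc i)) k - block d (V i) k))
     \<le> K * (\<mu>\<^sup>2 * sqn (centroid K d (G i))) + 2 * spread (V (Suc i)) + 2 * spread (V i)"
proof -
  have one: "(\<Sum>k<K. (vc j (Suc i) k - vc j i k)\<^sup>2) \<le> K * (\<mu> * ((\<Sum>k<K. gc j i k) / K))\<^sup>2
      + 2 * ip K (center (vc j (Suc i))) (center (vc j (Suc i))) + 2 * ip K (center (vc j i)) (center (vc j i))" if j: "j < d" for j
  proof -
    define m where "m = - (\<mu> * ((\<Sum>k<K. gc j i k) / K))"
    let ?c = "\<lambda>i k. center (vc j i) k"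
    have e: "vc j (Suc i) k - vc j i k = m + (?c (Suc i) k - ?c i k)" for k
      unfolding center_def m_def coordinate_consensus(1)[OF j] by (simp add: diff_divide_distrib)
    have "(\<Sum>k<K. (vc j (Suc i) k - vc j i k)\<^sup>2) = (\<Sum>k<K. m\<^sup>2 + 2 * m * (?c (Suc i) k - ?c i k) + (?c (Suc i) k - ?c i k)\<^sup>2)"
      unfolding e by (intro sum.cong refl) (simp add: power2_sum)
    also have "\<dots> = K * m\<^sup>2 + 2 * m * (\<Sum>k<K. ?c (Suc i) k - ?c i k) + (\<Sum>k<K. (?c (Suc i) k - ?c i k)\<^sup>2)"
      by (simp add: sum.distrib sum_distrib_left)
    also have "(\<Sum>k<K. ?c (Suc i) k - ?c i k) = 0" by (simp add: sum_subtractf center_sum)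
    finally have A: "(\<Sum>k<K. (vc j (Suc i) k - vc j i k)\<^sup>2) = K * m\<^sup>2 + (\<Sum>k<K. (?c (Suc i) k - ?c i k)\<^sup>2)" by simp
    have "(\<Sum>k<K. (?c (Suc i) k - ?c i k)\<^sup>2) \<le> (\<Sum>k<K. 2 * (?c (Suc i) k)\<^sup>2 + 2 * (?c i k)\<^sup>2)"
      by (intro sum_mono power2_diff2_le)
    then have B: "(\<Sum>k<K. (?c (Suc i) k - ?c i k)\<^sup>2)
        \<le> 2 * ip K (?c (Suc i)) (?c (Suc i)) + 2 * ip K (?c i) (?c i)"
      unfolding ip_self sum.distrib sum_distrib_left[symmetric] .
    have "m\<^sup>2 = (\<mu> * ((\<Sum>k<K. gc j i k) / K))\<^sup>2" by (simp add: m_def)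
    with A B show ?thesis by simp
  qed
  have "(\<Sum>k<K. sqn (block d (V (Suc i)) k - block d (V i) k)) = (\<Sum>k<K. \<Sum>j<d. (vc j (Suc i) k - vc j i k)\<^sup>2)"
    by (simp add: sqn_diff_sum[OF blockc blockc])
  also have "\<dots> = (\<Sum>j<d. \<Sum>k<K. (vc j (Suc i) k - vc j i k)\<^sup>2)" by (rule sum.swap)
  also have "\<dots> \<le> (\<Sum>j<d. K * (\<mu> * ((\<Sum>k<K. gc j i k) / K))\<^sup>2
      + 2 * ip K (center (vc j (Suc i))) (center (vc j (Suc i))) + 2 * ip K (center (vc j i)) (center (vc j i)))"
    by (intro sum_mono one) simp
  also have "\<dots> = K * (\<mu>\<^sup>2 * (\<Sum>j<d. ((\<Sum>k<K. gc j i k) / K)\<^sup>2)) + 2 * spread (V (Suc i)) + 2 * spread (V i)"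
    by (simp only: spread_coord sum.distrib power_mult_distrib sum_distrib_left[symmetric])
  also have "(\<Sum>j<d. ((\<Sum>k<K. gc j i k) / K)\<^sup>2) = sqn (centroid K d (G i))"
    unfolding sqn_carrier[OF centroidc] by (simp add: centroid_def)
  finally show ?thesis .
qed

end

text \<open>Identifies the quantity in \<open>zeta0_sq\<close>, where for EXTRA the matrix
  \<open>Ax\<close> is the identity, with the spread of the initial estimates.\<close>

lemma spread_averaging:
  assumes "Z \<in> carrier_vec (K * d)"
  shows "sqn ((1\<^sub>m (K * d) - averaging K d) *\<^sub>v Z) = (\<Sum>k<K. sqn (block d Z k - centroid K d Z))"
proof -
  let ?A = "averaging K d"
  have A: "?A \<in> carrier_mat (K * d) (K * d)" by (simp add: averaging_def kron_id_def)
  have e: "(1\<^sub>m (K * d) - ?A) *\<^sub>v Z = Z - ?A *\<^sub>v Z"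
    using minus_mult_distrib_mat_vec[OF one_carrier_mat A assms] assms by simp
  have av: "(?A *\<^sub>v Z) $ (k * d + j) = centroid K d Z $ j" if k: "k < K" and j: "j < d" for k j
  proof -
    have "(?A *\<^sub>v Z) $ (k * d + j) = (\<Sum>r<K * d. ?A $$ (k * d + j, r) * Z $ r)"
      unfolding mult_vec_app[OF A assms block_bound[OF k j]] app_def ..
    also have "\<dots> = (\<Sum>l<K. \<Sum>j'<d. ?A $$ (k * d + j, l * d + j') * Z $ (l * d + j'))" by (rule sum_blocks)
    also have "\<dots> = (\<Sum>l<K. \<Sum>j'<d. if j' = j then Z $ (l * d + j') / K else 0)"
    proof (intro sum.cong refl)
      fix l j' assume "l \<in> {..<K}" "j' \<in> {..<d}"
      then have lj: "l < K" "j' < d" by auto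
      have "?A $$ (k * d + j, l * d + j') = 1 / K * (if j = j' then 1 else 0)"
        using block_bound[OF k j] block_bound[OF lj] k j lj by (simp add: kron_id_def averaging_def)
      then show "?A $$ (k * d + j, l * d + j') * Z $ (l * d + j') = (if j' = j then Z $ (l * d + j') / K else 0)" by simp
    qed
    also have "\<dots> = centroid K d Z $ j" using j by (simp add: centroid_def sum_divide_distrib)
    finally show ?thesis .
  qed
  have c: "Z - ?A *\<^sub>v Z \<in> carrier_vec (K * d)" using A assms by (intro minus_carrier_vec mult_mat_vec_carrier)
  have "block d (Z - ?A *\<^sub>v Z) k = block d Z k - centroid K d Z" if "k < K" for k
    using av[OF that] block_bound[OF that] A by (intro eq_vecI) (simp_all add: carrier_vecD[OF centroidc] carrier_vecD[OF blockc])
  then show ?thesis unfolding e sqn_stacked[OF c] by simp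
qed

section \<open>Closing the loop of recursions\<close>

text \<open>Summing the recursion with \<open>(1 - \<beta>)^2 \<le> 1 - \<beta>\<close> turns a
  contraction into a bound on the whole sum with a single factor \<open>\<beta>\<close>.\<close>

lemma geometric_sum_bound:
  fixes a c :: "nat \<Rightarrow> real"
  assumes beta: "0 \<le> \<beta>" "\<beta> \<le> 1" and a: "\<And>i. 0 \<le> a i"
    and step: "\<And>i. i < n \<Longrightarrow> a (Suc i) \<le> (1 - \<beta>)\<^sup>2 * a i + c i"
  shows "\<beta> * (\<Sum>i\<le>n. a i) \<le> a 0 + (\<Sum>i<n. c i)"
proof -
  have sq: "(1 - \<beta>)\<^sup>2 \<le> 1 - \<beta>"
    using beta mult_left_le_one_le[of "1 - \<beta>" "1 - \<beta>"] by (simp add: power2_eq_square)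
  \<comment> \<open>The invariant keeps the undecayed share of the last term, which is the part
    passed on by the next step.\<close>
  have "\<beta> * (\<Sum>i\<le>m. a i) + (1 - \<beta>) * a m \<le> a 0 + (\<Sum>i<m. c i)" if "m \<le> n" for m
    using that
  proof (induction m)
    case 0 then show ?case by (simp add: algebra_simps)
  next
    case (Suc m)
    have "a (Suc m) \<le> (1 - \<beta>) * a m + c m"
      using step[of m] Suc.prems mult_right_mono[OF sq a[of m]] by simp
    moreover have "\<beta> * (\<Sum>i\<le>m. a i) + (1 - \<beta>) * a m \<le> a 0 + (\<Sum>i<m. c i)" using Suc by simp
    ultimately show ?case by (simp add: algebra_simps)
  qed
  moreover have "0 \<le> (1 - \<beta>) * a n" using beta a[of n] by simp
  ultimately show ?thesis by (smt (verit) order_refl)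
qed

text \<open>The deterministic core, in terms of expectations. \<open>a\<close> is the averaged
  error, \<open>u\<close> the error per agent, \<open>w\<close> the drift of the estimates and
  \<open>dev\<close> the spread, the last three per agent. \<open>C0\<close> controls increments
  inside the averaged error, \<open>C1\<close> the feedback of the spread into itself,
  \<open>C2\<close> the spread inside the gradient error, and \<open>C3\<close> trades the noise
  \<open>1 / gam^3\<close> of the spread for the leading noise \<open>T / K\<close>.\<close>

lemma descent_algebra:
  fixes SX SY Gx Gy Ex Ey a u inc dev w :: "nat \<Rightarrow> real" and n T b0 K :: nat
    and L s z gam \<beta> mx my V :: real
  assumes T: "T = Suc n" and K: "1 \<le> K" and b0: "0 < b0" and L: "0 < L" and s: "0 \<le> s" and z: "0 \<le> z"
    and gam: "0 < gam" "gam \<le> 1" and beta: "0 < \<beta>" "\<beta> \<le> 1" and mu: "0 < mx" "mx \<le> my"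
    and nonneg: "\<And>i. 0 \<le> SX i" "\<And>i. 0 \<le> SY i" "\<And>i. 0 \<le> Gx i" "\<And>i. 0 \<le> Gy i" "\<And>i. 0 \<le> Ex i" "\<And>i. 0 \<le> Ey i"
      "\<And>i. 0 \<le> a i" "\<And>i. 0 \<le> u i" "\<And>i. 0 \<le> inc i" "\<And>i. 0 \<le> dev i"
    and H1: "(\<Sum>i\<le>n. mx / 2 * SX i + mx / 8 * Gx i + my / 32 * SY i + my / 32 * Gy i)
        \<le> V + (\<Sum>i\<le>n. mx * Ex i + my / 8 * Ey i)"
    and H2: "\<And>i. i \<le> n \<Longrightarrow> Ex i + Ey i \<le> 2 * a i + 4 * L\<^sup>2 * dev i"
    and H3: "\<And>i. i < n \<Longrightarrow> a (Suc i) \<le> (1 - \<beta>)\<^sup>2 * a i + (4 * L\<^sup>2 / K * inc i + 4 * \<beta>\<^sup>2 * s / K)"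
    and H3': "a 0 \<le> 2 * s / (b0 * K)"
    and H4: "\<And>i. i < n \<Longrightarrow> u (Suc i) \<le> (1 - \<beta>)\<^sup>2 * u i + (4 * L\<^sup>2 * inc i + 4 * \<beta>\<^sup>2 * s)"
    and H4': "u 0 \<le> 2 * s"
    and H5: "\<And>i. i < n \<Longrightarrow> w i \<le> 4 * \<beta>\<^sup>2 * u i + 16 * L\<^sup>2 * inc i + 8 * \<beta>\<^sup>2 * s"
    and H6: "\<And>i. i < n \<Longrightarrow> inc i \<le> mx\<^sup>2 * Gx i + my\<^sup>2 * Gy i + 2 * dev (Suc i) + 2 * dev i"
    and H7: "(\<Sum>i\<le>n. dev i) \<le> my\<^sup>2 / gam\<^sup>2 * z + my\<^sup>2 / gam^3 * (\<Sum>i<n. w i)"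
    and C0: "1024 * L\<^sup>2 * my\<^sup>2 \<le> \<beta> * K" and C1: "256 * L\<^sup>2 * my\<^sup>2 \<le> gam^3" and C2: "128 * L\<^sup>2 * my\<^sup>2 \<le> 1"
    and C3: "K * (1 + 3 * \<beta> * T) \<le> gam^3 * T"
  shows "mx / 32 * (\<Sum>i\<le>n. SX i + SY i) \<le> V + my * (4 * s / (\<beta> * b0 * K) + 9 * \<beta> * s * T / K + z / (8 * gam\<^sup>2))"
proof -
  define A D I Sa Su Sw where "A = (\<Sum>i\<le>n. mx * Gx i + my * Gy i)" "D = (\<Sum>i\<le>n. dev i)" "I = (\<Sum>i<n. inc i)"
    "Sa = (\<Sum>i\<le>n. a i)" "Su = (\<Sum>i\<le>n. u i)" "Sw = (\<Sum>i<n. w i)"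
  note df = A_D_I_Sa_Su_Sw_def
  have my: "0 < my" using mu by simp
  have nT: "real n \<le> real T" using T by simp
  have nn: "0 \<le> A" "0 \<le> D" "0 \<le> I" "0 \<le> Sa" "0 \<le> Su"
    unfolding df using mu my nonneg by (auto intro!: sum_nonneg add_nonneg_nonneg mult_nonneg_nonneg)
  have S1: "\<beta> * Sa \<le> 2 * s / (b0 * K) + 4 * L\<^sup>2 / K * I + 4 * \<beta>\<^sup>2 * s * T / K"
  proof -
    have "\<beta> * Sa \<le> a 0 + (\<Sum>i<n. 4 * L\<^sup>2 / K * inc i + 4 * \<beta>\<^sup>2 * s / K)"
      unfolding df using beta nonneg(7) H3 by (intro geometric_sum_bound) auto
    also have "(\<Sum>i<n. 4 * L\<^sup>2 / K * inc i + 4 * \<beta>\<^sup>2 * s / K) = 4 * L\<^sup>2 / K * I + real n * (4 * \<beta>\<^sup>2 * s / K)"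
      unfolding df sum.distrib sum_distrib_left[symmetric] by simp
    also have "real n * (4 * \<beta>\<^sup>2 * s / K) \<le> real T * (4 * \<beta>\<^sup>2 * s / K)" using nT s K by (intro mult_right_mono) auto
    finally show ?thesis using H3' by (simp add: mult_ac)
  qed
  have S2: "\<beta> * Su \<le> 2 * s + 4 * L\<^sup>2 * I + 4 * \<beta>\<^sup>2 * s * T"
  proof -
    have "\<beta> * Su \<le> u 0 + (\<Sum>i<n. 4 * L\<^sup>2 * inc i + 4 * \<beta>\<^sup>2 * s)"
      unfolding df using beta nonneg(8) H4 by (intro geometric_sum_bound) auto
    also have "(\<Sum>i<n. 4 * L\<^sup>2 * inc i + 4 * \<beta>\<^sup>2 * s) = 4 * L\<^sup>2 * I + real n * (4 * \<beta>\<^sup>2 * s)"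
      unfolding df sum.distrib sum_distrib_left[symmetric] by simp
    also have "real n * (4 * \<beta>\<^sup>2 * s) \<le> real T * (4 * \<beta>\<^sup>2 * s)" using nT s by (intro mult_right_mono) auto
    finally show ?thesis using H4' by (simp add: mult_ac)
  qed
  \<comment> \<open>The drift contains \<open>\<beta>^2\<close> times the errors per agent, while
    their sum is controlled only with one factor \<open>\<beta>\<close>; the other
    \<open>\<beta>\<close> remains and is at most one, so the increments return with a bounded
    factor.\<close>
  have S3: "Sw \<le> 32 * L\<^sup>2 * I + 8 * \<beta> * s + 24 * \<beta>\<^sup>2 * s * T"
  proof -
    have "Sw \<le> (\<Sum>i<n. 4 * \<beta>\<^sup>2 * u i + 16 * L\<^sup>2 * inc i + 8 * \<beta>\<^sup>2 * s)" unfolding df by (intro sum_mono H5) simp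
    also have "\<dots> = 4 * \<beta>\<^sup>2 * (\<Sum>i<n. u i) + 16 * L\<^sup>2 * I + real n * (8 * \<beta>\<^sup>2 * s)"
      unfolding df sum.distrib sum_distrib_left[symmetric] by simp
    finally have 1: "Sw \<le> 4 * \<beta>\<^sup>2 * (\<Sum>i<n. u i) + 16 * L\<^sup>2 * I + real n * (8 * \<beta>\<^sup>2 * s)" .
    have "(\<Sum>i<n. u i) \<le> Su" unfolding df by (rule sum_mono2) (auto simp: nonneg)
    then have "4 * \<beta>\<^sup>2 * (\<Sum>i<n. u i) \<le> 4 * \<beta> * (\<beta> * Su)" using beta by (simp add: power2_eq_square mult.assoc)
    also have "\<dots> \<le> 4 * \<beta> * (2 * s + 4 * L\<^sup>2 * I + 4 * \<beta>\<^sup>2 * s * T)" using S2 beta by (intro mult_left_mono) auto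
    also have "\<dots> = 8 * \<beta> * s + \<beta> * (16 * L\<^sup>2 * I) + \<beta> * (16 * \<beta>\<^sup>2 * s * T)" by (simp add: algebra_simps)
    also have "\<dots> \<le> 8 * \<beta> * s + 1 * (16 * L\<^sup>2 * I) + 1 * (16 * \<beta>\<^sup>2 * s * T)"
      using beta nn s by (intro add_mono mult_right_mono order_refl) auto
    finally have 2: "4 * \<beta>\<^sup>2 * (\<Sum>i<n. u i) \<le> 8 * \<beta> * s + 16 * L\<^sup>2 * I + 16 * \<beta>\<^sup>2 * s * T" by simp
    have "real n * (8 * \<beta>\<^sup>2 * s) \<le> real T * (8 * \<beta>\<^sup>2 * s)" using nT s by (intro mult_right_mono) auto
    then have 3: "real n * (8 * \<beta>\<^sup>2 * s) \<le> 8 * \<beta>\<^sup>2 * s * T" by (simp add: mult_ac)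
    have 4: "24 * \<beta>\<^sup>2 * s * T = 16 * \<beta>\<^sup>2 * s * T + 8 * \<beta>\<^sup>2 * s * T" by simp
    have 5: "32 * L\<^sup>2 * I = 16 * L\<^sup>2 * I + 16 * L\<^sup>2 * I" by simp
    show ?thesis using 1 2 3 unfolding 4 5 by linarith
  qed
  \<comment> \<open>\<open>A\<close> carries one power of the step sizes and the increments two;
    bounding \<open>mx\<close> by \<open>my\<close> leaves the factor \<open>my\<close>. Shifting
    the index of \<open>dev\<close> drops only a nonnegative term.\<close>
  have S4: "I \<le> my * A + 4 * D"
  proof -
    have "I \<le> (\<Sum>i<n. mx\<^sup>2 * Gx i + my\<^sup>2 * Gy i + 2 * dev (Suc i) + 2 * dev i)" unfolding df by (intro sum_mono H6) simp
    also have "\<dots> \<le> (\<Sum>i<n. my * (mx * Gx i + my * Gy i) + 2 * dev (Suc i) + 2 * dev i)"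
    proof (intro sum_mono add_mono order_refl)
      fix i have "mx * (mx * Gx i) \<le> my * (mx * Gx i)" using mu nonneg by (intro mult_right_mono) auto
      then show "mx\<^sup>2 * Gx i + my\<^sup>2 * Gy i \<le> my * (mx * Gx i + my * Gy i)"
        by (simp add: power2_eq_square distrib_left mult.assoc)
    qed
    also have "\<dots> = my * (\<Sum>i<n. mx * Gx i + my * Gy i) + 2 * (\<Sum>i<n. dev (Suc i)) + 2 * (\<Sum>i<n. dev i)"
      unfolding sum.distrib sum_distrib_left[symmetric] by (simp add: sum.distrib)
    finally have 1: "I \<le> my * (\<Sum>i<n. mx * Gx i + my * Gy i) + 2 * (\<Sum>i<n. dev (Suc i)) + 2 * (\<Sum>i<n. dev i)" .
    have "(\<Sum>i<n. mx * Gx i + my * Gy i) \<le> A" unfolding df by (rule sum_mono2) (use mu my nonneg in auto)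
    then have 2: "my * (\<Sum>i<n. mx * Gx i + my * Gy i) \<le> my * A" using my by simp
    have 3: "(\<Sum>i<n. dev i) \<le> D" unfolding df by (rule sum_mono2) (auto simp: nonneg)
    have "D = dev 0 + (\<Sum>i<n. dev (Suc i))" unfolding df by (rule sum.atMost_shift)
    then have 4: "(\<Sum>i<n. dev (Suc i)) \<le> D" using nonneg(10)[of 0] by simp
    show ?thesis using 1 2 3 4 by linarith
  qed
  define c where "c = my\<^sup>2 / gam^3"
  have c: "0 < c" using my gam by (simp add: c_def)
  have g3: "0 < gam^3" using gam by simp
  have C1': "256 * L\<^sup>2 * c \<le> 1" unfolding c_def using C1 g3 by (simp add: field_simps)
  \<comment> \<open>The loop closes here: increments contain the spread, the drift contains the
    increments, and the spread contains the drift. By \<open>C1\<close> the spread returns with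
    factor at most one half and is moved to the left.\<close>
  have S5: "D \<le> 2 * (my\<^sup>2 / gam\<^sup>2 * z) + 64 * c * L\<^sup>2 * (my * A) + c * s * (16 * \<beta> + 48 * \<beta>\<^sup>2 * T)"
  proof -
    have "D \<le> my\<^sup>2 / gam\<^sup>2 * z + c * Sw" using H7 by (simp add: df c_def)
    also have "c * Sw \<le> c * (32 * L\<^sup>2 * (my * A + 4 * D) + 8 * \<beta> * s + 24 * \<beta>\<^sup>2 * s * T)"
    proof (rule mult_left_mono)
      have "32 * L\<^sup>2 * I \<le> 32 * L\<^sup>2 * (my * A + 4 * D)" using S4 by (intro mult_left_mono) auto
      then show "Sw \<le> 32 * L\<^sup>2 * (my * A + 4 * D) + 8 * \<beta> * s + 24 * \<beta>\<^sup>2 * s * T" using S3 by linarith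
    qed (use c in simp)
    also have "c * (32 * L\<^sup>2 * (my * A + 4 * D) + 8 * \<beta> * s + 24 * \<beta>\<^sup>2 * s * T)
      = 32 * c * L\<^sup>2 * (my * A) + (256 * L\<^sup>2 * c) * D / 2 + c * s * (8 * \<beta> + 24 * \<beta>\<^sup>2 * T)" by (simp add: algebra_simps)
    finally have "D \<le> my\<^sup>2 / gam\<^sup>2 * z + (32 * c * L\<^sup>2 * (my * A) + (256 * L\<^sup>2 * c) * D / 2 + c * s * (8 * \<beta> + 24 * \<beta>\<^sup>2 * T))" by simp
    moreover have "(256 * L\<^sup>2 * c) * D \<le> 1 * D" using C1' nn by (intro mult_right_mono) auto
    ultimately have "D \<le> 2 * (my\<^sup>2 / gam\<^sup>2 * z) + 2 * (32 * c * L\<^sup>2 * (my * A)) + 2 * (c * s * (8 * \<beta> + 24 * \<beta>\<^sup>2 * T))" by argo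
    then show ?thesis by (simp add: algebra_simps)
  qed
  have K0: "0 < real K" using K by simp
  have bK: "0 < \<beta> * K" using beta K0 by simp
  have S6: "mx / 32 * (\<Sum>i\<le>n. SX i + SY i) + A / 32 \<le> V + my * (2 * Sa + 4 * L\<^sup>2 * D)"
  proof -
    have "mx / 32 * (\<Sum>i\<le>n. SX i + SY i) + A / 32 = (\<Sum>i\<le>n. mx / 32 * (SX i + SY i) + (mx * Gx i + my * Gy i) / 32)"
    proof -
      have "(\<Sum>i\<le>n. mx / 32 * (SX i + SY i)) = mx / 32 * (\<Sum>i\<le>n. SX i + SY i)"
        "(\<Sum>i\<le>n. (mx * Gx i + my * Gy i) / 32) = (\<Sum>i\<le>n. mx * Gx i + my * Gy i) / 32"
        by (rule sum_distrib_left[symmetric], rule sum_divide_distrib[symmetric])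
      then show ?thesis unfolding df by (simp only: sum.distrib)
    qed
    also have "\<dots> \<le> (\<Sum>i\<le>n. mx / 2 * SX i + mx / 8 * Gx i + my / 32 * SY i + my / 32 * Gy i)"
    proof (rule sum_mono)
      fix i
      have "mx * SY i \<le> my * SY i" "0 \<le> mx * SX i" "0 \<le> mx * Gx i" using mu nonneg by (auto intro: mult_right_mono)
      then show "mx / 32 * (SX i + SY i) + (mx * Gx i + my * Gy i) / 32 \<le> mx / 2 * SX i + mx / 8 * Gx i + my / 32 * SY i + my / 32 * Gy i"
        unfolding times_divide_eq_left distrib_left by argo
    qed
    also have "\<dots> \<le> V + (\<Sum>i\<le>n. mx * Ex i + my / 8 * Ey i)" by (rule H1)
    also have "(\<Sum>i\<le>n. mx * Ex i + my / 8 * Ey i) \<le> (\<Sum>i\<le>n. my * (2 * a i + 4 * L\<^sup>2 * dev i))"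
    proof (rule sum_mono)
      fix i assume "i \<in> {..n}"
      then have i: "i \<le> n" by simp
      have "mx * Ex i \<le> my * Ex i" "my / 8 * Ey i \<le> my * Ey i" using mu my nonneg by (auto intro!: mult_right_mono)
      then have "mx * Ex i + my / 8 * Ey i \<le> my * (Ex i + Ey i)" by (simp only: distrib_left add_mono)
      also have "\<dots> \<le> my * (2 * a i + 4 * L\<^sup>2 * dev i)" using H2[OF i] my by (intro mult_left_mono) auto
      finally show "mx * Ex i + my / 8 * Ey i \<le> my * (2 * a i + 4 * L\<^sup>2 * dev i)" .
    qed
    also have "\<dots> = my * (2 * Sa + 4 * L\<^sup>2 * D)" unfolding df sum_distrib_left[symmetric] sum.distrib ..
    finally show ?thesis by simp
  qed
  \<comment> \<open>Weight of the increments in the averaged error after division by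
    \<open>\<beta>\<close>; \<open>C0\<close> says that it is at most
    \<open>1 / (1024 * L^2)\<close>.\<close>
  define q where "q = my\<^sup>2 / (\<beta> * K)"
  have q: "1024 * L\<^sup>2 * q \<le> 1" unfolding q_def using C0 bK by (simp add: field_simps)
  have q0: "0 \<le> q" using bK by (simp add: q_def)
  have S7: "my * (2 * Sa) \<le> 4 * my * s / (\<beta> * b0 * K) + 8 * L\<^sup>2 * q * A + 32 * L\<^sup>2 * q * D / my + 8 * my * \<beta> * s * T / K"
  proof -
    have "4 * L\<^sup>2 / K * I \<le> 4 * L\<^sup>2 / K * (my * A + 4 * D)" using S4 K0 by (intro mult_left_mono) auto
    then have "\<beta> * Sa \<le> 2 * s / (b0 * K) + 4 * L\<^sup>2 / K * (my * A + 4 * D) + 4 * \<beta>\<^sup>2 * s * T / K" using S1 by linarith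
    then have "(2 * my / \<beta>) * (\<beta> * Sa) \<le> (2 * my / \<beta>) * (2 * s / (b0 * K) + 4 * L\<^sup>2 / K * (my * A + 4 * D) + 4 * \<beta>\<^sup>2 * s * T / K)"
      using my beta by (intro mult_left_mono) auto
    moreover have "(2 * my / \<beta>) * (\<beta> * Sa) = my * (2 * Sa)" using beta by simp
    moreover have "(2 * my / \<beta>) * (2 * s / (b0 * K) + 4 * L\<^sup>2 / K * (my * A + 4 * D) + 4 * \<beta>\<^sup>2 * s * T / K)
       = 4 * my * s / (\<beta> * b0 * K) + 8 * L\<^sup>2 * q * A + 32 * L\<^sup>2 * q * D / my + 8 * my * \<beta> * s * T / K"
    proof -
      have e1: "(2 * my / \<beta>) * (2 * s / (b0 * K)) = 4 * my * s / (\<beta> * b0 * K)" by simp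
      have e2: "(2 * my / \<beta>) * (4 * L\<^sup>2 / K * (my * A)) = 8 * L\<^sup>2 * q * A" by (simp add: q_def power2_eq_square)
      have e3: "(2 * my / \<beta>) * (4 * L\<^sup>2 / K * (4 * D)) = 32 * L\<^sup>2 * q * D / my" using my by (simp add: q_def power2_eq_square)
      have e4: "(2 * my / \<beta>) * (4 * \<beta>\<^sup>2 * s * T / K) = 8 * my * \<beta> * s * T / K" using beta by (simp add: power2_eq_square)
      show ?thesis unfolding distrib_left e1 e2 e3 e4 by simp
    qed
    ultimately show ?thesis by simp
  qed
  \<comment> \<open>The spread reaches the gradient error twice, through the increments and through
    the distance of the agents to the centroid; each route costs at most
    \<open>D / (32 * my)\<close>.\<close>
  have S8: "32 * L\<^sup>2 * q * D / my + my * (4 * L\<^sup>2 * D) \<le> D / (16 * my)"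
  proof -
    have "32 * L\<^sup>2 * q * D \<le> 1 / 32 * D" using mult_right_mono[OF q nn(2)] by simp
    then have "32 * L\<^sup>2 * q * D / my \<le> 1 / 32 * D / my" using my by (intro divide_right_mono) auto
    moreover have "my * (4 * L\<^sup>2 * D) = (128 * L\<^sup>2 * my\<^sup>2) * (1 / 32 * D / my)" using my by (simp add: power2_eq_square)
    moreover have "\<dots> \<le> 1 * (1 / 32 * D / my)" using C2 nn my by (intro mult_right_mono) auto
    moreover have "D / (16 * my) = 1 / 32 * D / my + 1 * (1 / 32 * D / my)" by simp
    ultimately show ?thesis by linarith
  qed
  have S9: "D / (16 * my) \<le> my * (z / (8 * gam\<^sup>2)) + A / 64 + my * (\<beta> * s * T / K)"
  proof -
    have "D / (16 * my) \<le> (2 * (my\<^sup>2 / gam\<^sup>2 * z) + 64 * c * L\<^sup>2 * (my * A) + c * s * (16 * \<beta> + 48 * \<beta>\<^sup>2 * T)) / (16 * my)"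
      using S5 my by (intro divide_right_mono) auto
    also have "\<dots> = my * (z / (8 * gam\<^sup>2)) + (256 * L\<^sup>2 * c) * A / 64 + my * s * ((\<beta> + 3 * \<beta>\<^sup>2 * T) / gam^3)"
    proof -
      have e1: "2 * (my\<^sup>2 / gam\<^sup>2 * z) / (16 * my) = my * (z / (8 * gam\<^sup>2))" using my by (simp add: power2_eq_square)
      have e2: "64 * c * L\<^sup>2 * (my * A) / (16 * my) = (256 * L\<^sup>2 * c) * A / 64" using my by simp
      have "c * s * (16 * \<beta> + 48 * \<beta>\<^sup>2 * T) = (16 * my) * (my * s * ((\<beta> + 3 * \<beta>\<^sup>2 * T) / gam^3))"
        unfolding c_def by (simp add: power2_eq_square field_simps)
      then have e3: "c * s * (16 * \<beta> + 48 * \<beta>\<^sup>2 * T) / (16 * my) = my * s * ((\<beta> + 3 * \<beta>\<^sup>2 * T) / gam^3)" using my by simp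
      show ?thesis unfolding add_divide_distrib e1 e2 e3 ..
    qed
    also have "(256 * L\<^sup>2 * c) * A / 64 \<le> A / 64"
      using divide_right_mono[OF mult_right_mono[OF C1' nn(1)], of 64] by simp
    \<comment> \<open>By \<open>C3\<close> the noise that passes through the spread is no larger
      than the noise of the averaged estimate; it raises the constant of the latter from 8 to
      9.\<close>
    also have "my * s * ((\<beta> + 3 * \<beta>\<^sup>2 * T) / gam^3) \<le> my * s * (\<beta> * T / K)"
    proof (rule mult_left_mono)
      have "\<beta> * (K * (1 + 3 * \<beta> * T)) \<le> \<beta> * (gam^3 * T)" using C3 beta by (intro mult_left_mono) auto
      then have "(\<beta> + 3 * \<beta>\<^sup>2 * T) * K \<le> \<beta> * T * gam^3" by (simp add: power2_eq_square algebra_simps)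
      then show "(\<beta> + 3 * \<beta>\<^sup>2 * T) / gam^3 \<le> \<beta> * T / K" using K0 g3 by (simp add: frac_le_eq divide_le_0_iff divide_le_eq pos_le_divide_eq mult.commute)
    qed (use my s in simp)
    finally show ?thesis by (simp add: mult_ac)
  qed
  \<comment> \<open>The descent supplied \<open>A / 32\<close>. The averaged error uses
    \<open>A / 128\<close> of it and the spread \<open>A / 64\<close>.\<close>
  have "8 * L\<^sup>2 * q * A \<le> A / 128" using mult_right_mono[OF q nn(1)] by simp
  moreover have "my * (2 * Sa + 4 * L\<^sup>2 * D) = my * (2 * Sa) + my * (4 * L\<^sup>2 * D)" by (simp add: distrib_left)
  moreover have "A / 128 + A / 64 \<le> A / 32" using nn by simp
  ultimately have "mx / 32 * (\<Sum>i\<le>n. SX i + SY i) \<le> V + 4 * my * s / (\<beta> * b0 * K) + 8 * my * \<beta> * s * T / K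
      + my * (z / (8 * gam\<^sup>2)) + my * (\<beta> * s * T / K)"
    using S6 S7 S8 S9 by linarith
  also have "\<dots> = V + my * (4 * s / (\<beta> * b0 * K) + 9 * \<beta> * s * T / K + z / (8 * gam\<^sup>2))"
  proof -
    have e: "my * (9 * \<beta> * s * T / K) = 8 * my * \<beta> * s * T / K + my * (\<beta> * s * T / K)" by (simp add: add_divide_distrib[symmetric])
    show ?thesis unfolding distrib_left e by simp
  qed
  finally show ?thesis .
qed

section \<open>Orders of the terms\<close>

text \<open>All exponents in the statement are multiples of one third. Passing to cube roots makes
  every comparison one between monomials.\<close>

lemma cube_root_powers:
  fixes x :: nat
  assumes "1 \<le> x"
  obtains c :: real where "1 \<le> c" "real x = c^3" "real x powr (1/3) = c" "real x powr (2/3) = c^2"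
    "real x powr (4/3) = c^4" "real x powr (5/3) = c^5" "real x powr (7/3) = c^7"
proof
  let ?c = "real x powr (1/3)"
  have x: "0 < real x" using assms by simp
  have p: "real x powr (real n / 3) = ?c ^ n" for n :: nat
    using x by (simp add: powr_powr[symmetric] powr_realpow[symmetric] powr_powr)
  show "1 \<le> ?c" using assms by (simp add: ge_one_powr_ge_zero)
  show "real x = ?c ^ 3" using p[of 3] x by simp
  show "real x powr (1/3) = ?c" ..
  show "real x powr (2/3) = ?c^2" using p[of 2] by simp
  show "real x powr (4/3) = ?c^4" using p[of 4] by simp
  show "real x powr (5/3) = ?c^5" using p[of 5] by simp
  show "real x powr (7/3) = ?c^7" using p[of 7] by simp
qed

text \<open>In terms of \<open>a = K\<^sup>1\<^sup>/\<^sup>3\<close>, \<open>b = T\<^sup>1\<^sup>/\<^sup>3\<close> and \<open>g = 1 - \<lambda>\<close>, each remaining term exceeds the leading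
  order by a power of \<open>a\<^sup>2 / (b g)\<^sup>2\<close> up to factors at most one.\<close>

lemma rest_terms_le:
  assumes K: "1 \<le> K" and T: "1 \<le> T" and lam: "0 \<le> lam" "lam < 1" and s: "0 \<le> s" and z: "0 \<le> z"
    and large: "real K ^ 2 / (1 - lam) ^ 6 \<le> q ^ 3 * real T" and q: "0 \<le> q" "q \<le> 1"
  shows "rest_terms K T \<kappa> lam (ennreal s) (ennreal z) \<le> ennreal (\<kappa>\<^sup>2 / (real K * real T) powr (2/3) * (2 * q * (s + z)))"
proof -
  obtain a where a: "1 \<le> a" "real K = a^3" "real K powr (2/3) = a^2" "real K powr (5/3) = a^5"
    using cube_root_powers[OF K] by metis
  obtain b where b: "1 \<le> b" "real T = b^3" "real T powr (2/3) = b^2" "real T powr (4/3) = b^4" "real T powr (7/3) = b^7"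
    using cube_root_powers[OF T] by metis
  define g where "g = 1 - lam"
  have g: "0 < g" "g \<le> 1" using lam by (auto simp: g_def)
  have KT: "(real K * real T) powr (2/3) = a^2 * b^2" unfolding powr_mult a(3) b(3) ..
  \<comment> \<open>The cube of \<open>r\<close> is \<open>K^2 / ((1 - lam)^6 * T)\<close>, so the
    hypothesis \<open>large\<close> says exactly that \<open>r \<le> q\<close>.\<close>
  define r where "r = a^2 / (b * g^2)"
  have ap: "0 < a" and bp: "0 < b" using a(1) b(1) by auto
  have r0: "0 \<le> r" using ap bp g by (simp add: r_def)
  have "r ^ 3 \<le> q ^ 3"
  proof -
    have "r ^ 3 = (real K ^ 2 / g ^ 6) / real T"
      unfolding r_def a(2) b(2) by (simp add: power_divide power_mult_distrib power_mult[symmetric] mult.commute)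
    also have "\<dots> \<le> q ^ 3" using large bp unfolding g_def[symmetric] b(2) by (simp only: pos_divide_le_eq zero_less_power)
    finally show ?thesis .
  qed
  then have rq: "r \<le> q" using q power_mono_iff[of r q 3] r0 by simp
  then have r1: "r \<le> 1" using q by simp
  have p: "x ^ n \<le> 1" if "0 \<le> x" "x \<le> 1" for x :: real and n using that by (simp add: power_le_one)
  have ia: "1 / a ^ 3 \<le> 1" using one_le_power[OF a(1), of 3] ap by (simp add: divide_le_eq_1)
  let ?l = "1 / (a^2 * b^2)"
  have l0: "0 < ?l" using ap bp by simp
  \<comment> \<open>Each term is the leading order times \<open>r\<close> times a factor at most
    one. The terms with \<open>K\<close> in the numerator produce \<open>1 / a^3\<close>, harmless
    since there is at least one agent.\<close>
  have t1: "1 / (b^3 * g^2) = ?l * r" using ap bp g unfolding r_def by (simp add: field_simps eval_nat_numeral)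
  have t2: "a^2 / (b^4 * g^3) = ?l * (r * (r * g))" using ap bp g unfolding r_def by (simp add: field_simps eval_nat_numeral)
  have t3: "a^3 / ((b^3)^2 * g^3) = ?l * (r * (r^3 * g^5 * (1 / a^3)))" using ap bp g unfolding r_def by (simp add: field_simps eval_nat_numeral)
  have t4: "a^5 / (b^7 * g^4) = ?l * (r * (r^4 * g^6 * (1 / a^3)))" using ap bp g unfolding r_def by (simp add: field_simps eval_nat_numeral)
  have u2: "r * (r * g) \<le> q" "r * (r^3 * g^5 * (1 / a^3)) \<le> q" "r * (r^4 * g^6 * (1 / a^3)) \<le> q"
  proof -
    have one: "x * y \<le> 1" if "0 \<le> x" "x \<le> 1" "0 \<le> y" "y \<le> 1" for x y :: real
      using mult_mono[OF that(2,4)] that by simp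
    have "r * g \<le> 1" using r0 r1 g by (intro one) auto
    moreover have "r^3 * g^5 * (1 / a^3) \<le> 1" using r0 r1 g ap ia p[of r 3] p[of g 5] by (intro one mult_nonneg_nonneg) auto
    moreover have "r^4 * g^6 * (1 / a^3) \<le> 1" using r0 r1 g ap ia p[of r 4] p[of g 6] by (intro one mult_nonneg_nonneg) auto
    moreover have "r * x \<le> q" if "x \<le> 1" for x using mult_left_mono[OF that r0] rq by simp
    ultimately show "r * (r * g) \<le> q" "r * (r^3 * g^5 * (1 / a^3)) \<le> q" "r * (r^4 * g^6 * (1 / a^3)) \<le> q"
      by blast+
  qed
  have "rest_terms K T \<kappa> lam (ennreal s) (ennreal z)
     = ennreal (\<kappa>\<^sup>2 * (1 / (b^3 * g^2)) * z + \<kappa>\<^sup>2 * (a^2 / (b^4 * g^3)) * s + \<kappa>\<^sup>2 * (a^3 / ((b^3)^2 * g^3)) * s + \<kappa>\<^sup>2 * (a^5 / (b^7 * g^4)) * z)"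
    unfolding rest_terms_def g_def[symmetric] a(3,4) b(4,5) unfolding a(2) b(2)
    using ap bp g s z by (simp add: ennreal_mult[symmetric] ennreal_plus[symmetric] del: ennreal_plus)
  also have "\<dots> \<le> ennreal (\<kappa>\<^sup>2 * (?l * q) * z + \<kappa>\<^sup>2 * (?l * q) * s + \<kappa>\<^sup>2 * (?l * q) * s + \<kappa>\<^sup>2 * (?l * q) * z)"
    unfolding t1 t2 t3 t4
    by (intro ennreal_leI add_mono mult_right_mono mult_left_mono rq u2 s z less_imp_le[OF l0] zero_le_power2)
  also have "\<kappa>\<^sup>2 * (?l * q) * z + \<kappa>\<^sup>2 * (?l * q) * s + \<kappa>\<^sup>2 * (?l * q) * s + \<kappa>\<^sup>2 * (?l * q) * z
     = \<kappa>\<^sup>2 / (real K * real T) powr (2/3) * (2 * q * (s + z))" unfolding KT by (simp add: algebra_simps add_divide_distrib)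
  finally show ?thesis .
qed

lemma lead_terms_eq:
  assumes "0 \<le> G" "0 \<le> \<Delta>" "0 \<le> s"
  shows "lead_terms K T \<kappa> (ennreal G) (ennreal \<Delta>) (ennreal s) = ennreal (\<kappa>\<^sup>2 / (real K * real T) powr (2/3) * (G + \<Delta> + s))"
  unfolding lead_terms_def using assms
  by (simp add: mult.commute[of "real T"] ennreal_mult[symmetric] ennreal_plus[symmetric] distrib_left del: ennreal_plus)

lemma transient_order_ge: "real K ^ 2 / (1 - lam) ^ 6 \<le> transient_order K lam"
  unfolding transient_order_def by (rule Max_ge) auto

text \<open>The last of the four candidates dominates: it has the largest power of \<open>K\<close>,
  which is at least one, and the largest inverse power of \<open>1 - lam\<close>, which is at most
  one.\<close>

lemma transient_order_le:
  assumes K: "2 \<le> K" and lam: "0 \<le> lam" "lam < 1"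
  shows "transient_order K lam \<le> real K ^ 2 / (1 - lam) ^ 6"
proof -
  have g: "0 < 1 - lam" "1 - lam \<le> 1" using lam by auto
  have le: "real K powr x / (1 - lam) powr y \<le> real K ^ 2 / (1 - lam) ^ 6" if "x \<le> 2" "y \<le> 6" for x y
  proof (rule frac_le)
    show "real K powr x \<le> real K ^ 2" using K that powr_mono[of x 2 "real K"] by (simp add: powr_numeral)
    show "(1 - lam) ^ 6 \<le> (1 - lam) powr y" using g that powr_mono'[of y 6 "1 - lam"] by (simp add: powr_numeral)
  qed (use g in auto)
  have "real K ^ 2 / (1 - lam) powr (45/10) \<le> real K ^ 2 / (1 - lam) ^ 6"
    using le[of 2 "45/10"] K by (simp add: powr_numeral)
  then show ?thesis unfolding transient_order_def using le[of "7/5" "24/10"] le[of "5/4" "9/4"] by simp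
qed

definition settled where
  "settled G \<Delta> s z K \<kappa> lam t \<longleftrightarrow> (\<forall>T\<ge>t. rest_terms K T \<kappa> lam (ennreal s) (ennreal z)
                          \<le> lead_terms K T \<kappa> (ennreal G) (ennreal \<Delta>) (ennreal s))"

text \<open>Past a multiple of the transient order the ratio \<open>r\<close> of
  \<open>rest_terms_le\<close> is below any prescribed \<open>q\<close>; the factor
  \<open>\<kappa>\<^sup>2\<close> is common to both sides.\<close>

lemma transient_sufficient:
  assumes nn: "0 \<le> G" "0 \<le> \<Delta>" "0 \<le> s" "0 \<le> z" and pos: "0 < G + \<Delta> + s"
  shows "\<exists>c>0. \<forall>K \<kappa> lam t. 2 \<le> K \<and> 0 < \<kappa> \<and> 0 \<le> lam \<and> lam < 1 \<and> c * transient_order K lam \<le> real t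
     \<longrightarrow> settled G \<Delta> s z K \<kappa> lam t"
proof -
  define S where "S = G + \<Delta> + s"
  \<comment> \<open>Chosen so that \<open>2 * q * (s + z)\<close> is at most the sum
    \<open>S\<close> of the leading constants; the threshold constant is then
    \<open>1 / q ^ 3\<close>.\<close>
  define q where "q = S / (S + 2 * (s + z))"
  have S: "0 < S" "0 < S + 2 * (s + z)" using pos nn by (auto simp: S_def)
  have q: "0 < q" "q \<le> 1" using S nn by (auto simp: q_def)
  have qs: "2 * q * (s + z) \<le> S"
  proof -
    have "2 * (s + z) / (S + 2 * (s + z)) \<le> 1" using S by simp
    then have "S * (2 * (s + z) / (S + 2 * (s + z))) \<le> S * 1" using S by (intro mult_left_mono) auto
    moreover have "2 * (S / D) * (s + z) = S * (2 * (s + z) / D)" for D by simp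
    ultimately show ?thesis by (simp only: q_def mult_1_right)
  qed
  have main: "settled G \<Delta> s z K \<kappa> lam t" 
    if h: "2 \<le> K" "0 < \<kappa>" "0 \<le> lam" "lam < 1" "1 / q ^ 3 * transient_order K lam \<le> real t" for K lam t and \<kappa> :: real
    unfolding settled_def
  proof (intro allI impI)
    fix T assume T: "t \<le> T"
    have k: "0 < real K ^ 2 / (1 - lam) ^ 6" using h by simp
    have "1 / q ^ 3 * (real K ^ 2 / (1 - lam) ^ 6) \<le> 1 / q ^ 3 * transient_order K lam"
      using q by (intro mult_left_mono transient_order_ge) auto
    then have 1: "1 / q ^ 3 * (real K ^ 2 / (1 - lam) ^ 6) \<le> real T" using h(5) T by linarith
    moreover have "0 < 1 / q ^ 3" using q by simp
    from mult_pos_pos[OF this k] have "0 < 1 / q ^ 3 * (real K ^ 2 / (1 - lam) ^ 6)" .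
    ultimately have "0 < real T" by linarith
    then have T1: "1 \<le> T" by simp
    have large: "real K ^ 2 / (1 - lam) ^ 6 \<le> q ^ 3 * real T"
      using mult_left_mono[OF 1, of "q ^ 3"] q by simp
    have "rest_terms K T \<kappa> lam (ennreal s) (ennreal z) \<le> ennreal (\<kappa>\<^sup>2 / (real K * real T) powr (2/3) * (2 * q * (s + z)))"
      using h q nn T1 large by (intro rest_terms_le) auto
    also have "\<dots> \<le> ennreal (\<kappa>\<^sup>2 / (real K * real T) powr (2/3) * S)"
      by (intro ennreal_leI mult_left_mono qs) auto
    finally show "rest_terms K T \<kappa> lam (ennreal s) (ennreal z) \<le> lead_terms K T \<kappa> (ennreal G) (ennreal \<Delta>) (ennreal s)"
      unfolding lead_terms_eq[OF nn(1-3)] S_def .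
  qed
  show ?thesis by (rule exI[of _ "1 / q ^ 3"]) (use main q in auto)
qed

text \<open>Already the term of \<open>z\<close> at the single time \<open>t\<close> forces the
  order: comparing \<open>z / (t * (1 - lam)^2)\<close> with \<open>S / (K * t)^(2/3)\<close> and
  cubing gives \<open>(z / S)^3 * K^2 / (1 - lam)^6 \<le> t\<close>.\<close>

lemma transient_necessary:
  assumes nn: "0 \<le> G" "0 \<le> \<Delta>" "0 \<le> s" and pos: "0 < G + \<Delta> + s" and z: "0 < z"
  shows "\<exists>c>0. \<forall>K \<kappa> lam t. 2 \<le> K \<and> 0 < \<kappa> \<and> 0 \<le> lam \<and> lam < 1 \<and> 1 \<le> t \<and> settled G \<Delta> s z K \<kappa> lam t
     \<longrightarrow> c * transient_order K lam \<le> real t"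
proof -
  define S where "S = G + \<Delta> + s"
  have S: "0 < S" using pos by (simp add: S_def)
  have main: "(z / S) ^ 3 * transient_order K lam \<le> real t"
    if h: "2 \<le> K" "0 < \<kappa>" "0 \<le> lam" "lam < 1" "1 \<le> t" "settled G \<Delta> s z K \<kappa> lam t" for K lam t and \<kappa> :: real
  proof -
    have K: "1 \<le> K" using h by simp
    obtain a where a: "1 \<le> a" "real K = a^3" "real K powr (2/3) = a^2" using cube_root_powers[OF K] by metis
    obtain b where b: "1 \<le> b" "real t = b^3" "real t powr (2/3) = b^2" using cube_root_powers[OF h(5)] by metis
    have KT: "(real K * real t) powr (2/3) = a^2 * b^2" unfolding powr_mult a(3) b(3) ..
    define g where "g = 1 - lam"
    have g: "0 < g" using h by (simp add: g_def)
    have ap: "0 < a" and bp: "0 < b" using a(1) b(1) by auto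
    have "ennreal (\<kappa>\<^sup>2 / (real t * (1 - lam)^2)) * ennreal z \<le> rest_terms K t \<kappa> lam (ennreal s) (ennreal z)"
      unfolding rest_terms_def by (simp add: add.assoc)
    also have "\<dots> \<le> lead_terms K t \<kappa> (ennreal G) (ennreal \<Delta>) (ennreal s)" using h(6) by (simp add: settled_def)
    also have "\<dots> = ennreal (\<kappa>\<^sup>2 / (a^2 * b^2) * S)" unfolding lead_terms_eq[OF nn] KT S_def ..
    also have "ennreal (\<kappa>\<^sup>2 / (real t * (1 - lam)^2)) * ennreal z = ennreal (\<kappa>\<^sup>2 / (b^3 * g^2) * z)"
      unfolding b g_def using z ennreal_mult[of "\<kappa>\<^sup>2 / (b^3 * (1 - lam)^2)" z] bp by simp
    finally have "\<kappa>\<^sup>2 / (b^3 * g^2) * z \<le> \<kappa>\<^sup>2 / (a^2 * b^2) * S" using S by (simp add: ennreal_le_iff)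
    then have "(a^2 * b^3 * g^2 / \<kappa>\<^sup>2) * (\<kappa>\<^sup>2 / (b^3 * g^2) * z) \<le> (a^2 * b^3 * g^2 / \<kappa>\<^sup>2) * (\<kappa>\<^sup>2 / (a^2 * b^2) * S)"
      using ap bp by (intro mult_left_mono) auto
    then have "a^2 * z \<le> b * g^2 * S" using ap bp g h(2) by (simp add: eval_nat_numeral)
    then have "z / S * a^2 / g^2 \<le> b" using S g by (simp add: field_simps)
    then have "(z / S * a^2 / g^2) ^ 3 \<le> b ^ 3" using z S g by (intro power_mono) auto
    moreover have "(z / S * a^2 / g^2) ^ 3 = (z / S) ^ 3 * (real K ^ 2 / (1 - lam) ^ 6)"
      unfolding a g_def[symmetric] by (simp add: power_divide power_mult_distrib power_mult[symmetric])
    ultimately have "(z / S) ^ 3 * (real K ^ 2 / (1 - lam) ^ 6) \<le> real t" unfolding b by simp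
    moreover have "(z / S) ^ 3 * transient_order K lam \<le> (z / S) ^ 3 * (real K ^ 2 / (1 - lam) ^ 6)"
      using z S h by (intro mult_left_mono transient_order_le) auto
    ultimately show ?thesis by linarith
  qed
  show ?thesis by (rule exI[of _ "(z / S) ^ 3"]) (use main z S in auto)
qed

text \<open>Past the transient time both groups of terms are of the leading order, 3 from the
  leading and 4 from the remaining terms, hence the factor 7. \<open>G\<close>,
  \<open>\<Delta>\<close> and \<open>z\<close> may vary with the horizon, as the hyperparameters do,
  and are replaced by their common bound.\<close>

lemma sample_complexity:
  fixes avg :: "nat \<Rightarrow> ennreal"
  assumes C: "0 < C" and K: "2 \<le> K" and kappa: "0 < \<kappa>" and lam: "0 \<le> lam" "lam < 1" and T0: "1 \<le> T0"
    and bnd: "\<And>T. T0 \<le> T \<Longrightarrow> avg T \<le> ennreal C * (lead_terms K T \<kappa> (G T) (\<Delta> T) s + rest_terms K T \<kappa> lam s (z T))"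
    and R: "\<And>T. 1 \<le> T \<Longrightarrow> G T \<le> ennreal R \<and> \<Delta> T \<le> ennreal R \<and> s \<le> ennreal R \<and> z T \<le> ennreal R"
    and smp: "\<And>T. 1 \<le> T \<Longrightarrow> smp T \<le> 3 * real T"
  shows "\<exists>\<epsilon>0>0. \<forall>\<epsilon>. 0 < \<epsilon> \<and> \<epsilon> \<le> \<epsilon>0 \<longrightarrow> (\<exists>T\<ge>T0. avg T \<le> ennreal (\<epsilon>\<^sup>2) \<and>
      smp T \<le> 6 * (7 * C * max R 1) powr (3/2) * sample_order K \<kappa> lam \<epsilon>)"
proof -
  define R' where "R' = max R 1"
  have R': "1 \<le> R'" "R \<le> R'" by (auto simp: R'_def)
  have avg: "avg T \<le> ennreal (7 * C * R' * (\<kappa>\<^sup>2 / (real K * real T) powr (2/3)))"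
    if T: "T0 \<le> T" "real K ^ 2 / (1 - lam) ^ 6 \<le> real T" for T
  proof -
    have T1: "1 \<le> T" using T0 T by simp
    have le: "G T \<le> ennreal R'" "\<Delta> T \<le> ennreal R'" "s \<le> ennreal R'" "z T \<le> ennreal R'"
      using R[OF T1] ennreal_leI[OF R'(2)] by (auto intro: order_trans)
    have "lead_terms K T \<kappa> (G T) (\<Delta> T) s \<le> lead_terms K T \<kappa> (ennreal R') (ennreal R') (ennreal R')"
      unfolding lead_terms_def by (intro add_mono mult_left_mono le) auto
    also have "\<dots> = ennreal (\<kappa>\<^sup>2 / (real K * real T) powr (2/3) * (3 * R'))" using R' by (subst lead_terms_eq) auto
    finally have 1: "lead_terms K T \<kappa> (G T) (\<Delta> T) s \<le> ennreal (\<kappa>\<^sup>2 / (real K * real T) powr (2/3) * (3 * R'))" .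
    have "rest_terms K T \<kappa> lam s (z T) \<le> rest_terms K T \<kappa> lam (ennreal R') (ennreal R')"
      unfolding rest_terms_def by (intro add_mono mult_left_mono le) auto
    also have "\<dots> \<le> ennreal (\<kappa>\<^sup>2 / (real K * real T) powr (2/3) * (2 * 1 * (R' + R')))"
      using K T1 T lam R' by (intro rest_terms_le) auto
    finally have 2: "rest_terms K T \<kappa> lam s (z T) \<le> ennreal (\<kappa>\<^sup>2 / (real K * real T) powr (2/3) * (4 * R'))" by simp
    have "avg T \<le> ennreal C * (lead_terms K T \<kappa> (G T) (\<Delta> T) s + rest_terms K T \<kappa> lam s (z T))" by (rule bnd[OF T(1)])
    also have "\<dots> \<le> ennreal C * (ennreal (\<kappa>\<^sup>2 / (real K * real T) powr (2/3) * (3 * R')) + ennreal (\<kappa>\<^sup>2 / (real K * real T) powr (2/3) * (4 * R')))"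
      by (intro mult_left_mono add_mono 1 2) auto
    also have "\<dots> = ennreal (7 * C * R' * (\<kappa>\<^sup>2 / (real K * real T) powr (2/3)))"
      using C R' by (simp add: ennreal_plus[symmetric] ennreal_mult[symmetric] distrib_left[symmetric] mult_ac del: ennreal_plus)
    finally show ?thesis .
  qed
  \<comment> \<open>Solves \<open>7 * C * R' * \<kappa>\<^sup>2 / (K * T)^(2/3) =
    \<epsilon>\<^sup>2\<close> for \<open>T\<close>: the solution is
    \<open>N / \<epsilon> ^ 3\<close>.\<close>
  define N where "N = (7 * C * R') powr (3/2) * \<kappa> ^ 3 / real K"
  have K0: "0 < real K" using K by simp
  have CR: "0 < 7 * C * R'" using C R' by simp
  have N: "0 < N" using C R' K0 kappa by (simp add: N_def)
  \<comment> \<open>The solution must exceed both the threshold of the bound and the transient time;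
    \<open>\<epsilon>0\<close> is the accuracy at which it equals \<open>B\<close>. As
    \<open>B\<close> is at least one, rounding up at most doubles it.\<close>
  define B where "B = max (real T0) (real K ^ 2 / (1 - lam) ^ 6)"
  have B: "1 \<le> B" using T0 by (simp add: B_def)
  define \<epsilon>0 where "\<epsilon>0 = (N / B) powr (1/3)"
  have e0: "0 < \<epsilon>0" using N B by (simp add: \<epsilon>0_def)
  have main: "\<exists>T\<ge>T0. avg T \<le> ennreal (\<epsilon>\<^sup>2) \<and> smp T \<le> 6 * (7 * C * max R 1) powr (3/2) * sample_order K \<kappa> lam \<epsilon>"
    if e: "0 < \<epsilon>" "\<epsilon> \<le> \<epsilon>0" for \<epsilon>
  proof -
    define Q where "Q = N / \<epsilon> ^ 3"
    have "\<epsilon> ^ 3 \<le> \<epsilon>0 ^ 3" using e by (intro power_mono) auto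
    also have "\<epsilon>0 ^ 3 = N / B" unfolding \<epsilon>0_def using N B by (simp add: powr_powr powr_realpow[symmetric])
    finally have "B * \<epsilon> ^ 3 \<le> N" using B by (simp add: field_simps)
    then have QB: "B \<le> Q" unfolding Q_def using e by (simp add: pos_le_divide_eq)
    define T where "T = nat \<lceil>Q\<rceil>"
    have Q1: "1 \<le> Q" using QB B by simp
    have TQ: "Q \<le> real T" "real T \<le> 2 * Q" using Q1 by (auto simp: T_def) linarith
    have "real T0 \<le> real T" using TQ(1) QB by (simp add: B_def)
    then have TT0: "T0 \<le> T" by simp
    have Tl: "real K ^ 2 / (1 - lam) ^ 6 \<le> real T" using TQ(1) QB by (simp add: B_def)
    have "(real K * Q) powr (2/3) \<le> (real K * real T) powr (2/3)" using TQ K0 Q1 by (intro powr_mono2 mult_left_mono) auto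
    moreover have "(real K * Q) powr (2/3) = 7 * C * R' * \<kappa>\<^sup>2 / \<epsilon>\<^sup>2"
    proof -
      have "real K * Q = (7 * C * R') powr (3/2) * (\<kappa> / \<epsilon>) powr 3"
        unfolding Q_def N_def using K0 kappa e by (simp add: power_divide)
      then have "(real K * Q) powr (2/3) = ((7 * C * R') powr (3/2)) powr (2/3) * ((\<kappa> / \<epsilon>) powr 3) powr (2/3)"
        using powr_mult[of "(7 * C * R') powr (3/2)" "(\<kappa> / \<epsilon>) powr 3" "2/3"] by simp
      also have "\<dots> = (7 * C * R') * (\<kappa> / \<epsilon>)\<^sup>2" unfolding powr_powr using CR kappa e by simp
      finally show ?thesis by (simp add: power_divide)
    qed
    ultimately have "7 * C * R' * \<kappa>\<^sup>2 / \<epsilon>\<^sup>2 \<le> (real K * real T) powr (2/3)" by simp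
    moreover have "0 < (real K * real T) powr (2/3)" using K0 TQ Q1 by simp
    ultimately have "7 * C * R' * (\<kappa>\<^sup>2 / (real K * real T) powr (2/3)) \<le> \<epsilon>\<^sup>2" using e by (simp add: field_simps)
    then have A: "avg T \<le> ennreal (\<epsilon>\<^sup>2)" using avg[OF TT0 Tl] by (meson ennreal_leI order_trans)
    have "smp T \<le> 3 * real T" using smp TT0 T0 by simp
    also have "\<dots> \<le> 6 * Q" using TQ by simp
    also have "\<dots> = 6 * (7 * C * R') powr (3/2) * (\<kappa> ^ 3 * \<epsilon> powr (-3) / real K)"
    proof -
      have "\<epsilon> powr (-3) = inverse (\<epsilon> powr 3)" by (rule powr_minus)
      also have "\<epsilon> powr 3 = \<epsilon> ^ 3" using e by (simp add: powr_numeral)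
      finally show ?thesis unfolding Q_def N_def by (simp add: field_simps)
    qed
    also have "\<dots> \<le> 6 * (7 * C * R') powr (3/2) * sample_order K \<kappa> lam \<epsilon>"
    proof (intro mult_left_mono)
      have "0 \<le> \<kappa>\<^sup>2 * \<epsilon> powr (-2) / (1 - lam)^2" by simp
      moreover have "0 \<le> \<kappa> powr (15/10) * real K powr (5/10) * \<epsilon> powr (-15/10) / (1 - lam) powr (9/4)" by simp
      ultimately show "\<kappa> ^ 3 * \<epsilon> powr (-3) / real K \<le> sample_order K \<kappa> lam \<epsilon>" unfolding sample_order_def by linarith
    qed simp
    finally show ?thesis using A TT0 by (auto simp: R'_def)
  qed
  then show ?thesis using e0 by blast
qed

section \<open>Risks of the agents\<close>

context nonconvex_PL
begin

text \<open>First \<open>x\<close> is moved at \<open>y'\<close>, then \<open>y\<close> at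
  \<open>x\<close>. Within distance one the quadratic terms are linear, which gives the local
  Lipschitz form required by \<open>measurable_continuous_vec\<close>.\<close>

lemma F_continuous:
  assumes x: "x \<in> carrier_vec d1" and y: "y \<in> carrier_vec d2"
    and x': "x' \<in> carrier_vec d1" and y': "y' \<in> carrier_vec d2"
    and near: "nrm (x' - x) \<le> 1" "nrm (y' - y) \<le> 1"
  shows "\<bar>F x' y' - F x y\<bar> \<le> (nrm (gx x y) + nrm (gy x y) + 2 * L) * (nrm (x' - x) + nrm (y' - y))"
proof -
  define D E where "D = nrm (x' - x)" "E = nrm (y' - y)"
  have DE: "0 \<le> D" "0 \<le> E" "D \<le> 1" "E \<le> 1" "sqn (x' - x) = D\<^sup>2" "sqn (y' - y) = E\<^sup>2" using near by (auto simp: D_E_def)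
  have c: "gx x y' \<in> carrier_vec d1" "gx x y \<in> carrier_vec d1" "gy x y \<in> carrier_vec d2"
    "x' - x \<in> carrier_vec d1" "y' - y \<in> carrier_vec d2" using gxc gyc x y x' y' by auto
  have "gx x y' = (gx x y' - gx x y) + gx x y" using c by (intro eq_vecI) auto
  then have "nrm (gx x y') \<le> nrm (gx x y' - gx x y) + nrm (gx x y)"
    using nrm_triangle[of "gx x y' - gx x y" d1 "gx x y"] c by simp
  then have g: "nrm (gx x y') \<le> nrm (gx x y) + L * E" using lip_nrm_xy[OF x y y'] by (simp add: D_E_def)
  have "\<bar>gx x y' \<bullet> (x' - x)\<bar> \<le> nrm (gx x y') * D" unfolding D_E_def by (rule abs_scalar_prod_le) (use c in auto)
  also have "\<dots> \<le> (nrm (gx x y) + L * E) * D" using g DE by (intro mult_right_mono)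
  finally have 1: "\<bar>F x' y' - F x y'\<bar> \<le> (nrm (gx x y) + L * E) * D + L / 2 * D\<^sup>2"
    using descx[OF x x' y'] unfolding DE by linarith
  have "\<bar>gy x y \<bullet> (y' - y)\<bar> \<le> nrm (gy x y) * E" unfolding D_E_def by (rule abs_scalar_prod_le) (use c in auto)
  then have 2: "\<bar>F x y' - F x y\<bar> \<le> nrm (gy x y) * E + L / 2 * E\<^sup>2"
    using descy[OF x y y'] unfolding DE by linarith
  have 3: "L * E * D \<le> L * E" "L / 2 * D\<^sup>2 \<le> L * D" "L / 2 * E\<^sup>2 \<le> L * E"
    using DE Lpos mult_left_le[of D "L * E"] mult_left_le[of D "L * D"] mult_left_le[of E "L * E"]
      mult_nonneg_nonneg[of L "D\<^sup>2"] mult_nonneg_nonneg[of L "E\<^sup>2"]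
    by (auto simp: power2_eq_square mult.assoc)
  have 4: "0 \<le> nrm (gx x y) * E" "0 \<le> nrm (gy x y) * D" "0 \<le> L * D" "0 \<le> L * E" using DE Lpos by auto
  have "\<bar>F x' y' - F x y\<bar> \<le> \<bar>F x' y' - F x y'\<bar> + \<bar>F x y' - F x y\<bar>" by linarith
  also have "\<dots> \<le> (nrm (gx x y) + nrm (gy x y) + 2 * L) * (D + E)"
    unfolding distrib_left distrib_right using 1[unfolded distrib_right] 2 3 4 by linarith
  finally show ?thesis by (simp only: D_E_def)
qed

lemma F_measurable:
  assumes "u \<in> N \<rightarrow>\<^sub>M vec_borel d1" "v \<in> N \<rightarrow>\<^sub>M vec_borel d2"
  shows "(\<lambda>\<omega>. F (u \<omega>) (v \<omega>)) \<in> borel_measurable N"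
  by (rule measurable_continuous_vec[OF _ assms]) (use F_continuous in blast)

text \<open>A supremum over uncountably many points is not measurable for free; the local Lipschitz
  bound \<open>primal_diff_le\<close> settles it. The second variable of the general lemma is a
  constant dummy.\<close>

lemma Pm_measurable:
  assumes u: "u \<in> N \<rightarrow>\<^sub>M vec_borel d1" shows "(\<lambda>\<omega>. Pm (u \<omega>)) \<in> borel_measurable N"
proof (rule measurable_continuous_vec[where F = "\<lambda>x y. Pm x" and v = "\<lambda>_. 0\<^sub>v d2", OF _ u])
  show "(\<lambda>_. 0\<^sub>v d2) \<in> N \<rightarrow>\<^sub>M vec_borel d2" by (rule measurable_vecI) auto
  fix x y :: rvec assume x: "x \<in> carrier_vec d1" and y: "y \<in> carrier_vec d2"
  have "\<bar>Pm x' - Pm x\<bar> \<le> ((nrm (gx x y) + 2 * kap * nrm (gy x y)) + 6 * kap * L) * (nrm (x' - x) + nrm (y' - y))"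
    if x': "x' \<in> carrier_vec d1" and n: "nrm (x' - x) \<le> 1" for x' y' :: rvec
  proof -
    let ?D = "nrm (x' - x)" and ?A = "nrm (gx x y) + 2 * kap * nrm (gy x y)"
    have k: "0 \<le> 6 * kap * L" using kap1 Lpos by simp
    have A: "0 \<le> ?A" using kap1 by (intro add_nonneg_nonneg mult_nonneg_nonneg) auto
    have "sqn (x' - x) = ?D * ?D" unfolding nrm_sq[symmetric] by (rule power2_eq_square)
    also have "\<dots> \<le> ?D * 1" by (intro mult_left_mono n) simp
    finally have "6 * kap * L * sqn (x' - x) \<le> 6 * kap * L * ?D" using k by (intro mult_left_mono) auto
    then have "\<bar>Pm x' - Pm x\<bar> \<le> (?A + 6 * kap * L) * ?D" using primal_diff_le[OF x x' y] unfolding distrib_right by linarith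
    also have "\<dots> \<le> (?A + 6 * kap * L) * (?D + nrm (y' - y))" using A k by (intro mult_left_mono) auto
    finally show ?thesis .
  qed
  then show "\<exists>C. \<forall>x'\<in>carrier_vec d1. \<forall>y'\<in>carrier_vec d2. nrm (x' - x) \<le> 1 \<longrightarrow> nrm (y' - y) \<le> 1 \<longrightarrow>
      \<bar>Pm x' - Pm x\<bar> \<le> C * (nrm (x' - x) + nrm (y' - y))" by blast
qed

end

section \<open>The averaged risk as an objective with the PL inequality\<close>

lemma deriv_add_partials:
  assumes "has_partials d f x" "j < d"
  shows "DERIV (\<lambda>t. f (x + t \<cdot>\<^sub>v unit_vec d j)) 0 :> grad d f x $ j"
  using assms by (simp add: has_partials_def grad_def DERIV_deriv_iff_real_differentiable)

lemma mean_partials: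
  fixes f :: "nat \<Rightarrow> rvec \<Rightarrow> real"
  assumes "\<And>k. k < K \<Longrightarrow> has_partials d (f k) x"
  shows "has_partials d (\<lambda>z. (\<Sum>k<K. f k z) / real K) x"
    and "j < d \<Longrightarrow> grad d (\<lambda>z. (\<Sum>k<K. f k z) / real K) x $ j = (\<Sum>k<K. grad d (f k) x $ j) / real K"
proof -
  have D: "DERIV (\<lambda>t. (\<Sum>k<K. f k (x + t \<cdot>\<^sub>v unit_vec d j)) / real K) 0 :> (\<Sum>k<K. grad d (f k) x $ j) / real K"
    if "j < d" for j
    by (intro DERIV_cdivide DERIV_sum deriv_add_partials assms that) auto
  then show "has_partials d (\<lambda>z. (\<Sum>k<K. f k z) / real K) x"
    unfolding has_partials_def real_differentiable_def by blast
  show "j < d \<Longrightarrow> grad d (\<lambda>z. (\<Sum>k<K. f k z) / real K) x $ j = (\<Sum>k<K. grad d (f k) x $ j) / real K"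
    using DERIV_imp_deriv[OF D] by (simp add: grad_def)
qed

lemma mean_square_le: "((\<Sum>k<K. a k) / real K)\<^sup>2 \<le> (\<Sum>k<K. (a k)\<^sup>2) / real K" for a :: "nat \<Rightarrow> real"
proof (cases "K = 0")
  case False
  have "(\<Sum>k<K. a k * 1)\<^sup>2 \<le> (\<Sum>k<K. (a k)\<^sup>2) * (\<Sum>k<K. 1\<^sup>2)" by (rule Cauchy_Schwarz_ineq_sum)
  then show ?thesis using False by (simp add: power_divide power2_eq_square field_simps)
qed simp

lemma sqn_mean_le:
  assumes v: "v \<in> carrier_vec d" and w: "\<And>k. k < K \<Longrightarrow> w k \<in> carrier_vec d"
    and e: "\<And>j. j < d \<Longrightarrow> v $ j = (\<Sum>k<K. w k $ j) / real K"
  shows "sqn v \<le> (\<Sum>k<K. sqn (w k)) / real K"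
proof -
  have "sqn v \<le> (\<Sum>j<d. (\<Sum>k<K. (w k $ j)\<^sup>2) / real K)"
    unfolding sqn_carrier[OF v] by (intro sum_mono) (simp add: e mean_square_le)
  also have "\<dots> = (\<Sum>k<K. \<Sum>j<d. (w k $ j)\<^sup>2) / real K"
    by (subst sum.swap) (simp add: sum_divide_distrib)
  also have "\<dots> = (\<Sum>k<K. sqn (w k)) / real K" by (simp add: sqn_carrier[OF w])
  finally show ?thesis .
qed

locale dama_problem = sampling M p 0 \<xi> coin x0 y0
  for M :: "'w measure" and p :: "'s problem" and \<xi> and coin and x0 and y0 +
  fixes W :: rmat and \<nu> L :: real
  assumes agents2: "2 \<le> agents p" and wp: "well_posed p" and PLc: "PL_condition p \<nu>" and mss: "mean_square_smooth p L"
    and unb: "unbiased_gradients p" and nuL: "\<nu> \<le> L" and mixW: "mixing_matrix (agents p) W"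
begin

sublocale mixing "agents p" W by unfold_locales (use agents2 mixW in auto)

sublocale sx: stoch_grad M p 0 \<xi> coin x0 y0 "dimx p" "gradx_loss p" "gradx_risk p" L
proof unfold_locales
  show "gradx_loss p k x y s \<in> carrier_vec (dimx p)" "gradx_risk p k x y \<in> carrier_vec (dimx p)" for k x y s
    by (simp_all add: gradx_loss_def gradx_risk_def grad_def)
qed (use wp mss unb in \<open>auto simp: well_posed_def mean_square_smooth_def unbiased_gradients_def\<close>)

sublocale sy: stoch_grad M p 0 \<xi> coin x0 y0 "dimy p" "grady_loss p" "grady_risk p" L
proof unfold_locales
  show "grady_loss p k x y s \<in> carrier_vec (dimy p)" "grady_risk p k x y \<in> carrier_vec (dimy p)" for k x y s
    by (simp_all add: grady_loss_def grady_risk_def grad_def)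
qed (use wp mss unb in \<open>auto simp: well_posed_def mean_square_smooth_def unbiased_gradients_def\<close>)

lemma gradx_J_index:
  "x \<in> Xs p \<Longrightarrow> y \<in> Ys p \<Longrightarrow> j < dimx p \<Longrightarrow> gradx_J p x y $ j = (\<Sum>k<agents p. gradx_risk p k x y $ j) / real (agents p)"
  and J_partials_x: "x \<in> Xs p \<Longrightarrow> y \<in> Ys p \<Longrightarrow> has_partials (dimx p) (\<lambda>u. J p u y) x"
  using mean_partials[where K = "agents p" and d = "dimx p" and f = "\<lambda>k u. risk p k u y" and x = x] wp
  by (auto simp: gradx_J_def gradx_risk_def J_def well_posed_def)

lemma grady_J_index:
  "x \<in> Xs p \<Longrightarrow> y \<in> Ys p \<Longrightarrow> j < dimy p \<Longrightarrow> grady_J p x y $ j = (\<Sum>k<agents p. grady_risk p k x y $ j) / real (agents p)"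
  and J_partials_y: "x \<in> Xs p \<Longrightarrow> y \<in> Ys p \<Longrightarrow> has_partials (dimy p) (\<lambda>v. J p x v) y"
  using mean_partials[where K = "agents p" and d = "dimy p" and f = "\<lambda>k v. risk p k x v" and x = y] wp
  by (auto simp: grady_J_def grady_risk_def J_def well_posed_def)

lemma gradJ_carrier [simp]: "gradx_J p x y \<in> carrier_vec (dimx p)" "grady_J p x y \<in> carrier_vec (dimy p)"
  by (simp_all add: gradx_J_def grady_J_def grad_def)

lemma Kpos: "0 < agents p" using agents2 by simp

text \<open>Jensen over the agents, with each agent at its own point. Constant families give the
  Lipschitz bound of the gradient of \<open>J p\<close>; the actual iterates give the price of the
  spread in \<open>path_error\<close>.\<close>

lemma gradx_mean_lipschitz:
  assumes "x \<in> Xs p" "y \<in> Ys p" "\<And>k. k < agents p \<Longrightarrow> X k \<in> Xs p" "\<And>k. k < agents p \<Longrightarrow> Y k \<in> Ys p"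
    and "v \<in> carrier_vec (dimx p)"
    and "\<And>j. j < dimx p \<Longrightarrow> v $ j = (\<Sum>k<agents p. gradx_risk p k (X k) (Y k) $ j) / real (agents p) - gradx_J p x y $ j"
  shows "sqn v \<le> L\<^sup>2 * ((\<Sum>k<agents p. sqn (X k - x) + sqn (Y k - y)) / real (agents p))"
proof -
  let ?w = "\<lambda>k. gradx_risk p k (X k) (Y k) - gradx_risk p k x y"
  have "sqn v \<le> (\<Sum>k<agents p. sqn (?w k)) / real (agents p)"
  proof (rule sqn_mean_le[OF assms(5)])
    show "?w k \<in> carrier_vec (dimx p)" for k by (intro minus_carrier_vec sx.Rc)
    fix j assume j: "j < dimx p"
    have "?w k $ j = gradx_risk p k (X k) (Y k) $ j - gradx_risk p k x y $ j" for k using j sx.Rc[of k x y] by simp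
    then show "v $ j = (\<Sum>k<agents p. ?w k $ j) / real (agents p)"
      using assms(6)[OF j] gradx_J_index[OF assms(1,2) j] by (simp add: sum_subtractf diff_divide_distrib)
  qed
  also have "\<dots> \<le> (\<Sum>k<agents p. L\<^sup>2 * (sqn (X k - x) + sqn (Y k - y))) / real (agents p)"
    using assms by (intro divide_right_mono sum_mono sx.R_lipschitz) auto
  finally show ?thesis by (simp add: sum_distrib_left[symmetric])
qed

lemma grady_mean_lipschitz:
  assumes "x \<in> Xs p" "y \<in> Ys p" "\<And>k. k < agents p \<Longrightarrow> X k \<in> Xs p" "\<And>k. k < agents p \<Longrightarrow> Y k \<in> Ys p"
    and "v \<in> carrier_vec (dimy p)"
    and "\<And>j. j < dimy p \<Longrightarrow> v $ j = (\<Sum>k<agents p. grady_risk p k (X k) (Y k) $ j) / real (agents p) - grady_J p x y $ j"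
  shows "sqn v \<le> L\<^sup>2 * ((\<Sum>k<agents p. sqn (X k - x) + sqn (Y k - y)) / real (agents p))"
proof -
  let ?w = "\<lambda>k. grady_risk p k (X k) (Y k) - grady_risk p k x y"
  have "sqn v \<le> (\<Sum>k<agents p. sqn (?w k)) / real (agents p)"
  proof (rule sqn_mean_le[OF assms(5)])
    show "?w k \<in> carrier_vec (dimy p)" for k by (intro minus_carrier_vec sy.Rc)
    fix j assume j: "j < dimy p"
    have "?w k $ j = grady_risk p k (X k) (Y k) $ j - grady_risk p k x y $ j" for k using j sy.Rc[of k x y] by simp
    then show "v $ j = (\<Sum>k<agents p. ?w k $ j) / real (agents p)"
      using assms(6)[OF j] grady_J_index[OF assms(1,2) j] by (simp add: sum_subtractf diff_divide_distrib)
  qed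
  also have "\<dots> \<le> (\<Sum>k<agents p. L\<^sup>2 * (sqn (X k - x) + sqn (Y k - y))) / real (agents p)"
    using assms by (intro divide_right_mono sum_mono sy.R_lipschitz) auto
  finally show ?thesis by (simp add: sum_distrib_left[symmetric])
qed

lemma gradx_J_lipschitz:
  assumes "x \<in> Xs p" "x' \<in> Xs p" "y \<in> Ys p" "y' \<in> Ys p"
  shows "sqn (gradx_J p x y - gradx_J p x' y') \<le> L\<^sup>2 * (sqn (x - x') + sqn (y - y'))"
  using gradx_mean_lipschitz[of x' y' "\<lambda>_. x" "\<lambda>_. y" "gradx_J p x y - gradx_J p x' y'"] assms Kpos
  by (simp add: gradx_J_index carrier_vecD[OF gradJ_carrier(1)])

lemma grady_J_lipschitz:
  assumes "x \<in> Xs p" "x' \<in> Xs p" "y \<in> Ys p" "y' \<in> Ys p"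
  shows "sqn (grady_J p x y - grady_J p x' y') \<le> L\<^sup>2 * (sqn (x - x') + sqn (y - y'))"
  using grady_mean_lipschitz[of x' y' "\<lambda>_. x" "\<lambda>_. y" "grady_J p x y - grady_J p x' y'"] assms Kpos
  by (simp add: grady_J_index carrier_vecD[OF gradJ_carrier(2)])

lemma nu_pos: "0 < \<nu>" and L_pos: "0 < L" using PLc nuL by (auto simp: PL_condition_def)

lemma sqn_self: "x \<in> carrier_vec d \<Longrightarrow> sqn (x - x) = 0" by (simp add: sqn_sum)

text \<open>The quadratic expansions come from \<open>smooth_fun\<close> in one block with the other
  frozen, where the joint Lipschitz bound reduces to a bound in that block.\<close>

sublocale obj: nonconvex_PL "dimx p" "dimy p" "J p" "gradx_J p" "grady_J p" "P p" L \<nu> "Pstar p"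
proof
  show "0 < \<nu>" "\<nu> \<le> L" using nu_pos nuL by auto
next
  fix x x' y assume a: "x \<in> Xs p" "x' \<in> Xs p" "y \<in> Ys p"
  interpret s: smooth_fun "dimx p" "\<lambda>u. J p u y" L
    by unfold_locales (use J_partials_x a L_pos gradx_J_lipschitz in \<open>auto simp: gradx_J_def[symmetric] sqn_self\<close>,
      metis add.right_neutral a(3) gradx_J_lipschitz sqn_self)
  show "\<bar>J p x' y - J p x y - gradx_J p x y \<bullet> (x' - x)\<bar> \<le> L / 2 * sqn (x' - x)"
    using s.quadratic_bound[OF a(1,2)] by (simp add: gradx_J_def)
next
  fix x y y' assume a: "x \<in> Xs p" "y \<in> Ys p" "y' \<in> Ys p"
  interpret s: smooth_fun "dimy p" "\<lambda>v. J p x v" L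
    by unfold_locales (use J_partials_y a L_pos grady_J_lipschitz in \<open>auto simp: grady_J_def[symmetric] sqn_self\<close>,
      metis add.left_neutral a(1) grady_J_lipschitz sqn_self)
  show "\<bar>J p x y' - J p x y - grady_J p x y \<bullet> (y' - y)\<bar> \<le> L / 2 * sqn (y' - y)"
    using s.quadratic_bound[OF a(2,3)] by (simp add: grady_J_def)
next
  fix x y assume a: "x \<in> Xs p" "y \<in> Ys p"
  show "2 * \<nu> * (P p x - J p x y) \<le> sqn (grady_J p x y)" using PLc a by (simp add: PL_condition_def)
  \<comment> \<open>The attained maximum bounds the set of values, and only then is the supremum
    defining \<open>P p\<close> an upper bound.\<close>
  obtain z where "z \<in> Ys p" "\<And>y'. y' \<in> Ys p \<Longrightarrow> J p x y' \<le> J p x z" using PLc a by (auto simp: PL_condition_def)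
  then have "bdd_above (J p x ` Ys p)" by (intro bdd_aboveI[of _ "J p x z"]) auto
  then show "J p x y \<le> P p x" unfolding P_def by (rule cSUP_upper[OF a(2)])
next
  fix x assume "x \<in> Xs p"
  then show "Pstar p \<le> P p x" unfolding Pstar_def using PLc by (intro cINF_lower) (auto simp: PL_condition_def)
qed (use gradx_J_lipschitz grady_J_lipschitz in auto)

end

section \<open>The run as a random process\<close>

lemma measurable_mult_mat_vec:
  assumes A: "A \<in> carrier_mat n m" and f: "f \<in> N \<rightarrow>\<^sub>M vec_borel m"
  shows "(\<lambda>\<omega>. A *\<^sub>v f \<omega>) \<in> N \<rightarrow>\<^sub>M vec_borel n"
proof (rule measurable_vecI)
  fix j assume j: "j < n"
  have "(\<lambda>\<omega>. \<Sum>l<m. A $$ (j, l) * f \<omega> $ l) \<in> borel_measurable N"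
    by (intro borel_measurable_sum borel_measurable_times borel_measurable_const measurable_vec_index[OF f]) simp
  moreover have "(\<Sum>l<m. A $$ (j, l) * f \<omega> $ l) = (A *\<^sub>v f \<omega>) $ j" if "\<omega> \<in> space N" for \<omega>
    using A j carrier_vecD[OF measurable_vec_carrier[OF f that]] by (simp add: scalar_prod_def lessThan_atLeast0)
  ultimately show "(\<lambda>\<omega>. (A *\<^sub>v f \<omega>) $ j) \<in> borel_measurable N" by (rule measurable_cong[THEN iffD1, rotated])
qed (intro mult_mat_vec_carrier[OF A] measurable_vec_carrier[OF f])

lemma measurable_vec_add:
  assumes f: "f \<in> N \<rightarrow>\<^sub>M vec_borel m" and g: "g \<in> N \<rightarrow>\<^sub>M vec_borel m"
  shows "(\<lambda>\<omega>. f \<omega> + g \<omega>) \<in> N \<rightarrow>\<^sub>M vec_borel m"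
proof (rule measurable_vecI)
  fix j assume j: "j < m"
  have "(\<lambda>\<omega>. f \<omega> $ j + g \<omega> $ j) \<in> borel_measurable N"
    by (intro borel_measurable_add measurable_vec_index[OF f] measurable_vec_index[OF g] j)
  then show "(\<lambda>\<omega>. (f \<omega> + g \<omega>) $ j) \<in> borel_measurable N"
    by (rule measurable_cong[THEN iffD1, rotated]) (use j carrier_vecD[OF measurable_vec_carrier[OF g]] in simp)
qed (use measurable_vec_carrier[OF f] measurable_vec_carrier[OF g] in auto)

lemma measurable_vec_minus:
  assumes f: "f \<in> N \<rightarrow>\<^sub>M vec_borel m" and g: "g \<in> N \<rightarrow>\<^sub>M vec_borel m"
  shows "(\<lambda>\<omega>. f \<omega> - g \<omega>) \<in> N \<rightarrow>\<^sub>M vec_borel m"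
proof (rule measurable_vecI)
  fix j assume j: "j < m"
  have "(\<lambda>\<omega>. f \<omega> $ j - g \<omega> $ j) \<in> borel_measurable N"
    by (intro borel_measurable_diff measurable_vec_index[OF f] measurable_vec_index[OF g] j)
  then show "(\<lambda>\<omega>. (f \<omega> - g \<omega>) $ j) \<in> borel_measurable N"
    by (rule measurable_cong[THEN iffD1, rotated]) (use j carrier_vecD[OF measurable_vec_carrier[OF g]] in simp)
qed (use measurable_vec_carrier[OF f] measurable_vec_carrier[OF g] in auto)

lemma measurable_vec_smult:
  assumes f: "f \<in> N \<rightarrow>\<^sub>M vec_borel m"
  shows "(\<lambda>\<omega>. c \<cdot>\<^sub>v f \<omega>) \<in> N \<rightarrow>\<^sub>M vec_borel m"
proof (rule measurable_vecI)
  fix j assume j: "j < m"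
  have "(\<lambda>\<omega>. c * f \<omega> $ j) \<in> borel_measurable N"
    by (intro borel_measurable_times borel_measurable_const measurable_vec_index[OF f] j)
  then show "(\<lambda>\<omega>. (c \<cdot>\<^sub>v f \<omega>) $ j) \<in> borel_measurable N"
    by (rule measurable_cong[THEN iffD1, rotated]) (use j carrier_vecD[OF measurable_vec_carrier[OF f]] in simp)
qed (use measurable_vec_carrier[OF f] in auto)

lemma measurable_block:
  assumes f: "f \<in> N \<rightarrow>\<^sub>M vec_borel (K * d)" and k: "k < K"
  shows "(\<lambda>\<omega>. block d (f \<omega>) k) \<in> N \<rightarrow>\<^sub>M vec_borel d"
  by (rule measurable_vecI) (use measurable_vec_index[OF f block_bound[OF k]] in \<open>simp_all\<close>)

lemma measurable_stack:
  assumes f: "\<And>k. k < K \<Longrightarrow> f k \<in> N \<rightarrow>\<^sub>M vec_borel d"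
  shows "(\<lambda>\<omega>. stack K d (\<lambda>k. f k \<omega>)) \<in> N \<rightarrow>\<^sub>M vec_borel (K * d)"
proof (rule measurable_vecI)
  fix r assume r: "r < K * d"
  then have "0 < d" by (cases d) auto
  then have "r div d < K" "r mod d < d" using r by (auto simp: less_mult_imp_div_less)
  from measurable_vec_index[OF f[OF this(1)] this(2)]
  show "(\<lambda>\<omega>. stack K d (\<lambda>k. f k \<omega>) $ r) \<in> borel_measurable N" using r by (simp add: stack_def)
qed simp

lemma measurable_minibatch:
  assumes f: "\<And>j. f j \<in> N \<rightarrow>\<^sub>M vec_borel d"
  shows "(\<lambda>\<omega>. minibatch d n (\<lambda>j. f j \<omega>)) \<in> N \<rightarrow>\<^sub>M vec_borel d"
proof (rule measurable_vecI)
  fix c assume c: "c < d"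
  have "(\<lambda>\<omega>. (\<Sum>j<n. f j \<omega> $ c) / real n) \<in> borel_measurable N"
    by (intro borel_measurable_divide borel_measurable_sum borel_measurable_const measurable_vec_index[OF f] c)
  then show "(\<lambda>\<omega>. minibatch d n (\<lambda>j. f j \<omega>) $ c) \<in> borel_measurable N" using c by (simp add: minibatch_def)
qed (simp add: minibatch_def)

lemma measurable_grace:
  assumes c: "c \<in> N \<rightarrow>\<^sub>M count_space UNIV" and g: "g \<in> N \<rightarrow>\<^sub>M vec_borel d"
    and a: "\<And>j. a j \<in> N \<rightarrow>\<^sub>M vec_borel d" and b: "\<And>j. b j \<in> N \<rightarrow>\<^sub>M vec_borel d"
  shows "(\<lambda>\<omega>. grace d \<beta> h (c \<omega>) (g \<omega>) (\<lambda>j. a j \<omega>) (\<lambda>j. b j \<omega>)) \<in> N \<rightarrow>\<^sub>M vec_borel d"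
  unfolding grace_def
  by (intro measurable_If measurable_minibatch measurable_vec_add measurable_vec_smult measurable_vec_minus a b g)
     (use measurable_sets[OF c, of "{True}"] in \<open>simp add: vimage_def Int_def conj_commute\<close>)

lemma minibatch_one: "f 0 \<in> carrier_vec d \<Longrightarrow> minibatch d 1 f = f 0"
  by (rule eq_vecI) (auto simp: minibatch_def)

text \<open>A run with one sample per update and one parameter \<open>\<beta>\<close> for both
  blocks. The variance bound \<open>bv\<close> speaks of the actual run, with its coins, at the
  iterations below the horizon.\<close>

locale dama_run = dama_problem M p \<xi> coin x0 y0 W \<nu> L
  for M :: "'w measure" and p :: "'s problem" and \<xi> and coin and x0 and y0 and W and \<nu> and L +
  fixes Rx Ry :: rmat and u v :: rvec and h :: dama_hyper and \<sigma> \<beta> :: real and T :: nat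
  assumes Rx: "is_psd_sqrt (agents p * dimx p) Rx (1\<^sub>m (agents p * dimx p) - kron_id W (dimx p))"
    and Ry: "is_psd_sqrt (agents p * dimy p) Ry (1\<^sub>m (agents p * dimy p) - kron_id W (dimy p))"
    and uc: "u \<in> Xs p" and vc: "v \<in> Ys p"
    and batch1: "batch h = 1" and b0: "0 < batch0 h" and betas: "betax h = \<beta>" "betay h = \<beta>"
    and beta: "0 < \<beta>" "\<beta> \<le> 1"
    and bv: "bounded_variance M p \<xi> coin x0 y0 \<sigma> (run p (extra_matrices p W Rx Ry) h \<xi> coin x0 y0 u v) T"
begin

abbreviation "A \<equiv> extra_matrices p W Rx Ry"
abbreviation "K \<equiv> agents p"
abbreviation "traj c i \<omega> \<equiv> dama p A h (\<lambda>k i j. \<xi> k i j \<omega>) (\<lambda>i. c i \<omega>) (x0 \<omega>) (y0 \<omega>) u v i"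

lemma A_carrier: "Ax A \<in> carrier_mat (K * dimx p) (K * dimx p)" "Bx A \<in> carrier_mat (K * dimx p) (K * dimx p)"
  "Cx A \<in> carrier_mat (K * dimx p) (K * dimx p)" "Ay A \<in> carrier_mat (K * dimy p) (K * dimy p)"
  "By A \<in> carrier_mat (K * dimy p) (K * dimy p)" "Cy A \<in> carrier_mat (K * dimy p) (K * dimy p)"
  using Rx Ry kronc by (simp_all add: extra_matrices_def is_psd_sqrt_def psd_mat_def)

text \<open>Stated for an arbitrary increasing family \<open>F\<close> and arbitrary coins
  \<open>c\<close>, because it is needed twice: with all of \<open>M\<close> and the real coins, and
  with the history and constant coins. Estimates lag one index behind the iterates, as they use the
  samples of their own iteration.\<close>

lemma traj_measurable:
  assumes mono: "\<And>i N f. f \<in> F i \<rightarrow>\<^sub>M vec_borel N \<Longrightarrow> f \<in> F (Suc i) \<rightarrow>\<^sub>M vec_borel N"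
    and x: "x0 \<in> F 0 \<rightarrow>\<^sub>M vec_borel (dimx p)" and y: "y0 \<in> F 0 \<rightarrow>\<^sub>M vec_borel (dimy p)"
    and s: "\<And>k i j. k < K \<Longrightarrow> \<xi> k i j \<in> F (Suc i) \<rightarrow>\<^sub>M law p k" and c: "\<And>i. c i \<in> F (Suc i) \<rightarrow>\<^sub>M count_space UNIV"
  shows "(\<lambda>\<omega>. stX (traj c i \<omega>)) \<in> F i \<rightarrow>\<^sub>M vec_borel (K * dimx p) \<and> (\<lambda>\<omega>. stY (traj c i \<omega>)) \<in> F i \<rightarrow>\<^sub>M vec_borel (K * dimy p)
    \<and> (\<lambda>\<omega>. stDX (traj c i \<omega>)) \<in> F i \<rightarrow>\<^sub>M vec_borel (K * dimx p) \<and> (\<lambda>\<omega>. stDY (traj c i \<omega>)) \<in> F i \<rightarrow>\<^sub>M vec_borel (K * dimy p)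
    \<and> (\<lambda>\<omega>. stGX (traj c i \<omega>)) \<in> F (Suc i) \<rightarrow>\<^sub>M vec_borel (K * dimx p)
    \<and> (\<lambda>\<omega>. stGY (traj c i \<omega>)) \<in> F (Suc i) \<rightarrow>\<^sub>M vec_borel (K * dimy p)"
proof (induction i)
  case 0
  have cu: "(\<lambda>_. w) \<in> N \<rightarrow>\<^sub>M vec_borel d" if "w \<in> carrier_vec d" for w d and N :: "'w measure"
    by (rule measurable_vecI) (use that in auto)
  have X: "(\<lambda>\<omega>. stack K (dimx p) (\<lambda>_. x0 \<omega>)) \<in> F 0 \<rightarrow>\<^sub>M vec_borel (K * dimx p)"
    and Y: "(\<lambda>\<omega>. stack K (dimy p) (\<lambda>_. y0 \<omega>)) \<in> F 0 \<rightarrow>\<^sub>M vec_borel (K * dimy p)"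
    by (intro measurable_stack x y)+
  note X1 = mono[OF X] and Y1 = mono[OF Y]
  have "(\<lambda>\<omega>. stack K (dimx p) (\<lambda>k. minibatch (dimx p) (batch0 h) (\<lambda>j. gradx_loss p k
      (block (dimx p) (stack K (dimx p) (\<lambda>_. x0 \<omega>)) k) (block (dimy p) (stack K (dimy p) (\<lambda>_. y0 \<omega>)) k) (\<xi> k 0 j \<omega>))))
      \<in> F (Suc 0) \<rightarrow>\<^sub>M vec_borel (K * dimx p)"
    by (rule measurable_stack, rule measurable_minibatch, rule sx.Q_meas) (assumption | rule measurable_block X1 Y1 s)+
  moreover have "(\<lambda>\<omega>. stack K (dimy p) (\<lambda>k. minibatch (dimy p) (batch0 h) (\<lambda>j. grady_loss p k
      (block (dimx p) (stack K (dimx p) (\<lambda>_. x0 \<omega>)) k) (block (dimy p) (stack K (dimy p) (\<lambda>_. y0 \<omega>)) k) (\<xi> k 0 j \<omega>))))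
      \<in> F (Suc 0) \<rightarrow>\<^sub>M vec_borel (K * dimy p)"
    by (rule measurable_stack, rule measurable_minibatch, rule sy.Q_meas) (assumption | rule measurable_block X1 Y1 s)+
  ultimately show ?case using X Y by (simp add: Let_def cu measurable_stack uc vc)
next
  case (Suc i)
  let ?S = "traj c i" and ?S' = "traj c (Suc i)"
  note IH = Suc[THEN conjunct1] Suc[THEN conjunct2, THEN conjunct1] Suc[THEN conjunct2, THEN conjunct2, THEN conjunct1]
    Suc[THEN conjunct2, THEN conjunct2, THEN conjunct2, THEN conjunct1]
    Suc[THEN conjunct2, THEN conjunct2, THEN conjunct2, THEN conjunct2, THEN conjunct1]
    Suc[THEN conjunct2, THEN conjunct2, THEN conjunct2, THEN conjunct2, THEN conjunct2]
  have sX: "stX (?S' \<omega>) = Ax A *\<^sub>v (Cx A *\<^sub>v stX (?S \<omega>) - mux h \<cdot>\<^sub>v stGX (?S \<omega>)) - Bx A *\<^sub>v stDX (?S \<omega>)"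
    and sY: "stY (?S' \<omega>) = Ay A *\<^sub>v (Cy A *\<^sub>v stY (?S \<omega>) + muy h \<cdot>\<^sub>v stGY (?S \<omega>)) - By A *\<^sub>v stDY (?S \<omega>)"
    and sDX: "stDX (?S' \<omega>) = stDX (?S \<omega>) + Bx A *\<^sub>v stX (?S' \<omega>)" and sDY: "stDY (?S' \<omega>) = stDY (?S \<omega>) + By A *\<^sub>v stY (?S' \<omega>)"
    and sGX: "stGX (?S' \<omega>) = stack K (dimx p) (\<lambda>k. grace (dimx p) (betax h) h (c (Suc i) \<omega>) (block (dimx p) (stGX (?S \<omega>)) k)
        (\<lambda>j. gradx_loss p k (block (dimx p) (stX (?S \<omega>)) k) (block (dimy p) (stY (?S \<omega>)) k) (\<xi> k (Suc i) j \<omega>))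
        (\<lambda>j. gradx_loss p k (block (dimx p) (stX (?S' \<omega>)) k) (block (dimy p) (stY (?S' \<omega>)) k) (\<xi> k (Suc i) j \<omega>)))"
    and sGY: "stGY (?S' \<omega>) = stack K (dimy p) (\<lambda>k. grace (dimy p) (betay h) h (c (Suc i) \<omega>) (block (dimy p) (stGY (?S \<omega>)) k)
        (\<lambda>j. grady_loss p k (block (dimx p) (stX (?S \<omega>)) k) (block (dimy p) (stY (?S \<omega>)) k) (\<xi> k (Suc i) j \<omega>))
        (\<lambda>j. grady_loss p k (block (dimx p) (stX (?S' \<omega>)) k) (block (dimy p) (stY (?S' \<omega>)) k) (\<xi> k (Suc i) j \<omega>)))"
    for \<omega> by (simp_all add: Let_def)
  have X: "(\<lambda>\<omega>. stX (?S' \<omega>)) \<in> F (Suc i) \<rightarrow>\<^sub>M vec_borel (K * dimx p)" unfolding sX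
    by (intro measurable_vec_minus measurable_mult_mat_vec[OF A_carrier(1)] measurable_mult_mat_vec[OF A_carrier(2)]
        measurable_mult_mat_vec[OF A_carrier(3)] measurable_vec_smult IH(5) mono[OF IH(1)] mono[OF IH(3)])
  have Y: "(\<lambda>\<omega>. stY (?S' \<omega>)) \<in> F (Suc i) \<rightarrow>\<^sub>M vec_borel (K * dimy p)" unfolding sY
    by (intro measurable_vec_minus measurable_vec_add measurable_mult_mat_vec[OF A_carrier(4)] measurable_mult_mat_vec[OF A_carrier(5)]
        measurable_mult_mat_vec[OF A_carrier(6)] measurable_vec_smult IH(6) mono[OF IH(2)] mono[OF IH(4)])
  have DX: "(\<lambda>\<omega>. stDX (?S' \<omega>)) \<in> F (Suc i) \<rightarrow>\<^sub>M vec_borel (K * dimx p)" unfolding sDX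
    by (intro measurable_vec_add measurable_mult_mat_vec[OF A_carrier(2)] mono[OF IH(3)] X)
  have DY: "(\<lambda>\<omega>. stDY (?S' \<omega>)) \<in> F (Suc i) \<rightarrow>\<^sub>M vec_borel (K * dimy p)" unfolding sDY
    by (intro measurable_vec_add measurable_mult_mat_vec[OF A_carrier(5)] mono[OF IH(4)] Y)
  note mX = mono[OF mono[OF IH(1)]] and mY = mono[OF mono[OF IH(2)]]
  have GX: "(\<lambda>\<omega>. stGX (?S' \<omega>)) \<in> F (Suc (Suc i)) \<rightarrow>\<^sub>M vec_borel (K * dimx p)" unfolding sGX
    by (rule measurable_stack, rule measurable_grace)
       (assumption | rule c sx.Q_meas measurable_block mX mY mono[OF X] mono[OF Y] mono[OF IH(5)] s)+
  have GY: "(\<lambda>\<omega>. stGY (?S' \<omega>)) \<in> F (Suc (Suc i)) \<rightarrow>\<^sub>M vec_borel (K * dimy p)" unfolding sGY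
    by (rule measurable_stack, rule measurable_grace)
       (assumption | rule c sy.Q_meas measurable_block mX mY mono[OF X] mono[OF Y] mono[OF IH(6)] s)+
  show ?case using X Y DX DY GX GY by blast
qed

text \<open>Everything drawn before iteration \<open>i\<close>; the coins are left out because
  \<open>st\<close> does not consult them. Iterates \<open>i\<close> are determined by
  \<open>hist i\<close>, estimates \<open>i\<close> by \<open>hist (Suc i)\<close>.\<close>

definition "hist i = {Init} \<union> {Sample k n j | k n j. k < K \<and> n < i}"

lemma hist_sources: "hist i \<subseteq> sources" by (auto simp: hist_def sources_def)
lemma hist_mono: "hist i \<subseteq> hist (Suc i)" by (auto simp: hist_def)
lemma hist_fresh: "Sample k i j \<notin> hist i" by (auto simp: hist_def)

abbreviation "st \<equiv> traj (\<lambda>_ _. False)"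

lemma st_measurable:
  "(\<lambda>\<omega>. stX (st i \<omega>)) \<in> gen (hist i) \<rightarrow>\<^sub>M vec_borel (K * dimx p)" "(\<lambda>\<omega>. stY (st i \<omega>)) \<in> gen (hist i) \<rightarrow>\<^sub>M vec_borel (K * dimy p)"
  "(\<lambda>\<omega>. stDX (st i \<omega>)) \<in> gen (hist i) \<rightarrow>\<^sub>M vec_borel (K * dimx p)" "(\<lambda>\<omega>. stDY (st i \<omega>)) \<in> gen (hist i) \<rightarrow>\<^sub>M vec_borel (K * dimy p)"
  "(\<lambda>\<omega>. stGX (st i \<omega>)) \<in> gen (hist (Suc i)) \<rightarrow>\<^sub>M vec_borel (K * dimx p)"
  "(\<lambda>\<omega>. stGY (st i \<omega>)) \<in> gen (hist (Suc i)) \<rightarrow>\<^sub>M vec_borel (K * dimy p)"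
proof -
  have i: "Init \<in> hist 0" by (simp add: hist_def)
  have *: "(\<lambda>\<omega>. stX (st i \<omega>)) \<in> gen (hist i) \<rightarrow>\<^sub>M vec_borel (K * dimx p) \<and> (\<lambda>\<omega>. stY (st i \<omega>)) \<in> gen (hist i) \<rightarrow>\<^sub>M vec_borel (K * dimy p)
    \<and> (\<lambda>\<omega>. stDX (st i \<omega>)) \<in> gen (hist i) \<rightarrow>\<^sub>M vec_borel (K * dimx p) \<and> (\<lambda>\<omega>. stDY (st i \<omega>)) \<in> gen (hist i) \<rightarrow>\<^sub>M vec_borel (K * dimy p)
    \<and> (\<lambda>\<omega>. stGX (st i \<omega>)) \<in> gen (hist (Suc i)) \<rightarrow>\<^sub>M vec_borel (K * dimx p)
    \<and> (\<lambda>\<omega>. stGY (st i \<omega>)) \<in> gen (hist (Suc i)) \<rightarrow>\<^sub>M vec_borel (K * dimy p)"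
  proof (rule traj_measurable[where F = "\<lambda>i. gen (hist i)"])
    show "\<xi> k i j \<in> gen (hist (Suc i)) \<rightarrow>\<^sub>M law p k" if "k < K" for k i j
      by (rule xi_gen) (use that in \<open>auto simp: hist_def\<close>)
  qed (use init_gen[OF i] measurable_gen_mono[OF _ hist_mono] in auto)
  show "(\<lambda>\<omega>. stX (st i \<omega>)) \<in> gen (hist i) \<rightarrow>\<^sub>M vec_borel (K * dimx p)" "(\<lambda>\<omega>. stY (st i \<omega>)) \<in> gen (hist i) \<rightarrow>\<^sub>M vec_borel (K * dimy p)"
    "(\<lambda>\<omega>. stDX (st i \<omega>)) \<in> gen (hist i) \<rightarrow>\<^sub>M vec_borel (K * dimx p)" "(\<lambda>\<omega>. stDY (st i \<omega>)) \<in> gen (hist i) \<rightarrow>\<^sub>M vec_borel (K * dimy p)"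
    "(\<lambda>\<omega>. stGX (st i \<omega>)) \<in> gen (hist (Suc i)) \<rightarrow>\<^sub>M vec_borel (K * dimx p)"
    "(\<lambda>\<omega>. stGY (st i \<omega>)) \<in> gen (hist (Suc i)) \<rightarrow>\<^sub>M vec_borel (K * dimy p)" using * by blast+
qed

lemma run_measurable:
  "(\<lambda>\<omega>. stX (run p A h \<xi> coin x0 y0 u v i \<omega>)) \<in> M \<rightarrow>\<^sub>M vec_borel (K * dimx p)"
  "(\<lambda>\<omega>. stY (run p A h \<xi> coin x0 y0 u v i \<omega>)) \<in> M \<rightarrow>\<^sub>M vec_borel (K * dimy p)"
  using traj_measurable[where F = "\<lambda>_. M" and c = coin and i = i] x0_meas y0_meas xi_meas coin_meas
  unfolding run_def by blast+

lemma coin_False: "AE \<omega> in M. \<forall>i. \<not> coin i \<omega>"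
proof (subst AE_all_countable, rule allI)
  fix i
  have d: "distr M (count_space UNIV) (coin i) = measure_pmf (bernoulli_pmf 0)" using model by (simp add: sampling_model_def)
  have "AE b in measure_pmf (bernoulli_pmf 0). \<not> b" by (auto simp: AE_measure_pmf_iff set_pmf_iff)
  then have "AE b in distr M (count_space UNIV) (coin i). \<not> b" unfolding d .
  then show "AE \<omega> in M. \<not> coin i \<omega>" by (subst (asm) AE_distr_iff[OF coin_meas]) auto
qed

lemma run_eq_st: "AE \<omega> in M. \<forall>i. run p A h \<xi> coin x0 y0 u v i \<omega> = st i \<omega>"
  using coin_False by eventually_elim (simp add: run_def)

abbreviation "X i k \<omega> \<equiv> block (dimx p) (stX (st i \<omega>)) k"
abbreviation "Y i k \<omega> \<equiv> block (dimy p) (stY (st i \<omega>)) k"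
abbreviation "gX i k \<omega> \<equiv> block (dimx p) (stGX (st i \<omega>)) k"
abbreviation "gY i k \<omega> \<equiv> block (dimy p) (stGY (st i \<omega>)) k"

lemma past_gen: "past M p \<xi> coin x0 y0 i = gen ({Init} \<union> {Coin n | n. n < i} \<union> {Sample k n j | k n j. k < K \<and> n < i})"
  by (simp add: past_def gen_def)

text \<open>Integrating a conditional expectation removes the conditioning; the almost sure equality
  then moves the bound from the actual run to the coin-free one.\<close>

lemma conditional_bound:
  assumes "f \<in> borel_measurable M" and "AE \<omega> in M. nn_cond_exp M (past M p \<xi> coin x0 y0 i) f \<omega> \<le> c"
    and "AE \<omega> in M. f \<omega> = g \<omega>"
  shows "(\<integral>\<^sup>+\<omega>. g \<omega> \<partial>M) \<le> c"
proof -
  let ?F = "past M p \<xi> coin x0 y0 i"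
  have "subalgebra M ?F" unfolding past_gen by (rule gen_subalgebra) (auto simp: sources_def)
  then have "finite_measure_subalgebra M ?F"
    by (intro finite_measure_subalgebra.intro finite_measure_subalgebra_axioms.intro finite_measure_axioms)
  note sf = finite_measure_subalgebra_is_sigma_finite[OF this]
  have "(\<integral>\<^sup>+\<omega>. g \<omega> \<partial>M) = (\<integral>\<^sup>+\<omega>. 1 * f \<omega> \<partial>M)" using assms(3) by (intro nn_integral_cong_AE) auto
  also have "\<dots> = (\<integral>\<^sup>+\<omega>. 1 * nn_cond_exp M ?F f \<omega> \<partial>M)" by (rule sigma_finite_subalgebra.nn_cond_exp_intg[OF sf, symmetric]) (use assms(1) in auto)
  also have "\<dots> \<le> (\<integral>\<^sup>+\<omega>. c \<partial>M)" by (rule nn_integral_mono_AE) (use assms(2) in simp)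
  finally show ?thesis by (simp add: emeasure_space_1)
qed

lemma noise:
  assumes k: "k < K" and i: "i < T"
  shows "(\<integral>\<^sup>+\<omega>. ennreal (sqn (gradx_loss p k (X i k \<omega>) (Y i k \<omega>) (\<xi> k i j \<omega>) - gradx_risk p k (X i k \<omega>) (Y i k \<omega>))) \<partial>M) \<le> ennreal (\<sigma>\<^sup>2)"
    and "(\<integral>\<^sup>+\<omega>. ennreal (sqn (grady_loss p k (X i k \<omega>) (Y i k \<omega>) (\<xi> k i j \<omega>) - grady_risk p k (X i k \<omega>) (Y i k \<omega>))) \<partial>M) \<le> ennreal (\<sigma>\<^sup>2)"
proof -
  let ?r = "run p A h \<xi> coin x0 y0 u v"
  let ?x = "\<lambda>\<omega>. block (dimx p) (stX (?r i \<omega>)) k" and ?y = "\<lambda>\<omega>. block (dimy p) (stY (?r i \<omega>)) k"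
  note m = measurable_block[OF run_measurable(1) k] measurable_block[OF run_measurable(2) k]
  have fx: "(\<lambda>\<omega>. ennreal (sqn (gradx_loss p k (?x \<omega>) (?y \<omega>) (\<xi> k i j \<omega>) - gradx_risk p k (?x \<omega>) (?y \<omega>)))) \<in> borel_measurable M"
    by (intro measurable_compose[OF measurable_sqn[where d = "dimx p"] measurable_ennreal] measurable_vec_minus sx.Q_meas sx.R_meas m k xi_meas)
  have fy: "(\<lambda>\<omega>. ennreal (sqn (grady_loss p k (?x \<omega>) (?y \<omega>) (\<xi> k i j \<omega>) - grady_risk p k (?x \<omega>) (?y \<omega>)))) \<in> borel_measurable M"
    by (intro measurable_compose[OF measurable_sqn[where d = "dimy p"] measurable_ennreal] measurable_vec_minus sy.Q_meas sy.R_meas m k xi_meas)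
  note B = bv[unfolded bounded_variance_def Let_def, rule_format, OF k i, of j]
  show "(\<integral>\<^sup>+\<omega>. ennreal (sqn (gradx_loss p k (X i k \<omega>) (Y i k \<omega>) (\<xi> k i j \<omega>) - gradx_risk p k (X i k \<omega>) (Y i k \<omega>))) \<partial>M) \<le> ennreal (\<sigma>\<^sup>2)"
    by (rule conditional_bound[OF fx B[THEN conjunct1]]) (use run_eq_st in eventually_elim, simp)
  show "(\<integral>\<^sup>+\<omega>. ennreal (sqn (grady_loss p k (X i k \<omega>) (Y i k \<omega>) (\<xi> k i j \<omega>) - grady_risk p k (X i k \<omega>) (Y i k \<omega>))) \<partial>M) \<le> ennreal (\<sigma>\<^sup>2)"
    by (rule conditional_bound[OF fy B[THEN conjunct2]]) (use run_eq_st in eventually_elim, simp)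
qed

lemma gX_step:
  assumes "k < K"
  shows "gX (Suc i) k \<omega> = (1 - \<beta>) \<cdot>\<^sub>v (gX i k \<omega> - gradx_loss p k (X i k \<omega>) (Y i k \<omega>) (\<xi> k (Suc i) 0 \<omega>))
      + gradx_loss p k (X (Suc i) k \<omega>) (Y (Suc i) k \<omega>) (\<xi> k (Suc i) 0 \<omega>)"
proof -
  let ?b = "\<lambda>k. grace (dimx p) (betax h) h False (gX i k \<omega>) (\<lambda>j. gradx_loss p k (X i k \<omega>) (Y i k \<omega>) (\<xi> k (Suc i) j \<omega>))
     (\<lambda>j. gradx_loss p k (X (Suc i) k \<omega>) (Y (Suc i) k \<omega>) (\<xi> k (Suc i) j \<omega>))"
  have e: "?b k = (1 - \<beta>) \<cdot>\<^sub>v (gX i k \<omega> - gradx_loss p k (X i k \<omega>) (Y i k \<omega>) (\<xi> k (Suc i) 0 \<omega>))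
      + gradx_loss p k (X (Suc i) k \<omega>) (Y (Suc i) k \<omega>) (\<xi> k (Suc i) 0 \<omega>)"
    unfolding grace_def batch1 betas by (simp only: minibatch_one[OF sx.Qc] if_False)
  have "stGX (st (Suc i) \<omega>) = stack K (dimx p) ?b" by (simp add: Let_def)
  then have "gX (Suc i) k \<omega> = ?b k"
    using block_stack[OF assms, of ?b "dimx p"] unfolding e by (simp add: sx.Qc del: dama.simps)
  then show ?thesis unfolding e .
qed

lemma gY_step:
  assumes "k < K"
  shows "gY (Suc i) k \<omega> = (1 - \<beta>) \<cdot>\<^sub>v (gY i k \<omega> - grady_loss p k (X i k \<omega>) (Y i k \<omega>) (\<xi> k (Suc i) 0 \<omega>))
      + grady_loss p k (X (Suc i) k \<omega>) (Y (Suc i) k \<omega>) (\<xi> k (Suc i) 0 \<omega>)"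
proof -
  let ?b = "\<lambda>k. grace (dimy p) (betay h) h False (gY i k \<omega>) (\<lambda>j. grady_loss p k (X i k \<omega>) (Y i k \<omega>) (\<xi> k (Suc i) j \<omega>))
     (\<lambda>j. grady_loss p k (X (Suc i) k \<omega>) (Y (Suc i) k \<omega>) (\<xi> k (Suc i) j \<omega>))"
  have e: "?b k = (1 - \<beta>) \<cdot>\<^sub>v (gY i k \<omega> - grady_loss p k (X i k \<omega>) (Y i k \<omega>) (\<xi> k (Suc i) 0 \<omega>))
      + grady_loss p k (X (Suc i) k \<omega>) (Y (Suc i) k \<omega>) (\<xi> k (Suc i) 0 \<omega>)"
    unfolding grace_def batch1 betas by (simp only: minibatch_one[OF sy.Qc] if_False)
  have "stGY (st (Suc i) \<omega>) = stack K (dimy p) ?b" by (simp add: Let_def)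
  then have "gY (Suc i) k \<omega> = ?b k"
    using block_stack[OF assms, of ?b "dimy p"] unfolding e by (simp add: sy.Qc del: dama.simps)
  then show ?thesis unfolding e .
qed

lemma g_init:
  assumes "k < K"
  shows "gX 0 k \<omega> = minibatch (dimx p) (batch0 h) (\<lambda>j. gradx_loss p k (X 0 k \<omega>) (Y 0 k \<omega>) (\<xi> k 0 j \<omega>))"
    "gY 0 k \<omega> = minibatch (dimy p) (batch0 h) (\<lambda>j. grady_loss p k (X 0 k \<omega>) (Y 0 k \<omega>) (\<xi> k 0 j \<omega>))"
  using assms by (simp_all add: Let_def block_stack minibatch_def)

lemma stG_carrier: "stGX (st i \<omega>) \<in> carrier_vec (K * dimx p)" "stGY (st i \<omega>) \<in> carrier_vec (K * dimy p)"
  by (cases i; simp add: Let_def)+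

lemma consensus_x:
  assumes "\<omega> \<in> space M"
  shows "consensus_run K W (dimx p) Rx (mux h) (\<lambda>i. stX (st i \<omega>)) (\<lambda>i. stGX (st i \<omega>)) (\<lambda>i. stDX (st i \<omega>)) (x0 \<omega>) u"
proof unfold_locales
  show "stX (st (Suc i) \<omega>) = (kron_id W (dimx p) *\<^sub>v stX (st i \<omega>) - mux h \<cdot>\<^sub>v stGX (st i \<omega>)) - Rx *\<^sub>v stDX (st i \<omega>)" for i
  proof -
    have "kron_id W (dimx p) *\<^sub>v stX (st i \<omega>) - mux h \<cdot>\<^sub>v stGX (st i \<omega>) \<in> carrier_vec (K * dimx p)"
      using stG_carrier kronc by (intro minus_carrier_vec smult_carrier_vec mult_mat_vec_carrier[OF kronc]
        measurable_vec_carrier[OF st_measurable(1)]) (use assms in auto)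
    then show ?thesis by (simp add: Let_def extra_matrices_def)
  qed
  show "stDX (st (Suc i) \<omega>) = stDX (st i \<omega>) + Rx *\<^sub>v stX (st (Suc i) \<omega>)" for i by (simp add: Let_def extra_matrices_def)
qed (use Rx uc measurable_vec_carrier[OF x0_meas assms] stG_carrier in \<open>auto simp: Let_def\<close>)

text \<open>The ascent in \<open>y\<close> is a descent with step \<open>- muy h\<close>. Only the
  square of the step enters the spread bounds, so the sign is harmless.\<close>

lemma consensus_y:
  assumes "\<omega> \<in> space M"
  shows "consensus_run K W (dimy p) Ry (- muy h) (\<lambda>i. stY (st i \<omega>)) (\<lambda>i. stGY (st i \<omega>)) (\<lambda>i. stDY (st i \<omega>)) (y0 \<omega>) v"
proof unfold_locales
  show "stY (st (Suc i) \<omega>) = (kron_id W (dimy p) *\<^sub>v stY (st i \<omega>) - (- muy h) \<cdot>\<^sub>v stGY (st i \<omega>)) - Ry *\<^sub>v stDY (st i \<omega>)" for i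
  proof -
    have kc: "kron_id W (dimy p) *\<^sub>v stY (st i \<omega>) \<in> carrier_vec (K * dimy p)"
      by (intro mult_mat_vec_carrier[OF kronc] measurable_vec_carrier[OF st_measurable(2)]) (use assms in auto)
    have "kron_id W (dimy p) *\<^sub>v stY (st i \<omega>) - (- muy h) \<cdot>\<^sub>v stGY (st i \<omega>) = kron_id W (dimy p) *\<^sub>v stY (st i \<omega>) + muy h \<cdot>\<^sub>v stGY (st i \<omega>)"
      using kc stG_carrier(2) by (intro eq_vecI) auto
    moreover have "kron_id W (dimy p) *\<^sub>v stY (st i \<omega>) + muy h \<cdot>\<^sub>v stGY (st i \<omega>) \<in> carrier_vec (K * dimy p)"
      using kc stG_carrier(2) by simp
    ultimately show ?thesis by (simp add: Let_def extra_matrices_def)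
  qed
  show "stDY (st (Suc i) \<omega>) = stDY (st i \<omega>) + Ry *\<^sub>v stY (st (Suc i) \<omega>)" for i by (simp add: Let_def extra_matrices_def)
qed (use Ry vc measurable_vec_carrier[OF y0_meas assms] stG_carrier in \<open>auto simp: Let_def\<close>)

end

section \<open>Expected errors along the run\<close>

lemma measurable_centroid:
  assumes f: "f \<in> N \<rightarrow>\<^sub>M vec_borel (K * d)"
  shows "(\<lambda>\<omega>. centroid K d (f \<omega>)) \<in> N \<rightarrow>\<^sub>M vec_borel d"
proof (rule measurable_vecI)
  fix j assume j: "j < d"
  have "(\<lambda>\<omega>. (\<Sum>k<K. f \<omega> $ (k * d + j)) / real K) \<in> borel_measurable N"
    by (intro borel_measurable_divide borel_measurable_sum borel_measurable_const measurable_vec_index[OF f] block_bound j) simp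
  then show "(\<lambda>\<omega>. centroid K d (f \<omega>) $ j) \<in> borel_measurable N" using j by (simp add: centroid_def)
qed simp

lemma ennreal_double: "0 \<le> a \<Longrightarrow> ennreal (2 * a) * I = ennreal a * I + ennreal a * I"
proof -
  assume a: "0 \<le> a"
  have "ennreal (2 * a) = ennreal a + ennreal a" using ennreal_plus[OF a a] by (simp only: mult_2)
  then show ?thesis by (simp add: distrib_right)
qed

text \<open>The passage from extended integrals to expectations, in the shape of the recursions of
  \<open>E_step\<close>: integrability of the right side yields integrability of the left and the
  same inequality between reals.\<close>

lemma (in prob_space) integrable_of_bound:
  fixes f g1 g2 :: "'a \<Rightarrow> real"
  assumes f: "f \<in> borel_measurable M" "\<And>\<omega>. 0 \<le> f \<omega>" and g: "integrable M g1" "\<And>\<omega>. 0 \<le> g1 \<omega>" "integrable M g2" "\<And>\<omega>. 0 \<le> g2 \<omega>"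
    and c: "0 \<le> a" "0 \<le> b" "0 \<le> c"
    and le: "(\<integral>\<^sup>+\<omega>. ennreal (f \<omega>) \<partial>M) \<le> ennreal a * (\<integral>\<^sup>+\<omega>. ennreal (g1 \<omega>) \<partial>M) + ennreal b * (\<integral>\<^sup>+\<omega>. ennreal (g2 \<omega>) \<partial>M) + ennreal c"
  shows "integrable M f" "expectation f \<le> a * expectation g1 + b * expectation g2 + c"
proof -
  have e: "(\<integral>\<^sup>+\<omega>. ennreal (g1 \<omega>) \<partial>M) = ennreal (expectation g1)" "(\<integral>\<^sup>+\<omega>. ennreal (g2 \<omega>) \<partial>M) = ennreal (expectation g2)"
    using g by (simp_all add: nn_integral_eq_integral)
  have nn: "0 \<le> expectation g1" "0 \<le> expectation g2" using g by (simp_all add: integral_nonneg)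
  have le': "(\<integral>\<^sup>+\<omega>. ennreal (f \<omega>) \<partial>M) \<le> ennreal (a * expectation g1 + b * expectation g2 + c)"
    using le unfolding e using nn c by (simp add: ennreal_mult)
  show i: "integrable M f" by (rule integrableI_nonneg) (use f le' in \<open>auto intro: le_less_trans\<close>)
  have "(\<integral>\<^sup>+\<omega>. ennreal (f \<omega>) \<partial>M) = ennreal (expectation f)" using f i by (simp add: nn_integral_eq_integral)
  then show "expectation f \<le> a * expectation g1 + b * expectation g2 + c"
    using le' nn c by (metis add_nonneg_nonneg ennreal_le_iff mult_nonneg_nonneg)
qed

lemma (in prob_space) integrable_of_le:
  fixes f g :: "'a \<Rightarrow> real"
  assumes f: "f \<in> borel_measurable M" "\<And>\<omega>. 0 \<le> f \<omega>" and g: "integrable M g" and le: "\<And>\<omega>. \<omega> \<in> space M \<Longrightarrow> f \<omega> \<le> g \<omega>"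
  shows "integrable M f"
  by (rule Bochner_Integration.integrable_bound[OF g f(1)]) (use f(2) le in \<open>auto intro!: AE_I2 order_trans[OF le]\<close>)

context dama_run
begin

definition "xb i \<omega> = centroid K (dimx p) (stX (st i \<omega>))"
definition "yb i \<omega> = centroid K (dimy p) (stY (st i \<omega>))"
definition "gxb i \<omega> = centroid K (dimx p) (stGX (st i \<omega>))"
definition "gyb i \<omega> = centroid K (dimy p) (stGY (st i \<omega>))"

lemma centroid_carriers [simp]: "xb i \<omega> \<in> Xs p" "yb i \<omega> \<in> Ys p" "gxb i \<omega> \<in> Xs p" "gyb i \<omega> \<in> Ys p"
  by (simp_all add: xb_def yb_def gxb_def gyb_def)

lemma centroid_dims [simp]: "dim_vec (xb i \<omega>) = dimx p" "dim_vec (yb i \<omega>) = dimy p" "dim_vec (gxb i \<omega>) = dimx p" "dim_vec (gyb i \<omega>) = dimy p"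
  "dim_vec (gradx_J p x y) = dimx p" "dim_vec (grady_J p x y) = dimy p"
  by (rule carrier_vecD, simp)+

definition "fGX i \<omega> = sqn (gxb i \<omega>)"
definition "fGY i \<omega> = sqn (gyb i \<omega>)"
definition "fSX i \<omega> = sqn (gradx_J p (xb i \<omega>) (yb i \<omega>))"
definition "fSY i \<omega> = sqn (grady_J p (xb i \<omega>) (yb i \<omega>))"
definition "fEX i \<omega> = sqn (gxb i \<omega> - gradx_J p (xb i \<omega>) (yb i \<omega>))"
definition "fEY i \<omega> = sqn (gyb i \<omega> - grady_J p (xb i \<omega>) (yb i \<omega>))"
text \<open>Here and in \<open>finc\<close>, \<open>fu\<close>, \<open>fw\<close> and
  \<open>fz\<close> the agents are summed, whereas \<open>fa\<close> concerns averages and carries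
  no factor \<open>K\<close>.\<close>

definition "fdev i \<omega> = (\<Sum>k<K. sqn (X i k \<omega> - xb i \<omega>)) + (\<Sum>k<K. sqn (Y i k \<omega> - yb i \<omega>))"
definition "finc i \<omega> = (\<Sum>k<K. sqn (X (Suc i) k \<omega> - X i k \<omega>) + sqn (Y (Suc i) k \<omega> - Y i k \<omega>))"
definition "fu i \<omega> = (\<Sum>k<K. sqn (gX i k \<omega> - gradx_risk p k (X i k \<omega>) (Y i k \<omega>)) + sqn (gY i k \<omega> - grady_risk p k (X i k \<omega>) (Y i k \<omega>)))"
definition "fa i \<omega> = sqn (sx.merr (X i) (Y i) (gX i) \<omega>) + sqn (sy.merr (X i) (Y i) (gY i) \<omega>)"
definition "fw i \<omega> = (\<Sum>k<K. sqn (gX (Suc i) k \<omega> - gX i k \<omega>) + sqn (gY (Suc i) k \<omega> - gY i k \<omega>))"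
definition "fz \<omega> = (\<Sum>k<K. sqn (gX 0 k \<omega> - gxb 0 \<omega>)) + (\<Sum>k<K. sqn (gY 0 k \<omega> - gyb 0 \<omega>))"
definition "fpot i \<omega> = obj.pot (xb i \<omega>) (yb i \<omega>)"

lemma f_nonneg: "0 \<le> fGX i \<omega>" "0 \<le> fGY i \<omega>" "0 \<le> fSX i \<omega>" "0 \<le> fSY i \<omega>" "0 \<le> fEX i \<omega>" "0 \<le> fEY i \<omega>" "0 \<le> fdev i \<omega>"
    "0 \<le> finc i \<omega>" "0 \<le> fu i \<omega>" "0 \<le> fa i \<omega>" "0 \<le> fw i \<omega>" "0 \<le> fz \<omega>" "0 \<le> fpot i \<omega>"
  by (simp_all add: fGX_def fGY_def fSX_def fSY_def fEX_def fEY_def fdev_def finc_def fu_def fa_def fw_def fz_def fpot_def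
      sum_nonneg obj.pot_nonneg)

lemma hist_le: "i \<le> j \<Longrightarrow> hist i \<subseteq> hist j" by (auto simp: hist_def)

lemma agent_gen:
  assumes k: "k < K" and "i \<le> j"
  shows "X i k \<in> gen (hist j) \<rightarrow>\<^sub>M vec_borel (dimx p)" "Y i k \<in> gen (hist j) \<rightarrow>\<^sub>M vec_borel (dimy p)"
    and "Suc i \<le> j \<Longrightarrow> gX i k \<in> gen (hist j) \<rightarrow>\<^sub>M vec_borel (dimx p)" "Suc i \<le> j \<Longrightarrow> gY i k \<in> gen (hist j) \<rightarrow>\<^sub>M vec_borel (dimy p)"
proof -
  note m = hist_le[OF assms(2)]
  show "X i k \<in> gen (hist j) \<rightarrow>\<^sub>M vec_borel (dimx p)" by (rule measurable_gen_mono[OF measurable_block[OF st_measurable(1) k] m])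
  show "Y i k \<in> gen (hist j) \<rightarrow>\<^sub>M vec_borel (dimy p)" by (rule measurable_gen_mono[OF measurable_block[OF st_measurable(2) k] m])
  assume "Suc i \<le> j"
  note m' = hist_le[OF this]
  show "gX i k \<in> gen (hist j) \<rightarrow>\<^sub>M vec_borel (dimx p)" by (rule measurable_gen_mono[OF measurable_block[OF st_measurable(5) k] m'])
  show "gY i k \<in> gen (hist j) \<rightarrow>\<^sub>M vec_borel (dimy p)" by (rule measurable_gen_mono[OF measurable_block[OF st_measurable(6) k] m'])
qed

lemma agent_M:
  assumes k: "k < K"
  shows "X i k \<in> M \<rightarrow>\<^sub>M vec_borel (dimx p)" "Y i k \<in> M \<rightarrow>\<^sub>M vec_borel (dimy p)"
    "gX i k \<in> M \<rightarrow>\<^sub>M vec_borel (dimx p)" "gY i k \<in> M \<rightarrow>\<^sub>M vec_borel (dimy p)"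
  using agent_gen(1,2)[OF k order_refl, of i] agent_gen(3,4)[OF k, of i "Suc i"]
  by (auto intro!: measurable_gen_M[OF _ hist_sources])

lemma centroid_M:
  "xb i \<in> M \<rightarrow>\<^sub>M vec_borel (dimx p)" "yb i \<in> M \<rightarrow>\<^sub>M vec_borel (dimy p)"
  "gxb i \<in> M \<rightarrow>\<^sub>M vec_borel (dimx p)" "gyb i \<in> M \<rightarrow>\<^sub>M vec_borel (dimy p)"
  unfolding xb_def[abs_def] yb_def[abs_def] gxb_def[abs_def] gyb_def[abs_def]
  by (rule measurable_centroid, rule measurable_gen_M[OF _ hist_sources], rule st_measurable)+

lemma gradJ_M:
  assumes x: "x \<in> N \<rightarrow>\<^sub>M vec_borel (dimx p)" and y: "y \<in> N \<rightarrow>\<^sub>M vec_borel (dimy p)"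
  shows "(\<lambda>\<omega>. gradx_J p (x \<omega>) (y \<omega>)) \<in> N \<rightarrow>\<^sub>M vec_borel (dimx p)" "(\<lambda>\<omega>. grady_J p (x \<omega>) (y \<omega>)) \<in> N \<rightarrow>\<^sub>M vec_borel (dimy p)"
proof -
  note c = measurable_vec_carrier[OF x] measurable_vec_carrier[OF y]
  show "(\<lambda>\<omega>. gradx_J p (x \<omega>) (y \<omega>)) \<in> N \<rightarrow>\<^sub>M vec_borel (dimx p)"
  proof (rule measurable_vecI)
    fix j assume j: "j < dimx p"
    have "(\<lambda>\<omega>. (\<Sum>k<K. gradx_risk p k (x \<omega>) (y \<omega>) $ j) / real K) \<in> borel_measurable N"
      by (intro borel_measurable_divide borel_measurable_sum borel_measurable_const measurable_vec_index[OF sx.R_meas] x y j) simp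
    then show "(\<lambda>\<omega>. gradx_J p (x \<omega>) (y \<omega>) $ j) \<in> borel_measurable N"
      by (rule measurable_cong[THEN iffD1, rotated]) (use gradx_J_index c j in simp)
  qed simp
  show "(\<lambda>\<omega>. grady_J p (x \<omega>) (y \<omega>)) \<in> N \<rightarrow>\<^sub>M vec_borel (dimy p)"
  proof (rule measurable_vecI)
    fix j assume j: "j < dimy p"
    have "(\<lambda>\<omega>. (\<Sum>k<K. grady_risk p k (x \<omega>) (y \<omega>) $ j) / real K) \<in> borel_measurable N"
      by (intro borel_measurable_divide borel_measurable_sum borel_measurable_const measurable_vec_index[OF sy.R_meas] x y j) simp
    then show "(\<lambda>\<omega>. grady_J p (x \<omega>) (y \<omega>) $ j) \<in> borel_measurable N"
      by (rule measurable_cong[THEN iffD1, rotated]) (use grady_J_index c j in simp)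
  qed simp
qed

lemma f_measurable [measurable]: "fGX i \<in> borel_measurable M" "fGY i \<in> borel_measurable M" "fSX i \<in> borel_measurable M" "fSY i \<in> borel_measurable M"
  "fEX i \<in> borel_measurable M" "fEY i \<in> borel_measurable M" "fdev i \<in> borel_measurable M" "finc i \<in> borel_measurable M"
  "fu i \<in> borel_measurable M" "fa i \<in> borel_measurable M" "fw i \<in> borel_measurable M" "fz \<in> borel_measurable M" "fpot i \<in> borel_measurable M"
proof -
  note mx = measurable_sqn[where d = "dimx p"] and my = measurable_sqn[where d = "dimy p"]
  show "fGX i \<in> borel_measurable M" unfolding fGX_def[abs_def] by (intro mx centroid_M)
  show "fGY i \<in> borel_measurable M" unfolding fGY_def[abs_def] by (intro my centroid_M)
  show "fSX i \<in> borel_measurable M" unfolding fSX_def[abs_def] by (intro mx gradJ_M centroid_M)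
  show "fSY i \<in> borel_measurable M" unfolding fSY_def[abs_def] by (intro my gradJ_M centroid_M)
  show "fEX i \<in> borel_measurable M" unfolding fEX_def[abs_def] by (intro mx gradJ_M centroid_M measurable_vec_minus)
  show "fEY i \<in> borel_measurable M" unfolding fEY_def[abs_def] by (intro my gradJ_M centroid_M measurable_vec_minus)
  show "fdev i \<in> borel_measurable M" unfolding fdev_def[abs_def]
    by (intro borel_measurable_add borel_measurable_sum mx[OF measurable_vec_minus] my[OF measurable_vec_minus] agent_M centroid_M) auto
  show "finc i \<in> borel_measurable M" unfolding finc_def[abs_def]
    by (intro borel_measurable_sum borel_measurable_add mx[OF measurable_vec_minus] my[OF measurable_vec_minus] agent_M) auto
  show "fu i \<in> borel_measurable M" unfolding fu_def[abs_def]
    by (intro borel_measurable_sum borel_measurable_add mx[OF measurable_vec_minus] my[OF measurable_vec_minus] agent_M sx.R_meas sy.R_meas) auto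
  show "fa i \<in> borel_measurable M" unfolding fa_def[abs_def]
    by (intro borel_measurable_add mx[OF sx.err_measurable(2)] my[OF sy.err_measurable(2)] agent_M)
  show "fw i \<in> borel_measurable M" unfolding fw_def[abs_def]
    by (intro borel_measurable_sum borel_measurable_add mx[OF measurable_vec_minus] my[OF measurable_vec_minus] agent_M) auto
  show "fz \<in> borel_measurable M" unfolding fz_def[abs_def]
    by (intro borel_measurable_add borel_measurable_sum mx[OF measurable_vec_minus] my[OF measurable_vec_minus] agent_M centroid_M) auto
  show "fpot i \<in> borel_measurable M" unfolding fpot_def[abs_def] obj.pot_def
    by (intro borel_measurable_add borel_measurable_diff borel_measurable_divide borel_measurable_const obj.Pm_measurable obj.F_measurable centroid_M)
qed

lemma centroid_updates:
  assumes "\<omega> \<in> space M"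
  shows "xb (Suc i) \<omega> = xb i \<omega> - mux h \<cdot>\<^sub>v gxb i \<omega>" "yb (Suc i) \<omega> = yb i \<omega> + muy h \<cdot>\<^sub>v gyb i \<omega>"
proof -
  interpret cx: consensus_run K W "dimx p" Rx "mux h" "\<lambda>i. stX (st i \<omega>)" "\<lambda>i. stGX (st i \<omega>)" "\<lambda>i. stDX (st i \<omega>)" "x0 \<omega>" u
    by (rule consensus_x[OF assms])
  interpret cy: consensus_run K W "dimy p" Ry "- muy h" "\<lambda>i. stY (st i \<omega>)" "\<lambda>i. stGY (st i \<omega>)" "\<lambda>i. stDY (st i \<omega>)" "y0 \<omega>" v
    by (rule consensus_y[OF assms])
  show "xb (Suc i) \<omega> = xb i \<omega> - mux h \<cdot>\<^sub>v gxb i \<omega>" unfolding xb_def gxb_def by (rule cx.centroid_step)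
  have "yb (Suc i) \<omega> = yb i \<omega> - (- muy h) \<cdot>\<^sub>v gyb i \<omega>" unfolding yb_def gyb_def by (rule cy.centroid_step)
  also have "\<dots> = yb i \<omega> + muy h \<cdot>\<^sub>v gyb i \<omega>"
    by (rule eq_vecI) simp_all
  finally show "yb (Suc i) \<omega> = yb i \<omega> + muy h \<cdot>\<^sub>v gyb i \<omega>" .
qed

lemma path_inc:
  assumes "\<omega> \<in> space M"
  shows "finc i \<omega> \<le> real K * ((mux h)\<^sup>2 * fGX i \<omega> + (muy h)\<^sup>2 * fGY i \<omega>) + 2 * fdev (Suc i) \<omega> + 2 * fdev i \<omega>"
proof -
  interpret cx: consensus_run K W "dimx p" Rx "mux h" "\<lambda>i. stX (st i \<omega>)" "\<lambda>i. stGX (st i \<omega>)" "\<lambda>i. stDX (st i \<omega>)" "x0 \<omega>" u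
    by (rule consensus_x[OF assms])
  interpret cy: consensus_run K W "dimy p" Ry "- muy h" "\<lambda>i. stY (st i \<omega>)" "\<lambda>i. stGY (st i \<omega>)" "\<lambda>i. stDY (st i \<omega>)" "y0 \<omega>" v
    by (rule consensus_y[OF assms])
  have d: "fdev i \<omega> = cx.spread (stX (st i \<omega>)) + cy.spread (stY (st i \<omega>))" for i
    by (simp only: fdev_def cx.spread_def cy.spread_def xb_def yb_def)
  show ?thesis using cx.increment_bound[of i] cy.increment_bound[of i]
    unfolding finc_def sum.distrib d fGX_def fGY_def gxb_def gyb_def distrib_left power2_minus by linarith
qed

text \<open>Both blocks obey the same bound with their own step; the smaller step in
  \<open>x\<close> is replaced by \<open>muy h\<close> so that they can be added.\<close>

lemma path_dev:
  assumes "\<omega> \<in> space M" and mu: "0 < mux h" "mux h \<le> muy h"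
  shows "(\<Sum>i\<le>Suc n. fdev i \<omega>) \<le> (muy h)\<^sup>2 / gam\<^sup>2 * fz \<omega> + (muy h)\<^sup>2 / gam^3 * (\<Sum>i<n. fw i \<omega>)"
proof -
  interpret cx: consensus_run K W "dimx p" Rx "mux h" "\<lambda>i. stX (st i \<omega>)" "\<lambda>i. stGX (st i \<omega>)" "\<lambda>i. stDX (st i \<omega>)" "x0 \<omega>" u
    by (rule consensus_x[OF assms(1)])
  interpret cy: consensus_run K W "dimy p" Ry "- muy h" "\<lambda>i. stY (st i \<omega>)" "\<lambda>i. stGY (st i \<omega>)" "\<lambda>i. stDY (st i \<omega>)" "y0 \<omega>" v
    by (rule consensus_y[OF assms(1)])
  have d: "fdev i \<omega> = cx.spread (stX (st i \<omega>)) + cy.spread (stY (st i \<omega>))" for i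
    by (simp only: fdev_def cx.spread_def cy.spread_def xb_def yb_def)
  have z: "fz \<omega> = cx.spread (stGX (st 0 \<omega>)) + cy.spread (stGY (st 0 \<omega>))"
    by (simp only: fz_def cx.spread_def cy.spread_def gxb_def gyb_def)
  let ?wx = "\<Sum>i<n. \<Sum>k<K. sqn (gX (Suc i) k \<omega> - gX i k \<omega>)" and ?wy = "\<Sum>i<n. \<Sum>k<K. sqn (gY (Suc i) k \<omega> - gY i k \<omega>)"
  have w: "(\<Sum>i<n. fw i \<omega>) = ?wx + ?wy" by (simp only: fw_def sum.distrib)
  have m2: "(mux h)\<^sup>2 \<le> (muy h)\<^sup>2" using mu by (intro power_mono) auto
  have g: "0 < gam\<^sup>2" "0 < gam^3" using gam by auto
  have "(mux h)\<^sup>2 / gam\<^sup>2 * cx.spread (stGX (st 0 \<omega>)) \<le> (muy h)\<^sup>2 / gam\<^sup>2 * cx.spread (stGX (st 0 \<omega>))"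
    using m2 g by (intro mult_right_mono divide_right_mono cx.spread_nonneg) auto
  moreover have "(mux h)\<^sup>2 / gam^3 * ?wx \<le> (muy h)\<^sup>2 / gam^3 * ?wx"
    using m2 g by (intro mult_right_mono divide_right_mono sum_nonneg) auto
  ultimately show ?thesis using cx.spread_sum[of n] cy.spread_sum[of n]
    unfolding d z w sum.distrib distrib_left power2_minus by linarith
qed

text \<open>The averaged estimate differs from the gradient of \<open>J p\<close> at the centroid by
  the mean of the agents' errors plus a change of base points, which costs \<open>L\<^sup>2\<close>
  times the mean squared spread.\<close>

lemma path_error:
  assumes w: "\<omega> \<in> space M"
  shows "fEX i \<omega> \<le> 2 * sqn (sx.merr (X i) (Y i) (gX i) \<omega>) + 2 * L\<^sup>2 / real K * fdev i \<omega>"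
    and "fEY i \<omega> \<le> 2 * sqn (sy.merr (X i) (Y i) (gY i) \<omega>) + 2 * L\<^sup>2 / real K * fdev i \<omega>"
proof -
  have XY: "X i k \<omega> \<in> Xs p" "Y i k \<omega> \<in> Ys p" for k by simp_all
  have dv: "(\<Sum>k<K. sqn (X i k \<omega> - xb i \<omega>) + sqn (Y i k \<omega> - yb i \<omega>)) = fdev i \<omega>" by (simp only: fdev_def sum.distrib)
  let ?v = "Matrix.vec (dimx p) (\<lambda>j. (\<Sum>k<K. gradx_risk p k (X i k \<omega>) (Y i k \<omega>) $ j) / real K - gradx_J p (xb i \<omega>) (yb i \<omega>) $ j)"
  have "gxb i \<omega> - gradx_J p (xb i \<omega>) (yb i \<omega>) = sx.merr (X i) (Y i) (gX i) \<omega> + ?v"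
  proof (rule eq_vecI)
    fix j assume "j < dim_vec (sx.merr (X i) (Y i) (gX i) \<omega> + ?v)"
    then have j: "j < dimx p" by simp
    have "(gX i k \<omega> - gradx_risk p k (X i k \<omega>) (Y i k \<omega>)) $ j = gX i k \<omega> $ j - gradx_risk p k (X i k \<omega>) (Y i k \<omega>) $ j" for k
      using j sx.Rc[THEN carrier_vecD] by simp
    then have m: "sx.merr (X i) (Y i) (gX i) \<omega> $ j = (\<Sum>k<K. gX i k \<omega> $ j) / real K - (\<Sum>k<K. gradx_risk p k (X i k \<omega>) (Y i k \<omega>) $ j) / real K"
      using j by (simp add: sx.merr_def sum_subtractf diff_divide_distrib)
    have g: "gxb i \<omega> $ j = (\<Sum>k<K. gX i k \<omega> $ j) / real K" using j by (simp add: gxb_def centroid_def)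
    show "(gxb i \<omega> - gradx_J p (xb i \<omega>) (yb i \<omega>)) $ j = (sx.merr (X i) (Y i) (gX i) \<omega> + ?v) $ j"
      using j m g by simp
  qed simp
  then have "fEX i \<omega> \<le> 2 * sqn (sx.merr (X i) (Y i) (gX i) \<omega>) + 2 * sqn ?v"
    unfolding fEX_def by (simp only:) (rule sqn_add_le[of _ "dimx p"], auto)
  moreover have "sqn ?v \<le> L\<^sup>2 * ((\<Sum>k<K. sqn (X i k \<omega> - xb i \<omega>) + sqn (Y i k \<omega> - yb i \<omega>)) / real K)"
    by (rule gradx_mean_lipschitz) (use XY in auto)
  ultimately show "fEX i \<omega> \<le> 2 * sqn (sx.merr (X i) (Y i) (gX i) \<omega>) + 2 * L\<^sup>2 / real K * fdev i \<omega>"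
    unfolding dv by simp
  let ?v = "Matrix.vec (dimy p) (\<lambda>j. (\<Sum>k<K. grady_risk p k (X i k \<omega>) (Y i k \<omega>) $ j) / real K - grady_J p (xb i \<omega>) (yb i \<omega>) $ j)"
  have "gyb i \<omega> - grady_J p (xb i \<omega>) (yb i \<omega>) = sy.merr (X i) (Y i) (gY i) \<omega> + ?v"
  proof (rule eq_vecI)
    fix j assume "j < dim_vec (sy.merr (X i) (Y i) (gY i) \<omega> + ?v)"
    then have j: "j < dimy p" by simp
    have "(gY i k \<omega> - grady_risk p k (X i k \<omega>) (Y i k \<omega>)) $ j = gY i k \<omega> $ j - grady_risk p k (X i k \<omega>) (Y i k \<omega>) $ j" for k
      using j sy.Rc[THEN carrier_vecD] by simp
    then have m: "sy.merr (X i) (Y i) (gY i) \<omega> $ j = (\<Sum>k<K. gY i k \<omega> $ j) / real K - (\<Sum>k<K. grady_risk p k (X i k \<omega>) (Y i k \<omega>) $ j) / real K"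
      using j by (simp add: sy.merr_def sum_subtractf diff_divide_distrib)
    have g: "gyb i \<omega> $ j = (\<Sum>k<K. gY i k \<omega> $ j) / real K" using j by (simp add: gyb_def centroid_def)
    show "(gyb i \<omega> - grady_J p (xb i \<omega>) (yb i \<omega>)) $ j = (sy.merr (X i) (Y i) (gY i) \<omega> + ?v) $ j"
      using j m g by simp
  qed simp
  then have "fEY i \<omega> \<le> 2 * sqn (sy.merr (X i) (Y i) (gY i) \<omega>) + 2 * sqn ?v"
    unfolding fEY_def by (simp only:) (rule sqn_add_le[of _ "dimy p"], auto)
  moreover have "sqn ?v \<le> L\<^sup>2 * ((\<Sum>k<K. sqn (X i k \<omega> - xb i \<omega>) + sqn (Y i k \<omega> - yb i \<omega>)) / real K)"
    by (rule grady_mean_lipschitz) (use XY in auto)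
  ultimately show "fEY i \<omega> \<le> 2 * sqn (sy.merr (X i) (Y i) (gY i) \<omega>) + 2 * L\<^sup>2 / real K * fdev i \<omega>"
    unfolding dv by simp
qed

lemma path_error_sum:
  assumes "\<omega> \<in> space M" shows "fEX i \<omega> + fEY i \<omega> \<le> 2 * fa i \<omega> + 4 * L\<^sup>2 / real K * fdev i \<omega>"
proof -
  have "4 * L\<^sup>2 / real K * fdev i \<omega> = 2 * L\<^sup>2 / real K * fdev i \<omega> + 2 * L\<^sup>2 / real K * fdev i \<omega>" by simp
  then show ?thesis using path_error[OF assms, of i] unfolding fa_def distrib_left by argo
qed

end

section \<open>Recursions for the expected errors\<close>

context dama_run
begin

abbreviation "E f \<equiv> \<integral>\<^sup>+\<omega>. ennreal (f \<omega>) \<partial>M"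

declare dama.simps(2) [simp del]

lemma E_add:
  fixes f g :: "'w \<Rightarrow> real"
  assumes "f \<in> borel_measurable M" "g \<in> borel_measurable M" "\<And>\<omega>. 0 \<le> f \<omega>" "\<And>\<omega>. 0 \<le> g \<omega>"
  shows "E (\<lambda>\<omega>. f \<omega> + g \<omega>) = E f + E g"
proof -
  have "E (\<lambda>\<omega>. f \<omega> + g \<omega>) = (\<integral>\<^sup>+\<omega>. ennreal (f \<omega>) + ennreal (g \<omega>) \<partial>M)"
    by (intro nn_integral_cong ennreal_plus assms)
  also have "\<dots> = E f + E g" by (intro nn_integral_add measurable_compose[OF _ measurable_ennreal] assms)
  finally show ?thesis .
qed

lemma E_sum2:
  fixes a b :: "nat \<Rightarrow> 'w \<Rightarrow> real"
  assumes "\<And>k. k < K \<Longrightarrow> a k \<in> borel_measurable M" "\<And>k. k < K \<Longrightarrow> b k \<in> borel_measurable M"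
    "\<And>k \<omega>. 0 \<le> a k \<omega>" "\<And>k \<omega>. 0 \<le> b k \<omega>"
  shows "E (\<lambda>\<omega>. \<Sum>k<K. a k \<omega> + b k \<omega>) = (\<Sum>k<K. E (a k) + E (b k))"
proof -
  have "E (\<lambda>\<omega>. \<Sum>k<K. a k \<omega> + b k \<omega>) = (\<integral>\<^sup>+\<omega>. (\<Sum>k<K. ennreal (a k \<omega>) + ennreal (b k \<omega>)) \<partial>M)"
  proof (rule nn_integral_cong)
    fix \<omega>
    have "(\<Sum>k<K. ennreal (a k \<omega>) + ennreal (b k \<omega>)) = (\<Sum>k<K. ennreal (a k \<omega> + b k \<omega>))"
      by (intro sum.cong refl ennreal_plus[symmetric] assms)
    also have "\<dots> = ennreal (\<Sum>k<K. a k \<omega> + b k \<omega>)" by (intro sum_ennreal add_nonneg_nonneg assms)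
    finally show "ennreal (\<Sum>k<K. a k \<omega> + b k \<omega>) = (\<Sum>k<K. ennreal (a k \<omega>) + ennreal (b k \<omega>))" by (rule sym)
  qed
  also have "\<dots> = (\<Sum>k<K. \<integral>\<^sup>+\<omega>. ennreal (a k \<omega>) + ennreal (b k \<omega>) \<partial>M)"
    by (rule nn_integral_sum, rule borel_measurable_add) (auto intro!: measurable_compose[OF assms(1) measurable_ennreal] measurable_compose[OF assms(2) measurable_ennreal])
  also have "\<dots> = (\<Sum>k<K. E (a k) + E (b k))"
    by (rule sum.cong[OF refl], rule nn_integral_add) (auto intro!: measurable_compose[OF assms(1) measurable_ennreal] measurable_compose[OF assms(2) measurable_ennreal])
  finally show ?thesis .
qed

lemma sq_meas:
  assumes k: "k < K"
  shows "(\<lambda>\<omega>. sqn (X (Suc i) k \<omega> - X i k \<omega>)) \<in> borel_measurable M" "(\<lambda>\<omega>. sqn (Y (Suc i) k \<omega> - Y i k \<omega>)) \<in> borel_measurable M"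
    "(\<lambda>\<omega>. sqn (gX (Suc i) k \<omega> - gX i k \<omega>)) \<in> borel_measurable M" "(\<lambda>\<omega>. sqn (gY (Suc i) k \<omega> - gY i k \<omega>)) \<in> borel_measurable M"
    "(\<lambda>\<omega>. sqn (gX i k \<omega> - gradx_risk p k (X i k \<omega>) (Y i k \<omega>))) \<in> borel_measurable M"
    "(\<lambda>\<omega>. sqn (gY i k \<omega> - grady_risk p k (X i k \<omega>) (Y i k \<omega>))) \<in> borel_measurable M"
  by (intro measurable_sqn[OF measurable_vec_minus[where m = "dimx p"]] measurable_sqn[OF measurable_vec_minus[where m = "dimy p"]]
      agent_M k sx.R_meas sy.R_meas)+

lemma E_finc: "E (finc i) = (\<Sum>k<K. E (\<lambda>\<omega>. sqn (X (Suc i) k \<omega> - X i k \<omega>) + sqn (Y (Suc i) k \<omega> - Y i k \<omega>)))"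
proof -
  have "E (finc i) = (\<Sum>k<K. E (\<lambda>\<omega>. sqn (X (Suc i) k \<omega> - X i k \<omega>)) + E (\<lambda>\<omega>. sqn (Y (Suc i) k \<omega> - Y i k \<omega>)))"
    unfolding finc_def by (intro E_sum2 sq_meas sqn_nonneg)
  also have "\<dots> = (\<Sum>k<K. E (\<lambda>\<omega>. sqn (X (Suc i) k \<omega> - X i k \<omega>) + sqn (Y (Suc i) k \<omega> - Y i k \<omega>)))"
    by (intro sum.cong refl E_add[symmetric] sq_meas) auto
  finally show ?thesis .
qed

lemma E_fu: "E (fu i) = (\<Sum>k<K. E (\<lambda>\<omega>. sqn (gX i k \<omega> - gradx_risk p k (X i k \<omega>) (Y i k \<omega>)))
    + E (\<lambda>\<omega>. sqn (gY i k \<omega> - grady_risk p k (X i k \<omega>) (Y i k \<omega>))))"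
  unfolding fu_def by (intro E_sum2 sq_meas sqn_nonneg)

lemma E_fw: "E (fw i) = (\<Sum>k<K. E (\<lambda>\<omega>. sqn (gX (Suc i) k \<omega> - gX i k \<omega>)) + E (\<lambda>\<omega>. sqn (gY (Suc i) k \<omega> - gY i k \<omega>)))"
  unfolding fw_def by (intro E_sum2 sq_meas sqn_nonneg)

lemma E_fa: "E (fa i) = E (\<lambda>\<omega>. sqn (sx.merr (X i) (Y i) (gX i) \<omega>)) + E (\<lambda>\<omega>. sqn (sy.merr (X i) (Y i) (gY i) \<omega>))"
proof -
  have m: "(\<lambda>\<omega>. sqn (sx.merr (X i) (Y i) (gX i) \<omega>)) \<in> borel_measurable M" "(\<lambda>\<omega>. sqn (sy.merr (X i) (Y i) (gY i) \<omega>)) \<in> borel_measurable M"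
    by (intro measurable_sqn[OF sx.err_measurable(2)] measurable_sqn[OF sy.err_measurable(2)] agent_M; assumption)+
  then show ?thesis unfolding fa_def by (intro E_add sqn_nonneg)
qed

lemma E_initial:
  assumes "0 < T"
  shows "E (fa 0) \<le> ennreal (2 * \<sigma>\<^sup>2 / (batch0 h * real K))" "E (fu 0) \<le> ennreal (2 * \<sigma>\<^sup>2 / batch0 h * real K)"
proof -
  have Bx: "E (\<lambda>\<omega>. sqn (sx.merr (X 0) (Y 0) (gX 0) \<omega>)) \<le> ennreal (\<sigma>\<^sup>2 / (batch0 h * real K))"
    "\<And>k. k < K \<Longrightarrow> E (\<lambda>\<omega>. sqn (gX 0 k \<omega> - gradx_risk p k (X 0 k \<omega>) (Y 0 k \<omega>))) \<le> ennreal (\<sigma>\<^sup>2 / batch0 h)"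
    by (rule sx.minibatch_error_bounds[where I = "hist 0" and i = 0, OF hist_sources agent_gen(1)[OF _ order_refl] agent_gen(2)[OF _ order_refl]
        b0 hist_fresh noise(1)[OF _ assms] g_init(1) agent_M(3)]; assumption)+
  have By: "E (\<lambda>\<omega>. sqn (sy.merr (X 0) (Y 0) (gY 0) \<omega>)) \<le> ennreal (\<sigma>\<^sup>2 / (batch0 h * real K))"
    "\<And>k. k < K \<Longrightarrow> E (\<lambda>\<omega>. sqn (gY 0 k \<omega> - grady_risk p k (X 0 k \<omega>) (Y 0 k \<omega>))) \<le> ennreal (\<sigma>\<^sup>2 / batch0 h)"
    by (rule sy.minibatch_error_bounds[where I = "hist 0" and i = 0, OF hist_sources agent_gen(1)[OF _ order_refl] agent_gen(2)[OF _ order_refl]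
        b0 hist_fresh noise(2)[OF _ assms] g_init(2) agent_M(4)]; assumption)+
  have "E (fa 0) \<le> ennreal (\<sigma>\<^sup>2 / (batch0 h * real K)) + ennreal (\<sigma>\<^sup>2 / (batch0 h * real K))"
    unfolding E_fa by (intro add_mono Bx By)
  also have "\<dots> = ennreal (\<sigma>\<^sup>2 / (batch0 h * real K) + \<sigma>\<^sup>2 / (batch0 h * real K))" by (rule ennreal_plus[symmetric]) auto
  finally show "E (fa 0) \<le> ennreal (2 * \<sigma>\<^sup>2 / (batch0 h * real K))" by simp
  have "E (fu 0) \<le> (\<Sum>k<K. ennreal (\<sigma>\<^sup>2 / batch0 h) + ennreal (\<sigma>\<^sup>2 / batch0 h))"
    unfolding E_fu by (intro sum_mono add_mono Bx By) auto
  also have "\<dots> = (\<Sum>k<K. ennreal (2 * \<sigma>\<^sup>2 / batch0 h))"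
    by (intro sum.cong refl) (subst ennreal_plus[symmetric], auto)
  also have "\<dots> = ennreal (\<Sum>k<K. 2 * \<sigma>\<^sup>2 / batch0 h)" by (rule sum_ennreal) simp
  finally show "E (fu 0) \<le> ennreal (2 * \<sigma>\<^sup>2 / batch0 h * real K)" by (simp add: mult.commute)
qed

text \<open>The past is \<open>hist (Suc i)\<close>: it determines the new iterates and the old
  estimate, while the samples of iteration \<open>Suc i\<close> are fresh. The two blocks each
  contribute the full increment of both variables, so every constant of the one-block bounds
  doubles.\<close>

lemma E_step:
  assumes T: "Suc i < T"
  shows "E (fa (Suc i)) \<le> ennreal ((1 - \<beta>)\<^sup>2) * E (fa i) + ennreal (4 * L\<^sup>2 / (real K)\<^sup>2) * E (finc i) + ennreal (4 * \<beta>\<^sup>2 * \<sigma>\<^sup>2 / real K)"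
    and "E (fu (Suc i)) \<le> ennreal ((1 - \<beta>)\<^sup>2) * E (fu i) + ennreal (4 * L\<^sup>2) * E (finc i) + ennreal (4 * \<beta>\<^sup>2 * \<sigma>\<^sup>2 * real K)"
    and "E (fw i) \<le> ennreal (4 * \<beta>\<^sup>2) * E (fu i) + ennreal (16 * L\<^sup>2) * E (finc i) + ennreal (8 * \<beta>\<^sup>2 * \<sigma>\<^sup>2 * real K)"
proof -
  have be: "0 \<le> \<beta>" using beta by simp
  note side = hist_sources[of "Suc i"] agent_gen(1)[OF _ le_SucI[OF order_refl]] agent_gen(2)[OF _ le_SucI[OF order_refl]]
    agent_gen(1)[OF _ order_refl] agent_gen(2)[OF _ order_refl]
  note sX = side agent_gen(3)[OF _ le_SucI[OF order_refl] order_refl] hist_fresh be beta(2) noise(1)[OF _ T] gX_step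
  note sY = side agent_gen(4)[OF _ le_SucI[OF order_refl] order_refl] hist_fresh be beta(2) noise(2)[OF _ T] gY_step
  let ?I = "\<lambda>k. E (\<lambda>\<omega>. sqn (X (Suc i) k \<omega> - X i k \<omega>) + sqn (Y (Suc i) k \<omega> - Y i k \<omega>))"
  note xb = sx.storm_error_bounds[where i = "Suc i" and I = "hist (Suc i)" and X = "X i" and Y = "Y i" and X' = "X (Suc i)" and Y' = "Y (Suc i)"
      and g = "gX i" and g' = "gX (Suc i)" and \<sigma> = \<sigma> and \<beta> = \<beta>, OF sX agent_M(3)]
  note yb = sy.storm_error_bounds[where i = "Suc i" and I = "hist (Suc i)" and X = "X i" and Y = "Y i" and X' = "X (Suc i)" and Y' = "Y (Suc i)"
      and g = "gY i" and g' = "gY (Suc i)" and \<sigma> = \<sigma> and \<beta> = \<beta>, OF sY agent_M(4)]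
  note xd = sx.storm_drift[where i = "Suc i" and I = "hist (Suc i)" and X = "X i" and Y = "Y i" and X' = "X (Suc i)" and Y' = "Y (Suc i)"
      and g = "gX i" and g' = "gX (Suc i)" and \<sigma> = \<sigma> and \<beta> = \<beta>, OF sX]
  note yd = sy.storm_drift[where i = "Suc i" and I = "hist (Suc i)" and X = "X i" and Y = "Y i" and X' = "X (Suc i)" and Y' = "Y (Suc i)"
      and g = "gY i" and g' = "gY (Suc i)" and \<sigma> = \<sigma> and \<beta> = \<beta>, OF sY]
  have mx: "E (\<lambda>\<omega>. sqn (sx.merr (X (Suc i)) (Y (Suc i)) (gX (Suc i)) \<omega>)) \<le> ennreal ((1 - \<beta>)\<^sup>2) * E (\<lambda>\<omega>. sqn (sx.merr (X i) (Y i) (gX i) \<omega>))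
      + ennreal (2 * L\<^sup>2 / (real K)\<^sup>2) * (\<Sum>k<K. ?I k) + ennreal (2 * \<beta>\<^sup>2 * \<sigma>\<^sup>2 / real K)" by (rule xb(1); assumption)
  have my: "E (\<lambda>\<omega>. sqn (sy.merr (X (Suc i)) (Y (Suc i)) (gY (Suc i)) \<omega>)) \<le> ennreal ((1 - \<beta>)\<^sup>2) * E (\<lambda>\<omega>. sqn (sy.merr (X i) (Y i) (gY i) \<omega>))
      + ennreal (2 * L\<^sup>2 / (real K)\<^sup>2) * (\<Sum>k<K. ?I k) + ennreal (2 * \<beta>\<^sup>2 * \<sigma>\<^sup>2 / real K)" by (rule yb(1); assumption)
  have two: "ennreal (2 * c) = ennreal c + ennreal c" if "0 \<le> c" for c using ennreal_plus[OF that that] by (simp only: mult_2)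
  have d4: "ennreal (4 * L\<^sup>2 / (real K)\<^sup>2) * I = ennreal (2 * L\<^sup>2 / (real K)\<^sup>2) * I + ennreal (2 * L\<^sup>2 / (real K)\<^sup>2) * I"
    "ennreal (4 * L\<^sup>2) * I = ennreal (2 * L\<^sup>2) * I + ennreal (2 * L\<^sup>2) * I"
    "ennreal (16 * L\<^sup>2) * I = ennreal (8 * L\<^sup>2) * I + ennreal (8 * L\<^sup>2) * I" for I
    using ennreal_double[of "2 * L\<^sup>2 / (real K)\<^sup>2" I] ennreal_double[of "2 * L\<^sup>2" I] ennreal_double[of "8 * L\<^sup>2" I] by simp_all
  have n4: "ennreal (4 * \<beta>\<^sup>2 * \<sigma>\<^sup>2 / real K) = ennreal (2 * \<beta>\<^sup>2 * \<sigma>\<^sup>2 / real K) + ennreal (2 * \<beta>\<^sup>2 * \<sigma>\<^sup>2 / real K)"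
    using two[of "2 * \<beta>\<^sup>2 * \<sigma>\<^sup>2 / real K"] by (simp add: mult.assoc)
  have nK: "ennreal (2 * c * real K) = (\<Sum>k<K. ennreal c + ennreal c)" if "0 \<le> c" for c
  proof -
    have "(\<Sum>k<K. ennreal c + ennreal c) = (\<Sum>k<K. ennreal (2 * c))" using two[OF that] by simp
    also have "\<dots> = ennreal (\<Sum>k<K. 2 * c)" by (rule sum_ennreal) (use that in simp)
    finally show ?thesis by (simp add: mult.commute)
  qed
  show "E (fa (Suc i)) \<le> ennreal ((1 - \<beta>)\<^sup>2) * E (fa i) + ennreal (4 * L\<^sup>2 / (real K)\<^sup>2) * E (finc i) + ennreal (4 * \<beta>\<^sup>2 * \<sigma>\<^sup>2 / real K)"
    unfolding E_fa d4 n4 E_finc distrib_left by (rule order_trans[OF add_mono[OF mx my]]) (simp only: add_ac order_refl)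
  have ux: "E (\<lambda>\<omega>. sqn (gX (Suc i) k \<omega> - gradx_risk p k (X (Suc i) k \<omega>) (Y (Suc i) k \<omega>)))
      \<le> ennreal ((1 - \<beta>)\<^sup>2) * E (\<lambda>\<omega>. sqn (gX i k \<omega> - gradx_risk p k (X i k \<omega>) (Y i k \<omega>))) + ennreal (2 * L\<^sup>2) * ?I k + ennreal (2 * \<beta>\<^sup>2 * \<sigma>\<^sup>2)"
    if "k < K" for k by (rule xb(2); (assumption | rule that))
  have uy: "E (\<lambda>\<omega>. sqn (gY (Suc i) k \<omega> - grady_risk p k (X (Suc i) k \<omega>) (Y (Suc i) k \<omega>)))
      \<le> ennreal ((1 - \<beta>)\<^sup>2) * E (\<lambda>\<omega>. sqn (gY i k \<omega> - grady_risk p k (X i k \<omega>) (Y i k \<omega>))) + ennreal (2 * L\<^sup>2) * ?I k + ennreal (2 * \<beta>\<^sup>2 * \<sigma>\<^sup>2)"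
    if "k < K" for k by (rule yb(2); (assumption | rule that))
  have n4': "ennreal (4 * \<beta>\<^sup>2 * \<sigma>\<^sup>2 * real K) = (\<Sum>k<K. ennreal (2 * \<beta>\<^sup>2 * \<sigma>\<^sup>2) + ennreal (2 * \<beta>\<^sup>2 * \<sigma>\<^sup>2))"
    using nK[of "2 * \<beta>\<^sup>2 * \<sigma>\<^sup>2"] by (simp add: mult.assoc)
  have n8': "ennreal (8 * \<beta>\<^sup>2 * \<sigma>\<^sup>2 * real K) = (\<Sum>k<K. ennreal (4 * \<beta>\<^sup>2 * \<sigma>\<^sup>2) + ennreal (4 * \<beta>\<^sup>2 * \<sigma>\<^sup>2))"
    using nK[of "4 * \<beta>\<^sup>2 * \<sigma>\<^sup>2"] by (simp add: mult.assoc)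
  show "E (fu (Suc i)) \<le> ennreal ((1 - \<beta>)\<^sup>2) * E (fu i) + ennreal (4 * L\<^sup>2) * E (finc i) + ennreal (4 * \<beta>\<^sup>2 * \<sigma>\<^sup>2 * real K)"
    unfolding E_fu d4 n4' E_finc sum_distrib_left sum.distrib[symmetric] distrib_left
    by (rule sum_mono, rule order_trans[OF add_mono[OF ux uy]]) (auto simp: add_ac)
  show "E (fw i) \<le> ennreal (4 * \<beta>\<^sup>2) * E (fu i) + ennreal (16 * L\<^sup>2) * E (finc i) + ennreal (8 * \<beta>\<^sup>2 * \<sigma>\<^sup>2 * real K)"
    unfolding E_fw E_fu d4 n8' E_finc sum_distrib_left sum.distrib[symmetric] distrib_left
  proof (rule sum_mono)
    fix k assume "k \<in> {..<K}"
    then have k: "k < K" by simp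
    have wx: "E (\<lambda>\<omega>. sqn (gX (Suc i) k \<omega> - gX i k \<omega>)) \<le> ennreal (4 * \<beta>\<^sup>2) * E (\<lambda>\<omega>. sqn (gX i k \<omega> - gradx_risk p k (X i k \<omega>) (Y i k \<omega>)))
        + ennreal (8 * L\<^sup>2) * ?I k + ennreal (4 * \<beta>\<^sup>2 * \<sigma>\<^sup>2)" by (rule xd; (assumption | rule k))
    have wy: "E (\<lambda>\<omega>. sqn (gY (Suc i) k \<omega> - gY i k \<omega>)) \<le> ennreal (4 * \<beta>\<^sup>2) * E (\<lambda>\<omega>. sqn (gY i k \<omega> - grady_risk p k (X i k \<omega>) (Y i k \<omega>)))
        + ennreal (8 * L\<^sup>2) * ?I k + ennreal (4 * \<beta>\<^sup>2 * \<sigma>\<^sup>2)" by (rule yd; (assumption | rule k))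
    show "E (\<lambda>\<omega>. sqn (gX (Suc i) k \<omega> - gX i k \<omega>)) + E (\<lambda>\<omega>. sqn (gY (Suc i) k \<omega> - gY i k \<omega>))
       \<le> ennreal (4 * \<beta>\<^sup>2) * E (\<lambda>\<omega>. sqn (gX i k \<omega> - gradx_risk p k (X i k \<omega>) (Y i k \<omega>)))
        + ennreal (4 * \<beta>\<^sup>2) * E (\<lambda>\<omega>. sqn (gY i k \<omega> - grady_risk p k (X i k \<omega>) (Y i k \<omega>)))
        + (ennreal (8 * L\<^sup>2) * ?I k + ennreal (8 * L\<^sup>2) * ?I k)
        + (ennreal (4 * \<beta>\<^sup>2 * \<sigma>\<^sup>2) + ennreal (4 * \<beta>\<^sup>2 * \<sigma>\<^sup>2))"
      by (rule order_trans[OF add_mono[OF wx wy]]) (simp only: add_ac order_refl)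
  qed
qed

end

section \<open>Integrability along the run\<close>

context dama_run
begin

text \<open>Lets the integrability of an averaged estimate be inherited from its predecessor and the
  drift, without any prior control of the gradient at the new point.\<close>

lemma centroid_estimate_drift:
  "fGX (Suc i) \<omega> \<le> 2 / real K * fw i \<omega> + 2 * fGX i \<omega>" "fGY (Suc i) \<omega> \<le> 2 / real K * fw i \<omega> + 2 * fGY i \<omega>"
proof -
  have w: "(\<Sum>k<K. sqn (gX (Suc i) k \<omega> - gX i k \<omega>)) \<le> fw i \<omega>" "(\<Sum>k<K. sqn (gY (Suc i) k \<omega> - gY i k \<omega>)) \<le> fw i \<omega>"
    unfolding fw_def by (intro sum_mono; simp)+
  have d: "sqn (gxb (Suc i) \<omega> - gxb i \<omega>) \<le> (\<Sum>k<K. sqn (gX (Suc i) k \<omega> - gX i k \<omega>)) / real K"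
    "sqn (gyb (Suc i) \<omega> - gyb i \<omega>) \<le> (\<Sum>k<K. sqn (gY (Suc i) k \<omega> - gY i k \<omega>)) / real K"
  proof -
    show "sqn (gxb (Suc i) \<omega> - gxb i \<omega>) \<le> (\<Sum>k<K. sqn (gX (Suc i) k \<omega> - gX i k \<omega>)) / real K"
    proof (rule sqn_mean_le[where d = "dimx p"])
      fix j assume j: "j < dimx p"
      have "(gX (Suc i) k \<omega> - gX i k \<omega>) $ j = gX (Suc i) k \<omega> $ j - gX i k \<omega> $ j" for k using j by (intro index_minus_vec) (simp add: block_def)
      then show "(gxb (Suc i) \<omega> - gxb i \<omega>) $ j = (\<Sum>k<K. (gX (Suc i) k \<omega> - gX i k \<omega>) $ j) / real K"
        using j by (simp only: index_minus_vec centroid_dims) (simp add: gxb_def centroid_def sum_subtractf diff_divide_distrib)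
    qed simp_all
    show "sqn (gyb (Suc i) \<omega> - gyb i \<omega>) \<le> (\<Sum>k<K. sqn (gY (Suc i) k \<omega> - gY i k \<omega>)) / real K"
    proof (rule sqn_mean_le[where d = "dimy p"])
      fix j assume j: "j < dimy p"
      have "(gY (Suc i) k \<omega> - gY i k \<omega>) $ j = gY (Suc i) k \<omega> $ j - gY i k \<omega> $ j" for k using j by (intro index_minus_vec) (simp add: block_def)
      then show "(gyb (Suc i) \<omega> - gyb i \<omega>) $ j = (\<Sum>k<K. (gY (Suc i) k \<omega> - gY i k \<omega>) $ j) / real K"
        using j by (simp only: index_minus_vec centroid_dims) (simp add: gyb_def centroid_def sum_subtractf diff_divide_distrib)
    qed simp_all
  qed
  have k: "x / real K \<le> y / real K" if "x \<le> y" for x y :: real using that by (rule divide_right_mono) simp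
  have "gxb (Suc i) \<omega> = (gxb (Suc i) \<omega> - gxb i \<omega>) + gxb i \<omega>" "gyb (Suc i) \<omega> = (gyb (Suc i) \<omega> - gyb i \<omega>) + gyb i \<omega>"
    by (rule eq_vecI; simp)+
  then have "fGX (Suc i) \<omega> \<le> 2 * sqn (gxb (Suc i) \<omega> - gxb i \<omega>) + 2 * fGX i \<omega>"
    "fGY (Suc i) \<omega> \<le> 2 * sqn (gyb (Suc i) \<omega> - gyb i \<omega>) + 2 * fGY i \<omega>"
    using sqn_add_le[of "gxb (Suc i) \<omega> - gxb i \<omega>" "dimx p" "gxb i \<omega>"] sqn_add_le[of "gyb (Suc i) \<omega> - gyb i \<omega>" "dimy p" "gyb i \<omega>"]
    by (simp_all add: fGX_def fGY_def)
  then show "fGX (Suc i) \<omega> \<le> 2 / real K * fw i \<omega> + 2 * fGX i \<omega>" "fGY (Suc i) \<omega> \<le> 2 / real K * fw i \<omega> + 2 * fGY i \<omega>"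
    using d k[OF w(1)] k[OF w(2)] by simp_all
qed

lemma estimate_gradient_split:
  "fGX i \<omega> \<le> 2 * fEX i \<omega> + 2 * fSX i \<omega>" "fGY i \<omega> \<le> 2 * fEY i \<omega> + 2 * fSY i \<omega>"
  "fSX i \<omega> \<le> 2 * fGX i \<omega> + 2 * fEX i \<omega>" "fSY i \<omega> \<le> 2 * fGY i \<omega> + 2 * fEY i \<omega>"
proof -
  let ?a = "gradx_J p (xb i \<omega>) (yb i \<omega>)" and ?b = "grady_J p (xb i \<omega>) (yb i \<omega>)"
  have "gxb i \<omega> = (gxb i \<omega> - ?a) + ?a" "gyb i \<omega> = (gyb i \<omega> - ?b) + ?b"
    "?a = gxb i \<omega> - (gxb i \<omega> - ?a)" "?b = gyb i \<omega> - (gyb i \<omega> - ?b)" by (rule eq_vecI; simp)+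
  then show "fGX i \<omega> \<le> 2 * fEX i \<omega> + 2 * fSX i \<omega>" "fGY i \<omega> \<le> 2 * fEY i \<omega> + 2 * fSY i \<omega>"
    "fSX i \<omega> \<le> 2 * fGX i \<omega> + 2 * fEX i \<omega>" "fSY i \<omega> \<le> 2 * fGY i \<omega> + 2 * fEY i \<omega>"
    using sqn_add_le[of "gxb i \<omega> - ?a" "dimx p" ?a] sqn_add_le[of "gyb i \<omega> - ?b" "dimy p" ?b]
      sqn_sub_le[of "gxb i \<omega>" "dimx p" "gxb i \<omega> - ?a"] sqn_sub_le[of "gyb i \<omega>" "dimy p" "gyb i \<omega> - ?b"]
    by (simp_all add: fGX_def fGY_def fSX_def fSY_def fEX_def fEY_def)
qed

text \<open>The start of the induction: the potential bounds the dual gap up to a factor 8 and the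
  primal gap directly, and these bound both gradients.\<close>

lemma initial_gradients: "fSY 0 \<omega> \<le> 16 * L * fpot 0 \<omega>" "fSX 0 \<omega> \<le> (20 * obj.kap * L + 256 * obj.kap\<^sup>2 * L) * fpot 0 \<omega>"
proof -
  let ?P = "P p (xb 0 \<omega>) - Pstar p" and ?D = "P p (xb 0 \<omega>) - J p (xb 0 \<omega>) (yb 0 \<omega>)"
  have nn: "0 \<le> ?P" "0 \<le> ?D" using obj.Pst_le[of "xb 0 \<omega>"] obj.le_Pm[of "xb 0 \<omega>" "yb 0 \<omega>"] by simp_all
  have "fpot 0 \<omega> = ?P + ?D / 8" by (simp only: fpot_def obj.pot_def)
  then have le: "?P \<le> fpot 0 \<omega>" "?D \<le> 8 * fpot 0 \<omega>" using nn by argo+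
  have kap: "0 \<le> 20 * obj.kap * L" "0 \<le> 16 * obj.kap\<^sup>2" "0 \<le> 2 * L" using obj.kap1 L_pos by auto
  have "fSY 0 \<omega> \<le> 2 * L * ?D" unfolding fSY_def by (rule obj.sqn_gy_le) simp_all
  also have "\<dots> \<le> 2 * L * (8 * fpot 0 \<omega>)" using le(2) kap(3) by (rule mult_left_mono)
  finally show 1: "fSY 0 \<omega> \<le> 16 * L * fpot 0 \<omega>" by simp
  have "fSX 0 \<omega> \<le> 20 * obj.kap * L * ?P + 16 * obj.kap\<^sup>2 * fSY 0 \<omega>" unfolding fSX_def fSY_def by (rule obj.sqn_gx_le) simp_all
  also have "\<dots> \<le> 20 * obj.kap * L * fpot 0 \<omega> + 16 * obj.kap\<^sup>2 * (16 * L * fpot 0 \<omega>)"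
    by (intro add_mono mult_left_mono le(1) 1 kap)
  finally show "fSX 0 \<omega> \<le> (20 * obj.kap * L + 256 * obj.kap\<^sup>2 * L) * fpot 0 \<omega>" by (simp add: algebra_simps)
qed

context
  assumes ipot: "integrable M (fpot 0)" and iz: "integrable M fz" and mu: "0 < mux h" "mux h \<le> muy h" and T0: "0 < T"
begin

text \<open>The spread at index \<open>Suc m\<close> needs the drift only below \<open>m\<close>.
  This gap of indices, inherited from \<open>consensus\<close>, is what keeps the induction from
  being circular.\<close>

lemma dev_integrable:
  assumes "\<And>j. j < m \<Longrightarrow> integrable M (fw j)" and i: "i \<le> Suc m"
  shows "integrable M (fdev i)"
proof (rule integrable_of_le[OF f_measurable(7) f_nonneg(7)])
  show "integrable M (\<lambda>\<omega>. (muy h)\<^sup>2 / gam\<^sup>2 * fz \<omega> + (muy h)\<^sup>2 / gam^3 * (\<Sum>j<m. fw j \<omega>))"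
    by (intro Bochner_Integration.integrable_add integrable_mult_right Bochner_Integration.integrable_sum iz assms(1)) simp
  fix \<omega> assume w: "\<omega> \<in> space M"
  have "fdev i \<omega> \<le> (\<Sum>j\<le>Suc m. fdev j \<omega>)" using i by (intro member_le_sum f_nonneg) auto
  also note path_dev[OF w mu, of m]
  finally show "fdev i \<omega> \<le> (muy h)\<^sup>2 / gam\<^sup>2 * fz \<omega> + (muy h)\<^sup>2 / gam^3 * (\<Sum>j<m. fw j \<omega>)" .
qed

lemma err_integrable:
  assumes "integrable M (fa i)" "integrable M (fdev i)"
  shows "integrable M (fEX i)" "integrable M (fEY i)"
proof -
  have I: "integrable M (\<lambda>\<omega>. 2 * fa i \<omega> + 4 * L\<^sup>2 / real K * fdev i \<omega>)"
    by (intro Bochner_Integration.integrable_add integrable_mult_right assms)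
  show "integrable M (fEX i)"
  proof (rule integrable_of_le[OF f_measurable(5) f_nonneg(5) I])
    show "fEX i \<omega> \<le> 2 * fa i \<omega> + 4 * L\<^sup>2 / real K * fdev i \<omega>" if "\<omega> \<in> space M" for \<omega>
      using path_error_sum[OF that, of i] f_nonneg(6)[of i \<omega>] by linarith
  qed
  show "integrable M (fEY i)"
  proof (rule integrable_of_le[OF f_measurable(6) f_nonneg(6) I])
    show "fEY i \<omega> \<le> 2 * fa i \<omega> + 4 * L\<^sup>2 / real K * fdev i \<omega>" if "\<omega> \<in> space M" for \<omega>
      using path_error_sum[OF that, of i] f_nonneg(5)[of i \<omega>] by linarith
  qed
qed

lemma integrable_initial: "integrable M (fa 0)" "integrable M (fu 0)" "integrable M (fGX 0)" "integrable M (fGY 0)"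
proof -
  show a: "integrable M (fa 0)" by (rule integrableI_nonneg) (use E_initial(1)[OF T0] f_nonneg in \<open>auto intro: le_less_trans\<close>)
  show "integrable M (fu 0)" by (rule integrableI_nonneg) (use E_initial(2)[OF T0] f_nonneg in \<open>auto intro: le_less_trans\<close>)
  have d: "integrable M (fdev 0)" by (rule dev_integrable[of 0]) auto
  note e = err_integrable[OF a d]
  have s: "integrable M (fSX 0)" "integrable M (fSY 0)"
    by (rule integrable_of_le[OF f_measurable(3) f_nonneg(3) integrable_mult_right[OF ipot] initial_gradients(2)],
        rule integrable_of_le[OF f_measurable(4) f_nonneg(4) integrable_mult_right[OF ipot] initial_gradients(1)])
  show "integrable M (fGX 0)"
    by (rule integrable_of_le[OF f_measurable(1) f_nonneg(1) _ estimate_gradient_split(1)])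
       (intro Bochner_Integration.integrable_add integrable_mult_right s e)
  show "integrable M (fGY 0)"
    by (rule integrable_of_le[OF f_measurable(2) f_nonneg(2) _ estimate_gradient_split(2)])
       (intro Bochner_Integration.integrable_add integrable_mult_right s e)
qed

text \<open>The order matters: past drifts give the spread at \<open>i\<close> and
  \<open>Suc i\<close>; with the averaged estimates at \<open>i\<close> this gives the increment;
  the increment gives the new errors and the new drift by \<open>E_step\<close>; the drift gives the
  new averaged estimates.\<close>

lemma integrable_step:
  assumes T: "Suc i < T" and g: "integrable M (fGX i)" "integrable M (fGY i)" "integrable M (fu i)" "integrable M (fa i)"
    and w: "\<And>j. j < i \<Longrightarrow> integrable M (fw j)"
  shows "integrable M (finc i)" "integrable M (fw i)" "integrable M (fGX (Suc i))" "integrable M (fGY (Suc i))"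
    "integrable M (fu (Suc i))" "integrable M (fa (Suc i))"
    "expectation (fa (Suc i)) \<le> (1 - \<beta>)\<^sup>2 * expectation (fa i) + 4 * L\<^sup>2 / (real K)\<^sup>2 * expectation (finc i) + 4 * \<beta>\<^sup>2 * \<sigma>\<^sup>2 / real K"
    "expectation (fu (Suc i)) \<le> (1 - \<beta>)\<^sup>2 * expectation (fu i) + 4 * L\<^sup>2 * expectation (finc i) + 4 * \<beta>\<^sup>2 * \<sigma>\<^sup>2 * real K"
    "expectation (fw i) \<le> 4 * \<beta>\<^sup>2 * expectation (fu i) + 16 * L\<^sup>2 * expectation (finc i) + 8 * \<beta>\<^sup>2 * \<sigma>\<^sup>2 * real K"
proof -
  have d: "integrable M (fdev i)" "integrable M (fdev (Suc i))" by (rule dev_integrable[of i, OF w]; simp)+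
  show n: "integrable M (finc i)"
    by (rule integrable_of_le[OF f_measurable(8) f_nonneg(8) _ path_inc])
       (intro Bochner_Integration.integrable_add integrable_mult_right g d)
  note A = integrable_of_bound[OF f_measurable(10) f_nonneg(10) g(4) f_nonneg(10) n f_nonneg(8) _ _ _ E_step(1)[OF T]]
  note U = integrable_of_bound[OF f_measurable(9) f_nonneg(9) g(3) f_nonneg(9) n f_nonneg(8) _ _ _ E_step(2)[OF T]]
  note V = integrable_of_bound[OF f_measurable(11) f_nonneg(11) g(3) f_nonneg(9) n f_nonneg(8) _ _ _ E_step(3)[OF T]]
  show "integrable M (fa (Suc i))" "integrable M (fu (Suc i))"
    "expectation (fa (Suc i)) \<le> (1 - \<beta>)\<^sup>2 * expectation (fa i) + 4 * L\<^sup>2 / (real K)\<^sup>2 * expectation (finc i) + 4 * \<beta>\<^sup>2 * \<sigma>\<^sup>2 / real K"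
    "expectation (fu (Suc i)) \<le> (1 - \<beta>)\<^sup>2 * expectation (fu i) + 4 * L\<^sup>2 * expectation (finc i) + 4 * \<beta>\<^sup>2 * \<sigma>\<^sup>2 * real K"
    "expectation (fw i) \<le> 4 * \<beta>\<^sup>2 * expectation (fu i) + 16 * L\<^sup>2 * expectation (finc i) + 8 * \<beta>\<^sup>2 * \<sigma>\<^sup>2 * real K"
    by (rule A U V; simp)+
  show w: "integrable M (fw i)" by (rule V; simp)
  show "integrable M (fGX (Suc i))"
    by (rule integrable_of_le[OF f_measurable(1) f_nonneg(1) _ centroid_estimate_drift(1)])
       (intro Bochner_Integration.integrable_add integrable_mult_right g w)
  show "integrable M (fGY (Suc i))"
    by (rule integrable_of_le[OF f_measurable(2) f_nonneg(2) _ centroid_estimate_drift(2)])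
       (intro Bochner_Integration.integrable_add integrable_mult_right g w)
qed

lemma integrable_upto:
  "i < T \<Longrightarrow> integrable M (fGX i) \<and> integrable M (fGY i) \<and> integrable M (fu i) \<and> integrable M (fa i)
    \<and> (\<forall>j<i. integrable M (fw j))"
proof (induction i)
  case 0
  then show ?case using integrable_initial by simp
next
  case (Suc i)
  then have h: "integrable M (fGX i)" "integrable M (fGY i)" "integrable M (fu i)" "integrable M (fa i)" "\<And>j. j < i \<Longrightarrow> integrable M (fw j)"
    by simp_all
  show ?case using integrable_step(2-6)[OF Suc.prems h] h(5) by (simp add: less_Suc_eq)
qed

lemma integrable_all:
  assumes "i < T"
  shows "integrable M (fGX i)" "integrable M (fGY i)" "integrable M (fu i)" "integrable M (fa i)" "j < i \<Longrightarrow> integrable M (fw j)"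
    "integrable M (fdev i)" "integrable M (fEX i)" "integrable M (fEY i)" "integrable M (fSX i)" "integrable M (fSY i)"
proof -
  note I = integrable_upto[OF assms]
  show g: "integrable M (fGX i)" "integrable M (fGY i)" "integrable M (fu i)" and a: "integrable M (fa i)"
    and "j < i \<Longrightarrow> integrable M (fw j)" using I by auto
  show d: "integrable M (fdev i)" by (rule dev_integrable[of i]) (use I in auto)
  show e: "integrable M (fEX i)" "integrable M (fEY i)" by (rule err_integrable[OF a d])+
  show "integrable M (fSX i)"
    by (rule integrable_of_le[OF f_measurable(3) f_nonneg(3) _ estimate_gradient_split(3)])
       (intro Bochner_Integration.integrable_add integrable_mult_right g e)
  show "integrable M (fSY i)"
    by (rule integrable_of_le[OF f_measurable(4) f_nonneg(4) _ estimate_gradient_split(4)])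
       (intro Bochner_Integration.integrable_add integrable_mult_right g e)
qed

lemma integrable_inc: "Suc i < T \<Longrightarrow> integrable M (finc i)"
  using integrable_upto[of i] by (intro integrable_step(1)) auto

end

end

section \<open>Summed descent in expectation\<close>

context dama_run
begin

abbreviation "r \<equiv> run p A h \<xi> coin x0 y0 u v"

lemma initial_gap_nonneg: "0 \<le> P p (xb i \<omega>) - Pstar p" "0 \<le> P p (xb i \<omega>) - J p (xb i \<omega>) (yb i \<omega>)"
  using obj.Pst_le[of "xb i \<omega>"] obj.le_Pm[of "xb i \<omega>" "yb i \<omega>"] by simp_all

lemma nn_integral_run: "(\<integral>\<^sup>+\<omega>. f (r i \<omega>) \<partial>M) = (\<integral>\<^sup>+\<omega>. f (st i \<omega>) \<partial>M)"
  by (rule nn_integral_cong_AE) (use run_eq_st in eventually_elim, simp)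

lemma primal_gap0_eq: "primal_gap0 M p r = E (\<lambda>\<omega>. P p (xb 0 \<omega>) - Pstar p)"
  unfolding primal_gap0_def xb_def xc_def[symmetric] by (rule nn_integral_run)

lemma dual_gap0_eq: "dual_gap0 M p r = E (\<lambda>\<omega>. P p (xb 0 \<omega>) - J p (xb 0 \<omega>) (yb 0 \<omega>))"
  unfolding dual_gap0_def xb_def yb_def xc_def[symmetric] yc_def[symmetric] by (rule nn_integral_run)

lemma avg_sq_grad_eq: "avg_sq_grad M p r T = ennreal (1 / real T) * (\<Sum>i<T. E (fSX i) + E (fSY i))"
  unfolding avg_sq_grad_def fSX_def fSY_def xb_def yb_def xc_def[symmetric] yc_def[symmetric]
  by (simp only: nn_integral_run[where f = "\<lambda>S. ennreal (sqn (gradx_J p (xc p S) (yc p S)))"]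
      nn_integral_run[where f = "\<lambda>S. ennreal (sqn (grady_J p (xc p S) (yc p S)))"])

lemma zeta0_sq_eq: "zeta0_sq M p A r = ennreal (1 / real K) * E fz"
proof -
  let ?X = "\<lambda>\<omega>. \<Sum>k<K. sqn (gX 0 k \<omega> - gxb 0 \<omega>)" and ?Y = "\<lambda>\<omega>. \<Sum>k<K. sqn (gY 0 k \<omega> - gyb 0 \<omega>)"
  have m: "?X \<in> borel_measurable M" "?Y \<in> borel_measurable M"
    by (intro borel_measurable_sum measurable_sqn[OF measurable_vec_minus[where m = "dimx p"]] agent_M centroid_M; simp)
       (intro borel_measurable_sum measurable_sqn[OF measurable_vec_minus[where m = "dimy p"]] agent_M centroid_M; simp)
  have "Ax A = 1\<^sub>m (K * dimx p)" "Ay A = 1\<^sub>m (K * dimy p)" by (simp_all add: extra_matrices_def)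
  then have "zeta0_sq M p A r = ennreal (1 / real K) * E ?X + ennreal (1 / real K) * E ?Y"
    unfolding zeta0_sq_def gxb_def gyb_def spread_averaging[OF stG_carrier(1), symmetric] spread_averaging[OF stG_carrier(2), symmetric]
    by (simp only: nn_integral_run[where f = "\<lambda>S. ennreal (sqn (m *\<^sub>v stGX S))" for m]
        nn_integral_run[where f = "\<lambda>S. ennreal (sqn (m *\<^sub>v stGY S))" for m])
  also have "\<dots> = ennreal (1 / real K) * E (\<lambda>\<omega>. ?X \<omega> + ?Y \<omega>)"
    unfolding distrib_left[symmetric] by (subst E_add[OF m]) (auto intro: sum_nonneg)
  finally show ?thesis by (simp only: fz_def)
qed

text \<open>A pathwise inequality; it is integrated only afterwards, once the terms are known to be
  integrable.\<close>

lemma potential_sum: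
  assumes w: "\<omega> \<in> space M" and mx: "0 < mux h" "mux h * obj.kap\<^sup>2 \<le> muy h / 400" and cx: "obj.kap * L * mux h \<le> 1 / 40" and cy: "L * muy h \<le> 1 / 40"
  shows "fpot m \<omega> + (\<Sum>i<m. mux h / 2 * fSX i \<omega> + mux h / 8 * fGX i \<omega> + muy h / 32 * fSY i \<omega> + muy h / 32 * fGY i \<omega>)
    \<le> fpot 0 \<omega> + (\<Sum>i<m. mux h * fEX i \<omega> + muy h / 8 * fEY i \<omega>)"
proof (induction m)
  case (Suc m)
  have "fpot (Suc m) \<omega> + mux h / 2 * fSX m \<omega> + mux h / 8 * fGX m \<omega> + muy h / 32 * fSY m \<omega> + muy h / 32 * fGY m \<omega>
     \<le> fpot m \<omega> + mux h * fEX m \<omega> + muy h / 8 * fEY m \<omega>"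
    unfolding fpot_def fSX_def fGX_def fSY_def fGY_def fEX_def fEY_def centroid_updates[OF w]
    by (rule obj.potential_step[OF _ _ _ _ mx cx cy]) simp_all
  then show ?case using Suc unfolding sum.lessThan_Suc by argo
qed simp

text \<open>The hypotheses of \<open>descent_algebra\<close> are supplied by expectations, those of
  the summed quantities divided by \<open>K\<close>. In this scaling the increments enter the
  averaged error with \<open>L\<^sup>2 / K\<close>, the gain from independent agents.\<close>

lemma expected_descent:
  assumes I: "integrable M (fpot 0)" "integrable M fz"
    and mx: "0 < mux h" "mux h \<le> muy h" "mux h * obj.kap\<^sup>2 \<le> muy h / 400" and cx: "obj.kap * L * mux h \<le> 1 / 40" and cy: "L * muy h \<le> 1 / 40"
    and T: "T = Suc n"
    and C0: "1024 * L\<^sup>2 * (muy h)\<^sup>2 \<le> \<beta> * K" and C1: "256 * L\<^sup>2 * (muy h)\<^sup>2 \<le> gam^3" and C2: "128 * L\<^sup>2 * (muy h)\<^sup>2 \<le> 1"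
    and C3: "K * (1 + 3 * \<beta> * T) \<le> gam^3 * T"
  shows "mux h / 32 * (\<Sum>i\<le>n. expectation (fSX i) + expectation (fSY i)) \<le> expectation (fpot 0)
    + muy h * (4 * \<sigma>\<^sup>2 / (\<beta> * batch0 h * K) + 9 * \<beta> * \<sigma>\<^sup>2 * T / K + (expectation fz / K) / (8 * gam\<^sup>2))"
proof -
  have T0: "0 < T" using T by simp
  note io = integrable_all[OF I mx(1,2) T0]
  note ii = integrable_inc[OF I mx(1,2) T0]
  have iT: "i < T" if "i \<le> n" for i using that T by simp
  have sT: "Suc i < T" "i < T" if "i < n" for i using that T by simp_all
  have iw: "integrable M (fw i)" if "i < n" for i using that T by (intro io(5)[of "Suc i"]) auto
  have nn: "0 \<le> expectation (fSX i)" "0 \<le> expectation (fSY i)" "0 \<le> expectation (fGX i)" "0 \<le> expectation (fGY i)"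
    "0 \<le> expectation (fEX i)" "0 \<le> expectation (fEY i)" "0 \<le> expectation (fa i)" "0 \<le> expectation (fu i) / K"
    "0 \<le> expectation (finc i) / K" "0 \<le> expectation (fdev i) / K" "0 \<le> expectation fz / K" for i
    by (simp_all add: Bochner_Integration.integral_nonneg f_nonneg)
  have K: "1 \<le> K" "0 < real K" using Kpos by auto
  note up = integrable_upto[OF I mx(1,2) T0]
  note step = integrable_step(7-9)[OF I mx(1,2) T0]
  show ?thesis
  proof (rule descent_algebra[where inc = "\<lambda>i. expectation (finc i) / K" and u = "\<lambda>i. expectation (fu i) / K" and a = "\<lambda>i. expectation (fa i)"
      and dev = "\<lambda>i. expectation (fdev i) / K" and w = "\<lambda>i. expectation (fw i) / K" and Gx = "\<lambda>i. expectation (fGX i)" and Gy = "\<lambda>i. expectation (fGY i)"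
      and Ex = "\<lambda>i. expectation (fEX i)" and Ey = "\<lambda>i. expectation (fEY i)" and L = L,
      OF T K(1) b0 L_pos _ nn(11) gam beta mx(1,2) nn(1-10) _ _ _ _ _ _ _ _ _ C0 C1 C2 C3])
    show "0 \<le> \<sigma>\<^sup>2" by simp
    have "expectation (\<lambda>\<omega>. \<Sum>i\<le>n. mux h / 2 * fSX i \<omega> + mux h / 8 * fGX i \<omega> + muy h / 32 * fSY i \<omega> + muy h / 32 * fGY i \<omega>)
      \<le> expectation (\<lambda>\<omega>. fpot 0 \<omega> + (\<Sum>i\<le>n. mux h * fEX i \<omega> + muy h / 8 * fEY i \<omega>))"
    proof (rule integral_mono)
      fix \<omega> assume "\<omega> \<in> space M"
      \<comment> \<open>All \<open>Suc n\<close> iterations are used; the potential at the end is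
        dropped as nonnegative.\<close>
      from potential_sum[OF this mx(1,3) cx cy, of "Suc n"] f_nonneg(13)[of "Suc n" \<omega>]
      show "(\<Sum>i\<le>n. mux h / 2 * fSX i \<omega> + mux h / 8 * fGX i \<omega> + muy h / 32 * fSY i \<omega> + muy h / 32 * fGY i \<omega>)
        \<le> fpot 0 \<omega> + (\<Sum>i\<le>n. mux h * fEX i \<omega> + muy h / 8 * fEY i \<omega>)" unfolding lessThan_Suc_atMost by linarith
    qed (intro Bochner_Integration.integrable_add Bochner_Integration.integrable_sum integrable_mult_right io I iT; simp)+
    also have "expectation (\<lambda>\<omega>. \<Sum>i\<le>n. mux h / 2 * fSX i \<omega> + mux h / 8 * fGX i \<omega> + muy h / 32 * fSY i \<omega> + muy h / 32 * fGY i \<omega>)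
      = (\<Sum>i\<le>n. mux h / 2 * expectation (fSX i) + mux h / 8 * expectation (fGX i) + muy h / 32 * expectation (fSY i) + muy h / 32 * expectation (fGY i))"
      using io iT by (simp add: Bochner_Integration.integral_sum)
    also have "expectation (\<lambda>\<omega>. fpot 0 \<omega> + (\<Sum>i\<le>n. mux h * fEX i \<omega> + muy h / 8 * fEY i \<omega>))
      = expectation (fpot 0) + (\<Sum>i\<le>n. mux h * expectation (fEX i) + muy h / 8 * expectation (fEY i))"
    proof -
      have i: "integrable M (\<lambda>\<omega>. \<Sum>i\<le>n. mux h * fEX i \<omega> + muy h / 8 * fEY i \<omega>)"
        by (intro Bochner_Integration.integrable_add Bochner_Integration.integrable_sum integrable_mult_right io iT; simp)
      have "expectation (\<lambda>\<omega>. \<Sum>i\<le>n. mux h * fEX i \<omega> + muy h / 8 * fEY i \<omega>)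
        = (\<Sum>i\<le>n. mux h * expectation (fEX i) + muy h / 8 * expectation (fEY i))"
        using io iT by (simp add: Bochner_Integration.integral_sum)
      then show ?thesis by (simp only: Bochner_Integration.integral_add[OF I(1) i])
    qed
    finally show "(\<Sum>i\<le>n. mux h / 2 * expectation (fSX i) + mux h / 8 * expectation (fGX i) + muy h / 32 * expectation (fSY i) + muy h / 32 * expectation (fGY i))
      \<le> expectation (fpot 0) + (\<Sum>i\<le>n. mux h * expectation (fEX i) + muy h / 8 * expectation (fEY i))" .
    show "expectation (fEX i) + expectation (fEY i) \<le> 2 * expectation (fa i) + 4 * L\<^sup>2 * (expectation (fdev i) / K)" if i: "i \<le> n" for i
    proof -
      have "expectation (\<lambda>\<omega>. fEX i \<omega> + fEY i \<omega>) \<le> expectation (\<lambda>\<omega>. 2 * fa i \<omega> + 4 * L\<^sup>2 / real K * fdev i \<omega>)"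
        by (rule integral_mono) (intro Bochner_Integration.integrable_add integrable_mult_right io iT i path_error_sum; assumption)+
      then show ?thesis using io[OF iT[OF i]] by simp
    qed
    show "expectation (fa 0) \<le> 2 * \<sigma>\<^sup>2 / (batch0 h * K)"
      by (rule integral_real_bounded) (use E_initial(1)[OF T0] in simp_all)
    have "expectation (fu 0) \<le> 2 * \<sigma>\<^sup>2 / batch0 h * K"
      by (rule integral_real_bounded) (use E_initial(2)[OF T0] in simp_all)
    \<comment> \<open>The initial batch helps the averaged error only; for the agents' own errors it
      is enough that it contains a sample.\<close>
    also have "\<dots> \<le> 2 * \<sigma>\<^sup>2 * K" using b0 by (intro mult_right_mono) (simp_all add: divide_le_eq mult_le_cancel_left1)
    finally show "expectation (fu 0) / K \<le> 2 * \<sigma>\<^sup>2" using K by (simp add: divide_le_eq)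
    fix i assume i: "i < n"
    have "integrable M (fGX i)" "integrable M (fGY i)" "integrable M (fu i)" "integrable M (fa i)" "\<And>j. j < i \<Longrightarrow> integrable M (fw j)"
      using up[OF sT(2)[OF i]] by auto
    note s = step[OF sT(1)[OF i] this]
    show "expectation (fa (Suc i)) \<le> (1 - \<beta>)\<^sup>2 * expectation (fa i) + (4 * L\<^sup>2 / K * (expectation (finc i) / K) + 4 * \<beta>\<^sup>2 * \<sigma>\<^sup>2 / K)"
      using s(1) by (simp add: power2_eq_square[of "real K"])
    have d: "x / K \<le> y / K" if "x \<le> y" for x y :: real using that by (rule divide_right_mono) simp
    show "expectation (fu (Suc i)) / K \<le> (1 - \<beta>)\<^sup>2 * (expectation (fu i) / K) + (4 * L\<^sup>2 * (expectation (finc i) / K) + 4 * \<beta>\<^sup>2 * \<sigma>\<^sup>2)"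
      using d[OF s(2)] K by (simp add: add_divide_distrib)
    show "expectation (fw i) / K \<le> 4 * \<beta>\<^sup>2 * (expectation (fu i) / K) + 16 * L\<^sup>2 * (expectation (finc i) / K) + 8 * \<beta>\<^sup>2 * \<sigma>\<^sup>2"
      using d[OF s(3)] K by (simp add: add_divide_distrib)
    have "expectation (finc i) \<le> expectation (\<lambda>\<omega>. real K * ((mux h)\<^sup>2 * fGX i \<omega> + (muy h)\<^sup>2 * fGY i \<omega>) + 2 * fdev (Suc i) \<omega> + 2 * fdev i \<omega>)"
      by (rule integral_mono[OF ii[OF sT(1)[OF i]] _ path_inc])
         (intro Bochner_Integration.integrable_add integrable_mult_right io sT i; assumption)
    also have "\<dots> = real K * ((mux h)\<^sup>2 * expectation (fGX i) + (muy h)\<^sup>2 * expectation (fGY i)) + 2 * expectation (fdev (Suc i)) + 2 * expectation (fdev i)"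
      using io[OF sT(1)[OF i]] io[OF sT(2)[OF i]] by simp
    finally show "expectation (finc i) / K \<le> (mux h)\<^sup>2 * expectation (fGX i) + (muy h)\<^sup>2 * expectation (fGY i) + 2 * (expectation (fdev (Suc i)) / K) + 2 * (expectation (fdev i) / K)"
      using d K by (fastforce simp: add_divide_distrib)
  next
    have "expectation (\<lambda>\<omega>. \<Sum>i\<le>n. fdev i \<omega>) \<le> expectation (\<lambda>\<omega>. (muy h)\<^sup>2 / gam\<^sup>2 * fz \<omega> + (muy h)\<^sup>2 / gam^3 * (\<Sum>i<n. fw i \<omega>))"
    proof (rule integral_mono)
      fix \<omega> assume "\<omega> \<in> space M"
      \<comment> \<open>The bound reaches index \<open>Suc n\<close>, one more than needed, and the
        last spread is dropped.\<close>
      from path_dev[OF this mx(1,2), of n] f_nonneg(7)[of "Suc n" \<omega>]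
      show "(\<Sum>i\<le>n. fdev i \<omega>) \<le> (muy h)\<^sup>2 / gam\<^sup>2 * fz \<omega> + (muy h)\<^sup>2 / gam^3 * (\<Sum>i<n. fw i \<omega>)" unfolding sum.atMost_Suc by linarith
    qed (intro Bochner_Integration.integrable_add Bochner_Integration.integrable_sum integrable_mult_right io I iT iw; simp)+
    also have "expectation (\<lambda>\<omega>. \<Sum>i\<le>n. fdev i \<omega>) = (\<Sum>i\<le>n. expectation (fdev i))"
      by (rule Bochner_Integration.integral_sum) (use io iT in simp)
    also have "expectation (\<lambda>\<omega>. (muy h)\<^sup>2 / gam\<^sup>2 * fz \<omega> + (muy h)\<^sup>2 / gam^3 * (\<Sum>i<n. fw i \<omega>))
      = (muy h)\<^sup>2 / gam\<^sup>2 * expectation fz + (muy h)\<^sup>2 / gam^3 * (\<Sum>i<n. expectation (fw i))"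
    proof -
      have i: "integrable M (\<lambda>\<omega>. \<Sum>i<n. fw i \<omega>)" by (intro Bochner_Integration.integrable_sum iw) simp
      have "expectation (\<lambda>\<omega>. \<Sum>i<n. fw i \<omega>) = (\<Sum>i<n. expectation (fw i))"
        by (rule Bochner_Integration.integral_sum) (use iw in simp)
      then show ?thesis
        by (simp only: Bochner_Integration.integral_add[OF integrable_mult_right[OF I(2)] integrable_mult_right[OF i]] integral_mult_right_zero)
    qed
    finally have "(\<Sum>i\<le>n. expectation (fdev i)) / K
      \<le> ((muy h)\<^sup>2 / gam\<^sup>2 * expectation fz + (muy h)\<^sup>2 / gam^3 * (\<Sum>i<n. expectation (fw i))) / K" by (rule divide_right_mono) simp
    then show "(\<Sum>i\<le>n. expectation (fdev i) / K) \<le> (muy h)\<^sup>2 / gam\<^sup>2 * (expectation fz / K) + (muy h)\<^sup>2 / gam^3 * (\<Sum>i<n. expectation (fw i) / K)"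
      by (simp only: sum_divide_distrib[symmetric] add_divide_distrib times_divide_eq_right)
  qed
qed

text \<open>Finiteness of the three initial quantities is what makes \<open>fpot 0\<close> and
  \<open>fz\<close> integrable; the inequality is then \<open>expected_descent\<close> divided by
  \<open>mux h * T / 32\<close>.\<close>

lemma avg_bound:
  assumes fin: "primal_gap0 M p r = ennreal g" "dual_gap0 M p r = ennreal d" "zeta0_sq M p A r = ennreal z" "0 \<le> g" "0 \<le> d" "0 \<le> z"
    and mx: "0 < mux h" "mux h \<le> muy h" "mux h * obj.kap\<^sup>2 \<le> muy h / 400" and cx: "obj.kap * L * mux h \<le> 1 / 40" and cy: "L * muy h \<le> 1 / 40"
    and T: "0 < T"
    and C0: "1024 * L\<^sup>2 * (muy h)\<^sup>2 \<le> \<beta> * K" and C1: "256 * L\<^sup>2 * (muy h)\<^sup>2 \<le> gam^3" and C2: "128 * L\<^sup>2 * (muy h)\<^sup>2 \<le> 1"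
    and C3: "K * (1 + 3 * \<beta> * T) \<le> gam^3 * T"
  shows "avg_sq_grad M p r T \<le> ennreal (32 / (mux h * T) * (g + d / 8
    + muy h * (4 * \<sigma>\<^sup>2 / (\<beta> * batch0 h * K) + 9 * \<beta> * \<sigma>\<^sup>2 * T / K + z / (8 * gam\<^sup>2))))"
proof -
  obtain n where n: "T = Suc n" using T by (cases T) auto
  have K: "0 < real K" using Kpos by simp
  have mP: "(\<lambda>\<omega>. P p (xb 0 \<omega>) - Pstar p) \<in> borel_measurable M" "(\<lambda>\<omega>. P p (xb 0 \<omega>) - J p (xb 0 \<omega>) (yb 0 \<omega>)) \<in> borel_measurable M"
    by (intro borel_measurable_diff borel_measurable_const obj.Pm_measurable obj.F_measurable centroid_M)+
  have P: "integrable M (\<lambda>\<omega>. P p (xb 0 \<omega>) - Pstar p) \<and> expectation (\<lambda>\<omega>. P p (xb 0 \<omega>) - Pstar p) = g"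
    using fin(1,4) unfolding primal_gap0_eq
    by (subst (asm) nn_integral_eq_integrable) (use mP initial_gap_nonneg in auto)
  have D: "integrable M (\<lambda>\<omega>. P p (xb 0 \<omega>) - J p (xb 0 \<omega>) (yb 0 \<omega>)) \<and> expectation (\<lambda>\<omega>. P p (xb 0 \<omega>) - J p (xb 0 \<omega>) (yb 0 \<omega>)) = d"
    using fin(2,5) unfolding dual_gap0_eq
    by (subst (asm) nn_integral_eq_integrable) (use mP initial_gap_nonneg in auto)
  have pot: "fpot 0 = (\<lambda>\<omega>. (P p (xb 0 \<omega>) - Pstar p) + (P p (xb 0 \<omega>) - J p (xb 0 \<omega>) (yb 0 \<omega>)) / 8)"
    by (rule ext) (simp only: fpot_def obj.pot_def)
  have I: "integrable M (fpot 0)" "expectation (fpot 0) = g + d / 8"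
    unfolding pot using P D by (auto simp del: Bochner_Integration.integral_diff)
  have "E fz = ennreal (real K) * (ennreal (1 / real K) * E fz)"
    using K by (simp add: mult.assoc[symmetric] ennreal_mult[symmetric])
  also have "\<dots> = ennreal (real K * z)" using fin(3,6) unfolding zeta0_sq_eq by (simp add: ennreal_mult)
  finally have Z: "integrable M fz \<and> expectation fz = real K * z"
    by (subst (asm) nn_integral_eq_integrable) (use f_nonneg fin(6) in auto)
  note bd = expected_descent[OF I(1) conjunct1[OF Z] mx cx cy n C0 C1 C2 C3]
  note io = integrable_all[OF I(1) conjunct1[OF Z] mx(1,2) T]
  let ?S = "\<Sum>i\<le>n. expectation (fSX i) + expectation (fSY i)"
  have "avg_sq_grad M p r T = ennreal (1 / real T) * (\<Sum>i<T. ennreal (expectation (fSX i)) + ennreal (expectation (fSY i)))"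
    unfolding avg_sq_grad_eq
    by (intro arg_cong2[where f = "(*)"] refl sum.cong arg_cong2[where f = "(+)"] nn_integral_eq_integral io AE_I2 f_nonneg; simp)
  also have "(\<Sum>i<T. ennreal (expectation (fSX i)) + ennreal (expectation (fSY i))) = ennreal ?S"
    unfolding n lessThan_Suc_atMost
    by (simp add: sum_ennreal[symmetric] Bochner_Integration.integral_nonneg f_nonneg)
  also have "ennreal (1 / real T) * ennreal ?S = ennreal (?S / real T)"
    by (subst ennreal_mult[symmetric]) (auto intro: sum_nonneg simp: Bochner_Integration.integral_nonneg f_nonneg)
  also have "\<dots> \<le> ennreal (32 / (mux h * T) * (g + d / 8
    + muy h * (4 * \<sigma>\<^sup>2 / (\<beta> * batch0 h * K) + 9 * \<beta> * \<sigma>\<^sup>2 * T / K + z / (8 * gam\<^sup>2))))"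
  proof (rule ennreal_leI)
    let ?B = "g + d / 8 + muy h * (4 * \<sigma>\<^sup>2 / (\<beta> * batch0 h * K) + 9 * \<beta> * \<sigma>\<^sup>2 * T / K + z / (8 * gam\<^sup>2))"
    have z: "expectation fz / K = z" using Z K by simp
    have "mux h / 32 * ?S \<le> ?B" using bd unfolding I(2) z .
    then have "32 / (mux h * T) * (mux h / 32 * ?S) \<le> 32 / (mux h * T) * ?B" using mx(1) by (intro mult_left_mono) auto
    then show "?S / real T \<le> 32 / (mux h * T) * ?B" using mx(1) by simp
  qed
  finally show ?thesis .
qed

end

section \<open>The prescribed hyperparameters\<close>

text \<open>All coefficients are strictly positive, so an infinite initial quantity makes the bound
  infinite.\<close>

lemma bound_top:
  assumes "0 < C" "0 < \<kappa>" "1 \<le> K" "1 \<le> T" "lam < 1" "G = \<top> \<or> \<Delta> = \<top> \<or> z = \<top>"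
  shows "ennreal C * (lead_terms K T \<kappa> G \<Delta> s + rest_terms K T \<kappa> lam s z) = \<top>"
  using assms by (auto simp: lead_terms_def rest_terms_def ennreal_mult_top)

text \<open>For large horizons the estimate reached consists of the leading terms and the first
  network term; the other network terms only enlarge the right side.\<close>

lemma lead_le_bound:
  assumes "0 \<le> G" "0 \<le> \<Delta>" "0 \<le> s" "0 \<le> z" "0 \<le> C" "1 \<le> K" "1 \<le> T"
    and a: "a \<le> C * (\<kappa>\<^sup>2 / (real K * real T) powr (2/3) * (G + \<Delta> + s) + \<kappa>\<^sup>2 / (real T * (1 - lam)^2) * z)"
  shows "ennreal a \<le> ennreal C * (lead_terms K T \<kappa> (ennreal G) (ennreal \<Delta>) (ennreal s) + rest_terms K T \<kappa> lam (ennreal s) (ennreal z))"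
proof -
  define l w where "l = \<kappa>\<^sup>2 / (real K * real T) powr (2/3) * (G + \<Delta> + s)" and "w = \<kappa>\<^sup>2 / (real T * (1 - lam)^2)"
  have nn: "0 \<le> l" "0 \<le> w" "0 \<le> w * z" using assms(1-4) by (auto simp: l_def w_def)
  have "ennreal a \<le> ennreal (C * (l + w * z))" by (rule ennreal_leI[OF a[folded l_def w_def]])
  also have "\<dots> = ennreal C * (ennreal l + ennreal w * ennreal z)"
    using nn assms(4,5) by (simp only: ennreal_mult ennreal_plus add_nonneg_nonneg)
  also have "\<dots> = ennreal C * (lead_terms K T \<kappa> (ennreal G) (ennreal \<Delta>) (ennreal s) + ennreal (\<kappa>\<^sup>2 / (real T * (1 - lam)^2)) * ennreal z)"
    unfolding lead_terms_eq[OF assms(1-3)] l_def w_def ..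
  also have "\<dots> \<le> ennreal C * (lead_terms K T \<kappa> (ennreal G) (ennreal \<Delta>) (ennreal s) + rest_terms K T \<kappa> lam (ennreal s) (ennreal z))"
    unfolding rest_terms_def by (intro mult_left_mono add_left_mono) (auto simp: add.assoc intro: add_increasing2)
  finally show ?thesis .
qed

text \<open>With \<open>k\<close> and \<open>t\<close> the cube roots of \<open>K\<close> and
  \<open>T\<close> and \<open>g\<close> the cube of the spectral gap, one threshold yields all
  conditions: \<beta> at most one, \<open>L * muy h\<close> small, then \<open>C1\<close>,
  \<open>C2\<close> and finally \<open>C3\<close>, the one that dictates the fourth power of
  \<open>k\<close>.\<close>

lemma step_size_regime:
  fixes k t g :: real
  assumes k: "1 \<le> k" and t: "1 \<le> t" and g: "0 < g" "g \<le> 1" and big: "4 * k^4 / g \<le> t"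
  shows "k \<le> t\<^sup>2" "2 * k\<^sup>2 \<le> t" "k^4 \<le> g * t" "k^4 \<le> g * t\<^sup>2" "k^4 \<le> t\<^sup>2" "k^3 * (1 + 3 * (k * t)) \<le> g * t^3"
proof -
  have b: "4 * k^4 \<le> g * t" using big g by (simp add: divide_le_eq mult.commute)
  have gt: "g * t \<le> t" using g t by simp
  have t2: "t \<le> t\<^sup>2" "t\<^sup>2 \<le> t^3" using t by (auto intro: self_le_power power_increasing)
  have kp: "k \<le> k^4" "k\<^sup>2 \<le> k^4" "k^3 \<le> k^4" "1 \<le> k^4" using k by (auto intro: self_le_power power_increasing)
  show "k \<le> t\<^sup>2" "2 * k\<^sup>2 \<le> t" "k^4 \<le> g * t" "k^4 \<le> t\<^sup>2" using b gt t2 kp by linarith+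
  have gt2: "g * t \<le> g * t\<^sup>2" "g * t\<^sup>2 \<le> g * t^3" using t2 g by (auto intro: mult_left_mono)
  then show "k^4 \<le> g * t\<^sup>2" using \<open>k^4 \<le> g * t\<close> by linarith
  have "k^3 * 1 \<le> k^4 * t" using kp t by (intro mult_mono) auto
  moreover have "k^3 * (3 * (k * t)) = 3 * (k^4 * t)" by (simp add: power4_eq_xxxx power3_eq_cube)
  ultimately have "k^3 * (1 + 3 * (k * t)) \<le> 4 * k^4 * t" unfolding distrib_left by linarith
  also have "\<dots> \<le> g * t * t" using b t by (intro mult_right_mono) auto
  also have "\<dots> \<le> g * t^3" using gt2 by (simp add: power2_eq_square mult.assoc)
  finally show "k^3 * (1 + 3 * (k * t)) \<le> g * t^3" .
qed

context dama_problem
begin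

text \<open>The constants: 12800 is 32 times the ratio 400 demanded by
  \<open>potential_step\<close>, and 32 is the root of the 1024 in \<open>C0\<close>. In the result
  409600 is \<open>32 * 12800\<close>, and 166400 is \<open>12800 * 13\<close>, with 13 the sum of
  the noise constants 4 and 9.\<close>

lemma storm_rate:
  fixes T B :: nat and Rx Ry :: rmat and u v :: rvec
  defines "h \<equiv> storm_hyper (1 / (12800 * L)) (1 / (32 * L)) 1 1 1 B (agents p) (L / \<nu>) T"
  defines "r \<equiv> run p (extra_matrices p W Rx Ry) h \<xi> coin x0 y0 u v"
  assumes Rx: "is_psd_sqrt (agents p * dimx p) Rx (1\<^sub>m (agents p * dimx p) - kron_id W (dimx p))"
    and Ry: "is_psd_sqrt (agents p * dimy p) Ry (1\<^sub>m (agents p * dimy p) - kron_id W (dimy p))"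
    and uv: "u \<in> Xs p" "v \<in> Ys p" and bv: "bounded_variance M p \<xi> coin x0 y0 \<sigma> r T"
    and T: "1 \<le> T" and big: "(4 * (real (agents p) powr (1/3))^4 / gam^3)^3 \<le> T"
  shows "avg_sq_grad M p r T \<le> ennreal (409600 * L + 166400) *
    (lead_terms (agents p) T (L / \<nu>) (primal_gap0 M p r) (dual_gap0 M p r) (ennreal (\<sigma>\<^sup>2))
     + rest_terms (agents p) T (L / \<nu>) (lam2 W) (ennreal (\<sigma>\<^sup>2)) (zeta0_sq M p (extra_matrices p W Rx Ry) r))"
proof -
  have K1: "1 \<le> agents p" using Kpos by simp
  obtain k where k: "1 \<le> k" "real (agents p) = k^3" "real (agents p) powr (1/3) = k" "real (agents p) powr (2/3) = k\<^sup>2"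
    using cube_root_powers[OF K1] by metis
  obtain t where t: "1 \<le> t" "real T = t^3" "real T powr (1/3) = t" "real T powr (2/3) = t\<^sup>2"
    using cube_root_powers[OF T] by metis
  define \<kappa> where "\<kappa> = L / \<nu>"
  have kap: "1 \<le> \<kappa>" "obj.kap = \<kappa>" using obj.kap1 by (simp_all add: \<kappa>_def obj.kap_def)
  have g: "0 < gam^3" "gam^3 \<le> 1" using gam by (auto intro: power_le_one)
  \<comment> \<open>The threshold is stated for \<open>T\<close>, the cube of \<open>t\<close>;
    cubing is monotone.\<close>
  have "4 * k^4 / gam^3 \<le> t"
  proof (rule ccontr)
    assume "\<not> 4 * k^4 / gam^3 \<le> t"
    then have "t^3 < (4 * k^4 / gam^3)^3" using t(1) by (intro power_strict_mono) auto
    then show False using big unfolding t(2) k(3) by linarith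
  qed
  note reg = step_size_regime[OF k(1) t(1) g this]
  have pos: "0 < k" "0 < t" "0 < \<kappa>" "0 < L" using k t kap L_pos by auto
  have h: "mux h = k\<^sup>2 / (12800 * L * t * \<kappa>\<^sup>2)" "muy h = k\<^sup>2 / (32 * L * t)" "betax h = k / t\<^sup>2" "betay h = k / t\<^sup>2"
    "batch0 h = nat \<lceil>t / k\<^sup>2\<rceil>" "batch h = 1"
    unfolding h_def storm_hyper_def \<kappa>_def[symmetric] k(3,4) t(3,4) using pos by (simp_all add: mult.assoc)
  have b0: "0 < batch0 h" "t / k\<^sup>2 \<le> batch0 h" unfolding h(5) using pos by (simp_all add: real_nat_ceiling_ge)
  have beta: "0 < k / t\<^sup>2" "k / t\<^sup>2 \<le> 1" using pos reg(1) by simp_all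
  interpret run: dama_run M p \<xi> coin x0 y0 W \<nu> L Rx Ry u v h \<sigma> "k / t\<^sup>2" T
    by unfold_locales (use Rx Ry uv h b0 beta bv in \<open>auto simp: r_def\<close>)
  have kap2: "1 \<le> \<kappa>\<^sup>2" using kap by (simp add: one_le_power)
  have muxy: "mux h = muy h / (400 * \<kappa>\<^sup>2)" unfolding h using pos by simp
  have mu: "0 < muy h" "0 < mux h" "mux h * \<kappa>\<^sup>2 = muy h / 400" unfolding muxy using pos by (simp_all add: h)
  have "mux h * 1 \<le> mux h * \<kappa>\<^sup>2" using mu kap2 by (intro mult_left_mono) auto
  then have mle: "mux h \<le> muy h" using mu by linarith
  have Lmu: "L * muy h = k\<^sup>2 / t / 32" "k\<^sup>2 / t \<le> 1 / 2" using pos reg(2) by (simp_all add: h divide_le_eq)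
  have "\<kappa> * (\<kappa> * L * mux h) = L * muy h / 400" using mu(3) by (simp add: power2_eq_square mult_ac)
  moreover have "1 * (\<kappa> * L * mux h) \<le> \<kappa> * (\<kappa> * L * mux h)" using kap pos mu by (intro mult_right_mono) auto
  ultimately have cx: "\<kappa> * L * mux h \<le> 1 / 40" using Lmu by argo
  have cy: "L * muy h \<le> 1 / 40" using Lmu by argo
  have sq: "L\<^sup>2 * (muy h)\<^sup>2 = k^4 / t\<^sup>2 / 1024" unfolding power_mult_distrib[symmetric] Lmu(1) by (simp add: power_divide)
  \<comment> \<open>An equality for these step sizes: both sides are
    \<open>k^4 / t\<^sup>2\<close>.\<close>
  have C0: "1024 * L\<^sup>2 * (muy h)\<^sup>2 \<le> k / t\<^sup>2 * real (agents p)"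
    using sq unfolding k(2) by (simp add: mult.assoc power4_eq_xxxx power3_eq_cube)
  have q: "k^4 / t\<^sup>2 \<le> gam^3" "0 \<le> k^4 / t\<^sup>2" "k^4 / t\<^sup>2 \<le> 1" using reg(4,5) pos by (simp_all add: divide_le_eq)
  have C1: "256 * L\<^sup>2 * (muy h)\<^sup>2 \<le> gam^3" using sq q unfolding mult.assoc by argo
  have C2: "128 * L\<^sup>2 * (muy h)\<^sup>2 \<le> 1" using sq q unfolding mult.assoc by argo
  have C3: "real (agents p) * (1 + 3 * (k / t\<^sup>2) * T) \<le> gam^3 * T"
    using reg(6) pos unfolding k(2) t(2) by (simp add: power3_eq_cube power2_eq_square)
  let ?G = "primal_gap0 M p r" and ?D = "dual_gap0 M p r" and ?z = "zeta0_sq M p (extra_matrices p W Rx Ry) r"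
  show ?thesis
  proof (cases "?G = \<top> \<or> ?D = \<top> \<or> ?z = \<top>")
    case True
    have "ennreal (409600 * L + 166400) * (lead_terms (agents p) T \<kappa> ?G ?D (ennreal (\<sigma>\<^sup>2)) + rest_terms (agents p) T \<kappa> (lam2 W) (ennreal (\<sigma>\<^sup>2)) ?z) = \<top>"
      by (rule bound_top[OF _ pos(3) K1 T lam2_less True]) (use L_pos in simp)
    then show ?thesis unfolding \<kappa>_def[symmetric] by simp
  next
    case False
    then obtain G D z where f: "?G = ennreal G" "?D = ennreal D" "?z = ennreal z" "0 \<le> G" "0 \<le> D" "0 \<le> z"
      using ennreal_cases[of ?G] ennreal_cases[of ?D] ennreal_cases[of ?z] by metis
    note bd = run.avg_bound[folded r_def, OF f mu(2) mle eq_refl[OF mu(3)[folded kap(2)]] cx[folded kap(2)] cy _ C0 C1 C2 C3]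
    define Q where "Q = \<kappa>\<^sup>2 / (k\<^sup>2 * t\<^sup>2)"
    have Q: "0 \<le> Q" "\<kappa>\<^sup>2 / (real (agents p) * real T) powr (2/3) = Q"
      unfolding Q_def powr_mult k(4) t(4) by simp_all
    have c1: "32 / (mux h * T) = 409600 * L * Q" unfolding h(1) t(2) Q_def using pos
      by (simp add: divide_simps power2_eq_square power3_eq_cube)
    have c2: "32 / (mux h * T) * muy h = 12800 * \<kappa>\<^sup>2 / t^3" unfolding muxy t(2) using pos mu by simp
    have s0: "0 \<le> \<sigma>\<^sup>2" by simp
    \<comment> \<open>Rounding the initial batch up only lowers the initial noise. Its order is
      chosen so that this noise, summed over the memory of length \<open>1 / \<beta>\<close>,
      matches the noise accumulated later.\<close>
    have "k\<^sup>2 / t = k / t\<^sup>2 * (t / k\<^sup>2) * real (agents p)" unfolding k(2) using pos by (simp add: power2_eq_square power3_eq_cube)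
    also have "\<dots> \<le> k / t\<^sup>2 * batch0 h * real (agents p)" using b0 beta pos by (intro mult_right_mono mult_left_mono) auto
    finally have "4 * \<sigma>\<^sup>2 / (k / t\<^sup>2 * batch0 h * real (agents p)) \<le> 4 * \<sigma>\<^sup>2 / (k\<^sup>2 / t)"
      using pos b0(1) K1 by (intro divide_left_mono mult_pos_pos) auto
    moreover have "9 * (k / t\<^sup>2) * \<sigma>\<^sup>2 * T / real (agents p) = 9 * \<sigma>\<^sup>2 * (t / k\<^sup>2)" unfolding k(2) t(2) using pos
      by (simp add: power2_eq_square power3_eq_cube)
    ultimately have le: "4 * \<sigma>\<^sup>2 / (k / t\<^sup>2 * batch0 h * real (agents p)) + 9 * (k / t\<^sup>2) * \<sigma>\<^sup>2 * T / real (agents p) + z / (8 * gam\<^sup>2)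
        \<le> 13 * \<sigma>\<^sup>2 * (t / k\<^sup>2) + z / (8 * gam\<^sup>2)" by simp
    have "32 / (mux h * T) * (G + D / 8 + muy h * (4 * \<sigma>\<^sup>2 / (k / t\<^sup>2 * batch0 h * real (agents p)) + 9 * (k / t\<^sup>2) * \<sigma>\<^sup>2 * T / real (agents p) + z / (8 * gam\<^sup>2)))
      \<le> 32 / (mux h * T) * (G + D / 8 + muy h * (13 * \<sigma>\<^sup>2 * (t / k\<^sup>2) + z / (8 * gam\<^sup>2)))"
      using mu le by (intro mult_left_mono add_left_mono) auto
    also have "\<dots> = 409600 * L * Q * (G + D / 8) + 12800 * \<kappa>\<^sup>2 / t^3 * (13 * \<sigma>\<^sup>2 * (t / k\<^sup>2) + z / (8 * gam\<^sup>2))"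
      unfolding c1[symmetric] c2[symmetric] by (simp only: distrib_left mult.assoc)
    also have "12800 * \<kappa>\<^sup>2 / t^3 * (13 * \<sigma>\<^sup>2 * (t / k\<^sup>2) + z / (8 * gam\<^sup>2)) = 166400 * Q * \<sigma>\<^sup>2 + 1600 * (\<kappa>\<^sup>2 / (t^3 * gam\<^sup>2) * z)"
      unfolding distrib_left Q_def using pos gam by (simp add: power2_eq_square power3_eq_cube mult_ac)
    finally have 1: "32 / (mux h * T) * (G + D / 8 + muy h * (4 * \<sigma>\<^sup>2 / (k / t\<^sup>2 * batch0 h * real (agents p)) + 9 * (k / t\<^sup>2) * \<sigma>\<^sup>2 * T / real (agents p) + z / (8 * gam\<^sup>2)))
      \<le> 409600 * L * Q * (G + D / 8) + (166400 * Q * \<sigma>\<^sup>2 + 1600 * (\<kappa>\<^sup>2 / (t^3 * gam\<^sup>2) * z))" .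
    let ?C = "409600 * L + 166400" and ?R = "\<kappa>\<^sup>2 / (t^3 * gam\<^sup>2) * z"
    have "409600 * L * Q * (G + D / 8) = 409600 * L * (Q * (G + D / 8))" by simp
    also have "\<dots> \<le> ?C * (Q * (G + D))" using pos Q f by (intro mult_mono mult_left_mono) auto
    finally have 2: "409600 * L * Q * (G + D / 8) \<le> ?C * (Q * (G + D))" .
    have 3: "166400 * Q * \<sigma>\<^sup>2 \<le> ?C * (Q * \<sigma>\<^sup>2)" unfolding mult.assoc[of 166400] using pos Q by (intro mult_right_mono) auto
    have 4: "1600 * ?R \<le> ?C * ?R" using pos gam f by (intro mult_right_mono) auto
    have 5: "?C * (Q * (G + D + \<sigma>\<^sup>2) + ?R) = ?C * (Q * (G + D)) + ?C * (Q * \<sigma>\<^sup>2) + ?C * ?R" by (simp only: distrib_left)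
    have "avg_sq_grad M p r T \<le> ennreal (32 / (mux h * T) * (G + D / 8 + muy h * (4 * \<sigma>\<^sup>2 / (k / t\<^sup>2 * batch0 h * real (agents p)) + 9 * (k / t\<^sup>2) * \<sigma>\<^sup>2 * T / real (agents p) + z / (8 * gam\<^sup>2))))"
      by (rule bd) (use T in simp)
    also have "\<dots> \<le> ennreal ?C * (lead_terms (agents p) T \<kappa> (ennreal G) (ennreal D) (ennreal (\<sigma>\<^sup>2)) + rest_terms (agents p) T \<kappa> (lam2 W) (ennreal (\<sigma>\<^sup>2)) (ennreal z))"
    proof (rule lead_le_bound[OF f(4,5) s0 f(6) _ K1 T])
      show "0 \<le> ?C" using pos by simp
      have R: "\<kappa>\<^sup>2 / (real T * (1 - lam2 W)\<^sup>2) * z = ?R" by (simp only: t(2) gam_def)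
      show "32 / (mux h * T) * (G + D / 8 + muy h * (4 * \<sigma>\<^sup>2 / (k / t\<^sup>2 * batch0 h * real (agents p)) + 9 * (k / t\<^sup>2) * \<sigma>\<^sup>2 * T / real (agents p) + z / (8 * gam\<^sup>2)))
        \<le> ?C * (\<kappa>\<^sup>2 / (real (agents p) * real T) powr (2/3) * (G + D + \<sigma>\<^sup>2) + \<kappa>\<^sup>2 / (real T * (1 - lam2 W)\<^sup>2) * z)"
        unfolding Q(2) R 5 using 1 2 3 4 by linarith
    qed
    finally show ?thesis unfolding f \<kappa>_def .
  qed
qed

end

text \<open>The initial batch is at most \<open>T\<close>, as the cube root of \<open>T\<close> is,
  and each later iteration draws one sample; so the sample count follows the horizon.\<close>

lemma samples_le:
  fixes B K T :: nat and \<kappa> :: real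
  assumes "1 \<le> K" "1 \<le> T"
  shows "real (samples_per_agent (storm_hyper cx cy 1 1 1 B K \<kappa> T) T) \<le> 3 * real T"
proof -
  obtain k where k: "1 \<le> k" "real K powr (2/3) = k\<^sup>2" using cube_root_powers[OF assms(1)] by metis
  obtain t where t: "1 \<le> t" "real T = t^3" "real T powr (1/3) = t" using cube_root_powers[OF assms(2)] by metis
  have "t / k\<^sup>2 \<le> t" using k t by (simp add: divide_le_eq mult_le_cancel_left1 one_le_power)
  also have "\<dots> \<le> t^3" using t by (intro self_le_power) auto
  finally have "t / k\<^sup>2 \<le> real T" using t by simp
  then have "nat \<lceil>t / k\<^sup>2\<rceil> \<le> T" by (simp add: nat_le_iff ceiling_le_iff)
  moreover have "samples_per_agent (storm_hyper cx cy 1 1 1 B K \<kappa> T) T = nat \<lceil>t / k\<^sup>2\<rceil> + (T - 1)"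
    by (simp add: samples_per_agent_def storm_hyper_def k(2) t(3))
  ultimately show ?thesis by linarith
qed

text \<open>The witnesses are chosen before the problem, so they can depend on \<open>Lf\<close>
  alone; the threshold \<open>T0\<close> comes after it and may depend on the number of agents and
  on the spectral gap. The order of the transient time is proved in both directions, as a property
  of the terms of the bound.\<close>

theorem corollary2:
  fixes Lf lmin :: real
  shows
    "(\<exists>cx>0. \<exists>cy>0. \<exists>c\<beta>>0. \<exists>c0>0. \<exists>b\<ge>1. \<exists>C>0. \<exists>Cs :: real \<Rightarrow> real.
       \<forall>(p :: 's problem) W Rx Ry \<nu> \<sigma> (M :: 'w measure) \<xi> coin x0 y0 u v B.
         2 \<le> agents p \<longrightarrow> well_posed p \<longrightarrow>
         PL_condition p \<nu> \<longrightarrow> mean_square_smooth p Lf \<longrightarrow> unbiased_gradients p \<longrightarrow> \<nu> \<le> Lf \<longrightarrow>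
         mixing_matrix (agents p) W \<longrightarrow> min_nonzero_eig W = lmin \<longrightarrow>
         is_psd_sqrt (agents p * dimx p) Rx (1\<^sub>m (agents p * dimx p) - kron_id W (dimx p)) \<longrightarrow>
         is_psd_sqrt (agents p * dimy p) Ry (1\<^sub>m (agents p * dimy p) - kron_id W (dimy p)) \<longrightarrow>
         sampling_model M p 0 \<xi> coin x0 y0 \<longrightarrow> u \<in> Xs p \<longrightarrow> v \<in> Ys p \<longrightarrow>
         (let K = agents p; \<kappa> = Lf / \<nu>; lam = lam2 W;
              A = extra_matrices p W Rx Ry;
              h = storm_hyper cx cy c\<beta> c0 b B K \<kappa>;
              st = (\<lambda>T. run p A (h T) \<xi> coin x0 y0 u v);
              G = (\<lambda>T. primal_gap0 M p (st T));
              \<Delta> = (\<lambda>T. dual_gap0 M p (st T));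
              z = (\<lambda>T. zeta0_sq M p A (st T));
              s = ennreal (\<sigma>\<^sup>2)
          in (\<forall>T\<ge>1. bounded_variance M p \<xi> coin x0 y0 \<sigma> (st T) T) \<longrightarrow>
             (\<exists>T0\<ge>1.
               (\<forall>T\<ge>T0. avg_sq_grad M p (st T) T
                  \<le> ennreal C * (lead_terms K T \<kappa> (G T) (\<Delta> T) s + rest_terms K T \<kappa> lam s (z T))) \<and>
               (\<forall>R. (\<forall>T\<ge>1. G T \<le> ennreal R \<and> \<Delta> T \<le> ennreal R \<and> s \<le> ennreal R \<and> z T \<le> ennreal R) \<longrightarrow>
                 (\<exists>\<epsilon>0>0. \<forall>\<epsilon>. 0 < \<epsilon> \<and> \<epsilon> \<le> \<epsilon>0 \<longrightarrow>
                   (\<exists>T\<ge>T0. avg_sq_grad M p (st T) T \<le> ennreal (\<epsilon>\<^sup>2) \<and>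
                      real (samples_per_agent (h T) T) \<le> Cs R * sample_order K \<kappa> lam \<epsilon>))))))
     \<and>
     (\<forall>G \<Delta> s z :: real. 0 \<le> G \<and> 0 \<le> \<Delta> \<and> 0 \<le> s \<and> 0 \<le> z \<and> 0 < G + \<Delta> + s \<longrightarrow>
       (let settled = (\<lambda>K \<kappa> lam t. \<forall>T\<ge>t. rest_terms K T \<kappa> lam (ennreal s) (ennreal z)
                          \<le> lead_terms K T \<kappa> (ennreal G) (ennreal \<Delta>) (ennreal s))
        in (\<exists>c>0. \<forall>K \<kappa> lam t. 2 \<le> K \<and> 0 < \<kappa> \<and> 0 \<le> lam \<and> lam < 1 \<and>
              c * transient_order K lam \<le> real t \<longrightarrow> settled K \<kappa> lam t) \<and>
           (0 < z \<longrightarrow> (\<exists>c>0. \<forall>K \<kappa> lam t. 2 \<le> K \<and> 0 < \<kappa> \<and> 0 \<le> lam \<and> lam < 1 \<and> 1 \<le> t \<and>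
              settled K \<kappa> lam t \<longrightarrow> c * transient_order K lam \<le> real t))))"
proof -
  \<comment> \<open>The witnesses must be positive even when \<open>Lf\<close> is not; in that case
    \<nu> at most \<open>Lf\<close> with positive \<nu> is impossible and nothing remains to be
    shown about the run.\<close>
  define L where "L = (if 0 < Lf then Lf else 1)"
  have L: "0 < L" by (simp add: L_def)
  show ?thesis
  proof (rule conjI, goal_cases)
    case 1
    show ?case
    proof (rule exI[of _ "1 / (12800 * L)"], rule conjI, simp add: L, rule exI[of _ "1 / (32 * L)"], rule conjI, simp add: L,
        rule exI[of _ 1], rule conjI, simp, rule exI[of _ 1], rule conjI, simp, rule exI[of _ 1], rule conjI, simp,
        rule exI[of _ "409600 * L + 166400"], rule conjI, simp add: L add_pos_pos,
        rule exI[of _ "\<lambda>R. 6 * (7 * (409600 * L + 166400) * max R 1) powr (3/2)"], unfold Let_def, intro allI impI, goal_cases)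
      case (1 p W Rx Ry \<nu> \<sigma> M \<xi> coin x0 y0 u v B)
      have Lf: "Lf = L" using 1(3,6) by (auto simp: L_def PL_condition_def)
      interpret dama_problem M p \<xi> coin x0 y0 W \<nu> L
      proof (unfold dama_problem_def sampling_def sampling_axioms_def dama_problem_axioms_def, intro conjI)
        show "prob_space M" using 1(11) by (simp add: sampling_model_def)
      qed (use 1 Lf in simp_all)
      \<comment> \<open>The threshold of \<open>storm_rate\<close> rounded up. It makes the
        consensus part of the error subordinate and depends on the network only.\<close>
      define T0 where "T0 = max 1 (nat \<lceil>(4 * (real (agents p) powr (1/3))^4 / gam^3)^3\<rceil>)"
      have T0: "1 \<le> T0" by (simp add: T0_def)
      let ?h = "storm_hyper (1 / (12800 * L)) (1 / (32 * L)) 1 1 1 B (agents p) (L / \<nu>)"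
      let ?st = "\<lambda>T. run p (extra_matrices p W Rx Ry) (?h T) \<xi> coin x0 y0 u v"
      have bv: "\<And>T. 1 \<le> T \<Longrightarrow> bounded_variance M p \<xi> coin x0 y0 \<sigma> (?st T) T" using 1(14) unfolding Lf by blast
      have rate: "avg_sq_grad M p (?st T) T \<le> ennreal (409600 * L + 166400) *
          (lead_terms (agents p) T (L / \<nu>) (primal_gap0 M p (?st T)) (dual_gap0 M p (?st T)) (ennreal (\<sigma>\<^sup>2))
           + rest_terms (agents p) T (L / \<nu>) (lam2 W) (ennreal (\<sigma>\<^sup>2)) (zeta0_sq M p (extra_matrices p W Rx Ry) (?st T)))"
        if T: "T0 \<le> T" for T
      proof (rule storm_rate[OF 1(9,10,12,13) bv])
        show T1: "1 \<le> T" "1 \<le> T" using T T0 by simp_all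
        have "(4 * (real (agents p) powr (1/3))^4 / gam^3)^3 \<le> real T0" unfolding T0_def by linarith
        then show "(4 * (real (agents p) powr (1/3))^4 / gam^3)^3 \<le> real T" using T by linarith
      qed
      show ?case unfolding Lf
      proof (intro exI[of _ T0] conjI allI impI, rule T0, erule rate)
        fix R
        assume R: "\<forall>T\<ge>1. primal_gap0 M p (?st T) \<le> ennreal R \<and> dual_gap0 M p (?st T) \<le> ennreal R \<and>
          ennreal (\<sigma>\<^sup>2) \<le> ennreal R \<and> zeta0_sq M p (extra_matrices p W Rx Ry) (?st T) \<le> ennreal R"
        show "\<exists>\<epsilon>0>0. \<forall>\<epsilon>. 0 < \<epsilon> \<and> \<epsilon> \<le> \<epsilon>0 \<longrightarrow> (\<exists>T\<ge>T0. avg_sq_grad M p (?st T) T \<le> ennreal (\<epsilon>\<^sup>2) \<and>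
            real (samples_per_agent (?h T) T) \<le> 6 * (7 * (409600 * L + 166400) * max R 1) powr (3/2) * sample_order (agents p) (L / \<nu>) (lam2 W) \<epsilon>)"
        proof (rule sample_complexity[OF _ agents2 _ lam2_nonneg lam2_less T0 rate])
          show "0 < 409600 * L + 166400" using L by simp
          show "0 < L / \<nu>" using L nu_pos by simp
          have "1 \<le> agents p" using Kpos by simp
          then show "real (samples_per_agent (?h T) T) \<le> 3 * real T" if "1 \<le> T" for T using that by (rule samples_le)
        qed (assumption | rule R[rule_format])+
      qed
    qed
  next
    case 2
    show ?case unfolding Let_def
    proof (intro allI impI conjI, goal_cases)
      case (1 G \<Delta> s z)
      then show ?case by (intro transient_sufficient[unfolded settled_def]) auto
    next
      case (2 G \<Delta> s z)
      then show ?case by (intro transient_necessary[unfolded settled_def]) auto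
    qed
  qed
qed


end
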